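(* Let $G$ and $K$ be stable rational matrix functions of sizes $m\times p$ and $m\times q$, respectively, such that $T_GT_G^*-T_KT_K^*$ is strictly positive, and assume that there is no non-zero $x\in\mathbb{C}^p$ such that $G(z)x$ is identically zero on the open unit disc $\mathbb{D}$. Let $\begin{bmatrix} G&K\end{bmatrix}$ be given by the realization $$\begin{bmatrix} G(z)&K(z)\end{bmatrix}=\begin{bmatrix} D_1&D_2\end{bmatrix}+zC(I_n-zA)^{-1}\begin{bmatrix} B_1&B_2\end{bmatrix}$$ with $A$ a stable $n\times n$ matrix and $\{C,A\}$ observable. Let $P_1,P_2,R_0,\Gamma,Q,\Delta,A_0,Q_0,\Theta_0$ be the matrices defined in the context, and put $$C_0=\Delta^{-1}(C-\Gamma^*QA),\qquad C_j=D_j^*C_0+B_j^*QA_0\ (j=1,2),$$ $$\Omega=(P_1-P_2)(Q^{-1}+P_2-P_1)^{-1}Q^{-1},\qquad B_0=B_2-\Gamma\Delta^{-1}D_2+A_0\Omega C_2^*,$$ and let $\Delta_0$, $\Delta_1$ be the positive definite matrices determined by $$\Delta_0^2=I_q+C_2\Omega C_2^*+(D_2-\Gamma^*QB_2)^*\Delta^{-1}(D_2-\Gamma^*QB_2)+B_2^*QB_2,$$ $$\Delta_1^2=I_{p-m}+\Theta_0^*B_1^*\big((Q^{-1}+P_2-P_1)^{-1}-(Q_0^{-1}-P_1)^{-1}\big)B_1\Theta_0.$$ Define $$\Upsilon_{11}(z)=\Theta_0\Delta_1^{-1}-zC_1(I-zA_0)^{-1}Q^{-1}(Q^{-1}+P_2-P_1)^{-1}B_1\Theta_0\Delta_1^{-1},$$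 $$\Upsilon_{21}(z)=-zC_2(I-zA_0)^{-1}Q^{-1}(Q^{-1}+P_2-P_1)^{-1}B_1\Theta_0\Delta_1^{-1},$$ $$\Upsilon_{12}(z)=\big(D_1^*\Delta^{-1}D_2+D_1^*C_0\Omega C_2^*+B_1^*QB_0\big)\Delta_0^{-1}+zC_1(I-zA_0)^{-1}B_0\Delta_0^{-1},$$ $$\Upsilon_{22}(z)=\Delta_0+zC_2(I-zA_0)^{-1}B_0\Delta_0^{-1}.$$ Then the set of all solutions to the Leech problem, that is, of all $X\in H^\infty_{p\times q}$ with $G(z)X(z)=K(z)$ for $|z|<1$ and $\|X\|_\infty\le 1$, is the range of the linear fractional transformation $Y\mapsto X$ given by $$X(z)=\big(\Upsilon_{12}(z)+\Upsilon_{11}(z)Y(z)\big)\big(\Upsilon_{22}(z)+\Upsilon_{21}(z)Y(z)\big)^{-1},$$ where the free parameter $Y$ is any function in $H^\infty_{(p-m)\times q}$ with $\|Y\|_\infty\le 1$.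
   Context: General notation. $H^\infty_{k\times r}$ is the space of bounded analytic $k\times r$ matrix-valued functions on $\mathbb{D}$, with $\|F\|_\infty=\sup_{|z|<1}\|F(z)\|$. A rational matrix function is stable if all its poles lie in $|z|>1$ (infinity included); a square matrix is stable if all its eigenvalues are in $\mathbb{D}$. The pair $\{C,A\}$ is observable if $CA^\nu x=0$ for all $\nu\ge 0$ implies $x=0$. $\ell^2_+(\mathbb{C}^k)$ is the Hilbert space of square summable unilateral sequences in $\mathbb{C}^k$; $E_k=\begin{bmatrix}I_k&0&0&\cdots\end{bmatrix}^\top:\mathbb{C}^k\to\ell^2_+(\mathbb{C}^k)$ is the embedding onto the first coordinate space. For $F(z)=\sum_{\nu\ge 0}z^\nu F_\nu\in H^\infty_{k\times r}$, $T_F:\ell^2_+(\mathbb{C}^r)\to\ell^2_+(\mathbb{C}^k)$ is the block lower triangular Toeplitz operator $(T_Ff)_i=\sum_{j\le i}F_{i-j}f_j$. Strictly positive means $\ge\epsilon I$ for some $\epsilon>0$. Matrices. For $j=1,2$, $P_j$ is the unique solution of $P_j-AP_jA^*=B_jB_j^*$. Put $$R_0=D_1D_1^*-D_2D_2^*+C(P_1-P_2)C^*,\qquad \Gamma=B_1D_1^*-B_2D_2^*+A(P_1-P_2)C^*.$$ $Q$ is the stabilizing solution of the algebraic Riccati equation $$Q=A^*QA+(C-\Gamma^*QA)^*(R_0-\Gamma^*Q\Gamma)^{-1}(C-\Gamma^*QA),$$ meaning that $Q$ satisfies this equation, $\Delta:=R_0-\Gamma^*Q\Gamma$ is strictly positive,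 and $A_0:=A-\Gamma\Delta^{-1}(C-\Gamma^*QA)$ is stable. Put $R_{10}=D_1D_1^*+CP_1C^*$ and $\Gamma_0=B_1D_1^*+AP_1C^*$. $Q_0$ is the stabilizing solution of $$Q_0=A^*Q_0A+(C-\Gamma_0^*Q_0A)^*(R_{10}-\Gamma_0^*Q_0\Gamma_0)^{-1}(C-\Gamma_0^*Q_0A),$$ meaning that $R_{10}-\Gamma_0^*Q_0\Gamma_0$ is strictly positive and $A-\Gamma_0(R_{10}-\Gamma_0^*Q_0\Gamma_0)^{-1}(C-\Gamma_0^*Q_0A)$ is stable. It is known that, under the hypotheses of the theorem, $Q$ and $Q_0$ exist, are unique and invertible, and $Q^{-1}+P_2-P_1$ and $Q_0^{-1}-P_1$ are strictly positive. $\Theta_0$ (the left minimal rank factor) is a one-to-one $p\times(p-m)$ matrix with $$\Theta_0\Theta_0^*=I_p-E_p^*T_G^*(T_GT_G^* )^{-1}T_GE_p;$$ such a $\Theta_0$ exists and is unique up to multiplication on the right by a constant unitary matrix of order $p-m$.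
   Formalization: The factor D_2 is replaced by D_2 − Γ*QB_2 in the definition of B_0 and in the term D_1*Δ^{-1}D_2 of Υ_12; with D_2 alone the claim fails, e.g. for G = √(9/2), K = 1+z, A = 0, C = 1, B_1 = 0, B_2 = 1. *)

theory Defs
  imports
    "HOL-Complex_Analysis.Complex_Analysis"
    "Jordan_Normal_Form.Schur_Decomposition"
begin

text \<open>
  Matrices and vectors are those of \<^theory>\<open>Jordan_Normal_Form.Matrix\<close>, so sizes are ordinary
  natural numbers; in particular \<open>p - m\<close> may be \<open>0\<close>. The order on \<^typ>\<open>complex\<close> is the one of
  \<^theory>\<open>HOL-Library.Complex_Order\<close>, so \<open>a \<le> b\<close> includes \<open>Im a = Im b\<close>.
\<close>

unbundle no vec_syntax
hide_type (open) Finite_Cartesian_Product.vec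
hide_const (open) Finite_Cartesian_Product.vec Finite_Cartesian_Product.mat

notation mat_adjoint (\<open>_\<^sup>\<dagger>\<close> [1000] 1000)

abbreviation minv :: "complex mat \<Rightarrow> complex mat" where
  "minv M \<equiv> the (mat_inverse M)"

abbreviation unit_disc :: "complex set" (\<open>\<D>\<close>) where
  "\<D> \<equiv> ball 0 1"


section \<open>Operators on inner product spaces\<close>

text \<open>
  A Hilbert space is given by a carrier set and an inner product that is linear in the first
  argument.
\<close>

definition hilbert_adjoint ::
    "'a set \<Rightarrow> ('a \<Rightarrow> 'a \<Rightarrow> complex) \<Rightarrow> ('b \<Rightarrow> 'b \<Rightarrow> complex) \<Rightarrow> ('a \<Rightarrow> 'b) \<Rightarrow> 'b \<Rightarrow> 'a" where
  "hilbert_adjoint H ipH ipK T g = (THE h. h \<in> H \<and> (\<forall>f\<in>H. ipK (T f) g = ipH f h))"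

definition strictly_positive ::
    "'a set \<Rightarrow> ('a \<Rightarrow> 'a \<Rightarrow> complex) \<Rightarrow> ('a \<Rightarrow> 'a) \<Rightarrow> bool" where
  "strictly_positive H ip T \<longleftrightarrow>
    (\<exists>\<epsilon>::real. \<epsilon> > 0 \<and> (\<forall>x\<in>H. complex_of_real \<epsilon> * ip x x \<le> ip (T x) x))"

abbreviation cinner :: "complex vec \<Rightarrow> complex vec \<Rightarrow> complex" where
  "cinner x y \<equiv> x \<bullet>c y"

definition cnorm :: "complex vec \<Rightarrow> real" where
  "cnorm x = sqrt (Re (cinner x x))"


section \<open>Matrices\<close>

definition strictly_positive_mat :: "complex mat \<Rightarrow> bool" where
  "strictly_positive_mat M \<longleftrightarrow>
    square_mat M \<and> strictly_positive (carrier_vec (dim_row M)) cinner (\<lambda>x. M *\<^sub>v x)"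

definition positive_definite_mat :: "complex mat \<Rightarrow> bool" where
  "positive_definite_mat M \<longleftrightarrow>
    square_mat M \<and> (\<forall>x\<in>carrier_vec (dim_row M). x \<noteq> 0\<^sub>v (dim_row M) \<longrightarrow> 0 < cinner (M *\<^sub>v x) x)"

definition pos_sqrt_mat :: "complex mat \<Rightarrow> complex mat" where
  "pos_sqrt_mat M = (THE S. positive_definite_mat S \<and> S * S = M)"

definition stable_mat :: "complex mat \<Rightarrow> bool" where
  "stable_mat A \<longleftrightarrow> square_mat A \<and> (\<forall>k. eigenvalue A k \<longrightarrow> k \<in> \<D>)"

definition observable :: "complex mat \<Rightarrow> complex mat \<Rightarrow> bool" where
  "observable C A \<longleftrightarrow>
    (\<forall>x\<in>carrier_vec (dim_row A).
      (\<forall>\<nu>. C *\<^sub>v (A ^\<^sub>m \<nu> *\<^sub>v x) = 0\<^sub>v (dim_row C)) \<longrightarrow> x = 0\<^sub>v (dim_row A))"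

definition stabilizing_solution ::
    "complex mat \<Rightarrow> complex mat \<Rightarrow> complex mat \<Rightarrow> complex mat \<Rightarrow> complex mat \<Rightarrow> bool" where
  "stabilizing_solution A C R \<Gamma> Q \<longleftrightarrow>
    Q \<in> carrier_mat (dim_row A) (dim_row A) \<and>
    Q = A\<^sup>\<dagger> * Q * A + (C - \<Gamma>\<^sup>\<dagger> * Q * A)\<^sup>\<dagger> * minv (R - \<Gamma>\<^sup>\<dagger> * Q * \<Gamma>) * (C - \<Gamma>\<^sup>\<dagger> * Q * A) \<and>
    strictly_positive_mat (R - \<Gamma>\<^sup>\<dagger> * Q * \<Gamma>) \<and>
    stable_mat (A - \<Gamma> * minv (R - \<Gamma>\<^sup>\<dagger> * Q * \<Gamma>) * (C - \<Gamma>\<^sup>\<dagger> * Q * A))"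

text \<open>The operator norm induced by the Euclidean norms.\<close>

definition opnorm :: "complex mat \<Rightarrow> real" where
  "opnorm M = (SUP x\<in>{x \<in> carrier_vec (dim_col M). cnorm x \<le> 1}. cnorm (M *\<^sub>v x))"


section \<open>Matrix-valued functions on the disc\<close>

text \<open>
  The poles of the entry \<open>a / b\<close>, in lowest terms, are the zeros of \<open>b\<close>, and possibly infinity,
  where a pole is allowed. Only the values on the open disc are considered.
\<close>

definition stable_rational :: "nat \<Rightarrow> nat \<Rightarrow> (complex \<Rightarrow> complex mat) \<Rightarrow> bool" where
  "stable_rational k r F \<longleftrightarrow>
    (\<forall>z\<in>\<D>. F z \<in> carrier_mat k r) \<and>
    (\<forall>i<k. \<forall>j<r. \<exists>a b :: complex poly. coprime a b \<and>
      (\<forall>w. poly b w = 0 \<longrightarrow> norm w > 1) \<and>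
      (\<forall>z\<in>\<D>. F z $$ (i, j) = poly a z / poly b z))"

text \<open>
  Members of \<open>H\<^sup>\<infinity>\<close> are extensional, i.e. \<^const>\<open>undefined\<close> off the disc, so that
  equality in HOL is equality of functions on the disc.
\<close>

definition Hinf :: "nat \<Rightarrow> nat \<Rightarrow> (complex \<Rightarrow> complex mat) set" where
  "Hinf k r = {F \<in> \<D> \<rightarrow>\<^sub>E carrier_mat k r.
    (\<forall>i<k. \<forall>j<r. (\<lambda>z. F z $$ (i, j)) holomorphic_on \<D>) \<and>
    bdd_above ((\<lambda>z. opnorm (F z)) ` \<D>)}"

definition hinf_norm :: "(complex \<Rightarrow> complex mat) \<Rightarrow> real" where
  "hinf_norm F = (SUP z\<in>\<D>. opnorm (F z))"

definition leech_solutions ::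
    "nat \<Rightarrow> nat \<Rightarrow> (complex \<Rightarrow> complex mat) \<Rightarrow> (complex \<Rightarrow> complex mat)
      \<Rightarrow> (complex \<Rightarrow> complex mat) set" where
  "leech_solutions p q G K = {X \<in> Hinf p q. (\<forall>z\<in>\<D>. G z * X z = K z) \<and> hinf_norm X \<le> 1}"


section \<open>Block Toeplitz operators\<close>

definition ell2 :: "nat \<Rightarrow> (nat \<Rightarrow> complex vec) set" where
  "ell2 k = {f. (\<forall>i. f i \<in> carrier_vec k) \<and> summable (\<lambda>i. (cnorm (f i))\<^sup>2)}"

definition ell2_inner :: "(nat \<Rightarrow> complex vec) \<Rightarrow> (nat \<Rightarrow> complex vec) \<Rightarrow> complex" where
  "ell2_inner f g = (\<Sum>i. cinner (f i) (g i))"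

definition taylor_coeff :: "nat \<Rightarrow> nat \<Rightarrow> (complex \<Rightarrow> complex mat) \<Rightarrow> nat \<Rightarrow> complex mat" where
  "taylor_coeff k r F \<nu> = Matrix.mat k r (\<lambda>(i, j). fps_nth (fps_expansion (\<lambda>z. F z $$ (i, j)) 0) \<nu>)"

definition toeplitz_op ::
    "nat \<Rightarrow> nat \<Rightarrow> (complex \<Rightarrow> complex mat) \<Rightarrow> (nat \<Rightarrow> complex vec) \<Rightarrow> (nat \<Rightarrow> complex vec)" where
  "toeplitz_op k r F f =
    (\<lambda>i. Matrix.vec k (\<lambda>l. \<Sum>j\<le>i. (taylor_coeff k r F (i - j) *\<^sub>v f j) $ l))"

definition toeplitz_adj ::
    "nat \<Rightarrow> nat \<Rightarrow> (complex \<Rightarrow> complex mat) \<Rightarrow> (nat \<Rightarrow> complex vec) \<Rightarrow> (nat \<Rightarrow> complex vec)" where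
  "toeplitz_adj k r F = hilbert_adjoint (ell2 r) ell2_inner ell2_inner (toeplitz_op k r F)"

definition embed :: "nat \<Rightarrow> complex vec \<Rightarrow> (nat \<Rightarrow> complex vec)" where
  "embed k x = (\<lambda>i. if i = 0 then x else 0\<^sub>v k)"

definition embed_adj :: "nat \<Rightarrow> (nat \<Rightarrow> complex vec) \<Rightarrow> complex vec" where
  "embed_adj k = hilbert_adjoint (carrier_vec k) cinner ell2_inner (embed k)"

definition matrix_of_op :: "nat \<Rightarrow> (complex vec \<Rightarrow> complex vec) \<Rightarrow> complex mat" where
  "matrix_of_op k L = Matrix.mat k k (\<lambda>(i, j). L (unit_vec k j) $ i)"

definition left_minimal_rank_factor ::
    "nat \<Rightarrow> nat \<Rightarrow> (complex \<Rightarrow> complex mat) \<Rightarrow> complex mat \<Rightarrow> bool" where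
  "left_minimal_rank_factor m p G \<Theta> \<longleftrightarrow>
    \<Theta> \<in> carrier_mat p (p - m) \<and>
    inj_on (\<lambda>x. \<Theta> *\<^sub>v x) (carrier_vec (p - m)) \<and>
    \<Theta> * \<Theta>\<^sup>\<dagger> = 1\<^sub>m p - matrix_of_op p
      (embed_adj p \<circ> toeplitz_adj m p G
        \<circ> inv_into (ell2 m) (toeplitz_op m p G \<circ> toeplitz_adj m p G)
        \<circ> toeplitz_op m p G \<circ> embed p)"

text \<open>
  Let \<open>R = G G\<^sup>\<dagger> - K K\<^sup>\<dagger>\<close> on the circle, \<open>T\<^sub>R\<close> its Toeplitz operator,
  \<open>W\<^sub>0 = (C\<^sub>0 A\<^sub>0 ^ \<nu>)\<^sub>\<nu>\<close>, and \<open>S\<close> the forward shift. Then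
  \<open>T\<^sub>R\<inverse> T\<^sub>K E\<^sub>q = E\<^sub>m M + S W\<^sub>0 (B\<^sub>2 - \<Gamma> M)\<close> with
  \<open>M = \<Delta>\<inverse> (D\<^sub>2 - \<Gamma>\<^sup>\<dagger> Q B\<^sub>2)\<close>. This is where the factor
  \<open>D\<^sub>2 - \<Gamma>\<^sup>\<dagger> Q B\<^sub>2\<close> in \<open>B\<^sub>0\<close>, in \<open>\<Upsilon>\<^sub>1\<^sub>2(0)\<close> and in \<open>\<Delta>\<^sub>0\<close> comes from. In the
  source \<open>B\<^sub>0\<close> and \<open>\<Upsilon>\<^sub>1\<^sub>2(0)\<close> are printed with \<open>D\<^sub>2\<close> alone, for which the assertion fails:
  for \<open>m = p = q = n = 1\<close>, \<open>A = 0\<close>, \<open>C = 1\<close>, \<open>B\<^sub>1 = 0\<close>, \<open>B\<^sub>2 = 1\<close>, \<open>D\<^sub>1 = sqrt (9/2)\<close>,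
  \<open>D\<^sub>2 = 1\<close> one gets \<open>\<Upsilon>\<^sub>1\<^sub>2(0) / \<Upsilon>\<^sub>2\<^sub>2(0) = D\<^sub>1 / 9\<close>, while \<open>K(0) / G(0) = 2 D\<^sub>1 / 9\<close>.
\<close>

end

theory Submission
  imports Defs "Jordan_Normal_Form.Spectral_Radius"
begin

text \<open>
  Write \<open>(h\<^sub>1, h\<^sub>2) = \<Upsilon>(z) (u, v)\<close>. The Riccati equation makes the state space realization of \<open>\<Upsilon>\<close>
  an isometry between the forms \<open>|u|\<^sup>2 - |v|\<^sup>2\<close> and \<open>|h\<^sub>1|\<^sup>2 - |h\<^sub>2|\<^sup>2\<close> with storage form \<open>Q - Q P Q\<close>, where
  \<open>P = P\<^sub>1 - P\<^sub>2\<close>, and \<open>G h\<^sub>1 = K h\<^sub>2\<close>. Strict positivity of \<open>T\<^sub>G T\<^sub>G\<^sup>* - T\<^sub>K T\<^sub>K\<^sup>*\<close>, tested on the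
  sequences \<open>(c, C\<^sub>0 x, C\<^sub>0 A\<^sub>0 x, \<dots>)\<close>, makes the storage form positive definite. Hence for a Schur function \<open>Y\<close>
  the denominator is invertible and the quotient is a Schur solution. Conversely a solution \<open>X\<close> determines the
  state \<open>\<xi> = - (1 - P Q)\<inverse> (1 - z A)\<inverse> (B\<^sub>1 X - B\<^sub>2)\<close>, from which holomorphic \<open>U\<close>, \<open>V\<close> with
  \<open>\<Upsilon> (U, V) = (X, 1)\<close> can be read off. On circles \<open>|z| = s\<close> the isometry holds up to \<open>O(1 - s\<^sup>2)\<close>, and the maximum
  principle shows that \<open>V\<close> is invertible and \<open>Y = U V\<inverse>\<close> is a Schur function.
\<close>

text \<open>No inverse of the Toeplitz operator of the symbol belonging to G and K is ever formed.
  The test sequences are chosen because the adjoints of T_G and T_K map them to sequences of the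
  same shape, with \<open>C\<^sub>1\<close> and \<open>C\<^sub>2\<close> in place of
  \<open>C\<^sub>0\<close>: the Riccati equation makes the adjoint series telescope. Positivity thus
  becomes one finite-dimensional inequality in (c, x). \<Theta>_0 and Q_0 concern G alone and are
  covered by the same theory with q = 0. The outcome is that \<Theta>_0 is normalized with respect
  to the weight 1 + \<open>B\<^sub>1\<^sup>\<dagger>\<close> (Q_0^{-1} - P_1)^{-1} B_1. This is why
  Q_0 occurs in \<Delta>_1: it rewrites the identity matrix, and what remains is the weight that the
  isometry requires. The obstacle in the converse is that V is not known to be invertible inside the
  disc, and no boundary values are at hand. What helps is a bound \<rho> < 1 for the norm of
  U_22^{-1} U_21, uniform in z. It rests on recovering the state of \<Upsilon> from its outputs by
  the resolvent of A instead of that of A_0.\<close>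

no_notation fps_nth (infixl \<open>$\<close> 75)
no_notation Infinite_Set_Sum.abs_summable_on (infix \<open>abs'_summable'_on\<close> 50)

section \<open>Zero-padded matrices\<close>

text \<open>Matrices of all sizes, padded by zeros, form a ring (without unit), in which block identities are ring identities
  and no size conditions occur.\<close>

typedef fm = "{f :: nat \<Rightarrow> nat \<Rightarrow> complex. \<exists>N. \<forall>i j. i \<ge> N \<or> j \<ge> N \<longrightarrow> f i j = 0}"
  morphisms ent Abs_fm
  by (rule exI[of _ "\<lambda>_ _. 0"]) auto

setup_lifting type_definition_fm

lemma fm_eqI: "(\<And>i j. ent a i j = ent b i j) \<Longrightarrow> a = b"
  by (simp add: ent_inject[symmetric] ext)

lemma ent_bound: "\<exists>N. \<forall>i j. i \<ge> N \<or> j \<ge> N \<longrightarrow> ent a i j = 0"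
  using ent[of a] by auto

instantiation fm :: ring
begin

lift_definition zero_fm :: fm is "\<lambda>_ _. 0" by auto

lift_definition plus_fm :: "fm \<Rightarrow> fm \<Rightarrow> fm" is "\<lambda>f g i j. f i j + g i j"
proof -
  fix f g :: "nat \<Rightarrow> nat \<Rightarrow> complex"
  assume "\<exists>N. \<forall>i j. N \<le> i \<or> N \<le> j \<longrightarrow> f i j = 0" "\<exists>N. \<forall>i j. N \<le> i \<or> N \<le> j \<longrightarrow> g i j = 0"
  then obtain N M where "\<forall>i j. N \<le> i \<or> N \<le> j \<longrightarrow> f i j = 0" "\<forall>i j. M \<le> i \<or> M \<le> j \<longrightarrow> g i j = 0"
    by auto
  then show "\<exists>N. \<forall>i j. N \<le> i \<or> N \<le> j \<longrightarrow> f i j + g i j = 0"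
    by (intro exI[of _ "max N M"]) auto
qed

lift_definition uminus_fm :: "fm \<Rightarrow> fm" is "\<lambda>f i j. - f i j" by auto

definition minus_fm :: "fm \<Rightarrow> fm \<Rightarrow> fm" where "minus_fm a b = a + (- b)"

lift_definition times_fm :: "fm \<Rightarrow> fm \<Rightarrow> fm" is "\<lambda>f g i k. \<Sum>j. f i j * g j k"
proof -
  fix f g :: "nat \<Rightarrow> nat \<Rightarrow> complex"
  assume "\<exists>N. \<forall>i j. N \<le> i \<or> N \<le> j \<longrightarrow> f i j = 0" "\<exists>N. \<forall>i j. N \<le> i \<or> N \<le> j \<longrightarrow> g i j = 0"
  then obtain N M where "\<forall>i j. N \<le> i \<or> N \<le> j \<longrightarrow> f i j = 0" "\<forall>i j. M \<le> i \<or> M \<le> j \<longrightarrow> g i j = 0"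
    by auto
  then show "\<exists>N. \<forall>i k. N \<le> i \<or> N \<le> k \<longrightarrow> (\<Sum>j. f i j * g j k) = 0"
    by (intro exI[of _ "max N M"]) auto
qed

lemma ent_zero [simp]: "ent 0 i j = 0" by transfer simp
lemma ent_plus [simp]: "ent (a + b) i j = ent a i j + ent b i j" by transfer simp
lemma ent_uminus [simp]: "ent (- a) i j = - ent a i j" by transfer simp
lemma ent_minus [simp]: "ent (a - b) i j = ent a i j - ent b i j" by (simp add: minus_fm_def)

lemma ent_times:
  assumes "\<And>j. j \<ge> N \<Longrightarrow> ent a i j * ent b j k = 0"
  shows "ent (a * b) i k = (\<Sum>j<N. ent a i j * ent b j k)"
proof -
  have "ent (a * b) i k = (\<Sum>j. ent a i j * ent b j k)" by transfer simp
  also have "\<dots> = (\<Sum>j<N. ent a i j * ent b j k)"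
    using assms by (intro suminf_finite) (auto simp: not_less)
  finally show ?thesis .
qed

lemma ent_bound2: "\<exists>N. (\<forall>i j. i \<ge> N \<or> j \<ge> N \<longrightarrow> ent a i j = 0) \<and> (\<forall>i j. i \<ge> N \<or> j \<ge> N \<longrightarrow> ent b i j = 0)"
proof -
  obtain N M where "\<forall>i j. i \<ge> N \<or> j \<ge> N \<longrightarrow> ent a i j = 0" "\<forall>i j. i \<ge> M \<or> j \<ge> M \<longrightarrow> ent b i j = 0"
    using ent_bound by metis
  then show ?thesis by (intro exI[of _ "max N M"]) auto
qed

instance
proof
  fix a b c :: fm
  show "a + b + c = a + (b + c)" by (rule fm_eqI) simp
  show "a + b = b + a" by (rule fm_eqI) simp
  show "0 + a = a" by (rule fm_eqI) simp
  show "- a + a = 0" by (rule fm_eqI) simp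
  show "a - b = a + - b" by (simp add: minus_fm_def)
  obtain N where N: "\<forall>i j. i \<ge> N \<or> j \<ge> N \<longrightarrow> ent a i j = 0" "\<forall>i j. i \<ge> N \<or> j \<ge> N \<longrightarrow> ent b i j = 0"
    using ent_bound2 by metis
  obtain N' where N': "\<forall>i j. i \<ge> N' \<or> j \<ge> N' \<longrightarrow> ent c i j = 0" using ent_bound by metis
  show "a * b * c = a * (b * c)"
  proof (rule fm_eqI)
    fix i k
    have "ent (a * b * c) i k = (\<Sum>l<N'. (\<Sum>j<N. ent a i j * ent b j l) * ent c l k)"
      using N N' by (subst ent_times[of N'], simp) (intro sum.cong refl, subst ent_times[of N], auto)
    also have "\<dots> = (\<Sum>j<N. ent a i j * (\<Sum>l<N'. ent b j l * ent c l k))"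
      by (simp add: sum_distrib_left sum_distrib_right mult.assoc) (rule sum.swap)
    also have "\<dots> = ent (a * (b * c)) i k"
      using N N' by (subst ent_times[of N], simp) (intro sum.cong refl, subst ent_times[of N'], auto)
    finally show "ent (a * b * c) i k = ent (a * (b * c)) i k" .
  qed
  show "(a + b) * c = a * c + b * c"
    using N' by (intro fm_eqI) (simp add: ent_times[of N'] distrib_right sum.distrib)
  show "a * (b + c) = a * b + a * c"
    using N by (intro fm_eqI) (simp add: ent_times[of N] distrib_left sum.distrib)
qed

end

lift_definition adj :: "fm \<Rightarrow> fm" is "\<lambda>f i j. cnj (f j i)" by auto

lift_definition smul :: "complex \<Rightarrow> fm \<Rightarrow> fm" is "\<lambda>c f i j. c * f i j"
  by auto

lemma ent_adj [simp]: "ent (adj a) i j = cnj (ent a j i)" by transfer simp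
lemma ent_smul [simp]: "ent (smul c a) i j = c * ent a i j" by transfer simp

lemma adj_add [simp]: "adj (a + b) = adj a + adj b" by (rule fm_eqI) simp
lemma adj_diff [simp]: "adj (a - b) = adj a - adj b" by (rule fm_eqI) simp
lemma adj_zero [simp]: "adj 0 = 0" by (rule fm_eqI) simp
lemma adj_adj [simp]: "adj (adj a) = a" by (rule fm_eqI) simp
lemma adj_smul [simp]: "adj (smul c a) = smul (cnj c) (adj a)" by (rule fm_eqI) simp

lemma adj_mult [simp]: "adj (a * b) = adj b * adj a"
proof (rule fm_eqI)
  fix i k
  obtain N where N: "\<forall>i j. i \<ge> N \<or> j \<ge> N \<longrightarrow> ent a i j = 0" "\<forall>i j. i \<ge> N \<or> j \<ge> N \<longrightarrow> ent b i j = 0"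
    using ent_bound2 by metis
  then have "ent (a * b) k i = (\<Sum>j<N. ent a k j * ent b j i)"
    "ent (adj b * adj a) i k = (\<Sum>j<N. ent (adj b) i j * ent (adj a) j k)"
    by (intro ent_times; simp)+
  then show "ent (adj (a * b)) i k = ent (adj b * adj a) i k"
    by (simp add: mult.commute)
qed

lemma smul_mult_left [simp]: "smul c a * b = smul c (a * b)"
proof (rule fm_eqI)
  fix i k
  obtain N where N: "\<forall>i j. i \<ge> N \<or> j \<ge> N \<longrightarrow> ent a i j = 0" using ent_bound by metis
  then have "ent (a * b) i k = (\<Sum>j<N. ent a i j * ent b j k)"
    "ent (smul c a * b) i k = (\<Sum>j<N. ent (smul c a) i j * ent b j k)"
    by (intro ent_times; simp)+
  then show "ent (smul c a * b) i k = ent (smul c (a * b)) i k"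
    by (simp add: sum_distrib_left mult.assoc)
qed

lemma smul_mult_right [simp]: "a * smul c b = smul c (a * b)"
proof (rule fm_eqI)
  fix i k
  obtain N where N: "\<forall>i j. i \<ge> N \<or> j \<ge> N \<longrightarrow> ent a i j = 0" using ent_bound by metis
  then have "ent (a * b) i k = (\<Sum>j<N. ent a i j * ent b j k)"
    "ent (a * smul c b) i k = (\<Sum>j<N. ent a i j * ent (smul c b) j k)"
    by (intro ent_times; simp)+
  then show "ent (a * smul c b) i k = ent (smul c (a * b)) i k"
    by (simp add: sum_distrib_left mult.left_commute)
qed

lemma smul_add: "smul c (a + b) = smul c a + smul c b" by (rule fm_eqI) (simp add: distrib_left)
lemma smul_diff: "smul c (a - b) = smul c a - smul c b" by (rule fm_eqI) (simp add: right_diff_distrib)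
lemma smul_uminus [simp]: "smul c (- a) = - smul c a" by (rule fm_eqI) simp
lemma smul_smul [simp]: "smul c (smul d a) = smul (c * d) a" by (rule fm_eqI) simp
lemma smul_one [simp]: "smul 1 a = a" by (rule fm_eqI) simp

section \<open>Embedding of matrices and vectors into the ring\<close>

lift_definition fm :: "complex mat \<Rightarrow> fm" is
  "\<lambda>A i j. if i < dim_row A \<and> j < dim_col A then A $$ (i, j) else 0"
  subgoal for A by (rule exI[of _ "max (dim_row A) (dim_col A)"]) auto
  done

lift_definition fv :: "complex vec \<Rightarrow> fm" is
  "\<lambda>x i j. if i < dim_vec x \<and> j = 0 then x $ i else 0"
  subgoal for x by (rule exI[of _ "Suc (dim_vec x)"]) auto
  done

lemma ent_fm: "ent (fm A) i j = (if i < dim_row A \<and> j < dim_col A then A $$ (i, j) else 0)"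
  by (simp add: fm.rep_eq fv.rep_eq)

lemma ent_fv: "ent (fv x) i j = (if i < dim_vec x \<and> j = 0 then x $ i else 0)"
  by (simp add: fm.rep_eq fv.rep_eq)

text \<open>Padding forgets the sizes, so a matrix equation comes back from the ring only together
  with its two size conditions. Most matrix identities below are transported in this way.\<close>

lemma fm_cancel:
  assumes "fm A = fm B" "dim_row A = dim_row B" "dim_col A = dim_col B"
  shows "A = B"
proof (rule eq_matI)
  fix i j assume ij: "i < dim_row B" "j < dim_col B"
  have "ent (fm A) i j = ent (fm B) i j" using assms by simp
  then show "A $$ (i, j) = B $$ (i, j)" using ij assms(2,3) by (simp add: ent_fm)
qed (use assms in auto)

lemma fv_cancel:
  assumes "fv x = fv y" "dim_vec x = dim_vec y"
  shows "x = y"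
proof (rule eq_vecI)
  fix i assume i: "i < dim_vec y"
  have "ent (fv x) i 0 = ent (fv y) i 0" using assms by simp
  then show "x $ i = y $ i" using i assms(2) by (simp add: ent_fv)
qed (use assms in auto)

lemma mat_adjoint_dim [simp]: "dim_row (A\<^sup>\<dagger>) = dim_col A" "dim_col (A\<^sup>\<dagger>) = dim_row A"
  by (simp_all add: mat_adjoint_def)

lemma mat_adjoint_carrier [simp, intro]: "A \<in> carrier_mat k r \<Longrightarrow> A\<^sup>\<dagger> \<in> carrier_mat r k"
  by (metis carrier_matD carrier_matI mat_adjoint_dim)

lemma mat_adjoint_index [simp]:
  "i < dim_col A \<Longrightarrow> j < dim_row A \<Longrightarrow> (A\<^sup>\<dagger>) $$ (i, j) = cnj (A $$ (j, i))" for A :: "complex mat"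
  by (simp add: mat_adjoint_def mat_of_rows_def)

lemma fm_mult [simp]: "dim_col A = dim_row B \<Longrightarrow> fm (A * B) = fm A * fm B"
  by (rule fm_eqI, subst ent_times[of "dim_row B"])
     (auto simp: ent_fm scalar_prod_def lessThan_atLeast0)

lemma fm_add [simp]: "dim_row A = dim_row B \<Longrightarrow> dim_col A = dim_col B \<Longrightarrow> fm (A + B) = fm A + fm B"
  by (rule fm_eqI) (auto simp: ent_fm)

lemma fm_diff [simp]: "dim_row A = dim_row B \<Longrightarrow> dim_col A = dim_col B \<Longrightarrow> fm (A - B) = fm A - fm B"
  by (rule fm_eqI) (auto simp: ent_fm)

lemma fm_uminus [simp]: "fm (- A) = - fm A"
  by (rule fm_eqI) (auto simp: ent_fm)

lemma fm_smult [simp]: "fm (c \<cdot>\<^sub>m A) = smul c (fm A)"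
  by (rule fm_eqI) (auto simp: ent_fm)

lemma fm_adj [simp]: "fm (A\<^sup>\<dagger>) = adj (fm A)"
  by (rule fm_eqI) (auto simp: ent_fm)

lemma fm_zero [simp]: "fm (0\<^sub>m k r) = 0"
  by (rule fm_eqI) (auto simp: ent_fm)

lemma ent_one_fm: "ent (fm (1\<^sub>m n)) i j = (if i = j \<and> i < n then 1 else 0)"
  by (auto simp: ent_fm)

text \<open>In the absence of a unit, the padded identity of size n is an idempotent that acts as
  one on everything supported in the first n rows; the proof uses no other property of the right
  factor.\<close>

lemma fm_one_left [simp]:
  "dim_row A = n \<Longrightarrow> fm (1\<^sub>m n) * fm A = fm A"
  "dim_vec x = n \<Longrightarrow> fm (1\<^sub>m n) * fv x = fv x"
proof -
  have "fm (1\<^sub>m n) * X = X" if X: "\<And>i j. i \<ge> n \<Longrightarrow> ent X i j = 0" for X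
  proof (rule fm_eqI)
    fix i j
    have "ent (fm (1\<^sub>m n) * X) i j = (\<Sum>l<n. ent (fm (1\<^sub>m n)) i l * ent X l j)"
      by (rule ent_times) (simp add: X)
    also have "\<dots> = (\<Sum>l<n. if l = i then ent X l j else 0)"
      by (intro sum.cong) (auto simp: ent_one_fm)
    also have "\<dots> = ent X i j" using X by (auto simp: not_less)
    finally show "ent (fm (1\<^sub>m n) * X) i j = ent X i j" .
  qed
  then show "dim_row A = n \<Longrightarrow> fm (1\<^sub>m n) * fm A = fm A"
    "dim_vec x = n \<Longrightarrow> fm (1\<^sub>m n) * fv x = fv x"
    by (simp_all add: ent_fm ent_fv)
qed

lemma adj_fm_one [simp]: "adj (fm (1\<^sub>m n)) = fm (1\<^sub>m n)"
  by (rule fm_eqI) (auto simp: ent_fm)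

lemma fm_one_right [simp]: "dim_col A = n \<Longrightarrow> fm A * fm (1\<^sub>m n) = fm A"
  using arg_cong[OF fm_one_left(1)[of "A\<^sup>\<dagger>" n], of adj] by simp

lemma fm_one_left_assoc [simp]:
  "dim_row A = n \<Longrightarrow> fm (1\<^sub>m n) * (fm A * X) = fm A * X"
  by (simp flip: mult.assoc)

lemma fv_mult [simp]: "dim_vec x = dim_col A \<Longrightarrow> fv (A *\<^sub>v x) = fm A * fv x"
  by (rule fm_eqI, subst ent_times[of "dim_col A"])
     (auto simp: ent_fm ent_fv scalar_prod_def lessThan_atLeast0)

lemma fv_add [simp]: "dim_vec x = dim_vec y \<Longrightarrow> fv (x + y) = fv x + fv y"
  by (rule fm_eqI) (auto simp: ent_fv)

lemma fv_diff [simp]: "dim_vec x = dim_vec y \<Longrightarrow> fv (x - y) = fv x - fv y"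
  by (rule fm_eqI) (auto simp: ent_fv)

lemma fv_uminus [simp]: "fv (- x) = - fv x"
  by (rule fm_eqI) (auto simp: ent_fv)

lemma fv_smult [simp]: "fv (c \<cdot>\<^sub>v x) = smul c (fv x)"
  by (rule fm_eqI) (auto simp: ent_fv)

lemma fv_zero [simp]: "fv (0\<^sub>v k) = 0"
  by (rule fm_eqI) (auto simp: ent_fv)

text \<open>Vectors occupy column 0, so an inner product is one entry of a product. A ring identity
  multiplied by vectors from both sides thereby becomes an identity between forms.\<close>

lemma cinner_fv: "dim_vec x = dim_vec y \<Longrightarrow> cinner x y = ent (adj (fv y) * fv x) 0 0"
  by (subst ent_times[of "dim_vec x"])
     (auto simp: ent_fv scalar_prod_def lessThan_atLeast0 mult.commute)

section \<open>Norms, inverses and positive definite matrices\<close>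

lemma cinner_sum: "dim_vec y = n \<Longrightarrow> cinner x y = (\<Sum>i<n. x $ i * cnj (y $ i))"
  by (simp add: scalar_prod_def lessThan_atLeast0)

lemma cnorm_L2: "cnorm x = L2_set (\<lambda>i. cmod (x $ i)) {..<dim_vec x}"
  unfolding cnorm_def L2_set_def
  by (simp add: cinner_sum flip: complex_norm_square)

lemma cnorm_ge0 [simp]: "0 \<le> cnorm x"
  by (simp add: cnorm_L2)

lemma cinner_self: "cinner x x = complex_of_real ((cnorm x)\<^sup>2)"
proof -
  have "cinner x x = complex_of_real (\<Sum>i<dim_vec x. (cmod (x $ i))\<^sup>2)"
    by (simp only: cinner_sum complex_norm_square of_real_sum)
  then show ?thesis
    by (simp add: cnorm_L2 L2_set_def sum_nonneg)
qed

lemma cnorm_sq: "(cnorm x)\<^sup>2 = Re (cinner x x)"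
  by (simp only: cinner_self Re_complex_of_real)

lemma cinner_cnj: "dim_vec x = dim_vec y \<Longrightarrow> cinner y x = cnj (cinner x y)"
  by (simp add: cinner_sum mult.commute)

lemma cauchy_schwarz: "dim_vec x = dim_vec y \<Longrightarrow> cmod (cinner x y) \<le> cnorm x * cnorm y"
proof -
  assume d: "dim_vec x = dim_vec y"
  have "cmod (cinner x y) \<le> (\<Sum>i<dim_vec y. \<bar>cmod (x $ i)\<bar> * \<bar>cmod (y $ i)\<bar>)"
    by (simp only: cinner_sum) (rule sum_norm_le, simp add: norm_mult)
  also have "\<dots> \<le> cnorm x * cnorm y"
    unfolding cnorm_L2 d by (rule L2_set_mult_ineq)
  finally show ?thesis .
qed

lemma cnorm_triangle: "dim_vec x = dim_vec y \<Longrightarrow> cnorm (x + y) \<le> cnorm x + cnorm y"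
proof -
  assume d: "dim_vec x = dim_vec y"
  have "cnorm (x + y) \<le> L2_set (\<lambda>i. cmod (x $ i) + cmod (y $ i)) {..<dim_vec y}"
    unfolding cnorm_L2 index_add_vec(2) using d by (intro L2_set_mono) (auto intro: norm_triangle_ineq)
  also have "\<dots> \<le> cnorm x + cnorm y"
    unfolding cnorm_L2 d by (rule L2_set_triangle_ineq)
  finally show ?thesis .
qed

lemma cnorm_smult [simp]: "cnorm (c \<cdot>\<^sub>v x) = cmod c * cnorm x"
  unfolding cnorm_L2 by (subst L2_set_right_distrib) (auto intro!: L2_set_cong simp: norm_mult)

lemma cnorm_zero [simp]: "cnorm (0\<^sub>v n) = 0"
  by (simp add: cnorm_L2 L2_set_def)

lemma cnorm_triangle_diff: "dim_vec x = dim_vec y \<Longrightarrow> cnorm (x - y) \<le> cnorm x + cnorm y"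
proof -
  assume d: "dim_vec x = dim_vec y"
  have "cnorm (x - y) \<le> L2_set (\<lambda>i. cmod (x $ i) + cmod (y $ i)) {..<dim_vec y}"
    unfolding cnorm_L2 index_minus_vec(2) using d by (intro L2_set_mono) (auto intro: norm_triangle_ineq4)
  also have "\<dots> \<le> cnorm x + cnorm y"
    unfolding cnorm_L2 d by (rule L2_set_triangle_ineq)
  finally show ?thesis .
qed

lemma cnorm_eq_0_iff: "x \<in> carrier_vec n \<Longrightarrow> cnorm x = 0 \<longleftrightarrow> x = 0\<^sub>v n"
  unfolding cnorm_L2 by (subst L2_set_eq_0_iff) (auto intro!: eq_vecI)

lemma cmod_index_le: "i < dim_vec x \<Longrightarrow> cmod (x $ i) \<le> cnorm x"
  unfolding cnorm_L2 by (rule member_le_L2_set) auto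

lemma cnorm_le_sum: "cnorm x \<le> (\<Sum>i<dim_vec x. cmod (x $ i))"
  unfolding cnorm_L2 by (rule L2_set_le_sum) auto

lemma mult_mat_vec_index_sum:
  "i < dim_row M \<Longrightarrow> dim_vec x = dim_col M \<Longrightarrow> (M *\<^sub>v x) $ i = (\<Sum>j<dim_col M. M $$ (i, j) * x $ j)"
  by (simp add: scalar_prod_def lessThan_atLeast0)

lemma cnorm_mult_entry_bound:
  assumes "M \<in> carrier_mat k r" "x \<in> carrier_vec r"
    and b: "\<And>i j. i < k \<Longrightarrow> j < r \<Longrightarrow> cmod (M $$ (i, j)) \<le> b"
  shows "cnorm (M *\<^sub>v x) \<le> (real k * real r * b) * cnorm x"
proof -
  have "cmod ((M *\<^sub>v x) $ i) \<le> real r * (b * cnorm x)" if i: "i < k" for i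
  proof -
    have "cmod ((M *\<^sub>v x) $ i) \<le> (\<Sum>j<r. cmod (M $$ (i, j)) * cmod (x $ j))"
      using assms i by (simp add: mult_mat_vec_index_sum del: index_mult_mat_vec)
        (rule sum_norm_le, simp add: norm_mult)
    also have "\<dots> \<le> (\<Sum>j<r. b * cnorm x)"
      using assms(1,2) i by (intro sum_mono mult_mono b cmod_index_le order_trans[OF norm_ge_zero b]) auto
    finally show ?thesis by simp
  qed
  then have "(\<Sum>i<k. cmod ((M *\<^sub>v x) $ i)) \<le> (\<Sum>i<k. real r * (b * cnorm x))"
    by (intro sum_mono) auto
  then show ?thesis using cnorm_le_sum[of "M *\<^sub>v x"] assms(1) by (simp add: mult.assoc)
qed

lemma mult_mat_zero_vec [simp]: "dim_col M = n \<Longrightarrow> M *\<^sub>v 0\<^sub>v n = 0\<^sub>v (dim_row M)" for M :: "complex mat"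
  by (rule fv_cancel) simp_all

lemma cinner_mult_left:
  assumes "dim_vec x = dim_col M" "dim_vec y = dim_row M"
  shows "cinner (M *\<^sub>v x) y = cinner x (M\<^sup>\<dagger> *\<^sub>v y)"
  using assms by (simp add: cinner_fv mult.assoc)

section \<open>Inverses and positive definite matrices\<close>

lemma minv_works:
  assumes M: "M \<in> carrier_mat n n" and inj: "\<forall>x\<in>carrier_vec n. M *\<^sub>v x = 0\<^sub>v n \<longrightarrow> x = 0\<^sub>v n"
  shows "minv M \<in> carrier_mat n n" "M * minv M = 1\<^sub>m n" "minv M * M = 1\<^sub>m n" "invertible_mat M" "det M \<noteq> 0"
proof -
  show d: "det M \<noteq> 0" using det_0_iff_vec_prod_zero_field[OF M] inj by blast
  from det_non_zero_imp_unit[OF M d] mat_inverse(1)[OF M]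
  obtain B where B: "mat_inverse M = Some B" by (metis option.exhaust)
  from mat_inverse(2)[OF M B] B
  show "minv M \<in> carrier_mat n n" "M * minv M = 1\<^sub>m n" "minv M * M = 1\<^sub>m n" by auto
  then show "invertible_mat M" using M
    unfolding invertible_mat_def inverts_mat_def by auto
qed

lemma minv_fm:
  assumes "M \<in> carrier_mat n n" and "\<forall>x\<in>carrier_vec n. M *\<^sub>v x = 0\<^sub>v n \<longrightarrow> x = 0\<^sub>v n"
  shows "fm M * fm (minv M) = fm (1\<^sub>m n)" "fm (minv M) * fm M = fm (1\<^sub>m n)"
  using minv_works[OF assms] assms(1) by (metis carrier_matD fm_mult)+

lemma minv_eqI:
  assumes M: "M \<in> carrier_mat n n" and N: "N \<in> carrier_mat n n" and NM: "N * M = 1\<^sub>m n"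
  shows "minv M = N"
proof -
  have "x = 0\<^sub>v n" if "x \<in> carrier_vec n" "M *\<^sub>v x = 0\<^sub>v n" for x
  proof -
    have "x = (N * M) *\<^sub>v x" using that NM by simp
    also have "\<dots> = N *\<^sub>v (M *\<^sub>v x)" using M N that by simp
    finally show ?thesis using that N by (simp add: mult_mat_zero_vec)
  qed
  then have inj: "\<forall>x\<in>carrier_vec n. M *\<^sub>v x = 0\<^sub>v n \<longrightarrow> x = 0\<^sub>v n" by blast
  have "minv M = (N * M) * minv M" using minv_works(1)[OF M inj] NM by simp
  also have "\<dots> = N * (M * minv M)" using minv_works(1)[OF M inj] M N by (intro assoc_mult_mat) auto
  finally show ?thesis using minv_works(2)[OF M inj] N by simp
qed

lemma minv_solve:
  assumes M: "M \<in> carrier_mat n n" and inj: "\<forall>x\<in>carrier_vec n. M *\<^sub>v x = 0\<^sub>v n \<longrightarrow> x = 0\<^sub>v n"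
    and y: "y \<in> carrier_vec n"
  shows "M *\<^sub>v (minv M *\<^sub>v y) = y" "minv M *\<^sub>v (M *\<^sub>v y) = y"
  using minv_works(1,2,3)[OF M inj] y M
  by (metis assoc_mult_mat_vec one_mult_mat_vec)+

text \<open>Polarization: on e_i + c e_j the mixed part of the form is c M_ij + cnj c M_ji, and the
  choices c = 1 and c = \<i> compare imaginary and real parts of M_ij and M_ji. Reality of the form
  is what the order on \<open>complex\<close> supplies, since comparable numbers have equal
  imaginary parts.\<close>

lemma hermitian_of_real_form:
  fixes M :: "complex mat"
  assumes M: "M \<in> carrier_mat n n" and r: "\<And>x. x \<in> carrier_vec n \<Longrightarrow> Im (cinner (M *\<^sub>v x) x) = 0"
  shows "M\<^sup>\<dagger> = M"
proof (rule eq_matI)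
  fix i j assume "i < dim_row M" "j < dim_col M"
  then have ij: "i < n" "j < n" using M by auto
  have u: "cinner (M *\<^sub>v unit_vec n b) (unit_vec n a) = M $$ (a, b)" if "a < n" "b < n" for a b
  proof -
    have "cinner (M *\<^sub>v unit_vec n b) (unit_vec n a) = (\<Sum>i<n. (M *\<^sub>v unit_vec n b) $ i * cnj (unit_vec n a $ i))"
      using M by (simp add: cinner_sum)
    also have "\<dots> = (\<Sum>i<n. if i = a then (M *\<^sub>v unit_vec n b) $ i else 0)"
      using that by (intro sum.cong) auto
    also have "\<dots> = (M *\<^sub>v unit_vec n b) $ a" using that by simp
    also have "\<dots> = M $$ (a, b)" using M that by (simp add: scalar_prod_right_unit[of b n])
    finally show ?thesis .
  qed
  have q: "cinner (M *\<^sub>v (unit_vec n i + c \<cdot>\<^sub>v unit_vec n j)) (unit_vec n i + c \<cdot>\<^sub>v unit_vec n j)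
     = M $$ (i, i) + c * M $$ (i, j) + cnj c * M $$ (j, i) + c * cnj c * M $$ (j, j)" for c
  proof -
    have "cinner (M *\<^sub>v (unit_vec n i + c \<cdot>\<^sub>v unit_vec n j)) (unit_vec n i + c \<cdot>\<^sub>v unit_vec n j)
     = cinner (M *\<^sub>v unit_vec n i) (unit_vec n i) + c * cinner (M *\<^sub>v unit_vec n j) (unit_vec n i)
      + cnj c * cinner (M *\<^sub>v unit_vec n i) (unit_vec n j) + c * cnj c * cinner (M *\<^sub>v unit_vec n j) (unit_vec n j)"
      using M by (simp add: cinner_fv smul_add algebra_simps)
    then show ?thesis using ij by (simp add: u)
  qed
  have ii: "Im (M $$ (i, i)) = 0" using r[of "unit_vec n i"] u[of i i] ij by simp
  have jj: "Im (M $$ (j, j)) = 0" using r[of "unit_vec n j"] u[of j j] ij by simp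
  have "Im (M $$ (i, j) + M $$ (j, i)) = 0"
    using r[of "unit_vec n i + 1 \<cdot>\<^sub>v unit_vec n j"] ii jj unfolding q[of 1] by simp
  moreover have "Im (\<i> * M $$ (i, j) - \<i> * M $$ (j, i)) = 0"
    using r[of "unit_vec n i + \<i> \<cdot>\<^sub>v unit_vec n j"] ii jj unfolding q[of \<i>] by simp
  ultimately show "M\<^sup>\<dagger> $$ (i, j) = M $$ (i, j)"
    using M ij by (simp add: complex_eq_iff)
qed (use M in auto)

lemma strictly_positive_matD:
  assumes M: "M \<in> carrier_mat n n" and p: "strictly_positive_mat M"
  shows "M\<^sup>\<dagger> = M" "positive_definite_mat M"
proof -
  obtain e where e: "e > 0" "\<And>x. x \<in> carrier_vec n \<Longrightarrow> complex_of_real e * cinner x x \<le> cinner (M *\<^sub>v x) x"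
    using p M unfolding strictly_positive_mat_def strictly_positive_def by auto
  show "M\<^sup>\<dagger> = M"
  proof (rule hermitian_of_real_form[OF M])
    fix x :: "complex vec" assume "x \<in> carrier_vec n"
    from e(2)[OF this] show "Im (cinner (M *\<^sub>v x) x) = 0"
      by (simp add: cinner_self less_eq_complex_def)
  qed
  have "0 < cinner (M *\<^sub>v x) x" if x: "x \<in> carrier_vec n" "x \<noteq> 0\<^sub>v n" for x :: "complex vec"
  proof -
    have "0 < complex_of_real e * cinner x x"
    proof -
      have "0 < e * (cnorm x)\<^sup>2"
        using x e(1) cnorm_eq_0_iff[OF x(1)] by simp
      then have "0 < complex_of_real (e * (cnorm x)\<^sup>2)" by (simp add: less_complex_def)
      then show ?thesis by (simp add: cinner_self)
    qed
    then show ?thesis using e(2)[OF x(1)] by (rule less_le_trans)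
  qed
  then show "positive_definite_mat M"
    using M unfolding positive_definite_mat_def by auto
qed

lemma positive_definite_matI:
  assumes M: "M \<in> carrier_mat n n" and h: "M\<^sup>\<dagger> = M"
    and p: "\<And>x. x \<in> carrier_vec n \<Longrightarrow> x \<noteq> 0\<^sub>v n \<Longrightarrow> 0 < Re (cinner (M *\<^sub>v x) x)"
  shows "positive_definite_mat M"
proof -
  have "Im (cinner (M *\<^sub>v x) x) = 0" if "x \<in> carrier_vec n" for x :: "complex vec"
  proof -
    have "cinner (M *\<^sub>v x) x = cinner x (M *\<^sub>v x)" using M that by (simp add: cinner_mult_left h)
    then have "cnj (cinner (M *\<^sub>v x) x) = cinner (M *\<^sub>v x) x"
      using M that by (simp add: cinner_cnj[of "M *\<^sub>v x" x])
    then show ?thesis by (simp add: complex_eq_iff)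
  qed
  then show ?thesis using M p unfolding positive_definite_mat_def by (auto simp: less_complex_def)
qed

lemma positive_definite_matD:
  assumes M: "M \<in> carrier_mat n n" and p: "positive_definite_mat M"
  shows "M\<^sup>\<dagger> = M"
    "x \<in> carrier_vec n \<Longrightarrow> x \<noteq> 0\<^sub>v n \<Longrightarrow> 0 < Re (cinner (M *\<^sub>v x) x)"
    "x \<in> carrier_vec n \<Longrightarrow> 0 \<le> Re (cinner (M *\<^sub>v x) x)"
    "\<forall>x\<in>carrier_vec n. M *\<^sub>v x = 0\<^sub>v n \<longrightarrow> x = 0\<^sub>v n"
proof -
  have pos: "0 < cinner (M *\<^sub>v x) x" if "x \<in> carrier_vec n" "x \<noteq> 0\<^sub>v n" for x :: "complex vec"
    using p M that unfolding positive_definite_mat_def by auto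
  show "M\<^sup>\<dagger> = M"
  proof (rule hermitian_of_real_form[OF M])
    fix x :: "complex vec" assume "x \<in> carrier_vec n"
    then show "Im (cinner (M *\<^sub>v x) x) = 0"
      using pos[of x] M by (cases "x = 0\<^sub>v n") (auto simp: less_complex_def)
  qed
  show *: "0 < Re (cinner (M *\<^sub>v x) x)" if "x \<in> carrier_vec n" "x \<noteq> 0\<^sub>v n"
    using pos[OF that] by (simp add: less_complex_def)
  show "0 \<le> Re (cinner (M *\<^sub>v x) x)" if "x \<in> carrier_vec n"
    using that * M by (cases "x = 0\<^sub>v n") (auto simp: less_imp_le)
  show "\<forall>x\<in>carrier_vec n. M *\<^sub>v x = 0\<^sub>v n \<longrightarrow> x = 0\<^sub>v n"
  proof (intro ballI impI, rule ccontr)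
    fix x assume x: "x \<in> carrier_vec n" "M *\<^sub>v x = 0\<^sub>v n" "x \<noteq> 0\<^sub>v n"
    from pos[OF x(1,3)] x(1,2) show False by simp
  qed
qed

lemma positive_definite_minv:
  assumes M: "M \<in> carrier_mat n n" and p: "positive_definite_mat M"
  shows "positive_definite_mat (minv M)" "(minv M)\<^sup>\<dagger> = minv M"
proof -
  note d = positive_definite_matD[OF M p] and w = minv_works[OF M positive_definite_matD(4)[OF M p]]
  have "(minv M)\<^sup>\<dagger> * M = 1\<^sub>m n"
  proof (rule fm_cancel)
    have "fm ((minv M)\<^sup>\<dagger> * M) = adj (fm (M\<^sup>\<dagger> * minv M))" using M w(1) by simp
    also have "\<dots> = fm (1\<^sub>m n)" unfolding d(1) w(2) by simp
    finally show "fm ((minv M)\<^sup>\<dagger> * M) = fm (1\<^sub>m n)" .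
  qed (use M w(1) in auto)
  then show h: "(minv M)\<^sup>\<dagger> = minv M" using w(1) by (intro minv_eqI[OF M, symmetric]) auto
  show "positive_definite_mat (minv M)"
  proof (rule positive_definite_matI[OF w(1) h])
    fix x :: "complex vec" assume x: "x \<in> carrier_vec n" "x \<noteq> 0\<^sub>v n"
    define y where "y = minv M *\<^sub>v x"
    have y: "y \<in> carrier_vec n" "M *\<^sub>v y = x" using w(1) x minv_solve(1)[OF M d(4) x(1)] unfolding y_def by auto
    then have "y \<noteq> 0\<^sub>v n" using x M by auto
    have "cinner (minv M *\<^sub>v x) x = cinner y (M *\<^sub>v y)" using y by (simp add: y_def)
    also have "\<dots> = cinner (M *\<^sub>v y) y" using M y(1) d(1) by (simp add: cinner_mult_left)
    finally show "0 < Re (cinner (minv M *\<^sub>v x) x)" using d(2)[OF y(1) \<open>y \<noteq> 0\<^sub>v n\<close>] by simp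
  qed
qed

section \<open>Stable matrices\<close>

lemma pow_mat_carrier [simp, intro]: "A \<in> carrier_mat n n \<Longrightarrow> A ^\<^sub>m k \<in> carrier_mat n n" for A :: "complex mat"
  by (rule pow_carrier_mat)

lemma mult_mat_vec_carrier' [simp, intro]: "A \<in> carrier_mat k r \<Longrightarrow> A *\<^sub>v x \<in> carrier_vec k" for A :: "complex mat"
  by (auto intro: carrier_vecI)

lemma mat_pow_add: "A \<in> carrier_mat n n \<Longrightarrow> A ^\<^sub>m (k + l) = A ^\<^sub>m k * A ^\<^sub>m l" for A :: "complex mat"
proof (induction l)
  case (Suc l)
  then have "A ^\<^sub>m (k + Suc l) = A ^\<^sub>m k * A ^\<^sub>m l * A" by simp
  also have "\<dots> = A ^\<^sub>m k * (A ^\<^sub>m l * A)" using Suc.prems by (intro assoc_mult_mat) auto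
  finally show ?case by simp
qed auto

lemma mat_pow_Suc2: "A \<in> carrier_mat n n \<Longrightarrow> A ^\<^sub>m (Suc k) = A * A ^\<^sub>m k" for A :: "complex mat"
  using mat_pow_add[of A n 1 k] by simp

lemma smult_mat_pow: "A \<in> carrier_mat n n \<Longrightarrow> (c \<cdot>\<^sub>m A) ^\<^sub>m k = c ^ k \<cdot>\<^sub>m A ^\<^sub>m k" for A :: "complex mat"
proof (induction k)
  case 0
  then show ?case by (intro eq_matI) auto
next
  case (Suc k)
  have "(c \<cdot>\<^sub>m A) ^\<^sub>m Suc k = (c ^ k \<cdot>\<^sub>m A ^\<^sub>m k) * (c \<cdot>\<^sub>m A)" using Suc by simp
  also have "\<dots> = c ^ Suc k \<cdot>\<^sub>m A ^\<^sub>m Suc k"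
    using Suc.prems by (intro fm_cancel) (auto simp: mult.commute)
  finally show ?case .
qed

lemma adjoint_mult: "dim_col A = dim_row B \<Longrightarrow> (A * B)\<^sup>\<dagger> = B\<^sup>\<dagger> * A\<^sup>\<dagger>" for A :: "complex mat"
  by (rule fm_cancel) auto

lemma adjoint_adjoint [simp]: "(A\<^sup>\<dagger>)\<^sup>\<dagger> = A" for A :: "complex mat"
  by (rule fm_cancel) auto

lemma adjoint_mat_pow: "A \<in> carrier_mat n n \<Longrightarrow> (A ^\<^sub>m k)\<^sup>\<dagger> = (A\<^sup>\<dagger>) ^\<^sub>m k" for A :: "complex mat"
proof (induction k)
  case 0
  then show ?case by (intro fm_cancel) auto
next
  case (Suc k)
  have "(A ^\<^sub>m Suc k)\<^sup>\<dagger> = (A * A ^\<^sub>m k)\<^sup>\<dagger>" using mat_pow_Suc2[OF Suc.prems] by simp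
  also have "\<dots> = (A\<^sup>\<dagger>) ^\<^sub>m Suc k" using Suc by (subst adjoint_mult) auto
  finally show ?case .
qed

text \<open>Stability with explicit constants: every series below is compared with a geometric one,
  and the same constants serve the adjoint matrix.\<close>

definition decay :: "nat \<Rightarrow> complex mat \<Rightarrow> real \<Rightarrow> real \<Rightarrow> bool" where
  "decay n A c \<rho> \<longleftrightarrow> A \<in> carrier_mat n n \<and> 0 \<le> c \<and> 0 < \<rho> \<and> \<rho> < 1 \<and>
    (\<forall>k i j. i < n \<longrightarrow> j < n \<longrightarrow> cmod ((A ^\<^sub>m k) $$ (i, j)) \<le> c * \<rho> ^ k)"

text \<open>Dividing by a number strictly between the largest eigenvalue modulus and 1 leaves a
  matrix of spectral radius below 1, whose powers are bounded; the divisor is the geometric rate.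
  Size 0 is separate because its spectrum is empty.\<close>

lemma stable_decay:
  assumes A: "A \<in> carrier_mat n n" and st: "stable_mat A"
  obtains c \<rho> where "decay n A c \<rho>"
proof (cases "n = 0")
  case True
  then show ?thesis using A that[of 0 "1/2"] by (auto simp: decay_def)
next
  case False
  define \<mu> where "\<mu> = Max (insert 0 (norm ` spectrum A))"
  have fin: "finite (insert 0 (norm ` spectrum A))" using card_finite_spectrum(1)[OF A] by simp
  have \<mu>: "0 \<le> \<mu>" "\<And>k. eigenvalue A k \<Longrightarrow> norm k \<le> \<mu>"
    unfolding \<mu>_def using fin by (auto intro!: Max_ge simp: spectrum_def)
  have "\<mu> \<in> insert 0 (norm ` spectrum A)" unfolding \<mu>_def using fin by (intro Max_in) auto
  then have \<mu>1: "\<mu> < 1" using st unfolding stable_mat_def spectrum_def by auto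
  define \<rho> where "\<rho> = (1 + \<mu>) / 2"
  have \<rho>: "0 < \<rho>" "\<rho> < 1" "\<mu> < \<rho>" using \<mu>(1) \<mu>1 unfolding \<rho>_def by auto
  define B where "B = complex_of_real (1 / \<rho>) \<cdot>\<^sub>m A"
  have B: "B \<in> carrier_mat n n" using A unfolding B_def by simp
  have AB: "A = complex_of_real \<rho> \<cdot>\<^sub>m B" using \<rho>(1) unfolding B_def by (intro fm_cancel) (auto simp flip: of_real_mult)
  have "spectral_radius B \<in> norm ` spectrum B" using spectral_radius_mem_max(1)[OF B] False by simp
  then obtain k where k: "eigenvalue B k" "spectral_radius B = norm k" unfolding spectrum_def by auto
  then obtain v where v: "v \<in> carrier_vec n" "v \<noteq> 0\<^sub>v n" "B *\<^sub>v v = k \<cdot>\<^sub>v v"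
    using B unfolding eigenvalue_def eigenvector_def by auto
  have "A *\<^sub>v v = (complex_of_real \<rho> * k) \<cdot>\<^sub>v v"
  proof (rule fv_cancel)
    have "fm B * fv v = smul k (fv v)" 
    proof -
      have "fm B * fv v = fv (B *\<^sub>v v)" using v(1) B by simp
      then show ?thesis unfolding v(3) by simp
    qed
    then show "fv (A *\<^sub>v v) = fv ((complex_of_real \<rho> * k) \<cdot>\<^sub>v v)"
      using v B by (subst AB) simp
  qed (use A v in auto)
  then have "eigenvalue A (complex_of_real \<rho> * k)" using v A unfolding eigenvalue_def eigenvector_def by auto
  from \<mu>(2)[OF this] \<rho> have "norm k < 1"
    by (simp add: norm_mult) (metis mult_cancel_left2 mult_le_cancel_left_pos not_le order_le_less_trans)
  with spectral_radius_jnf_norm_bound_less_1_upper_triangular[OF B] k(2)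
  obtain c where c: "\<forall>k. norm_bound (B ^\<^sub>m k) c" by auto
  have "cmod ((A ^\<^sub>m k) $$ (i, j)) \<le> \<bar>c\<bar> * \<rho> ^ k" if ij: "i < n" "j < n" for k i j
  proof -
    have "A ^\<^sub>m k = complex_of_real \<rho> ^ k \<cdot>\<^sub>m B ^\<^sub>m k" by (subst AB) (rule smult_mat_pow[OF B])
    then have "cmod ((A ^\<^sub>m k) $$ (i, j)) = \<rho> ^ k * cmod ((B ^\<^sub>m k) $$ (i, j))"
      using ij B \<rho>(1) by (simp add: norm_mult norm_power)
    also have "\<dots> \<le> \<rho> ^ k * \<bar>c\<bar>"
      using c ij B \<rho>(1) unfolding norm_bound_def by (intro mult_left_mono) (auto intro: order_trans[of _ c])
    finally show ?thesis by (simp add: mult.commute)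
  qed
  then show ?thesis using that[of "\<bar>c\<bar>" \<rho>] A \<rho> unfolding decay_def by auto
qed

lemma decay_adjoint: "decay n A c \<rho> \<Longrightarrow> decay n (A\<^sup>\<dagger>) c \<rho>"
proof -
  assume d: "decay n A c \<rho>"
  have "cmod (((A\<^sup>\<dagger>) ^\<^sub>m k) $$ (i, j)) = cmod ((A ^\<^sub>m k) $$ (j, i))" if "i < n" "j < n" for k i j
  proof -
    have A: "A \<in> carrier_mat n n" using d unfolding decay_def by simp
    show ?thesis using that A unfolding adjoint_mat_pow[OF A, symmetric] by simp
  qed
  with d show ?thesis unfolding decay_def by simp
qed

lemma decay_vec:
  assumes "decay n A c \<rho>" "x \<in> carrier_vec n"
  shows "cnorm (A ^\<^sub>m k *\<^sub>v x) \<le> (real n * real n * c) * \<rho> ^ k * cnorm x"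
  using cnorm_mult_entry_bound[of "A ^\<^sub>m k" n n x "c * \<rho> ^ k"] assms
  unfolding decay_def by (auto simp: mult.assoc)

lemma decay_power_tendsto:
  assumes "decay n A c \<rho>"
  shows "(\<lambda>k. a * \<rho> ^ k * b) \<longlonglongrightarrow> 0"
proof -
  have "(\<lambda>k. \<rho> ^ k) \<longlonglongrightarrow> 0" using assms unfolding decay_def by (intro LIMSEQ_power_zero) auto
  then show ?thesis by (intro tendsto_mult_left_zero tendsto_mult_right_zero)
qed

lemma mat_bounded:
  assumes "M \<in> carrier_mat k r"
  obtains b where "0 \<le> b" "\<And>x. x \<in> carrier_vec r \<Longrightarrow> cnorm (M *\<^sub>v x) \<le> b * cnorm x"
proof -
  define e where "e = (\<Sum>i<k. \<Sum>j<r. cmod (M $$ (i, j)))"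
  have "cmod (M $$ (i, j)) \<le> e" if "i < k" "j < r" for i j
  proof -
    have "cmod (M $$ (i, j)) \<le> (\<Sum>j<r. cmod (M $$ (i, j)))" using that by (intro member_le_sum) auto
    also have "\<dots> \<le> e" unfolding e_def using that
      by (intro member_le_sum[of i _ "\<lambda>i. \<Sum>j<r. cmod (M $$ (i, j))"]) (auto intro: sum_nonneg)
    finally show ?thesis .
  qed
  then have "cnorm (M *\<^sub>v x) \<le> (real k * real r * e) * cnorm x" if "x \<in> carrier_vec r" for x
    using cnorm_mult_entry_bound[OF assms that] by simp
  moreover have "0 \<le> real k * real r * e"
    unfolding e_def by (intro mult_nonneg_nonneg sum_nonneg) auto
  ultimately show ?thesis using that by blast
qed

lemma cinner_unit_vec:
  assumes "M \<in> carrier_mat n n" "a < n" "b < n"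
  shows "cinner (M *\<^sub>v unit_vec n b) (unit_vec n a) = M $$ (a, b)"
proof -
  have "cinner (M *\<^sub>v unit_vec n b) (unit_vec n a) = (\<Sum>i<n. (M *\<^sub>v unit_vec n b) $ i * cnj (unit_vec n a $ i))"
    using assms by (simp add: cinner_sum)
  also have "\<dots> = (\<Sum>i<n. if i = a then (M *\<^sub>v unit_vec n b) $ i else 0)"
    using assms by (intro sum.cong) auto
  also have "\<dots> = (M *\<^sub>v unit_vec n b) $ a" using assms by simp
  also have "\<dots> = M $$ (a, b)" using assms by (simp add: scalar_prod_right_unit[of b n])
  finally show ?thesis .
qed

text \<open>This disposes of the remainder in the telescoping arguments for Sylvester and Stein
  equations: the two arguments of the form are driven to zero by stable matrices, possibly different
  ones.\<close>

lemma cinner_pow_tendsto: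
  assumes L: "decay n L c \<rho>" and R: "decay n R c' \<rho>'" and X: "X \<in> carrier_mat n n"
    and xy: "x \<in> carrier_vec n" "y \<in> carrier_vec n"
  shows "(\<lambda>k. cinner (X *\<^sub>v (R ^\<^sub>m k *\<^sub>v x)) (L ^\<^sub>m k *\<^sub>v y)) \<longlonglongrightarrow> 0"
proof -
  note d = L[unfolded decay_def] R[unfolded decay_def]
  obtain b where b: "0 \<le> b" "\<And>x. x \<in> carrier_vec n \<Longrightarrow> cnorm (X *\<^sub>v x) \<le> b * cnorm x"
    using mat_bounded[OF X] by metis
  let ?c = "real n * real n * c" and ?c' = "real n * real n * c'"
  have c0: "0 \<le> ?c" "0 \<le> ?c'" using d by auto
  have "cmod (cinner (X *\<^sub>v (R ^\<^sub>m k *\<^sub>v x)) (L ^\<^sub>m k *\<^sub>v y)) \<le> (b * ?c' * cnorm x * (?c * cnorm y)) * \<rho>' ^ k * 1" for k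
  proof -
    have "cmod (cinner (X *\<^sub>v (R ^\<^sub>m k *\<^sub>v x)) (L ^\<^sub>m k *\<^sub>v y)) \<le> cnorm (X *\<^sub>v (R ^\<^sub>m k *\<^sub>v x)) * cnorm (L ^\<^sub>m k *\<^sub>v y)"
      using X d xy by (intro cauchy_schwarz) auto
    also have "\<dots> \<le> (b * (?c' * \<rho>' ^ k * cnorm x)) * (?c * \<rho> ^ k * cnorm y)"
      using X d xy b c0 by (intro mult_mono order_trans[OF b(2)] mult_left_mono decay_vec[OF R] decay_vec[OF L]) auto
    also have "\<dots> \<le> (b * (?c' * \<rho>' ^ k * cnorm x)) * (?c * 1 * cnorm y)"
      using b(1) c0 d by (intro mult_left_mono mult_right_mono power_le_one mult_nonneg_nonneg) auto
    finally show ?thesis by (simp add: mult_ac)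
  qed
  then have "\<forall>\<^sub>F k in sequentially. norm (cinner (X *\<^sub>v (R ^\<^sub>m k *\<^sub>v x)) (L ^\<^sub>m k *\<^sub>v y)) \<le> (b * ?c' * cnorm x * (?c * cnorm y)) * \<rho>' ^ k * 1"
    by (intro always_eventually allI)
  then show ?thesis
    by (rule Lim_null_comparison) (rule decay_power_tendsto[OF R])
qed

text \<open>Iterating the equation moves the k-th power of A into both arguments of the form, where
  it tends to zero. Applied to the differences of \<open>P\<close> and \<open>Q\<close> from their
  adjoints, this shows that both are Hermitian.\<close>

lemma stein_unique:
  assumes A: "A \<in> carrier_mat n n" "stable_mat A" and X: "X \<in> carrier_mat n n" "X = A\<^sup>\<dagger> * X * A"
  shows "X = 0\<^sub>m n n"
proof (rule eq_matI)
  obtain c \<rho> where d: "decay n A c \<rho>" using stable_decay[OF A] by blast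
  fix i j assume ij: "i < dim_row (0\<^sub>m n n)" "j < dim_col (0\<^sub>m n n)"
  have step: "cinner (X *\<^sub>v x) y = cinner (X *\<^sub>v (A *\<^sub>v x)) (A *\<^sub>v y)"
    if "x \<in> carrier_vec n" "y \<in> carrier_vec n" for x y
  proof -
    have "fm X = adj (fm A) * fm X * fm A" using X(1) A arg_cong[OF X(2), of fm] by simp
    then have "cinner (X *\<^sub>v x) y = ent (adj (fv y) * (adj (fm A) * fm X * fm A) * fv x) 0 0"
      using that X(1) A by (simp add: cinner_fv mult.assoc)
    then show ?thesis using that X(1) A by (simp add: cinner_fv mult.assoc)
  qed
  have "cinner (X *\<^sub>v x) y = cinner (X *\<^sub>v (A ^\<^sub>m k *\<^sub>v x)) (A ^\<^sub>m k *\<^sub>v y)"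
    if "x \<in> carrier_vec n" "y \<in> carrier_vec n" for x y k
  proof (induction k)
    case (Suc k)
    have "A ^\<^sub>m Suc k *\<^sub>v v = A *\<^sub>v (A ^\<^sub>m k *\<^sub>v v)" if "v \<in> carrier_vec n" for v
      using assoc_mult_mat_vec[OF A(1) pow_mat_carrier[OF A(1)] that] by (simp add: mat_pow_Suc2[OF A(1)] del: pow_mat.simps)
    then show ?case using that A Suc step[of "A ^\<^sub>m k *\<^sub>v x" "A ^\<^sub>m k *\<^sub>v y"]
      by (simp add: mult_mat_vec_carrier[OF pow_mat_carrier[OF A(1)]] del: pow_mat.simps)
  qed (use A that in auto)
  note eq = this
  have "(\<lambda>k::nat. cinner (X *\<^sub>v unit_vec n j) (unit_vec n i)) \<longlonglongrightarrow> 0"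
    using cinner_pow_tendsto[OF d d X(1), of "unit_vec n j" "unit_vec n i"] eq[of "unit_vec n j" "unit_vec n i"] by simp
  then have "X $$ (i, j) = 0" using X(1) ij by (simp add: cinner_unit_vec LIMSEQ_const_iff)
  then show "X $$ (i, j) = 0\<^sub>m n n $$ (i, j)" using ij by simp
qed (use X in auto)

text \<open>The entrywise bound on powers passes to the adjoint. On an eigenvector it bounds the
  powers of the modulus of the eigenvalue by a null sequence.\<close>

lemma stable_adjoint:
  assumes A: "A \<in> carrier_mat n n" and st: "stable_mat A"
  shows "stable_mat (A\<^sup>\<dagger>)"
  unfolding stable_mat_def
proof (intro conjI allI impI)
  show "square_mat (A\<^sup>\<dagger>)" using A by auto
  fix k assume "eigenvalue (A\<^sup>\<dagger>) k"
  then obtain v where v: "v \<in> carrier_vec n" "v \<noteq> 0\<^sub>v n" "A\<^sup>\<dagger> *\<^sub>v v = k \<cdot>\<^sub>v v"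
    using A unfolding eigenvalue_def eigenvector_def by auto
  obtain c \<rho> where "decay n A c \<rho>" using stable_decay[OF A st] by blast
  then have d: "decay n (A\<^sup>\<dagger>) c \<rho>" by (rule decay_adjoint)
  have "(A\<^sup>\<dagger>) ^\<^sub>m j *\<^sub>v v = k ^ j \<cdot>\<^sub>v v" for j
    using eigenvector_pow[of "A\<^sup>\<dagger>" n v k j] A v by (auto simp: eigenvector_def)
  then have le: "cmod k ^ j * cnorm v \<le> (real n * real n * c) * \<rho> ^ j * cnorm v" for j
    using decay_vec[OF d v(1), of j] by (simp add: norm_power)
  have cv: "cnorm v > 0" using cnorm_eq_0_iff[OF v(1)] v(2) cnorm_ge0[of v] by linarith
  have "(\<lambda>j. (real n * real n * c) * \<rho> ^ j * 1) \<longlonglongrightarrow> 0" by (rule decay_power_tendsto[OF d])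
  then have "\<forall>\<^sub>F j in sequentially. (real n * real n * c) * \<rho> ^ j * 1 < 1"
    by (rule order_tendstoD) simp
  then obtain j where "(real n * real n * c) * \<rho> ^ j * 1 < 1"
    using eventually_happens'[OF sequentially_bot] by blast
  then have "cmod k ^ j < 1" using le[of j] cv by (simp add: le_less_trans)
  then have "cmod k < 1" by (meson not_less one_le_power)
  then show "k \<in> \<D>" by simp
qed

text \<open>Iterating x = y + z A x, with y = (1 - z A) x, gives a finite Neumann sum whose
  remainder tends to zero. The constant does not depend on z in the closed disc, as the uniform
  state estimates require.\<close>

lemma resolvent_bound:
  assumes d: "decay n A c \<rho>" and z: "cmod z \<le> 1" and x: "x \<in> carrier_vec n"
  shows "cnorm x \<le> (real n * real n * c) / (1 - \<rho>) * cnorm ((1\<^sub>m n - z \<cdot>\<^sub>m A) *\<^sub>v x)"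
proof -
  have A: "A \<in> carrier_mat n n" and \<rho>: "0 < \<rho>" "\<rho> < 1" and c: "0 \<le> c" using d unfolding decay_def by auto
  define y where "y = (1\<^sub>m n - z \<cdot>\<^sub>m A) *\<^sub>v x"
  have y: "y \<in> carrier_vec n" unfolding y_def using A by (intro mult_mat_vec_carrier'[where r = n]) auto
  let ?K = "real n * real n * c"
  have rec: "x = y + z \<cdot>\<^sub>v (A *\<^sub>v x)"
    by (rule fv_cancel) (use A x in \<open>auto simp: y_def algebra_simps\<close>)
  have step: "cnorm (A ^\<^sub>m k *\<^sub>v x) \<le> cnorm (A ^\<^sub>m k *\<^sub>v y) + cnorm (A ^\<^sub>m Suc k *\<^sub>v x)" for k
  proof -
    have "A ^\<^sub>m k *\<^sub>v x = A ^\<^sub>m k *\<^sub>v y + z \<cdot>\<^sub>v (A ^\<^sub>m Suc k *\<^sub>v x)"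
      by (rule fv_cancel, subst rec) (use A x y in \<open>auto simp: algebra_simps\<close>)
    then have "cnorm (A ^\<^sub>m k *\<^sub>v x) \<le> cnorm (A ^\<^sub>m k *\<^sub>v y) + cmod z * cnorm (A ^\<^sub>m Suc k *\<^sub>v x)"
      using A cnorm_triangle[of "A ^\<^sub>m k *\<^sub>v y" "z \<cdot>\<^sub>v (A ^\<^sub>m Suc k *\<^sub>v x)"] by simp
    also have "\<dots> \<le> cnorm (A ^\<^sub>m k *\<^sub>v y) + 1 * cnorm (A ^\<^sub>m Suc k *\<^sub>v x)"
      using z by (intro add_left_mono mult_right_mono) auto
    finally show ?thesis by simp
  qed
  have part: "cnorm x \<le> (\<Sum>j<k. cnorm (A ^\<^sub>m j *\<^sub>v y)) + cnorm (A ^\<^sub>m k *\<^sub>v x)" for k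
  proof (induction k)
    case (Suc k)
    then show ?case using step[of k] by simp
  qed (use A x in simp)
  have "(\<Sum>j<k. cnorm (A ^\<^sub>m j *\<^sub>v y)) \<le> ?K / (1 - \<rho>) * cnorm y" for k
  proof -
    have "(\<Sum>j<k. cnorm (A ^\<^sub>m j *\<^sub>v y)) \<le> (\<Sum>j<k. ?K * \<rho> ^ j * cnorm y)"
      by (intro sum_mono decay_vec[OF d y])
    also have "\<dots> = ?K * cnorm y * (\<Sum>j<k. \<rho> ^ j)" by (simp add: sum_distrib_left mult_ac)
    also have "\<dots> \<le> ?K * cnorm y * (1 / (1 - \<rho>))"
    proof (rule mult_left_mono)
      have "(\<Sum>j<k. \<rho> ^ j) \<le> (\<Sum>j. \<rho> ^ j)" using \<rho> by (intro sum_le_suminf summable_geometric) auto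
      then show "(\<Sum>j<k. \<rho> ^ j) \<le> 1 / (1 - \<rho>)" using \<rho> by (simp add: suminf_geometric)
    qed (use c in simp)
    finally show ?thesis by simp
  qed
  then have le: "cnorm x \<le> ?K / (1 - \<rho>) * cnorm y + ?K * \<rho> ^ k * cnorm x" for k
    using part[of k] decay_vec[OF d x, of k] by (smt (verit))
  have "(\<lambda>k. ?K / (1 - \<rho>) * cnorm y + ?K * \<rho> ^ k * cnorm x) \<longlonglongrightarrow> ?K / (1 - \<rho>) * cnorm y + 0"
    by (intro tendsto_add tendsto_const decay_power_tendsto[OF d])
  from LIMSEQ_le_const[OF this] le show ?thesis unfolding y_def by auto
qed

lemma resolvent_inj:
  assumes d: "decay n A c \<rho>" and z: "cmod z \<le> 1"
  shows "\<forall>x\<in>carrier_vec n. (1\<^sub>m n - z \<cdot>\<^sub>m A) *\<^sub>v x = 0\<^sub>v n \<longrightarrow> x = 0\<^sub>v n"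
proof (intro ballI impI)
  fix x assume x: "x \<in> carrier_vec n" "(1\<^sub>m n - z \<cdot>\<^sub>m A) *\<^sub>v x = 0\<^sub>v n"
  have "cnorm x \<le> 0" using resolvent_bound[OF d z x(1)] unfolding x(2) by simp
  then show "x = 0\<^sub>v n" using cnorm_eq_0_iff[OF x(1)] cnorm_ge0[of x] by linarith
qed

section \<open>Transfer functions and positive square roots\<close>

lemma resolvent_carrier [simp]: "A \<in> carrier_mat n n \<Longrightarrow> 1\<^sub>m n - z \<cdot>\<^sub>m A \<in> carrier_mat n n" for A :: "complex mat"
  by (auto intro!: minus_carrier_mat smult_carrier_mat)

text \<open>With y = x - z A x each term is a difference of consecutive values of C A^k x z^k, so
  the series telescopes entry by entry and convergence of matrix series need not be
  discussed.\<close>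

lemma resolvent_sums:
  assumes d: "decay n A c \<rho>" and z: "cmod z \<le> 1" and C: "C \<in> carrier_mat m n"
    and y: "y \<in> carrier_vec n" and i: "i < m"
  shows "(\<lambda>k. (C *\<^sub>v (A ^\<^sub>m k *\<^sub>v y)) $ i * z ^ k) sums ((C *\<^sub>v (minv (1\<^sub>m n - z \<cdot>\<^sub>m A) *\<^sub>v y)) $ i)"
proof -
  have A: "A \<in> carrier_mat n n" and \<rho>: "0 < \<rho>" "\<rho> < 1" and c: "0 \<le> c" using d unfolding decay_def by auto
  have M: "1\<^sub>m n - z \<cdot>\<^sub>m A \<in> carrier_mat n n" using A by simp
  define x where "x = minv (1\<^sub>m n - z \<cdot>\<^sub>m A) *\<^sub>v y"
  have x: "x \<in> carrier_vec n" unfolding x_def using minv_works(1)[OF M resolvent_inj[OF d z]] by auto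
  have "(1\<^sub>m n - z \<cdot>\<^sub>m A) *\<^sub>v x = y" unfolding x_def by (rule minv_solve(1)[OF M resolvent_inj[OF d z] y])
  then have yx: "y = x - z \<cdot>\<^sub>v (A *\<^sub>v x)"
  proof -
    have "(1\<^sub>m n - z \<cdot>\<^sub>m A) *\<^sub>v x = x - z \<cdot>\<^sub>v (A *\<^sub>v x)"
      by (rule fv_cancel) (use A x in \<open>auto simp: algebra_simps\<close>)
    with \<open>(1\<^sub>m n - z \<cdot>\<^sub>m A) *\<^sub>v x = y\<close> show ?thesis by simp
  qed
  define s where "s k = (C *\<^sub>v (A ^\<^sub>m k *\<^sub>v x)) $ i * z ^ k" for k
  have t: "(C *\<^sub>v (A ^\<^sub>m k *\<^sub>v y)) $ i * z ^ k = s k - s (Suc k)" for k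
  proof -
    have "C *\<^sub>v (A ^\<^sub>m k *\<^sub>v y) = C *\<^sub>v (A ^\<^sub>m k *\<^sub>v x) - z \<cdot>\<^sub>v (C *\<^sub>v (A ^\<^sub>m Suc k *\<^sub>v x))"
      unfolding yx by (rule fv_cancel) (use A C x in \<open>auto simp: algebra_simps\<close>)
    then show ?thesis using C i by (simp add: s_def algebra_simps del: index_mult_mat_vec pow_mat.simps)
  qed
  obtain b where b: "0 \<le> b" "\<And>x. x \<in> carrier_vec n \<Longrightarrow> cnorm (C *\<^sub>v x) \<le> b * cnorm x"
    using mat_bounded[OF C] by metis
  have "cmod (s k) \<le> (b * (real n * real n * c)) * \<rho> ^ k * cnorm x" for k
  proof -
    have "cmod (s k) \<le> cnorm (C *\<^sub>v (A ^\<^sub>m k *\<^sub>v x)) * 1"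
      unfolding s_def norm_mult norm_power using C i z
      by (intro mult_mono cmod_index_le power_le_one) auto
    also have "\<dots> \<le> b * ((real n * real n * c) * \<rho> ^ k * cnorm x)"
      using b A x by (auto intro!: order_trans[OF b(2)] mult_left_mono decay_vec[OF d])
    finally show ?thesis by (simp add: mult_ac)
  qed
  then have "s \<longlonglongrightarrow> 0"
    by (intro Lim_null_comparison[OF always_eventually decay_power_tendsto[OF d]]) auto
  from telescope_sums'[OF this] show ?thesis
    using A x C by (simp add: t s_def x_def[symmetric] del: index_mult_mat_vec)
qed

text \<open>The resolvent series converges on the whole disc, hence it is the expansion of each
  entry at 0, and expansions are unique. The factor z in front of the resolvent shifts the index by
  one.\<close>

lemma taylor_state_space:
  assumes d: "decay n A c \<rho>" and C: "C \<in> carrier_mat m n" and B: "B \<in> carrier_mat n p" and D: "D \<in> carrier_mat m p"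
    and F: "\<forall>z\<in>\<D>. F z = D + z \<cdot>\<^sub>m (C * minv (1\<^sub>m n - z \<cdot>\<^sub>m A) * B)"
  shows "taylor_coeff m p F \<nu> = (case \<nu> of 0 \<Rightarrow> D | Suc k \<Rightarrow> C * A ^\<^sub>m k * B)"
proof (rule eq_matI)
  have A: "A \<in> carrier_mat n n" using d unfolding decay_def by auto
  let ?R = "case \<nu> of 0 \<Rightarrow> D | Suc k \<Rightarrow> C * A ^\<^sub>m k * B"
  have dims: "dim_row ?R = m" "dim_col ?R = p" using C B D by (auto split: nat.splits)
  show "dim_row (taylor_coeff m p F \<nu>) = dim_row ?R" "dim_col (taylor_coeff m p F \<nu>) = dim_col ?R"
    unfolding dims by (simp_all add: taylor_coeff_def)
  fix i j assume ij: "i < dim_row ?R" "j < dim_col ?R"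
  then have ij: "i < m" "j < p" unfolding dims by auto
  define a where "a k = (case k of 0 \<Rightarrow> D | Suc k \<Rightarrow> C * A ^\<^sub>m k * B) $$ (i, j)" for k
  have colB: "col B j \<in> carrier_vec n" using B by auto
  have col: "(M * B) $$ (i, j) = (M *\<^sub>v col B j) $ i" if "M \<in> carrier_mat m n" for M
    using that B ij by simp
  have "(\<lambda>k. a k * z ^ k) sums F z $$ (i, j)" if z: "z \<in> \<D>" for z
  proof -
    have z1: "cmod z \<le> 1" using z by simp
    have M: "1\<^sub>m n - z \<cdot>\<^sub>m A \<in> carrier_mat n n" using A by simp
    note mi = minv_works(1)[OF M resolvent_inj[OF d z1]]
    have aS: "a (Suc k) * z ^ Suc k = z * ((C *\<^sub>v (A ^\<^sub>m k *\<^sub>v col B j)) $ i * z ^ k)" for k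
    proof -
      have "a (Suc k) = (C * A ^\<^sub>m k *\<^sub>v col B j) $ i" unfolding a_def using A C by (simp add: col del: index_mult_mat)
      also have "C * A ^\<^sub>m k *\<^sub>v col B j = C *\<^sub>v (A ^\<^sub>m k *\<^sub>v col B j)"
        using assoc_mult_mat_vec[OF C pow_mat_carrier[OF A] colB] .
      finally show ?thesis by simp
    qed
    have Fz: "F z $$ (i, j) = z * ((C *\<^sub>v (minv (1\<^sub>m n - z \<cdot>\<^sub>m A) *\<^sub>v col B j)) $ i) + a 0"
    proof -
      have "F z $$ (i, j) = D $$ (i, j) + z * ((C * minv (1\<^sub>m n - z \<cdot>\<^sub>m A) * B) $$ (i, j))"
        using F z ij C B D by simp
      also have "(C * minv (1\<^sub>m n - z \<cdot>\<^sub>m A) * B) $$ (i, j) = (C * minv (1\<^sub>m n - z \<cdot>\<^sub>m A) *\<^sub>v col B j) $ i"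
        by (rule col) (use C mi in auto)
      also have "C * minv (1\<^sub>m n - z \<cdot>\<^sub>m A) *\<^sub>v col B j = C *\<^sub>v (minv (1\<^sub>m n - z \<cdot>\<^sub>m A) *\<^sub>v col B j)"
        using assoc_mult_mat_vec[OF C mi colB] .
      finally show ?thesis by (simp add: a_def)
    qed
    have "(\<lambda>k. a (Suc k) * z ^ Suc k) sums (z * ((C *\<^sub>v (minv (1\<^sub>m n - z \<cdot>\<^sub>m A) *\<^sub>v col B j)) $ i))"
      unfolding aS by (rule sums_mult[OF resolvent_sums[OF d z1 C colB ij(1)]])
    from sums_Suc[OF this] show ?thesis unfolding Fz by simp
  qed
  moreover have "\<forall>\<^sub>F z in nhds (0::complex). z \<in> \<D>" by (rule eventually_nhds_in_open) auto
  ultimately have "\<forall>\<^sub>F z in nhds 0. (\<lambda>k. fps_nth (Abs_fps a) k * z ^ k) sums F z $$ (i, j)"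
    by (auto elim!: eventually_mono)
  then have "(\<lambda>z. F z $$ (i, j)) has_fps_expansion Abs_fps a" by (rule has_fps_expansionI)
  from fps_nth_fps_expansion[OF this, of \<nu>]
  have "fps_nth (fps_expansion (\<lambda>z. F z $$ (i, j)) 0) \<nu> = a \<nu>" by (simp add: fps_expansion_def)
  then show "taylor_coeff m p F \<nu> $$ (i, j) = ?R $$ (i, j)"
    using ij by (simp add: taylor_coeff_def a_def)
qed

section \<open>Square roots of positive definite matrices from the binomial series\<close>

lemma gbinomial_norm_le_1:
  assumes "0 \<le> s" "s \<le> 1"
  shows "cmod (complex_of_real s gchoose k) \<le> 1"
proof (induction k)
  case (Suc k)
  have "complex_of_real s gchoose Suc k = (complex_of_real s gchoose k) * ((complex_of_real s - of_nat k) / of_nat (Suc k))"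
    by (simp add: gbinomial_prod_rev field_simps)
  moreover have "cmod ((complex_of_real s - of_nat k) / of_nat (Suc k)) \<le> 1"
  proof -
    have "cmod (complex_of_real s - of_nat k) = \<bar>s - real k\<bar>"
      by (metis norm_of_real of_real_diff of_real_of_nat_eq)
    also have "\<dots> \<le> real (Suc k)" using assms by (simp add: abs_le_iff)
    finally have "cmod (complex_of_real s - of_nat k) \<le> real (Suc k)" .
    then show ?thesis by (simp only: norm_divide norm_of_nat) simp
  qed
  ultimately show ?case using Suc mult_mono[of "cmod (complex_of_real s gchoose k)" 1] by (simp only: norm_mult) simp
qed simp

text \<open>A positive definite matrix is \<open>c (1 - E)\<close> with \<open>E\<close> stable, so the binomial series at \<open>s = 1 / 2\<close> yields its
  square root without the spectral theorem.\<close>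

definition binom_mat :: "nat \<Rightarrow> complex mat \<Rightarrow> real \<Rightarrow> complex mat" where
  "binom_mat n E s = Matrix.mat n n (\<lambda>(i, j). \<Sum>k. ((complex_of_real s gchoose k) * (-1) ^ k) * (E ^\<^sub>m k) $$ (i, j))"

lemma binom_mat_summable:
  assumes d: "decay n E c \<rho>" and s: "0 \<le> s" "s \<le> 1" and ij: "i < n" "j < n"
  shows "summable (\<lambda>k. cmod (((complex_of_real s gchoose k) * (-1) ^ k) * (E ^\<^sub>m k) $$ (i, j)))"
proof (rule summable_comparison_test')
  show "summable (\<lambda>k. c * \<rho> ^ k)" using d unfolding decay_def by (intro summable_mult summable_geometric) auto
  fix k
  have "cmod ((E ^\<^sub>m k) $$ (i, j)) \<le> c * \<rho> ^ k" using d ij unfolding decay_def by auto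
  then show "norm (cmod (((complex_of_real s gchoose k) * (-1) ^ k) * (E ^\<^sub>m k) $$ (i, j))) \<le> c * \<rho> ^ k"
    using mult_mono[OF gbinomial_norm_le_1[OF s, of k], of "cmod ((E ^\<^sub>m k) $$ (i, j))" "c * \<rho> ^ k"]
    by (simp add: norm_mult norm_power)
qed

text \<open>The series represents (1 - E)^s. Additivity in the exponent is the Cauchy product
  combined with the Vandermonde identity for generalized binomial coefficients.\<close>

lemma binom_mat_mult:
  assumes d: "decay n E c \<rho>" and s: "0 \<le> s" "s \<le> 1" and t: "0 \<le> t" "t \<le> 1"
  shows "binom_mat n E s * binom_mat n E t = binom_mat n E (s + t)"
proof (rule eq_matI)
  have E: "E \<in> carrier_mat n n" using d unfolding decay_def by auto
  let ?b = "\<lambda>s k. (complex_of_real s gchoose k) * (-1) ^ k"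
  fix i j assume "i < dim_row (binom_mat n E (s + t))" "j < dim_col (binom_mat n E (s + t))"
  then have ij: "i < n" "j < n" unfolding binom_mat_def by auto
  note sm = binom_mat_summable[OF d]
  have "(binom_mat n E s * binom_mat n E t) $$ (i, j)
    = (\<Sum>l<n. (\<Sum>k. ?b s k * (E ^\<^sub>m k) $$ (i, l)) * (\<Sum>k. ?b t k * (E ^\<^sub>m k) $$ (l, j)))"
    using ij by (simp add: binom_mat_def scalar_prod_def lessThan_atLeast0)
  also have "\<dots> = (\<Sum>l<n. \<Sum>q. \<Sum>k\<le>q. (?b s k * (E ^\<^sub>m k) $$ (i, l)) * (?b t (q - k) * (E ^\<^sub>m (q - k)) $$ (l, j)))"
    using ij s t by (intro sum.cong refl Cauchy_product sm) auto
  also have "\<dots> = (\<Sum>q. \<Sum>l<n. \<Sum>k\<le>q. (?b s k * (E ^\<^sub>m k) $$ (i, l)) * (?b t (q - k) * (E ^\<^sub>m (q - k)) $$ (l, j)))"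
    using ij s t by (intro suminf_sum[symmetric] summable_Cauchy_product sm) auto
  also have "(\<lambda>q. \<Sum>l<n. \<Sum>k\<le>q. (?b s k * (E ^\<^sub>m k) $$ (i, l)) * (?b t (q - k) * (E ^\<^sub>m (q - k)) $$ (l, j)))
    = (\<lambda>q. ?b (s + t) q * (E ^\<^sub>m q) $$ (i, j))"
  proof
    fix q
    have "(\<Sum>l<n. \<Sum>k\<le>q. (?b s k * (E ^\<^sub>m k) $$ (i, l)) * (?b t (q - k) * (E ^\<^sub>m (q - k)) $$ (l, j)))
      = (\<Sum>k\<le>q. \<Sum>l<n. (?b s k * (E ^\<^sub>m k) $$ (i, l)) * (?b t (q - k) * (E ^\<^sub>m (q - k)) $$ (l, j)))"
      by (rule sum.swap)
    also have "\<dots> = (\<Sum>k\<le>q. ((complex_of_real s gchoose k) * (complex_of_real t gchoose (q - k))) * ((-1) ^ q * (E ^\<^sub>m q) $$ (i, j)))"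
    proof (rule sum.cong[OF refl])
      fix k assume k: "k \<in> {..q}"
      then have q: "q = k + (q - k)" by simp
      have "(E ^\<^sub>m q) $$ (i, j) = (E ^\<^sub>m k * E ^\<^sub>m (q - k)) $$ (i, j)"
        by (subst q) (simp add: mat_pow_add[OF E])
      also have "\<dots> = (\<Sum>l<n. (E ^\<^sub>m k) $$ (i, l) * (E ^\<^sub>m (q - k)) $$ (l, j))"
        using ij E by (simp add: scalar_prod_def lessThan_atLeast0)
      finally have e: "(E ^\<^sub>m q) $$ (i, j) = (\<Sum>l<n. (E ^\<^sub>m k) $$ (i, l) * (E ^\<^sub>m (q - k)) $$ (l, j))" .
      have p: "(-1::complex) ^ q = (-1) ^ k * (-1) ^ (q - k)" by (subst q) (rule power_add)
      show "(\<Sum>l<n. (?b s k * (E ^\<^sub>m k) $$ (i, l)) * (?b t (q - k) * (E ^\<^sub>m (q - k)) $$ (l, j)))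
        = ((complex_of_real s gchoose k) * (complex_of_real t gchoose (q - k))) * ((-1) ^ q * (E ^\<^sub>m q) $$ (i, j))"
        unfolding e p sum_distrib_left by (intro sum.cong refl) (simp only: mult_ac)
    qed
    also have "\<dots> = ?b (s + t) q * (E ^\<^sub>m q) $$ (i, j)"
      using gbinomial_Vandermonde[of "complex_of_real s" "complex_of_real t" q]
      unfolding sum_distrib_right[symmetric] by (simp add: atLeast0AtMost mult.assoc)
    finally show "(\<Sum>l<n. \<Sum>k\<le>q. (?b s k * (E ^\<^sub>m k) $$ (i, l)) * (?b t (q - k) * (E ^\<^sub>m (q - k)) $$ (l, j)))
      = ?b (s + t) q * (E ^\<^sub>m q) $$ (i, j)" .
  qed
  finally show "(binom_mat n E s * binom_mat n E t) $$ (i, j) = binom_mat n E (s + t) $$ (i, j)"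
    using ij by (simp add: binom_mat_def)
qed (auto simp: binom_mat_def)

lemma binom_mat_1:
  assumes E: "E \<in> carrier_mat n n"
  shows "binom_mat n E 1 = 1\<^sub>m n - E"
proof (rule eq_matI)
  fix i j assume ij: "i < dim_row (1\<^sub>m n - E)" "j < dim_col (1\<^sub>m n - E)"
  have g: "(1::complex) gchoose k = (if k = 0 \<or> k = 1 then 1 else 0)" for k
    using binomial_gbinomial[of 1 k, where 'a = complex] by (cases "k \<le> 1") (auto simp: le_Suc_eq not_le binomial_eq_0)
  have "(\<Sum>k. ((complex_of_real 1 gchoose k) * (-1) ^ k) * (E ^\<^sub>m k) $$ (i, j))
    = (\<Sum>k<2. ((complex_of_real 1 gchoose k) * (-1) ^ k) * (E ^\<^sub>m k) $$ (i, j))"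
    by (rule suminf_finite) (auto simp: g)
  then show "binom_mat n E 1 $$ (i, j) = (1\<^sub>m n - E) $$ (i, j)"
    using ij E by (auto simp: binom_mat_def g numeral_2_eq_2)
qed (use E in \<open>auto simp: binom_mat_def\<close>)

lemma binom_mat_hermitian:
  assumes d: "decay n E c \<rho>" and h: "E\<^sup>\<dagger> = E" and s: "0 \<le> s" "s \<le> 1"
  shows "(binom_mat n E s)\<^sup>\<dagger> = binom_mat n E s"
proof (rule eq_matI)
  have E: "E \<in> carrier_mat n n" using d unfolding decay_def by auto
  fix i j assume "i < dim_row (binom_mat n E s)" "j < dim_col (binom_mat n E s)"
  then have ij: "i < n" "j < n" unfolding binom_mat_def by auto
  have g: "cnj (complex_of_real s gchoose k) = (complex_of_real s gchoose k)" for k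
    by (simp add: gbinomial_prod_rev)
  have "cnj (\<Sum>k. ((complex_of_real s gchoose k) * (-1) ^ k) * (E ^\<^sub>m k) $$ (j, i))
    = (\<Sum>k. cnj (((complex_of_real s gchoose k) * (-1) ^ k) * (E ^\<^sub>m k) $$ (j, i)))"
    using sums_cnj[THEN iffD2, OF summable_sums[OF summable_norm_cancel[OF binom_mat_summable[OF d s ij(2,1)]]]]
    by (rule sums_unique)
  also have "\<dots> = (\<Sum>k. ((complex_of_real s gchoose k) * (-1) ^ k) * (E ^\<^sub>m k) $$ (i, j))"
  proof (rule suminf_cong)
    fix k
    have "(E ^\<^sub>m k)\<^sup>\<dagger> = E ^\<^sub>m k" by (simp add: adjoint_mat_pow[OF E] h)
    then have "(E ^\<^sub>m k) $$ (i, j) = cnj ((E ^\<^sub>m k) $$ (j, i))"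
      using mat_adjoint_index[of i "E ^\<^sub>m k" j] E ij by simp
    then show "cnj (((complex_of_real s gchoose k) * (-1) ^ k) * (E ^\<^sub>m k) $$ (j, i))
       = ((complex_of_real s gchoose k) * (-1) ^ k) * (E ^\<^sub>m k) $$ (i, j)" by (simp add: g)
  qed
  finally show "((binom_mat n E s)\<^sup>\<dagger>) $$ (i, j) = binom_mat n E s $$ (i, j)"
    using ij by (simp add: binom_mat_def)
qed (auto simp: binom_mat_def)

text \<open>For t above a norm bound of M the Hermitian matrix E = 1 - M / t has its eigenvalues in
  (0, 1): below 1 because M is positive definite, above 0 because the form of M stays below t times
  the squared norm.\<close>

lemma pos_sqrt_exists:
  assumes M: "M \<in> carrier_mat n n" and p: "positive_definite_mat M"
  shows "\<exists>S\<in>carrier_mat n n. positive_definite_mat S \<and> S * S = M"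
proof -
  note pd = positive_definite_matD[OF M p]
  obtain b where b: "0 \<le> b" "\<And>x. x \<in> carrier_vec n \<Longrightarrow> cnorm (M *\<^sub>v x) \<le> b * cnorm x"
    using mat_bounded[OF M] by metis
  define t where "t = b + 1"
  have t: "0 < t" "b < t" using b(1) by (auto simp: t_def)
  define E where "E = 1\<^sub>m n - complex_of_real (1 / t) \<cdot>\<^sub>m M"
  have E: "E \<in> carrier_mat n n" using M unfolding E_def by simp
  have EM: "1\<^sub>m n - E = complex_of_real (1 / t) \<cdot>\<^sub>m M"
    unfolding E_def by (rule fm_cancel) (use M in auto)
  have Eh: "E\<^sup>\<dagger> = E"
    by (rule fm_cancel) (use M arg_cong[OF pd(1), of fm] in \<open>auto simp: E_def\<close>)
  have "stable_mat E" unfolding stable_mat_def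
  proof (intro conjI allI impI)
    show "square_mat E" using E by auto
    fix k assume "eigenvalue E k"
    then obtain v where v: "v \<in> carrier_vec n" "v \<noteq> 0\<^sub>v n" "E *\<^sub>v v = k \<cdot>\<^sub>v v"
      using E unfolding eigenvalue_def eigenvector_def by auto
    have cv: "cnorm v > 0" using cnorm_eq_0_iff[OF v(1)] v(2) cnorm_ge0[of v] by linarith
    have "M *\<^sub>v v = (complex_of_real t * (1 - k)) \<cdot>\<^sub>v v"
    proof -
      have "M *\<^sub>v v = complex_of_real t \<cdot>\<^sub>v (v - E *\<^sub>v v)"
        by (rule fv_cancel) (use M v(1) t in \<open>auto simp: E_def algebra_simps smul_diff simp flip: of_real_mult\<close>)
      also have "\<dots> = (complex_of_real t * (1 - k)) \<cdot>\<^sub>v v"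
        unfolding v(3) by (rule eq_vecI) (auto simp: algebra_simps)
      finally show ?thesis .
    qed
    then have ip: "cinner (M *\<^sub>v v) v = complex_of_real t * (1 - k) * complex_of_real ((cnorm v)\<^sup>2)"
      using v(1) by (simp add: cinner_self)
    have "0 < cinner (M *\<^sub>v v) v" using p M v unfolding positive_definite_mat_def by auto
    then have r: "0 < Re (cinner (M *\<^sub>v v) v)" "Im (cinner (M *\<^sub>v v) v) = 0" by (auto simp: less_complex_def)
    have "Re (cinner (M *\<^sub>v v) v) = t * (cnorm v)\<^sup>2 * (1 - Re k)" "Im (cinner (M *\<^sub>v v) v) = - (t * (cnorm v)\<^sup>2) * Im k"
      unfolding ip by (simp_all add: mult_ac)
    moreover have tc: "0 < t * (cnorm v)\<^sup>2" using t cv by simp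
    ultimately have k: "Re k < 1" "Im k = 0"
      using r zero_less_mult_pos[of "t * (cnorm v)\<^sup>2" "1 - Re k"] by auto
    have "Re (cinner (M *\<^sub>v v) v) \<le> b * (cnorm v)\<^sup>2"
    proof -
      have "Re (cinner (M *\<^sub>v v) v) \<le> cnorm (M *\<^sub>v v) * cnorm v"
        using cauchy_schwarz[of "M *\<^sub>v v" v] complex_Re_le_cmod[of "cinner (M *\<^sub>v v) v"] M v by auto
      also have "\<dots> \<le> b * cnorm v * cnorm v" using b(2)[OF v(1)] by (intro mult_right_mono) auto
      finally show ?thesis by (simp add: power2_eq_square mult_ac)
    qed
    also have "\<dots> < t * (cnorm v)\<^sup>2" using t cv by (intro mult_strict_right_mono) auto
    finally have "t * (cnorm v)\<^sup>2 * (1 - Re k) < t * (cnorm v)\<^sup>2 * 1"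
      unfolding ip using k(2) by (simp add: mult_ac)
    then have "0 < Re k" using tc by (subst (asm) mult_less_cancel_left_pos) auto
    with k have "cmod k < 1" by (simp add: cmod_eq_Re)
    then show "k \<in> \<D>" by simp
  qed
  then obtain c \<rho> where d: "decay n E c \<rho>" using stable_decay[OF E] by blast
  \<comment> \<open>The fourth root serves positivity only: the form of its square \<open>?S\<close>
    at x is the squared norm of \<open>?R\<close> x.\<close>
  let ?S = "binom_mat n E (1/2)" and ?R = "binom_mat n E (1/4)"
  have S: "?S \<in> carrier_mat n n" and R: "?R \<in> carrier_mat n n" by (auto simp: binom_mat_def)
  have RR: "?R * ?R = ?S" using binom_mat_mult[OF d, of "1/4" "1/4"] by simp
  have SS: "?S * ?S = complex_of_real (1 / t) \<cdot>\<^sub>m M" using binom_mat_mult[OF d, of "1/2" "1/2"] binom_mat_1[OF E] EM by simp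
  have Rh: "?R\<^sup>\<dagger> = ?R" and Sh: "?S\<^sup>\<dagger> = ?S" using binom_mat_hermitian[OF d Eh] by auto
  define S' where "S' = complex_of_real (sqrt t) \<cdot>\<^sub>m ?S"
  have S': "S' \<in> carrier_mat n n" unfolding S'_def using S by simp
  have "S' * S' = M"
  proof (rule fm_cancel)
    have "fm ?S * fm ?S = smul (complex_of_real (1 / t)) (fm M)" using arg_cong[OF SS, of fm] S by simp
    then show "fm (S' * S') = fm M" using S t
      by (simp add: S'_def flip: of_real_mult)
  qed (use S' M in auto)
  moreover have "positive_definite_mat S'"
  proof (rule positive_definite_matI[OF S'])
    have "fm ?S = adj (fm ?S)" using arg_cong[OF Sh, of fm] by simp
    then show "S'\<^sup>\<dagger> = S'" using S by (intro fm_cancel) (auto simp: S'_def)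
    fix x :: "complex vec" assume x: "x \<in> carrier_vec n" "x \<noteq> 0\<^sub>v n"
    have "cinner (S' *\<^sub>v x) x = complex_of_real (sqrt t) * cinner (?S *\<^sub>v x) x"
      using x S by (simp add: cinner_fv S'_def)
    also have "cinner (?S *\<^sub>v x) x = cinner (?R *\<^sub>v x) (?R *\<^sub>v x)"
    proof -
      have "cinner (?S *\<^sub>v x) x = cinner (?R *\<^sub>v (?R *\<^sub>v x)) x"
        using assoc_mult_mat_vec[OF R R x(1)] RR by simp
      also have "\<dots> = cinner (?R *\<^sub>v x) (?R\<^sup>\<dagger> *\<^sub>v x)" using R x by (intro cinner_mult_left) auto
      finally show ?thesis unfolding Rh .
    qed
    finally have "Re (cinner (S' *\<^sub>v x) x) = sqrt t * (cnorm (?R *\<^sub>v x))\<^sup>2" by (simp add: cinner_self)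
    \<comment> \<open>M x is t times S R applied to R x, so R x = 0 would contradict the injectivity
      of M.\<close>
    moreover have "?R *\<^sub>v x \<noteq> 0\<^sub>v n"
    proof
      assume z: "?R *\<^sub>v x = 0\<^sub>v n"
      have "fv (M *\<^sub>v x) = smul (complex_of_real t) (fm (?S * ?S) * fv x)"
        using M x t unfolding SS by (simp flip: of_real_mult)
      also have "fm (?S * ?S) * fv x = fm ?S * (fm ?R * fv (?R *\<^sub>v x))"
        using S R x unfolding RR[symmetric] by (simp add: mult.assoc)
      also have "\<dots> = 0" unfolding z by simp
      finally have "M *\<^sub>v x = 0\<^sub>v n" using M by (intro fv_cancel) (auto simp: fm_eqI)
      then show False using pd(4) x by blast
    qed
    then have "cnorm (?R *\<^sub>v x) \<noteq> 0" using cnorm_eq_0_iff[of "?R *\<^sub>v x" n] R by auto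
    ultimately show "0 < Re (cinner (S' *\<^sub>v x) x)" using t by simp
  qed
  ultimately show ?thesis using S' by blast
qed

lemma trace_comm:
  fixes A B :: "complex mat"
  assumes "A \<in> carrier_mat n n" "B \<in> carrier_mat n n"
  shows "(\<Sum>i<n. (A * B) $$ (i, i)) = (\<Sum>i<n. (B * A) $$ (i, i))"
proof -
  have "(\<Sum>i<n. (A * B) $$ (i, i)) = (\<Sum>i<n. \<Sum>j<n. A $$ (i, j) * B $$ (j, i))"
    using assms by (intro sum.cong) (auto simp: scalar_prod_def lessThan_atLeast0)
  also have "\<dots> = (\<Sum>j<n. \<Sum>i<n. B $$ (j, i) * A $$ (i, j))"
    by (subst sum.swap) (simp add: mult.commute)
  also have "\<dots> = (\<Sum>i<n. (B * A) $$ (i, i))"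
    using assms by (intro sum.cong) (auto simp: scalar_prod_def lessThan_atLeast0)
  finally show ?thesis .
qed

text \<open>For D = S - T the equation reads S D + D T = 0. Multiplied by D from the left and
  traced, it says that the traces of D S D and D T D add up to zero. All diagonal entries involved
  are nonnegative, so the form of S vanishes at every column of D. No commutation of S and T is
  involved.\<close>

lemma pos_sqrt_unique:
  assumes S: "S \<in> carrier_mat n n" "positive_definite_mat S" and T: "T \<in> carrier_mat n n" "positive_definite_mat T"
    and eq: "S * S = T * T"
  shows "S = T"
proof -
  note dS = positive_definite_matD[OF S] and dT = positive_definite_matD[OF T]
  define D where "D = S - T"
  have D: "D \<in> carrier_mat n n" unfolding D_def using S T by auto
  have Dh: "D\<^sup>\<dagger> = D" using arg_cong[OF dS(1), of fm] arg_cong[OF dT(1), of fm] S T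
    unfolding D_def by (intro fm_cancel) auto
  have q: "(D * X * D) $$ (i, i) = cinner (X *\<^sub>v (D *\<^sub>v unit_vec n i)) (D *\<^sub>v unit_vec n i)"
    if X: "X \<in> carrier_mat n n" and i: "i < n" for X i
  proof -
    have "(D * X * D) $$ (i, i) = cinner ((D * X * D) *\<^sub>v unit_vec n i) (unit_vec n i)"
      using D X i by (intro cinner_unit_vec[symmetric]) auto
    also have "\<dots> = cinner (X *\<^sub>v (D *\<^sub>v unit_vec n i)) (D\<^sup>\<dagger> *\<^sub>v unit_vec n i)"
      using D X by (simp add: cinner_fv mult.assoc)
    finally show ?thesis unfolding Dh .
  qed
  have z: "D * S * D + D * (D * T) = 0\<^sub>m n n"
  proof (rule fm_cancel)
    have "fm S * fm S = fm T * fm T" using arg_cong[OF eq, of fm] S T by simp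
    then have "fm S * fm D + fm D * fm T = 0"
      using S T by (simp add: D_def algebra_simps)
    then have "fm D * (fm S * fm D + fm D * fm T) = 0" by simp
    then show "fm (D * S * D + D * (D * T)) = fm (0\<^sub>m n n)"
      using S T D by (simp add: distrib_left mult.assoc)
  qed (use D S T in auto)
  have "(\<Sum>i<n. (D * S * D) $$ (i, i)) + (\<Sum>i<n. (D * (D * T)) $$ (i, i)) = (\<Sum>i<n. (D * S * D + D * (D * T)) $$ (i, i))"
    using D S T by (simp add: sum.distrib)
  also have "\<dots> = 0" unfolding z by simp
  \<comment> \<open>\<open>D * (D * T)\<close> need not be Hermitian; only its trace agrees with
    that of the nonnegative \<open>D * T * D\<close>.\<close>
  also have "(\<Sum>i<n. (D * (D * T)) $$ (i, i)) = (\<Sum>i<n. (D * T * D) $$ (i, i))"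
    using D T by (intro trace_comm) auto
  finally have "Re ((\<Sum>i<n. (D * S * D) $$ (i, i)) + (\<Sum>i<n. (D * T * D) $$ (i, i))) = 0" by simp
  then have s0: "(\<Sum>i<n. Re (cinner (S *\<^sub>v (D *\<^sub>v unit_vec n i)) (D *\<^sub>v unit_vec n i))
     + Re (cinner (T *\<^sub>v (D *\<^sub>v unit_vec n i)) (D *\<^sub>v unit_vec n i))) = 0"
    using q[OF S(1)] q[OF T(1)] by (simp add: sum.distrib del: index_mult_mat)
  have De: "D *\<^sub>v unit_vec n i = 0\<^sub>v n" if i: "i < n" for i
  proof -
    have nn: "0 \<le> Re (cinner (S *\<^sub>v (D *\<^sub>v unit_vec n i)) (D *\<^sub>v unit_vec n i))"
       "0 \<le> Re (cinner (T *\<^sub>v (D *\<^sub>v unit_vec n i)) (D *\<^sub>v unit_vec n i))" for i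
      using dS(3) dT(3) D by auto
    then have "Re (cinner (S *\<^sub>v (D *\<^sub>v unit_vec n i)) (D *\<^sub>v unit_vec n i)) + Re (cinner (T *\<^sub>v (D *\<^sub>v unit_vec n i)) (D *\<^sub>v unit_vec n i)) = 0"
      using s0 i by (subst (asm) sum_nonneg_eq_0_iff) auto
    then have "\<not> 0 < Re (cinner (S *\<^sub>v (D *\<^sub>v unit_vec n i)) (D *\<^sub>v unit_vec n i))" using nn[of i] by linarith
    then show ?thesis using dS(2)[of "D *\<^sub>v unit_vec n i"] D by auto
  qed
  have "D $$ (i, j) = 0" if "i < n" "j < n" for i j
    using cinner_unit_vec[OF D that] De[OF that(2)] by simp
  then show ?thesis using S T unfolding D_def by (intro eq_matI) auto
qed

lemma pos_sqrt_mat: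
  assumes M: "M \<in> carrier_mat n n" and p: "positive_definite_mat M"
  shows "pos_sqrt_mat M \<in> carrier_mat n n" "positive_definite_mat (pos_sqrt_mat M)" "pos_sqrt_mat M * pos_sqrt_mat M = M"
proof -
  obtain S where S: "S \<in> carrier_mat n n" "positive_definite_mat S" "S * S = M"
    using pos_sqrt_exists[OF M p] by blast
  have "pos_sqrt_mat M = S" unfolding pos_sqrt_mat_def
  proof (rule the_equality)
    fix T assume T: "positive_definite_mat T \<and> T * T = M"
    then have "dim_row T = n" "dim_col T = n" using M by (metis carrier_matD index_mult_mat(2,3))+
    then show "T = S" using pos_sqrt_unique[of T n S] S T by auto
  qed (use S in auto)
  with S show "pos_sqrt_mat M \<in> carrier_mat n n" "positive_definite_mat (pos_sqrt_mat M)" "pos_sqrt_mat M * pos_sqrt_mat M = M"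
    by auto
qed

section \<open>Toeplitz operators\<close>

lemma ell2_carrier: "f \<in> ell2 k \<Longrightarrow> f i \<in> carrier_vec k"
  and ell2_summable: "f \<in> ell2 k \<Longrightarrow> summable (\<lambda>i. (cnorm (f i))\<^sup>2)"
  unfolding ell2_def by auto

lemma ell2_dim: "f \<in> ell2 k \<Longrightarrow> dim_vec (f i) = k"
  using ell2_carrier by (rule carrier_vecD)

lemma l2_product_summable:
  fixes s t :: "nat \<Rightarrow> real"
  assumes "summable (\<lambda>i. (s i)\<^sup>2)" "summable (\<lambda>i. (t i)\<^sup>2)"
  shows "summable (\<lambda>i. \<bar>s i * t i\<bar>)"
proof (rule summable_comparison_test')
  show "summable (\<lambda>i. (s i)\<^sup>2 + (t i)\<^sup>2)" using assms by (rule summable_add)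
  fix i
  have "2 * \<bar>s i * t i\<bar> \<le> (s i)\<^sup>2 + (t i)\<^sup>2"
    using sum_squares_bound[of "\<bar>s i\<bar>" "\<bar>t i\<bar>"] by (simp add: abs_mult)
  then show "norm \<bar>s i * t i\<bar> \<le> (s i)\<^sup>2 + (t i)\<^sup>2" by simp
qed

lemma ell2_inner_summable:
  assumes "f \<in> ell2 k" "g \<in> ell2 k"
  shows "summable (\<lambda>i. cinner (f i) (g i))"
proof (rule summable_norm_cancel, rule summable_comparison_test')
  show "summable (\<lambda>i. \<bar>cnorm (f i) * cnorm (g i)\<bar>)"
    by (rule l2_product_summable) (use assms ell2_summable in auto)
  show "norm (norm (cinner (f i) (g i))) \<le> \<bar>cnorm (f i) * cnorm (g i)\<bar>" for i
    using cauchy_schwarz[of "f i" "g i"] ell2_dim[OF assms(1)] ell2_dim[OF assms(2)] by simp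
qed

lemma ell2_inner_self: "f \<in> ell2 k \<Longrightarrow> ell2_inner f f = complex_of_real (\<Sum>i. (cnorm (f i))\<^sup>2)"
  unfolding ell2_inner_def cinner_self by (rule suminf_of_real[symmetric]) (rule ell2_summable)

lemma ell2_diff:
  assumes "f \<in> ell2 k" "g \<in> ell2 k"
  shows "(\<lambda>i. f i - g i) \<in> ell2 k"
proof -
  have "summable (\<lambda>i. (cnorm (f i - g i))\<^sup>2)"
  proof (rule summable_comparison_test')
    show "summable (\<lambda>i. 2 * ((cnorm (f i))\<^sup>2 + (cnorm (g i))\<^sup>2))"
      using assms by (intro summable_mult summable_add ell2_summable)
    fix i
    have "(cnorm (f i - g i))\<^sup>2 \<le> (cnorm (f i) + cnorm (g i))\<^sup>2"
      using ell2_dim[OF assms(1)] ell2_dim[OF assms(2)] by (intro power_mono cnorm_triangle_diff) auto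
    also have "\<dots> \<le> 2 * ((cnorm (f i))\<^sup>2 + (cnorm (g i))\<^sup>2)"
      using sum_squares_bound[of "cnorm (f i)" "cnorm (g i)"] by (simp add: power2_sum)
    finally show "norm ((cnorm (f i - g i))\<^sup>2) \<le> 2 * ((cnorm (f i))\<^sup>2 + (cnorm (g i))\<^sup>2)" by simp
  qed
  moreover have "f i - g i \<in> carrier_vec k" for i
    using assms by (intro minus_carrier_vec ell2_carrier)
  ultimately show ?thesis unfolding ell2_def by blast
qed

lemma ell2_inner_diff:
  assumes "f \<in> ell2 k" "g \<in> ell2 k" "h \<in> ell2 k"
  shows "ell2_inner (\<lambda>i. f i - g i) h = ell2_inner f h - ell2_inner g h"
    "ell2_inner h (\<lambda>i. f i - g i) = ell2_inner h f - ell2_inner h g"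
proof -
  have "cinner (f i - g i) (h i) = cinner (f i) (h i) - cinner (g i) (h i)"
    "cinner (h i) (f i - g i) = cinner (h i) (f i) - cinner (h i) (g i)" for i
    using ell2_dim[OF assms(1)] ell2_dim[OF assms(2)] ell2_dim[OF assms(3)] by (simp_all add: cinner_fv algebra_simps)
  then show "ell2_inner (\<lambda>i. f i - g i) h = ell2_inner f h - ell2_inner g h"
    "ell2_inner h (\<lambda>i. f i - g i) = ell2_inner h f - ell2_inner h g"
    unfolding ell2_inner_def using assms by (simp_all add: suminf_diff ell2_inner_summable)
qed

lemma ell2_eq_0: "f \<in> ell2 k \<Longrightarrow> ell2_inner f f = 0 \<Longrightarrow> f i = 0\<^sub>v k"
proof -
  assume f: "f \<in> ell2 k" and z: "ell2_inner f f = 0"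
  have "(\<Sum>i. (cnorm (f i))\<^sup>2) = 0" using z unfolding ell2_inner_self[OF f] by simp
  then have "(cnorm (f i))\<^sup>2 = 0" using suminf_eq_zero_iff[OF ell2_summable[OF f]] by simp
  then show ?thesis using cnorm_eq_0_iff[OF ell2_carrier[OF f]] by simp
qed

text \<open>The hypothesis tests only against the difference f - g, which is what two candidates for
  the same adjoint vector provide.\<close>

lemma ell2_eqI:
  assumes "f \<in> ell2 k" "g \<in> ell2 k" and "ell2_inner (\<lambda>i. f i - g i) f = ell2_inner (\<lambda>i. f i - g i) g"
  shows "f = g"
proof
  fix i
  have "ell2_inner (\<lambda>i. f i - g i) (\<lambda>i. f i - g i) = 0"
    using ell2_inner_diff(2)[OF assms(1,2) ell2_diff[OF assms(1,2)]] assms(3) by simp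
  from ell2_eq_0[OF ell2_diff[OF assms(1,2)] this] have "f i - g i = 0\<^sub>v k" .
  then have "fv (f i) - fv (g i) = 0" using assms(1,2) by (metis ell2_dim fv_diff fv_zero)
  then show "f i = g i" using assms(1,2) by (intro fv_cancel) (auto simp: ell2_dim[OF assms(1)] ell2_dim[OF assms(2)])
qed

text \<open>The smoothing \<open>s j = (\<Sum>\<nu>. \<rho> ^ \<nu> * t (j + \<nu>))\<close> satisfies \<open>s j = t j + \<rho> * s (j + 1)\<close>,
  so convexity gives \<open>(s j)\<^sup>2 \<le> (t j)\<^sup>2 / (1 - \<rho>) + \<rho> * (s (j + 1))\<^sup>2\<close>, which can be summed.\<close>

lemma geometric_smoothing:
  fixes t :: "nat \<Rightarrow> real"
  assumes \<rho>: "0 < \<rho>" "\<rho> < 1" and t: "\<And>j. 0 \<le> t j" "summable (\<lambda>j. (t j)\<^sup>2)"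
  shows "summable (\<lambda>\<nu>. \<rho> ^ \<nu> * t (j + \<nu>))" "summable (\<lambda>j. (\<Sum>\<nu>. \<rho> ^ \<nu> * t (j + \<nu>))\<^sup>2)"
proof -
  define T where "T = (\<Sum>j. (t j)\<^sup>2)"
  have tT: "t j \<le> sqrt T" for j
    unfolding T_def using sum_le_suminf[OF t(2), of "{j}"] by (intro real_le_rsqrt) auto
  show sm: "summable (\<lambda>\<nu>. \<rho> ^ \<nu> * t (j + \<nu>))" for j
  proof (rule summable_comparison_test')
    show "summable (\<lambda>\<nu>. \<rho> ^ \<nu> * sqrt T)" using \<rho> by (intro summable_mult2 summable_geometric) auto
    show "norm (\<rho> ^ \<nu> * t (j + \<nu>)) \<le> \<rho> ^ \<nu> * sqrt T" for \<nu>
      using \<rho> t(1) tT by (simp add: abs_mult mult_left_mono)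
  qed
  define s where "s j = (\<Sum>\<nu>. \<rho> ^ \<nu> * t (j + \<nu>))" for j
  have rec: "s j = t j + \<rho> * s (Suc j)" for j
  proof -
    have "s j = (\<Sum>\<nu>. \<rho> ^ Suc \<nu> * t (j + Suc \<nu>)) + t j"
      unfolding s_def using suminf_split_head[OF sm[of j]] by simp
    also have "(\<Sum>\<nu>. \<rho> ^ Suc \<nu> * t (j + Suc \<nu>)) = (\<Sum>\<nu>. \<rho> * (\<rho> ^ \<nu> * t (Suc j + \<nu>)))"
      by (simp add: mult.assoc)
    also have "\<dots> = \<rho> * s (Suc j)" unfolding s_def by (rule suminf_mult[OF sm])
    finally show ?thesis by simp
  qed
  have s0: "0 \<le> s j" for j unfolding s_def using \<rho> t(1) by (intro suminf_nonneg sm) auto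
  \<comment> \<open>A crude uniform bound, needed only for the boundary term (s N)^2 that the index
    shift leaves behind.\<close>
  have sb: "s j \<le> sqrt T / (1 - \<rho>)" for j
  proof -
    have "s j \<le> (\<Sum>\<nu>. \<rho> ^ \<nu> * sqrt T)" unfolding s_def
      using \<rho> tT by (intro suminf_le sm summable_mult2 summable_geometric mult_left_mono) auto
    also have "\<dots> = sqrt T / (1 - \<rho>)"
      using \<rho> by (subst suminf_mult2[symmetric]) (auto intro: summable_geometric simp: suminf_geometric)
    finally show ?thesis .
  qed
  have step: "(s j)\<^sup>2 \<le> (t j)\<^sup>2 / (1 - \<rho>) + \<rho> * (s (Suc j))\<^sup>2" for j
  proof -
    have "(t j)\<^sup>2 / (1 - \<rho>) + \<rho> * (s (Suc j))\<^sup>2 - (s j)\<^sup>2 = \<rho> / (1 - \<rho>) * (t j - (1 - \<rho>) * s (Suc j))\<^sup>2"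
      unfolding rec[of j] using \<rho> by (simp add: field_simps power2_eq_square)
    also have "\<dots> \<ge> 0" using \<rho> by simp
    finally show ?thesis by simp
  qed
  have "(\<Sum>j<N. (s j)\<^sup>2) \<le> (T / (1 - \<rho>) + (sqrt T / (1 - \<rho>))\<^sup>2) / (1 - \<rho>)" for N
  proof -
    have "(\<Sum>j<N. (s j)\<^sup>2) \<le> (\<Sum>j<N. (t j)\<^sup>2 / (1 - \<rho>) + \<rho> * (s (Suc j))\<^sup>2)"
      by (intro sum_mono step)
    also have "\<dots> = (\<Sum>j<N. (t j)\<^sup>2) / (1 - \<rho>) + \<rho> * (\<Sum>j<N. (s (Suc j))\<^sup>2)"
      by (simp add: sum.distrib sum_divide_distrib sum_distrib_left)
    also have "(\<Sum>j<N. (s (Suc j))\<^sup>2) = (\<Sum>j<N. (s j)\<^sup>2) + (s N)\<^sup>2 - (s 0)\<^sup>2"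
      using sum.lessThan_Suc_shift[of "\<lambda>j. (s j)\<^sup>2" N] by simp
    finally have "(1 - \<rho>) * (\<Sum>j<N. (s j)\<^sup>2) \<le> (\<Sum>j<N. (t j)\<^sup>2) / (1 - \<rho>) + \<rho> * ((s N)\<^sup>2 - (s 0)\<^sup>2)"
      by (simp add: algebra_simps)
    also have "\<dots> \<le> T / (1 - \<rho>) + 1 * (sqrt T / (1 - \<rho>))\<^sup>2"
    proof (intro add_mono divide_right_mono)
      show "(\<Sum>j<N. (t j)\<^sup>2) \<le> T" unfolding T_def by (intro sum_le_suminf t(2)) auto
      have "\<rho> * ((s N)\<^sup>2 - (s 0)\<^sup>2) \<le> \<rho> * (s N)\<^sup>2" using \<rho> by (intro mult_left_mono) auto
      also have "\<dots> \<le> 1 * (sqrt T / (1 - \<rho>))\<^sup>2" using \<rho> s0 sb by (intro mult_mono power_mono) auto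
      finally show "\<rho> * ((s N)\<^sup>2 - (s 0)\<^sup>2) \<le> 1 * (sqrt T / (1 - \<rho>))\<^sup>2" .
    qed (use \<rho> in auto)
    finally show ?thesis using \<rho> by (simp add: pos_le_divide_eq mult.commute)
  qed
  then show "summable (\<lambda>j. (\<Sum>\<nu>. \<rho> ^ \<nu> * t (j + \<nu>))\<^sup>2)"
    unfolding s_def[symmetric] by (intro summableI_nonneg_bounded) auto
qed

text \<open>The bound is put on the adjoint coefficients because it is the adjoint operator that is
  shown to map \<open>ell2\<close> into \<open>ell2\<close>; the operator itself enters through
  pairings.\<close>

definition coeff_decay :: "nat \<Rightarrow> nat \<Rightarrow> (nat \<Rightarrow> complex mat) \<Rightarrow> real \<Rightarrow> real \<Rightarrow> bool" where
  "coeff_decay k r F a \<rho> \<longleftrightarrow> 0 \<le> a \<and> 0 < \<rho> \<and> \<rho> < 1 \<and> (\<forall>\<nu>. F \<nu> \<in> carrier_mat k r) \<and>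
    (\<forall>\<nu> y. y \<in> carrier_vec k \<longrightarrow> cnorm ((F \<nu>)\<^sup>\<dagger> *\<^sub>v y) \<le> a * \<rho> ^ \<nu> * cnorm y)"

text \<open>The block upper triangular candidate for the adjoint, as an explicit series. The
  definite description \<open>toeplitz_adj\<close> is evaluated by identifying it with this.\<close>

definition coeff_adj :: "nat \<Rightarrow> (nat \<Rightarrow> complex mat) \<Rightarrow> (nat \<Rightarrow> complex vec) \<Rightarrow> nat \<Rightarrow> complex vec" where
  "coeff_adj r F g j = Matrix.vec r (\<lambda>l. \<Sum>\<nu>. ((F \<nu>)\<^sup>\<dagger> *\<^sub>v g (j + \<nu>)) $ l)"

lemma coeff_adj_summable:
  assumes F: "coeff_decay k r F a \<rho>" and g: "g \<in> ell2 k" and l: "l < r"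
  shows "summable (\<lambda>\<nu>. cmod (((F \<nu>)\<^sup>\<dagger> *\<^sub>v g (j + \<nu>)) $ l))"
    "cmod (\<Sum>\<nu>. ((F \<nu>)\<^sup>\<dagger> *\<^sub>v g (j + \<nu>)) $ l) \<le> a * (\<Sum>\<nu>. \<rho> ^ \<nu> * cnorm (g (j + \<nu>)))"
proof -
  note d = F[unfolded coeff_decay_def]
  have sm: "summable (\<lambda>\<nu>. \<rho> ^ \<nu> * cnorm (g (j + \<nu>)))"
    by (rule geometric_smoothing(1)) (use d ell2_summable[OF g] in auto)
  have b: "cmod (((F \<nu>)\<^sup>\<dagger> *\<^sub>v g (j + \<nu>)) $ l) \<le> a * (\<rho> ^ \<nu> * cnorm (g (j + \<nu>)))" for \<nu>
  proof -
    have "cmod (((F \<nu>)\<^sup>\<dagger> *\<^sub>v g (j + \<nu>)) $ l) \<le> cnorm ((F \<nu>)\<^sup>\<dagger> *\<^sub>v g (j + \<nu>))"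
      using d l by (intro cmod_index_le) (metis carrier_matD(2) dim_mult_mat_vec mat_adjoint_dim(1))
    also have "\<dots> \<le> a * \<rho> ^ \<nu> * cnorm (g (j + \<nu>))" using d ell2_carrier[OF g] by auto
    finally show ?thesis by (simp add: mult.assoc)
  qed
  show sm2: "summable (\<lambda>\<nu>. cmod (((F \<nu>)\<^sup>\<dagger> *\<^sub>v g (j + \<nu>)) $ l))"
    by (rule summable_comparison_test'[OF summable_mult[OF sm, of a]]) (use b in auto)
  have "cmod (\<Sum>\<nu>. ((F \<nu>)\<^sup>\<dagger> *\<^sub>v g (j + \<nu>)) $ l) \<le> (\<Sum>\<nu>. a * (\<rho> ^ \<nu> * cnorm (g (j + \<nu>))))"
    by (rule order_trans[OF summable_norm[OF sm2] suminf_le[OF b sm2 summable_mult[OF sm]]])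
  then show "cmod (\<Sum>\<nu>. ((F \<nu>)\<^sup>\<dagger> *\<^sub>v g (j + \<nu>)) $ l) \<le> a * (\<Sum>\<nu>. \<rho> ^ \<nu> * cnorm (g (j + \<nu>)))"
    by (simp add: suminf_mult[OF sm])
qed

lemma coeff_adj_ell2:
  assumes F: "coeff_decay k r F a \<rho>" and g: "g \<in> ell2 k"
  shows "coeff_adj r F g \<in> ell2 r"
proof -
  note d = F[unfolded coeff_decay_def]
  let ?s = "\<lambda>j. \<Sum>\<nu>. \<rho> ^ \<nu> * cnorm (g (j + \<nu>))"
  have "cnorm (coeff_adj r F g j) \<le> real r * a * ?s j" for j
  proof -
    have "cnorm (coeff_adj r F g j) \<le> (\<Sum>l<r. cmod (coeff_adj r F g j $ l))"
      using cnorm_le_sum[of "coeff_adj r F g j"] by (simp add: coeff_adj_def)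
    also have "\<dots> \<le> (\<Sum>l<r. a * ?s j)"
      by (rule sum_mono) (use coeff_adj_summable(2)[OF F g] in \<open>auto simp: coeff_adj_def\<close>)
    finally show ?thesis by simp
  qed
  then have le: "norm ((cnorm (coeff_adj r F g j))\<^sup>2) \<le> (real r * a)\<^sup>2 * (?s j)\<^sup>2" for j
    using power_mono[of "cnorm (coeff_adj r F g j)" "real r * a * ?s j" 2] by (simp add: power_mult_distrib)
  have "summable (\<lambda>j. (cnorm (coeff_adj r F g j))\<^sup>2)"
  proof (rule summable_comparison_test'[OF _ le])
    show "summable (\<lambda>j. (real r * a)\<^sup>2 * (?s j)\<^sup>2)"
      by (intro summable_mult geometric_smoothing(2)) (use d ell2_summable[OF g] in auto)
  qed
  then show ?thesis unfolding ell2_def by (auto simp: coeff_adj_def)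
qed

lemma coeff_adj_diff:
  assumes F: "coeff_decay k r F a \<rho>" and f: "f \<in> ell2 k" and g: "g \<in> ell2 k"
  shows "coeff_adj r F (\<lambda>i. f i - g i) j = coeff_adj r F f j - coeff_adj r F g j"
proof (rule eq_vecI)
  fix l assume "l < dim_vec (coeff_adj r F f j - coeff_adj r F g j)"
  then have l: "l < r" by (simp add: coeff_adj_def)
  note sm = summable_norm_cancel[OF coeff_adj_summable(1)[OF F _ l]]
  have "((F \<nu>)\<^sup>\<dagger> *\<^sub>v (f (j + \<nu>) - g (j + \<nu>))) $ l = ((F \<nu>)\<^sup>\<dagger> *\<^sub>v f (j + \<nu>)) $ l - ((F \<nu>)\<^sup>\<dagger> *\<^sub>v g (j + \<nu>)) $ l" for \<nu>
  proof -
    have c: "F \<nu> \<in> carrier_mat k r" using F unfolding coeff_decay_def by auto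
    then have "(F \<nu>)\<^sup>\<dagger> *\<^sub>v (f (j + \<nu>) - g (j + \<nu>)) = (F \<nu>)\<^sup>\<dagger> *\<^sub>v f (j + \<nu>) - (F \<nu>)\<^sup>\<dagger> *\<^sub>v g (j + \<nu>)"
      by (intro fv_cancel) (auto simp: right_diff_distrib ell2_dim[OF f] ell2_dim[OF g])
    then show ?thesis using l c by (simp del: index_mult_mat_vec)
  qed
  then show "coeff_adj r F (\<lambda>i. f i - g i) j $ l = (coeff_adj r F f j - coeff_adj r F g j) $ l"
    using l suminf_diff[OF sm[OF f] sm[OF g]] by (simp add: coeff_adj_def del: index_mult_mat_vec)
qed (simp add: coeff_adj_def)

definition coeff_op :: "nat \<Rightarrow> (nat \<Rightarrow> complex mat) \<Rightarrow> (nat \<Rightarrow> complex vec) \<Rightarrow> nat \<Rightarrow> complex vec" where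
  "coeff_op k F f i = Matrix.vec k (\<lambda>l. \<Sum>j\<le>i. (F (i - j) *\<^sub>v f j) $ l)"

text \<open>Both sides are one double sum over (j, \<nu>), grouped by j on the right and by i = j +
  \<nu> on the left. It converges absolutely because the sum over \<nu> is at most a |f_j| times the
  geometric smoothing of |g| at j, so that the sum over j pairs two square summable
  sequences.\<close>

lemma coeff_op_adjoint:
  assumes F: "coeff_decay k r F a \<rho>" and f: "f \<in> ell2 r" and g: "g \<in> ell2 k"
  shows "ell2_inner (coeff_op k F f) g = ell2_inner f (coeff_adj r F g)"
    "summable (\<lambda>i. cinner (coeff_op k F f i) (g i))"
proof -
  note d = F[unfolded coeff_decay_def]
  have Fc: "F \<nu> \<in> carrier_mat k r" for \<nu> using d by auto
  define h where "h j \<nu> = cinner (f j) ((F \<nu>)\<^sup>\<dagger> *\<^sub>v g (j + \<nu>))" for j \<nu>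
  let ?s = "\<lambda>j. \<Sum>\<nu>. \<rho> ^ \<nu> * cnorm (g (j + \<nu>))"
  have sm: "summable (\<lambda>\<nu>. \<rho> ^ \<nu> * cnorm (g (j + \<nu>)))" for j
    by (rule geometric_smoothing(1)) (use d ell2_summable[OF g] in auto)
  have hb: "cmod (h j \<nu>) \<le> (a * cnorm (f j)) * (\<rho> ^ \<nu> * cnorm (g (j + \<nu>)))" for j \<nu>
  proof -
    have "cmod (h j \<nu>) \<le> cnorm (f j) * cnorm ((F \<nu>)\<^sup>\<dagger> *\<^sub>v g (j + \<nu>))"
      unfolding h_def using Fc[of \<nu>] by (intro cauchy_schwarz) (auto simp: ell2_dim[OF f])
    also have "\<dots> \<le> cnorm (f j) * (a * \<rho> ^ \<nu> * cnorm (g (j + \<nu>)))"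
      using d ell2_carrier[OF g] by (intro mult_left_mono) auto
    finally show ?thesis by (simp add: mult_ac)
  qed
  have hs: "summable (\<lambda>\<nu>. cmod (h j \<nu>))" for j
    by (rule summable_comparison_test'[OF summable_mult[OF sm[of j], of "a * cnorm (f j)"]]) (use hb in auto)
  have hsum: "(\<Sum>\<nu>. cmod (h j \<nu>)) \<le> a * cnorm (f j) * ?s j" for j
    unfolding suminf_mult[OF sm, symmetric] by (intro suminf_le hb hs summable_mult sm)
  have hss: "summable (\<lambda>j. \<Sum>\<nu>. cmod (h j \<nu>))"
  proof (rule summable_comparison_test')
    have "summable (\<lambda>j. \<bar>cnorm (f j) * ?s j\<bar>)"
      by (intro l2_product_summable geometric_smoothing(2)) (use d ell2_summable[OF g] ell2_summable[OF f] in auto)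
    then show "summable (\<lambda>j. a * \<bar>cnorm (f j) * ?s j\<bar>)" by (rule summable_mult)
    fix j
    have "0 \<le> (\<Sum>\<nu>. cmod (h j \<nu>))" by (intro suminf_nonneg hs) auto
    moreover have "0 \<le> ?s j" using d by (intro suminf_nonneg sm) auto
    ultimately show "norm (\<Sum>\<nu>. cmod (h j \<nu>)) \<le> a * \<bar>cnorm (f j) * ?s j\<bar>"
      using hsum[of j] by (simp add: abs_mult mult.assoc)
  qed
  have ons: "(\<lambda>\<nu>. h j \<nu>) abs_summable_on UNIV" for j
    using hs[of j] by (simp add: summable_on_UNIV_nonneg_real_iff)
  have infn: "infsum (\<lambda>\<nu>. cmod (h j \<nu>)) UNIV = (\<Sum>\<nu>. cmod (h j \<nu>))" for j
    using has_sum_imp_sums[OF has_sum_infsum[OF ons[of j]]] by (simp add: sums_iff)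
  have abs: "(\<lambda>(j, \<nu>). h j \<nu>) abs_summable_on (UNIV \<times> UNIV)"
  proof (rule iffD2[OF Infinite_Sum.abs_summable_on_Sigma_iff[where f = "\<lambda>(j, \<nu>). h j \<nu>" and A = UNIV and B = "\<lambda>_. UNIV"]], intro conjI ballI)
    show "(\<lambda>\<nu>. case (j, \<nu>) of (j, \<nu>) \<Rightarrow> h j \<nu>) abs_summable_on UNIV" for j using ons[of j] by simp
    have "(\<lambda>j. infsum (\<lambda>\<nu>. cmod (h j \<nu>)) UNIV) summable_on UNIV"
      unfolding infn using hss by (subst summable_on_UNIV_nonneg_real_iff) (auto intro: suminf_nonneg hs)
    moreover have "0 \<le> infsum (\<lambda>\<nu>. cmod (h j \<nu>)) UNIV" for j by (rule infsum_nonneg) auto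
    ultimately show "(\<lambda>j. infsum (\<lambda>\<nu>. norm (case (j, \<nu>) of (j, \<nu>) \<Rightarrow> h j \<nu>)) UNIV) abs_summable_on UNIV"
      by simp
  qed
  then have so: "(\<lambda>(j, \<nu>). h j \<nu>) summable_on (UNIV \<times> UNIV)" by (rule abs_summable_summable)
  let ?S = "infsum (\<lambda>(j, \<nu>). h j \<nu>) (UNIV \<times> UNIV)"
  have inner: "infsum (h j) UNIV = cinner (f j) (coeff_adj r F g j)" for j
  proof -
    have "infsum (h j) UNIV = (\<Sum>\<nu>. h j \<nu>)"
      using has_sum_imp_sums[OF has_sum_infsum[OF abs_summable_summable[OF ons[of j]]]] by (simp add: sums_iff)
    also have "\<dots> = (\<Sum>\<nu>. \<Sum>l<r. f j $ l * cnj (((F \<nu>)\<^sup>\<dagger> *\<^sub>v g (j + \<nu>)) $ l))"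
      unfolding h_def using Fc by (intro suminf_cong cinner_sum) auto
    also have "\<dots> = (\<Sum>l<r. f j $ l * cnj (coeff_adj r F g j $ l))"
    proof -
      have "(\<lambda>\<nu>. f j $ l * cnj (((F \<nu>)\<^sup>\<dagger> *\<^sub>v g (j + \<nu>)) $ l)) sums (f j $ l * cnj (coeff_adj r F g j $ l))"
        if l: "l \<in> {..<r}" for l
      proof -
        have lr: "l < r" using l by simp
        note sml = summable_norm_cancel[OF coeff_adj_summable(1)[OF F g lr, of j]]
        have "(\<lambda>\<nu>. f j $ l * cnj (((F \<nu>)\<^sup>\<dagger> *\<^sub>v g (j + \<nu>)) $ l)) sums (f j $ l * cnj (\<Sum>\<nu>. ((F \<nu>)\<^sup>\<dagger> *\<^sub>v g (j + \<nu>)) $ l))"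
          using summable_sums[OF sml] by (intro sums_mult) (simp only: sums_cnj)
        then show ?thesis using lr by (simp add: coeff_adj_def del: index_mult_mat_vec)
      qed
      from sums_unique[OF sums_sum[of "{..<r}", OF this]] show ?thesis by (rule sym)
    qed
    also have "\<dots> = cinner (f j) (coeff_adj r F g j)" by (simp add: cinner_sum coeff_adj_def)
    finally show ?thesis .
  qed
  have "?S = infsum (\<lambda>j. cinner (f j) (coeff_adj r F g j)) UNIV"
    using infsum_Sigma'_banach[OF so] by (simp add: inner)
  moreover have "(\<lambda>j. cinner (f j) (coeff_adj r F g j)) summable_on UNIV"
    using summable_on_Sigma_banach[OF so] by (simp add: inner)
  ultimately have 1: "(\<lambda>j. cinner (f j) (coeff_adj r F g j)) sums ?S"
    using has_sum_imp_sums[OF has_sum_infsum] by metis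
  \<comment> \<open>Pairs (i, j) with j \<le> i correspond to pairs (j, \<nu>) with \<nu> = i - j;
    on this range the truncated subtraction is exact.\<close>
  have bij: "bij_betw (\<lambda>(i, j). (j, i - j)) (Sigma UNIV (\<lambda>i::nat. {..i})) (UNIV \<times> UNIV)"
    by (rule bij_betwI[where g = "\<lambda>(j, \<nu>). (j + \<nu>, j)"]) auto
  have conv: "(\<Sum>j\<le>i. h j (i - j)) = cinner (coeff_op k F f i) (g i)" for i
  proof -
    have "(\<Sum>j\<le>i. h j (i - j)) = (\<Sum>j\<le>i. cinner (F (i - j) *\<^sub>v f j) (g i))"
    proof (rule sum.cong[OF refl])
      fix j assume "j \<in> {..i}"
      then have "j + (i - j) = i" by simp
      then show "h j (i - j) = cinner (F (i - j) *\<^sub>v f j) (g i)"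
        unfolding h_def using Fc[of "i - j"] by (subst cinner_mult_left) (auto simp: ell2_dim[OF f] ell2_dim[OF g])
    qed
    also have "\<dots> = (\<Sum>j\<le>i. \<Sum>l<k. (F (i - j) *\<^sub>v f j) $ l * cnj (g i $ l))"
      by (intro sum.cong refl cinner_sum) (simp add: ell2_dim[OF g])
    also have "\<dots> = cinner (coeff_op k F f i) (g i)"
      by (subst sum.swap) (simp add: cinner_sum[OF ell2_dim[OF g]] coeff_op_def sum_distrib_right)
    finally show ?thesis .
  qed
  have so2: "(\<lambda>(i, j). h j (i - j)) summable_on (Sigma UNIV (\<lambda>i::nat. {..i}))"
    using summable_on_reindex_bij_betw[OF bij, of "\<lambda>(j, \<nu>). h j \<nu>"] so by (simp add: case_prod_unfold)
  have "?S = infsum (\<lambda>(i, j). h j (i - j)) (Sigma UNIV (\<lambda>i::nat. {..i}))"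
    using infsum_reindex_bij_betw[OF bij, of "\<lambda>(j, \<nu>). h j \<nu>"] by (simp add: case_prod_unfold)
  also have "\<dots> = infsum (\<lambda>i. infsum (\<lambda>j. h j (i - j)) {..i}) UNIV"
    using infsum_Sigma'_banach[OF so2] by simp
  finally have "?S = infsum (\<lambda>i. cinner (coeff_op k F f i) (g i)) UNIV" by (simp add: conv)
  moreover have "(\<lambda>i. cinner (coeff_op k F f i) (g i)) summable_on UNIV"
    using summable_on_Sigma_banach[OF so2] by (simp add: conv)
  ultimately have 2: "(\<lambda>i. cinner (coeff_op k F f i) (g i)) sums ?S"
    using has_sum_imp_sums[OF has_sum_infsum] by metis
  from 1 2 show "ell2_inner (coeff_op k F f) g = ell2_inner f (coeff_adj r F g)"
    "summable (\<lambda>i. cinner (coeff_op k F f i) (g i))"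
    unfolding ell2_inner_def by (auto simp: sums_iff)
qed

lemma toeplitz_op_coeff: "toeplitz_op k r F = coeff_op k (taylor_coeff k r F)"
  unfolding toeplitz_op_def coeff_op_def by (intro ext) simp

lemma toeplitz_adj_coeff:
  assumes F: "coeff_decay k r (taylor_coeff k r F) a \<rho>" and g: "g \<in> ell2 k"
  shows "toeplitz_adj k r F g = coeff_adj r (taylor_coeff k r F) g"
  unfolding toeplitz_adj_def hilbert_adjoint_def toeplitz_op_coeff
proof (rule the_equality)
  let ?h = "coeff_adj r (taylor_coeff k r F) g"
  show 1: "?h \<in> ell2 r \<and> (\<forall>f\<in>ell2 r. ell2_inner (coeff_op k (taylor_coeff k r F) f) g = ell2_inner f ?h)"
    using coeff_adj_ell2[OF F g] coeff_op_adjoint(1)[OF F _ g] by blast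
  fix h assume h: "h \<in> ell2 r \<and> (\<forall>f\<in>ell2 r. ell2_inner (coeff_op k (taylor_coeff k r F) f) g = ell2_inner f h)"
  show "h = ?h"
    by (rule ell2_eqI[of _ r]) (use 1 h ell2_diff[of h r ?h] in auto)
qed

lemma embed_inner:
  assumes "f \<in> ell2 p" "x \<in> carrier_vec p"
  shows "ell2_inner (embed p x) f = cinner x (f 0)"
proof -
  have "ell2_inner (embed p x) f = (\<Sum>i<1. cinner (embed p x i) (f i))"
    unfolding ell2_inner_def by (rule suminf_finite) (use assms in \<open>auto simp: embed_def carrier_vec_conjugate ell2_carrier\<close>)
  then show ?thesis by (simp add: embed_def)
qed

lemma embed_adj_eq: "f \<in> ell2 p \<Longrightarrow> embed_adj p f = f 0"
  unfolding embed_adj_def hilbert_adjoint_def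
proof (rule the_equality)
  assume f: "f \<in> ell2 p"
  show "f 0 \<in> carrier_vec p \<and> (\<forall>x\<in>carrier_vec p. ell2_inner (embed p x) f = cinner x (f 0))"
    using f embed_inner ell2_carrier by blast
  fix h assume h: "h \<in> carrier_vec p \<and> (\<forall>x\<in>carrier_vec p. ell2_inner (embed p x) f = cinner x h)"
  define w where "w = h - f 0"
  have w: "w \<in> carrier_vec p" unfolding w_def using h ell2_carrier[OF f] by auto
  have "cinner w h = cinner w (f 0)" using h w embed_inner[OF f w] by auto
  moreover have "cinner w w = cinner w h - cinner w (f 0)"
  proof -
    have "dim_vec h = p" using h by auto
    then show ?thesis unfolding w_def by (simp add: cinner_fv algebra_simps ell2_dim[OF f])
  qed
  ultimately have "(cnorm w)\<^sup>2 = 0" by (simp add: cnorm_sq)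
  then have "w = 0\<^sub>v p" using cnorm_eq_0_iff[OF w] by simp
  then have "fv h - fv (f 0) = 0" unfolding w_def using h f by (metis carrier_vecD ell2_dim fv_diff fv_zero)
  then show "h = f 0" using h by (intro fv_cancel) (auto simp: ell2_dim[OF f])
qed

text \<open>The sequence \<open>E c + S (C\<^sub>0 A\<^sub>0 ^ \<nu> x)\<^sub>\<nu>\<close> with \<open>S\<close> the forward shift. Testing positivity of
  \<open>T\<^sub>G T\<^sub>G\<^sup>* - T\<^sub>K T\<^sub>K\<^sup>*\<close> on these sequences alone is enough for everything below.\<close>

definition st :: "complex mat \<Rightarrow> complex mat \<Rightarrow> complex vec \<Rightarrow> complex vec \<Rightarrow> nat \<Rightarrow> complex vec" where
  "st C\<^sub>0 A\<^sub>0 c x i = (case i of 0 \<Rightarrow> c | Suc k \<Rightarrow> C\<^sub>0 *\<^sub>v (A\<^sub>0 ^\<^sub>m k *\<^sub>v x))"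

lemma st_simps [simp]: "st C\<^sub>0 A\<^sub>0 c x 0 = c" "st C\<^sub>0 A\<^sub>0 c x (Suc k) = C\<^sub>0 *\<^sub>v (A\<^sub>0 ^\<^sub>m k *\<^sub>v x)"
  by (simp_all add: st_def)

lemma st_ell2:
  assumes d: "decay n A\<^sub>0 b \<rho>" and C\<^sub>0: "C\<^sub>0 \<in> carrier_mat k n" and c: "c \<in> carrier_vec k" and x: "x \<in> carrier_vec n"
  shows "st C\<^sub>0 A\<^sub>0 c x \<in> ell2 k"
    "summable (\<lambda>i. (cnorm (C\<^sub>0 *\<^sub>v (A\<^sub>0 ^\<^sub>m i *\<^sub>v x)))\<^sup>2)"
    "(\<Sum>i. (cnorm (st C\<^sub>0 A\<^sub>0 c x i))\<^sup>2) = (cnorm c)\<^sup>2 + (\<Sum>i. (cnorm (C\<^sub>0 *\<^sub>v (A\<^sub>0 ^\<^sub>m i *\<^sub>v x)))\<^sup>2)"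
proof -
  have A: "A\<^sub>0 \<in> carrier_mat n n" and \<rho>: "0 < \<rho>" "\<rho> < 1" using d unfolding decay_def by auto
  obtain g where g: "0 \<le> g" "\<And>x. x \<in> carrier_vec n \<Longrightarrow> cnorm (C\<^sub>0 *\<^sub>v x) \<le> g * cnorm x"
    using mat_bounded[OF C\<^sub>0] by metis
  let ?K = "g * (real n * real n * b) * cnorm x"
  show s: "summable (\<lambda>i. (cnorm (C\<^sub>0 *\<^sub>v (A\<^sub>0 ^\<^sub>m i *\<^sub>v x)))\<^sup>2)"
  proof (rule summable_comparison_test')
    show "summable (\<lambda>i. ?K\<^sup>2 * (\<rho>\<^sup>2) ^ i)"
      using \<rho> by (intro summable_mult summable_geometric) (auto simp: abs_square_less_1)
    fix i
    have "cnorm (C\<^sub>0 *\<^sub>v (A\<^sub>0 ^\<^sub>m i *\<^sub>v x)) \<le> g * ((real n * real n * b) * \<rho> ^ i * cnorm x)"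
      using g A x by (auto intro!: order_trans[OF g(2)] mult_left_mono decay_vec[OF d])
    then have "cnorm (C\<^sub>0 *\<^sub>v (A\<^sub>0 ^\<^sub>m i *\<^sub>v x)) \<le> ?K * \<rho> ^ i" by (simp add: mult_ac)
    from power_mono[OF this, of 2]
    show "norm ((cnorm (C\<^sub>0 *\<^sub>v (A\<^sub>0 ^\<^sub>m i *\<^sub>v x)))\<^sup>2) \<le> ?K\<^sup>2 * (\<rho>\<^sup>2) ^ i"
      by (simp add: power_mult_distrib power_mult[symmetric] mult.commute)
  qed
  have "(\<lambda>i. (cnorm (st C\<^sub>0 A\<^sub>0 c x (Suc i)))\<^sup>2) sums (\<Sum>i. (cnorm (C\<^sub>0 *\<^sub>v (A\<^sub>0 ^\<^sub>m i *\<^sub>v x)))\<^sup>2)"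
    using summable_sums[OF s] by simp
  from sums_Suc[OF this] have sm: "(\<lambda>i. (cnorm (st C\<^sub>0 A\<^sub>0 c x i))\<^sup>2) sums ((\<Sum>i. (cnorm (C\<^sub>0 *\<^sub>v (A\<^sub>0 ^\<^sub>m i *\<^sub>v x)))\<^sup>2) + (cnorm c)\<^sup>2)"
    by simp
  then show "(\<Sum>i. (cnorm (st C\<^sub>0 A\<^sub>0 c x i))\<^sup>2) = (cnorm c)\<^sup>2 + (\<Sum>i. (cnorm (C\<^sub>0 *\<^sub>v (A\<^sub>0 ^\<^sub>m i *\<^sub>v x)))\<^sup>2)"
    by (simp add: sums_iff)
  have "st C\<^sub>0 A\<^sub>0 c x i \<in> carrier_vec k" for i
    using C\<^sub>0 c by (cases i) auto
  then show "st C\<^sub>0 A\<^sub>0 c x \<in> ell2 k"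
    unfolding ell2_def using sums_summable[OF sm] by blast
qed

section \<open>Toeplitz operators of state space realizations on the test sequences\<close>

abbreviation ss_coeff :: "complex mat \<Rightarrow> complex mat \<Rightarrow> complex mat \<Rightarrow> complex mat \<Rightarrow> nat \<Rightarrow> complex mat" where
  "ss_coeff A B C D \<equiv> (\<lambda>\<nu>. case \<nu> of 0 \<Rightarrow> D | Suc k \<Rightarrow> C * A ^\<^sub>m k * B)"

lemma ss_coeff_decay:
  assumes d: "decay n A c \<rho>" and C: "C \<in> carrier_mat m n" and B: "B \<in> carrier_mat n p" and D: "D \<in> carrier_mat m p"
  obtains a where "coeff_decay m p (ss_coeff A B C D) a \<rho>"
proof -
  have A: "A \<in> carrier_mat n n" and \<rho>: "0 < \<rho>" "\<rho> < 1" and c: "0 \<le> c" using d unfolding decay_def by auto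
  obtain b\<^sub>1 where b1: "0 \<le> b\<^sub>1" "\<And>x. x \<in> carrier_vec m \<Longrightarrow> cnorm (D\<^sup>\<dagger> *\<^sub>v x) \<le> b\<^sub>1 * cnorm x"
    using mat_bounded[OF mat_adjoint_carrier[OF D]] by metis
  obtain b\<^sub>2 where b2: "0 \<le> b\<^sub>2" "\<And>x. x \<in> carrier_vec n \<Longrightarrow> cnorm (B\<^sup>\<dagger> *\<^sub>v x) \<le> b\<^sub>2 * cnorm x"
    using mat_bounded[OF mat_adjoint_carrier[OF B]] by metis
  obtain b\<^sub>3 where b3: "0 \<le> b\<^sub>3" "\<And>x. x \<in> carrier_vec m \<Longrightarrow> cnorm (C\<^sup>\<dagger> *\<^sub>v x) \<le> b\<^sub>3 * cnorm x"
    using mat_bounded[OF mat_adjoint_carrier[OF C]] by metis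
  let ?K = "real n * real n * c"
  \<comment> \<open>Coefficient k + 1 contains only the k-th power of A, which costs one factor 1 /
    \<rho>.\<close>
  define a where "a = b\<^sub>1 + b\<^sub>2 * ?K * b\<^sub>3 / \<rho>"
  have a: "b\<^sub>1 \<le> a" "b\<^sub>2 * ?K * b\<^sub>3 / \<rho> \<le> a" "0 \<le> a" unfolding a_def using b1(1) b2(1) b3(1) c \<rho> by auto
  have "cnorm ((ss_coeff A B C D \<nu>)\<^sup>\<dagger> *\<^sub>v y) \<le> a * \<rho> ^ \<nu> * cnorm y" if y: "y \<in> carrier_vec m" for \<nu> y
  proof (cases \<nu>)
    case 0
    have "cnorm (D\<^sup>\<dagger> *\<^sub>v y) \<le> b\<^sub>1 * cnorm y" using b1(2)[OF y] .
    also have "\<dots> \<le> a * cnorm y" using a by (intro mult_right_mono) auto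
    finally show ?thesis using 0 by simp
  next
    case (Suc k)
    have "(C * A ^\<^sub>m k * B)\<^sup>\<dagger> *\<^sub>v y = B\<^sup>\<dagger> *\<^sub>v ((A\<^sup>\<dagger>) ^\<^sub>m k *\<^sub>v (C\<^sup>\<dagger> *\<^sub>v y))"
      unfolding adjoint_mat_pow[OF A, symmetric] by (rule fv_cancel) (use A B C y in \<open>auto simp: mult.assoc\<close>)
    also have "cnorm \<dots> \<le> b\<^sub>2 * (?K * \<rho> ^ k * (b\<^sub>3 * cnorm y))"
      using A C y b2(1) b3(2)[OF y] c \<rho>
      by (auto intro!: order_trans[OF b2(2)] mult_left_mono order_trans[OF decay_vec[OF decay_adjoint[OF d]]])
    also have "\<dots> = (b\<^sub>2 * ?K * b\<^sub>3 / \<rho>) * \<rho> ^ Suc k * cnorm y" using \<rho> by simp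
    also have "\<dots> \<le> a * \<rho> ^ Suc k * cnorm y" using a \<rho> by (intro mult_right_mono) auto
    finally show ?thesis using Suc by simp
  qed
  moreover have "ss_coeff A B C D \<nu> \<in> carrier_mat m p" for \<nu> using A B C D by (cases \<nu>) auto
  ultimately show ?thesis using that a(3) \<rho> unfolding coeff_decay_def by blast
qed

lemma vec_index_cinner: "x \<in> carrier_vec p \<Longrightarrow> l < p \<Longrightarrow> x $ l = cinner x (unit_vec p l)"
proof -
  assume x: "x \<in> carrier_vec p" and l: "l < p"
  have "cinner x (unit_vec p l) = (\<Sum>i<p. if i = l then x $ i else 0)"
    unfolding cinner_sum[of "unit_vec p l" p, simplified] using l by (intro sum.cong) auto
  then show ?thesis using l by simp
qed

text \<open>The Sylvester equation for \<open>Q\<close> makes the series telescope: beyond the first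
  coefficient it sums to \<open>B\<^sup>\<dagger> * Q\<close> applied to the current state
  \<open>A\<^sub>0 ^\<^sub>m j *\<^sub>v x\<close>. Hence the family \<open>st\<close> is preserved
  with the same \<open>A\<^sub>0\<close>; only the output matrix and the first entry change.\<close>

lemma coeff_adj_st:
  assumes d: "decay n A c \<rho>" and C: "C \<in> carrier_mat m n" and B: "B \<in> carrier_mat n p" and D: "D \<in> carrier_mat m p"
    and d0: "decay n A\<^sub>0 c' \<rho>'" and C\<^sub>0: "C\<^sub>0 \<in> carrier_mat m n" and Q: "Q \<in> carrier_mat n n"
    and st: "Q - A\<^sup>\<dagger> * Q * A\<^sub>0 = C\<^sup>\<dagger> * C\<^sub>0"
    and u: "u \<in> carrier_vec m" and x: "x \<in> carrier_vec n"
  shows "coeff_adj p (ss_coeff A B C D) (st C\<^sub>0 A\<^sub>0 u x)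
    = st (D\<^sup>\<dagger> * C\<^sub>0 + B\<^sup>\<dagger> * Q * A\<^sub>0) A\<^sub>0 (D\<^sup>\<dagger> *\<^sub>v u + B\<^sup>\<dagger> *\<^sub>v (Q *\<^sub>v x)) x"
proof
  fix j
  have A: "A \<in> carrier_mat n n" and A\<^sub>0: "A\<^sub>0 \<in> carrier_mat n n" using d d0 unfolding decay_def by auto
  let ?F = "ss_coeff A B C D" and ?g = "st C\<^sub>0 A\<^sub>0 u x"
  define y where "y = A\<^sub>0 ^\<^sub>m j *\<^sub>v x"
  have y: "y \<in> carrier_vec n" unfolding y_def using A\<^sub>0 by auto
  have gc: "?g j \<in> carrier_vec m" using C\<^sub>0 u by (cases j) auto
  have fst: "fm Q - adj (fm A) * (fm Q * fm A\<^sub>0) = adj (fm C) * fm C\<^sub>0"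
    using arg_cong[OF st, of fm] A A\<^sub>0 Q C C\<^sub>0 by (simp add: mult.assoc)
  have "coeff_adj p ?F ?g j = D\<^sup>\<dagger> *\<^sub>v ?g j + B\<^sup>\<dagger> *\<^sub>v (Q *\<^sub>v y)"
  proof (rule eq_vecI)
    fix l assume "l < dim_vec (D\<^sup>\<dagger> *\<^sub>v ?g j + B\<^sup>\<dagger> *\<^sub>v (Q *\<^sub>v y))"
    then have l: "l < p" using B by simp
    let ?e = "unit_vec p l"
    define s where "s k = cinner (Q *\<^sub>v (A\<^sub>0 ^\<^sub>m k *\<^sub>v y)) (A ^\<^sub>m k *\<^sub>v (B *\<^sub>v ?e))" for k
    have t: "((?F (Suc k))\<^sup>\<dagger> *\<^sub>v ?g (j + Suc k)) $ l = s k - s (Suc k)" for k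
    proof -
      define w where "w = A\<^sub>0 ^\<^sub>m k *\<^sub>v y"
      define v where "v = A ^\<^sub>m k *\<^sub>v (B *\<^sub>v ?e)"
      have w: "w \<in> carrier_vec n" and v: "v \<in> carrier_vec n" unfolding w_def v_def using A A\<^sub>0 by auto
      have gw: "?g (j + Suc k) = C\<^sub>0 *\<^sub>v w"
      proof -
        have "A\<^sub>0 ^\<^sub>m (j + k) *\<^sub>v x = w"
          unfolding w_def y_def using assoc_mult_mat_vec[OF pow_mat_carrier[OF A\<^sub>0] pow_mat_carrier[OF A\<^sub>0] x, of k j]
          by (simp add: mat_pow_add[OF A\<^sub>0, symmetric] add.commute)
        then show ?thesis by simp
      qed
      have w1: "A\<^sub>0 ^\<^sub>m Suc k *\<^sub>v y = A\<^sub>0 *\<^sub>v w" unfolding w_def mat_pow_Suc2[OF A\<^sub>0]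
        by (rule assoc_mult_mat_vec[OF A\<^sub>0 pow_mat_carrier[OF A\<^sub>0] y])
      have v1: "A ^\<^sub>m Suc k *\<^sub>v (B *\<^sub>v ?e) = A *\<^sub>v v" unfolding v_def mat_pow_Suc2[OF A]
        using B by (intro assoc_mult_mat_vec[OF A pow_mat_carrier[OF A]]) auto
      have "((?F (Suc k))\<^sup>\<dagger> *\<^sub>v ?g (j + Suc k)) $ l = cinner ((C * A ^\<^sub>m k * B)\<^sup>\<dagger> *\<^sub>v (C\<^sub>0 *\<^sub>v w)) ?e"
        unfolding gw using B l by (subst vec_index_cinner[of _ p]) (auto intro!: carrier_vecI)
      also have "\<dots> = ent (adj (fv v) * (adj (fm C) * fm C\<^sub>0) * fv w) 0 0"
        unfolding v_def using A B C C\<^sub>0 w l by (simp add: cinner_fv mult.assoc)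
      also have "\<dots> = s k - s (Suc k)"
        unfolding s_def w1 v1 w_def[symmetric] v_def[symmetric] fst[symmetric]
        using A A\<^sub>0 Q w v by (simp add: cinner_fv algebra_simps)
      finally show ?thesis .
    qed
    have "s \<longlonglongrightarrow> 0" unfolding s_def using B by (intro cinner_pow_tendsto[OF d d0 Q y]) auto
    from telescope_sums'[OF this]
    have "(\<lambda>k. ((?F (Suc k))\<^sup>\<dagger> *\<^sub>v ?g (j + Suc k)) $ l) sums s 0" unfolding t by simp
    from sums_Suc[OF this]
    have "(\<Sum>\<nu>. ((?F \<nu>)\<^sup>\<dagger> *\<^sub>v ?g (j + \<nu>)) $ l) = s 0 + (D\<^sup>\<dagger> *\<^sub>v ?g j) $ l"
      by (simp add: sums_iff)
    also have "s 0 = (B\<^sup>\<dagger> *\<^sub>v (Q *\<^sub>v y)) $ l"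
      unfolding s_def using A A\<^sub>0 B Q y l by (subst vec_index_cinner[of _ p]) (auto simp: cinner_fv mult.assoc intro!: carrier_vecI)
    finally show "coeff_adj p ?F ?g j $ l = (D\<^sup>\<dagger> *\<^sub>v ?g j + B\<^sup>\<dagger> *\<^sub>v (Q *\<^sub>v y)) $ l"
      using l B D by (simp add: coeff_adj_def del: index_mult_mat_vec)
  qed (use B in \<open>simp add: coeff_adj_def\<close>)
  also have "\<dots> = st (D\<^sup>\<dagger> * C\<^sub>0 + B\<^sup>\<dagger> * Q * A\<^sub>0) A\<^sub>0 (D\<^sup>\<dagger> *\<^sub>v u + B\<^sup>\<dagger> *\<^sub>v (Q *\<^sub>v x)) x j"
  proof (cases j)
    case 0
    then show ?thesis using A\<^sub>0 x by (simp add: y_def)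
  next
    case (Suc i)
    have y2: "y = A\<^sub>0 *\<^sub>v (A\<^sub>0 ^\<^sub>m i *\<^sub>v x)" unfolding y_def Suc mat_pow_Suc2[OF A\<^sub>0]
      by (rule assoc_mult_mat_vec[OF A\<^sub>0 pow_mat_carrier[OF A\<^sub>0] x])
    show ?thesis unfolding y2 unfolding Suc st_simps
      by (rule fv_cancel) (use A\<^sub>0 B D C\<^sub>0 Q x in \<open>auto simp: algebra_simps\<close>)
  qed
  finally show "coeff_adj p ?F ?g j = \<dots>" .
qed

text \<open>At each step along the orbit of \<open>A\<^sub>0\<close> the difference of the two
  output energies is the drop of the form of X, so the total is the initial value of that
  form.\<close>

lemma stein_telescope:
  assumes d: "decay n A\<^sub>0 c \<rho>" and C\<^sub>1: "C\<^sub>1 \<in> carrier_mat p n" and C\<^sub>2: "C\<^sub>2 \<in> carrier_mat q n" and X: "X \<in> carrier_mat n n"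
    and st: "X - A\<^sub>0\<^sup>\<dagger> * X * A\<^sub>0 = C\<^sub>1\<^sup>\<dagger> * C\<^sub>1 - C\<^sub>2\<^sup>\<dagger> * C\<^sub>2" and x: "x \<in> carrier_vec n"
  shows "(\<Sum>i. (cnorm (C\<^sub>1 *\<^sub>v (A\<^sub>0 ^\<^sub>m i *\<^sub>v x)))\<^sup>2) - (\<Sum>i. (cnorm (C\<^sub>2 *\<^sub>v (A\<^sub>0 ^\<^sub>m i *\<^sub>v x)))\<^sup>2) = Re (cinner (X *\<^sub>v x) x)"
proof -
  have A\<^sub>0: "A\<^sub>0 \<in> carrier_mat n n" using d unfolding decay_def by auto
  have fst: "adj (fm C\<^sub>1) * fm C\<^sub>1 - adj (fm C\<^sub>2) * fm C\<^sub>2 = fm X - adj (fm A\<^sub>0) * (fm X * fm A\<^sub>0)"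
    using arg_cong[OF st, of fm] A\<^sub>0 X C\<^sub>1 C\<^sub>2 by (simp add: mult.assoc)
  define s where "s k = Re (cinner (X *\<^sub>v (A\<^sub>0 ^\<^sub>m k *\<^sub>v x)) (A\<^sub>0 ^\<^sub>m k *\<^sub>v x))" for k
  have t: "(cnorm (C\<^sub>1 *\<^sub>v (A\<^sub>0 ^\<^sub>m k *\<^sub>v x)))\<^sup>2 - (cnorm (C\<^sub>2 *\<^sub>v (A\<^sub>0 ^\<^sub>m k *\<^sub>v x)))\<^sup>2 = s k - s (Suc k)" for k
  proof -
    define w where "w = A\<^sub>0 ^\<^sub>m k *\<^sub>v x"
    have w: "w \<in> carrier_vec n" unfolding w_def using A\<^sub>0 by auto
    have w1: "A\<^sub>0 ^\<^sub>m Suc k *\<^sub>v x = A\<^sub>0 *\<^sub>v w" unfolding w_def mat_pow_Suc2[OF A\<^sub>0]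
      by (rule assoc_mult_mat_vec[OF A\<^sub>0 pow_mat_carrier[OF A\<^sub>0] x])
    have "(cnorm (C\<^sub>1 *\<^sub>v w))\<^sup>2 - (cnorm (C\<^sub>2 *\<^sub>v w))\<^sup>2
      = Re (ent (adj (fv w) * (adj (fm C\<^sub>1) * fm C\<^sub>1 - adj (fm C\<^sub>2) * fm C\<^sub>2) * fv w) 0 0)"
      unfolding cnorm_sq using C\<^sub>1 C\<^sub>2 w by (simp add: cinner_fv algebra_simps)
    also have "\<dots> = s k - s (Suc k)"
      unfolding fst s_def w1 w_def[symmetric] using A\<^sub>0 X w by (simp add: cinner_fv algebra_simps)
    finally show ?thesis unfolding w_def .
  qed
  have "s \<longlonglongrightarrow> Re 0" unfolding s_def by (intro tendsto_Re cinner_pow_tendsto[OF d d X x x])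
  from telescope_sums'[OF this]
  have "(\<lambda>k. (cnorm (C\<^sub>1 *\<^sub>v (A\<^sub>0 ^\<^sub>m k *\<^sub>v x)))\<^sup>2 - (cnorm (C\<^sub>2 *\<^sub>v (A\<^sub>0 ^\<^sub>m k *\<^sub>v x)))\<^sup>2) sums s 0"
    unfolding t by simp
  then show ?thesis
    using suminf_diff[OF st_ell2(2)[OF d C\<^sub>1 zero_carrier_vec x] st_ell2(2)[OF d C\<^sub>2 zero_carrier_vec x]] A\<^sub>0 x
    by (simp add: sums_iff s_def)
qed

text \<open>Pairing with f turns positivity into a comparison of the norms of the two adjoints at f,
  and there the explicit series can be inserted.\<close>

lemma pos_adjoints:
  assumes pos: "strictly_positive (ell2 m) ell2_inner
      (\<lambda>f i. toeplitz_op m p G (toeplitz_adj m p G f) i - toeplitz_op m q K (toeplitz_adj m q K f) i)"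
    and G: "coeff_decay m p (taylor_coeff m p G) a \<rho>" and K: "coeff_decay m q (taylor_coeff m q K) a' \<rho>'"
  obtains e where "e > 0" "\<And>f. f \<in> ell2 m \<Longrightarrow>
    e * (\<Sum>i. (cnorm (f i))\<^sup>2) + (\<Sum>i. (cnorm (coeff_adj q (taylor_coeff m q K) f i))\<^sup>2)
      \<le> (\<Sum>i. (cnorm (coeff_adj p (taylor_coeff m p G) f i))\<^sup>2)"
proof -
  obtain e where e: "e > 0" "\<And>f. f \<in> ell2 m \<Longrightarrow> complex_of_real e * ell2_inner f f
    \<le> ell2_inner (\<lambda>i. toeplitz_op m p G (toeplitz_adj m p G f) i - toeplitz_op m q K (toeplitz_adj m q K f) i) f"
    using pos unfolding strictly_positive_def by auto
  show ?thesis
  proof (rule that[OF e(1)])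
    fix f assume f: "f \<in> ell2 m"
    let ?g = "coeff_adj p (taylor_coeff m p G) f" and ?k = "coeff_adj q (taylor_coeff m q K) f"
    have gk: "?g \<in> ell2 p" "?k \<in> ell2 q" using coeff_adj_ell2[OF G f] coeff_adj_ell2[OF K f] by auto
    let ?Tg = "coeff_op m (taylor_coeff m p G) ?g" and ?Tk = "coeff_op m (taylor_coeff m q K) ?k"
    have "ell2_inner (\<lambda>i. ?Tg i - ?Tk i) f = (\<Sum>i. cinner (?Tg i) (f i) - cinner (?Tk i) (f i))"
      unfolding ell2_inner_def
      by (intro suminf_cong) (simp add: cinner_fv algebra_simps ell2_dim[OF f] coeff_op_def)
    also have "\<dots> = ell2_inner ?Tg f - ell2_inner ?Tk f"
      unfolding ell2_inner_def
      by (intro suminf_diff[symmetric] coeff_op_adjoint(2)[OF G gk(1) f] coeff_op_adjoint(2)[OF K gk(2) f])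
    also have "\<dots> = complex_of_real ((\<Sum>i. (cnorm (?g i))\<^sup>2) - (\<Sum>i. (cnorm (?k i))\<^sup>2))"
      by (simp add: coeff_op_adjoint(1)[OF G gk(1) f] coeff_op_adjoint(1)[OF K gk(2) f] ell2_inner_self[OF gk(1)] ell2_inner_self[OF gk(2)])
    finally have "complex_of_real (e * (\<Sum>i. (cnorm (f i))\<^sup>2)) \<le> complex_of_real ((\<Sum>i. (cnorm (?g i))\<^sup>2) - (\<Sum>i. (cnorm (?k i))\<^sup>2))"
      using e(2)[OF f] by (simp add: toeplitz_op_coeff toeplitz_adj_coeff[OF G f] toeplitz_adj_coeff[OF K f] ell2_inner_self[OF f])
    then have "e * (\<Sum>i. (cnorm (f i))\<^sup>2) \<le> (\<Sum>i. (cnorm (?g i))\<^sup>2) - (\<Sum>i. (cnorm (?k i))\<^sup>2)"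
      unfolding less_eq_complex_def by simp
    then show "e * (\<Sum>i. (cnorm (f i))\<^sup>2) + (\<Sum>i. (cnorm (?k i))\<^sup>2) \<le> (\<Sum>i. (cnorm (?g i))\<^sup>2)" by simp
  qed
qed

section \<open>Riccati identities\<close>

text \<open>\<open>C\<^sub>0\<close> is given by the equation it solves and the Riccati equation is
  taken in mixed form, with \<open>A\<^sub>0\<close> on one side only, because the ring has neither
  inverses nor a unit.\<close>

locale fm_riccati =
  fixes a b\<^sub>1 b\<^sub>2 c d\<^sub>1 d\<^sub>2 P Q R g C\<^sub>0 A\<^sub>0 C\<^sub>1 C\<^sub>2 :: fm
  assumes hP: "adj P = P" and hQ: "adj Q = Q"
    and lyap: "P - a * P * adj a = b\<^sub>1 * adj b\<^sub>1 - b\<^sub>2 * adj b\<^sub>2"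
    and R: "R = d\<^sub>1 * adj d\<^sub>1 - d\<^sub>2 * adj d\<^sub>2 + c * P * adj c"
    and g: "g = b\<^sub>1 * adj d\<^sub>1 - b\<^sub>2 * adj d\<^sub>2 + a * P * adj c"
    and C\<^sub>0: "(R - adj g * Q * g) * C\<^sub>0 = c - adj g * Q * a"
    and A\<^sub>0: "A\<^sub>0 = a - g * C\<^sub>0"
    and ric: "Q = adj a * Q * A\<^sub>0 + adj c * C\<^sub>0"
    and C\<^sub>1: "C\<^sub>1 = adj d\<^sub>1 * C\<^sub>0 + adj b\<^sub>1 * Q * A\<^sub>0"
    and C\<^sub>2: "C\<^sub>2 = adj d\<^sub>2 * C\<^sub>0 + adj b\<^sub>2 * Q * A\<^sub>0"
begin

lemma dd: "d\<^sub>1 * adj d\<^sub>1 - d\<^sub>2 * adj d\<^sub>2 = R - c * P * adj c"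
  by (simp add: R)

lemma db: "d\<^sub>1 * adj b\<^sub>1 - d\<^sub>2 * adj b\<^sub>2 = adj g - c * P * adj a"
  by (simp add: g hP mult.assoc)

lemma bd: "b\<^sub>1 * adj d\<^sub>1 - b\<^sub>2 * adj d\<^sub>2 = g - a * P * adj c"
  by (simp add: g)

lemma hR: "adj R = R"
  by (simp add: R hP mult.assoc)

lemma hD: "adj (R - adj g * Q * g) = R - adj g * Q * g"
  by (simp add: hR hQ mult.assoc)

text \<open>The combination of x and y occurs in two roles: x = \<open>C\<^sub>0\<close>, y =
  \<open>A\<^sub>0\<close> produces \<open>C\<^sub>1\<close> and \<open>C\<^sub>2\<close>, while x =
  \<open>N\<close>, y = \<open>B\<^sub>0\<close> produces \<open>X\<^sub>0\<close> and
  \<open>L\<close>. This lemma and \<open>b_apply\<close> serve both.\<close>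

lemma d_apply: "d\<^sub>1 * (adj d\<^sub>1 * x + adj b\<^sub>1 * Q * y) - d\<^sub>2 * (adj d\<^sub>2 * x + adj b\<^sub>2 * Q * y)
  = R * x + adj g * Q * y - c * P * (adj c * x + adj a * Q * y)"
proof -
  have "d\<^sub>1 * (adj d\<^sub>1 * x + adj b\<^sub>1 * Q * y) - d\<^sub>2 * (adj d\<^sub>2 * x + adj b\<^sub>2 * Q * y)
    = (d\<^sub>1 * adj d\<^sub>1 - d\<^sub>2 * adj d\<^sub>2) * x + (d\<^sub>1 * adj b\<^sub>1 - d\<^sub>2 * adj b\<^sub>2) * Q * y"
    by (simp add: algebra_simps)
  also have "\<dots> = R * x + adj g * Q * y - c * P * (adj c * x + adj a * Q * y)"
    unfolding dd db by (simp add: algebra_simps)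
  finally show ?thesis .
qed

lemma b_apply: "b\<^sub>1 * (adj d\<^sub>1 * x + adj b\<^sub>1 * Q * y) - b\<^sub>2 * (adj d\<^sub>2 * x + adj b\<^sub>2 * Q * y)
  = g * x + P * Q * y - a * P * (adj c * x + adj a * Q * y)"
proof -
  have "b\<^sub>1 * (adj d\<^sub>1 * x + adj b\<^sub>1 * Q * y) - b\<^sub>2 * (adj d\<^sub>2 * x + adj b\<^sub>2 * Q * y)
    = (b\<^sub>1 * adj d\<^sub>1 - b\<^sub>2 * adj d\<^sub>2) * x + (b\<^sub>1 * adj b\<^sub>1 - b\<^sub>2 * adj b\<^sub>2) * Q * y"
    by (simp add: algebra_simps)
  also have "\<dots> = g * x + P * Q * y - a * P * (adj c * x + adj a * Q * y)"
    unfolding bd lyap[symmetric] by (simp add: algebra_simps)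
  finally show ?thesis .
qed

text \<open>Together with \<open>b_C\<close>: in the coordinate (1 - P Q) \<xi> the closed loop
  \<open>A\<^sub>0\<close> with outputs \<open>C\<^sub>1\<close>, \<open>C\<^sub>2\<close> obeys the
  output and state equations of the realization of G and K. The Riccati equation collapses the
  bracket behind P to Q.\<close>

lemma d_C: "d\<^sub>1 * C\<^sub>1 - d\<^sub>2 * C\<^sub>2 = c - c * P * Q"
proof -
  have "d\<^sub>1 * C\<^sub>1 - d\<^sub>2 * C\<^sub>2 = R * C\<^sub>0 + adj g * Q * A\<^sub>0 - c * P * (adj c * C\<^sub>0 + adj a * Q * A\<^sub>0)"
    unfolding C\<^sub>1 C\<^sub>2 by (rule d_apply)
  also have "R * C\<^sub>0 + adj g * Q * A\<^sub>0 = (R - adj g * Q * g) * C\<^sub>0 + adj g * Q * a"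
    by (simp add: A\<^sub>0 algebra_simps)
  also have "\<dots> = c" unfolding C\<^sub>0 by simp
  also have "adj c * C\<^sub>0 + adj a * Q * A\<^sub>0 = Q" using ric by (simp add: add.commute)
  finally show ?thesis .
qed

lemma b_C: "b\<^sub>1 * C\<^sub>1 - b\<^sub>2 * C\<^sub>2 = (a - a * P * Q) - (A\<^sub>0 - P * Q * A\<^sub>0)"
proof -
  have "b\<^sub>1 * C\<^sub>1 - b\<^sub>2 * C\<^sub>2 = g * C\<^sub>0 + P * Q * A\<^sub>0 - a * P * (adj c * C\<^sub>0 + adj a * Q * A\<^sub>0)"
    unfolding C\<^sub>1 C\<^sub>2 by (rule b_apply)
  also have "g * C\<^sub>0 = a - A\<^sub>0" by (simp add: A\<^sub>0)
  also have "adj c * C\<^sub>0 + adj a * Q * A\<^sub>0 = Q" using ric by (simp add: add.commute)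
  finally show ?thesis by (simp add: algebra_simps)
qed

lemma adj_ric: "adj C\<^sub>0 * c + adj A\<^sub>0 * Q * a = Q"
proof -
  have "adj (adj a * Q * A\<^sub>0 + adj c * C\<^sub>0) = Q" by (simp only: ric[symmetric] hQ)
  then show ?thesis by (simp add: hQ mult.assoc add.commute)
qed

text \<open>The left factor of each product is expanded by its definition, the right one is absorbed
  by \<open>d_C\<close> and \<open>b_C\<close>, and the adjoint Riccati equation collects the
  rest.\<close>

lemma stein: "(Q - Q * P * Q) - adj A\<^sub>0 * (Q - Q * P * Q) * A\<^sub>0 = adj C\<^sub>1 * C\<^sub>1 - adj C\<^sub>2 * C\<^sub>2"
proof -
  have "adj C\<^sub>1 * C\<^sub>1 - adj C\<^sub>2 * C\<^sub>2 = adj (adj d\<^sub>1 * C\<^sub>0 + adj b\<^sub>1 * Q * A\<^sub>0) * C\<^sub>1 - adj (adj d\<^sub>2 * C\<^sub>0 + adj b\<^sub>2 * Q * A\<^sub>0) * C\<^sub>2"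
    unfolding C\<^sub>1[symmetric] C\<^sub>2[symmetric] ..
  also have "\<dots> = adj C\<^sub>0 * (d\<^sub>1 * C\<^sub>1 - d\<^sub>2 * C\<^sub>2) + adj A\<^sub>0 * Q * (b\<^sub>1 * C\<^sub>1 - b\<^sub>2 * C\<^sub>2)"
    by (simp add: hQ algebra_simps)
  also have "\<dots> = (adj C\<^sub>0 * c + adj A\<^sub>0 * Q * a) - (adj C\<^sub>0 * c + adj A\<^sub>0 * Q * a) * P * Q - adj A\<^sub>0 * (Q - Q * P * Q) * A\<^sub>0"
    unfolding d_C b_C by (simp add: algebra_simps)
  finally show ?thesis unfolding adj_ric by (simp add: mult.assoc)
qed

end

text \<open>Again every matrix is given by its equation: \<open>Om\<close> is (1 - P Q)^{-1} P and
  \<open>\<eta>\<close> is (1 - P Q)^{-1} B_1 \<Theta>. \<open>X\<^sub>0\<close> is the value of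
  \<Upsilon>_12 at 0 before normalization by \<Delta>_0, and \<open>L\<close> is \<Delta>_0^2 - 1.
  Here \<open>z\<close> is the matrix (Q^{-1} - P)^{-1}, not a point of the disc.\<close>

locale fm_leech = fm_riccati +
  fixes Om M B\<^sub>0 X\<^sub>0 L \<Theta> \<eta> z :: fm
  assumes Om: "Om - P * Q * Om = P" and hOm: "adj Om = Om"
    and M: "(R - adj g * Q * g) * M = d\<^sub>2 - adj g * Q * b\<^sub>2"
    and B\<^sub>0: "B\<^sub>0 = b\<^sub>2 - g * M + A\<^sub>0 * Om * adj C\<^sub>2"
    and X\<^sub>0: "X\<^sub>0 = adj d\<^sub>1 * M + adj d\<^sub>1 * C\<^sub>0 * Om * adj C\<^sub>2 + adj b\<^sub>1 * Q * B\<^sub>0"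
    and L: "L = C\<^sub>2 * Om * adj C\<^sub>2 + adj (d\<^sub>2 - adj g * Q * b\<^sub>2) * M + adj b\<^sub>2 * Q * b\<^sub>2"
    and \<Theta>: "d\<^sub>1 * \<Theta> = 0"
    and \<eta>: "\<eta> - P * Q * \<eta> = b\<^sub>1 * \<Theta>" and hz: "adj z = z" and Q\<eta>: "Q * \<eta> = z * b\<^sub>1 * \<Theta>"
begin

text \<open>With this feedthrough \<open>X\<^sub>0\<close> and \<open>L\<close> are built like
  \<open>C\<^sub>1\<close> and \<open>C\<^sub>2\<close>, with \<open>N\<close> and
  \<open>B\<^sub>0\<close> replacing \<open>C\<^sub>0\<close> and \<open>A\<^sub>0\<close>.\<close>

definition "N = M + C\<^sub>0 * Om * adj C\<^sub>2"

lemma X\<^sub>0': "X\<^sub>0 = adj d\<^sub>1 * N + adj b\<^sub>1 * Q * B\<^sub>0"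
  by (simp add: X\<^sub>0 N_def algebra_simps)

lemma B\<^sub>0': "B\<^sub>0 = b\<^sub>2 - g * N + a * Om * adj C\<^sub>2"
  by (simp add: B\<^sub>0 N_def A\<^sub>0 algebra_simps)

lemma L': "L = adj d\<^sub>2 * N + adj b\<^sub>2 * Q * B\<^sub>0"
proof -
  have "C\<^sub>2 * Om * adj C\<^sub>2 = adj d\<^sub>2 * C\<^sub>0 * Om * adj C\<^sub>2 + adj b\<^sub>2 * Q * A\<^sub>0 * Om * adj C\<^sub>2"
    by (subst (1) C\<^sub>2) (simp add: algebra_simps)
  then show ?thesis by (simp add: L B\<^sub>0 N_def hQ algebra_simps)
qed

text \<open>Only the middle summand does not look Hermitian; the equation for \<open>M\<close>
  rewrites it as a congruence of the Hermitian \<open>R - adj g * Q * g\<close>.\<close>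

lemma hL: "adj L = L"
proof -
  have "adj (d\<^sub>2 - adj g * Q * b\<^sub>2) * M = adj M * (R - adj g * Q * g) * M"
    unfolding M[symmetric] adj_mult hD ..
  moreover have "adj (adj M * D * M) = adj M * D * M" if "adj D = D" for D
    by (simp add: that mult.assoc)
  note this[OF hD]
  ultimately show ?thesis
    unfolding L by (simp add: hOm hQ mult.assoc)
qed

lemma PQOm: "P * Q * Om = Om - P"
  using Om by (simp add: algebra_simps)

text \<open>The counterpart for \<open>N\<close> and \<open>B\<^sub>0\<close> of the Riccati
  equation \<open>adj c * C\<^sub>0 + adj a * Q * A\<^sub>0 = Q\<close>. It evaluates the bracket
  that \<open>d_apply\<close> and \<open>b_apply\<close> leave behind P.\<close>

lemma W: "adj c * N + adj a * Q * B\<^sub>0 = adj C\<^sub>2 + Q * Om * adj C\<^sub>2"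
proof -
  have "(adj c - adj a * Q * g) * M = adj ((R - adj g * Q * g) * C\<^sub>0) * M"
    unfolding C\<^sub>0 by (simp add: hQ mult.assoc)
  also have "\<dots> = adj C\<^sub>0 * ((R - adj g * Q * g) * M)"
    unfolding adj_mult hD by (simp add: mult.assoc)
  also have "\<dots> = adj C\<^sub>0 * d\<^sub>2 - adj C\<^sub>0 * adj g * Q * b\<^sub>2"
    unfolding M by (simp add: algebra_simps)
  finally have 1: "(adj c - adj a * Q * g) * M = adj C\<^sub>0 * d\<^sub>2 - adj C\<^sub>0 * adj g * Q * b\<^sub>2" .
  have 2: "adj C\<^sub>2 = adj C\<^sub>0 * d\<^sub>2 - adj C\<^sub>0 * adj g * Q * b\<^sub>2 + adj a * Q * b\<^sub>2"
    by (simp add: C\<^sub>2 A\<^sub>0 hQ algebra_simps)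
  have "adj c * N + adj a * Q * B\<^sub>0
    = (adj c - adj a * Q * g) * M + adj a * Q * b\<^sub>2 + (adj a * Q * A\<^sub>0 + adj c * C\<^sub>0) * Om * adj C\<^sub>2"
    by (simp add: N_def B\<^sub>0 algebra_simps)
  also have "\<dots> = adj C\<^sub>2 + Q * Om * adj C\<^sub>2"
    unfolding 1 ric[symmetric] using 2 by (simp add: algebra_simps)
  finally show ?thesis .
qed

text \<open>This is d_1 X_0 = d_2 (1 + L), the relation G \<Upsilon>_12 = K \<Upsilon>_22 at the
  origin. The two terms \<open>c * Om * adj C\<^sub>2\<close> cancel because P + P Q Om =
  Om.\<close>

lemma d_X: "d\<^sub>1 * X\<^sub>0 - d\<^sub>2 * L = d\<^sub>2"
proof -
  have "d\<^sub>1 * X\<^sub>0 - d\<^sub>2 * L = R * N + adj g * Q * B\<^sub>0 - c * P * (adj c * N + adj a * Q * B\<^sub>0)"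
    unfolding X\<^sub>0' L' by (rule d_apply)
  also have "R * N + adj g * Q * B\<^sub>0 = (R - adj g * Q * g) * M + adj g * Q * b\<^sub>2
     + ((R - adj g * Q * g) * C\<^sub>0 + adj g * Q * a) * Om * adj C\<^sub>2"
    by (simp add: N_def B\<^sub>0 A\<^sub>0 algebra_simps)
  also have "\<dots> = d\<^sub>2 + c * Om * adj C\<^sub>2" unfolding M C\<^sub>0 by simp
  also have "c * P * (adj c * N + adj a * Q * B\<^sub>0) = c * (P + P * Q * Om) * adj C\<^sub>2"
    unfolding W by (simp add: algebra_simps)
  also have "\<dots> = c * Om * adj C\<^sub>2" unfolding PQOm by simp
  finally show ?thesis by simp
qed

lemma b_X: "b\<^sub>1 * X\<^sub>0 - b\<^sub>2 * L = b\<^sub>2 - (B\<^sub>0 - P * Q * B\<^sub>0)"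
proof -
  have "b\<^sub>1 * X\<^sub>0 - b\<^sub>2 * L = g * N + P * Q * B\<^sub>0 - a * P * (adj c * N + adj a * Q * B\<^sub>0)"
    unfolding X\<^sub>0' L' by (rule b_apply)
  also have "a * P * (adj c * N + adj a * Q * B\<^sub>0) = a * (P + P * Q * Om) * adj C\<^sub>2"
    unfolding W by (simp add: algebra_simps)
  also have "\<dots> = a * Om * adj C\<^sub>2" unfolding PQOm by simp
  also have "g * N = b\<^sub>2 + a * Om * adj C\<^sub>2 - B\<^sub>0" unfolding B\<^sub>0' by simp
  finally show ?thesis by simp
qed

text \<open>The mixed block of \<zeta> and v in the energy balance, obtained like the Stein equation
  with \<open>d_X\<close> and \<open>b_X\<close> in place of \<open>d_C\<close> and
  \<open>b_C\<close>. \<open>X_X\<close> supplies the block of v with itself.\<close>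

lemma C_X: "adj C\<^sub>1 * X\<^sub>0 - adj C\<^sub>2 * L = adj C\<^sub>2 - adj A\<^sub>0 * (Q - Q * P * Q) * B\<^sub>0"
proof -
  have "adj C\<^sub>1 * X\<^sub>0 - adj C\<^sub>2 * L = adj C\<^sub>0 * (d\<^sub>1 * X\<^sub>0 - d\<^sub>2 * L) + adj A\<^sub>0 * Q * (b\<^sub>1 * X\<^sub>0 - b\<^sub>2 * L)"
    unfolding C\<^sub>1 C\<^sub>2 by (simp add: hQ algebra_simps)
  also have "\<dots> = adj C\<^sub>2 - adj A\<^sub>0 * (Q - Q * P * Q) * B\<^sub>0"
    unfolding d_X b_X by (simp add: C\<^sub>2 hQ algebra_simps)
  finally show ?thesis .
qed

lemma X_X: "adj X\<^sub>0 * X\<^sub>0 - L * L = L - adj B\<^sub>0 * (Q - Q * P * Q) * B\<^sub>0"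
proof -
  have "adj X\<^sub>0 * X\<^sub>0 - adj L * L = adj N * (d\<^sub>1 * X\<^sub>0 - d\<^sub>2 * L) + adj B\<^sub>0 * Q * (b\<^sub>1 * X\<^sub>0 - b\<^sub>2 * L)"
    by (subst (1) X\<^sub>0', subst (1) L') (simp add: hQ algebra_simps)
  also have "\<dots> = adj (adj d\<^sub>2 * N + adj b\<^sub>2 * Q * B\<^sub>0) - adj B\<^sub>0 * (Q - Q * P * Q) * B\<^sub>0"
    unfolding d_X b_X by (simp add: hQ algebra_simps)
  finally show ?thesis unfolding L'[symmetric] hL .
qed

lemma \<Theta>d: "adj \<Theta> * adj d\<^sub>1 = 0"
  using arg_cong[OF \<Theta>, of adj] by simp

text \<open>The storage form meets \<open>\<eta>\<close> only through (1 - P Q) \<eta> = B_1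
  \<Theta>. Together with d_1 \<Theta> = 0 this makes all mixed blocks of u in the energy balance
  vanish.\<close>

lemma \<eta>Q: "adj \<eta> * (Q - Q * P * Q) = adj \<Theta> * adj b\<^sub>1 * Q"
  using arg_cong[OF arg_cong[OF \<eta>, of adj], of "\<lambda>x. x * Q"] by (simp add: hP hQ algebra_simps)

lemma \<Theta>_X: "adj \<Theta> * X\<^sub>0 = adj \<Theta> * adj b\<^sub>1 * Q * B\<^sub>0"
proof -
  have "adj \<Theta> * X\<^sub>0 = (adj \<Theta> * adj d\<^sub>1) * N + adj \<Theta> * adj b\<^sub>1 * Q * B\<^sub>0"
    by (simp add: X\<^sub>0' algebra_simps)
  then show ?thesis by (simp add: \<Theta>d)
qed

lemma \<Theta>_C: "adj \<Theta> * C\<^sub>1 = adj \<Theta> * adj b\<^sub>1 * Q * A\<^sub>0"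
proof -
  have "adj \<Theta> * C\<^sub>1 = (adj \<Theta> * adj d\<^sub>1) * C\<^sub>0 + adj \<Theta> * adj b\<^sub>1 * Q * A\<^sub>0"
    by (simp add: C\<^sub>1 algebra_simps)
  then show ?thesis by (simp add: \<Theta>d)
qed

text \<open>With \<open>\<zeta> = z \<xi>\<close>: the system with state \<open>\<xi>\<close> and input \<open>(u, v)\<close> is an indefinite isometry with storage form
  \<open>Q - Q P Q\<close>.\<close>

lemma isometry:
  fixes u v \<zeta> :: fm
  defines "h\<^sub>1 \<equiv> \<Theta> * u + X\<^sub>0 * v + C\<^sub>1 * \<zeta>" and "h\<^sub>2 \<equiv> v + L * v + C\<^sub>2 * \<zeta>" and "\<xi> \<equiv> A\<^sub>0 * \<zeta> - \<eta> * u + B\<^sub>0 * v"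
  defines "K \<equiv> Q - Q * P * Q"
  shows "adj h\<^sub>1 * h\<^sub>1 - adj h\<^sub>2 * h\<^sub>2 + adj \<xi> * K * \<xi>
    = adj u * (adj \<Theta> * \<Theta> + adj \<Theta> * adj b\<^sub>1 * z * b\<^sub>1 * \<Theta>) * u - adj v * (v + L * v) + adj \<zeta> * K * \<zeta>"
proof -
  have hK: "adj K = K" unfolding K_def by (simp add: hP hQ mult.assoc)
  have \<eta>K: "adj \<eta> * K = adj \<Theta> * adj b\<^sub>1 * Q" unfolding K_def by (rule \<eta>Q)
  have c11: "adj \<eta> * K * \<eta> = adj \<Theta> * adj b\<^sub>1 * z * b\<^sub>1 * \<Theta>"
    unfolding \<eta>K using Q\<eta> by (simp add: mult.assoc)
  have c12: "adj \<Theta> * X\<^sub>0 - adj \<eta> * K * B\<^sub>0 = 0" unfolding \<eta>K by (simp add: \<Theta>_X)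
  have c13: "adj \<Theta> * C\<^sub>1 - adj \<eta> * K * A\<^sub>0 = 0" unfolding \<eta>K by (simp add: \<Theta>_C)
  have c23: "adj C\<^sub>1 * X\<^sub>0 - adj C\<^sub>2 * L - adj C\<^sub>2 + adj A\<^sub>0 * K * B\<^sub>0 = 0" unfolding K_def C_X by simp
  have c22: "adj X\<^sub>0 * X\<^sub>0 - L * L - L + adj B\<^sub>0 * K * B\<^sub>0 = 0" unfolding K_def X_X by simp
  have c33: "adj C\<^sub>1 * C\<^sub>1 - adj C\<^sub>2 * C\<^sub>2 + adj A\<^sub>0 * K * A\<^sub>0 - K = 0"
    unfolding stein[folded K_def, symmetric] by simp
  \<comment> \<open>Expanded in u, v and \<zeta>, the discrepancy consists of the blocks computed
    above and their adjoints; the block of u with itself cancels by its form.\<close>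
  have "adj h\<^sub>1 * h\<^sub>1 - adj h\<^sub>2 * h\<^sub>2 + adj \<xi> * K * \<xi>
    - (adj u * (adj \<Theta> * \<Theta> + adj \<eta> * K * \<eta>) * u - adj v * (v + L * v) + adj \<zeta> * K * \<zeta>)
    = adj u * (adj \<Theta> * X\<^sub>0 - adj \<eta> * K * B\<^sub>0) * v + adj v * adj (adj \<Theta> * X\<^sub>0 - adj \<eta> * K * B\<^sub>0) * u
    + adj u * (adj \<Theta> * C\<^sub>1 - adj \<eta> * K * A\<^sub>0) * \<zeta> + adj \<zeta> * adj (adj \<Theta> * C\<^sub>1 - adj \<eta> * K * A\<^sub>0) * u
    + adj \<zeta> * (adj C\<^sub>1 * X\<^sub>0 - adj C\<^sub>2 * L - adj C\<^sub>2 + adj A\<^sub>0 * K * B\<^sub>0) * v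
    + adj v * adj (adj C\<^sub>1 * X\<^sub>0 - adj C\<^sub>2 * L - adj C\<^sub>2 + adj A\<^sub>0 * K * B\<^sub>0) * \<zeta>
    + adj v * (adj X\<^sub>0 * X\<^sub>0 - L * L - L + adj B\<^sub>0 * K * B\<^sub>0) * v
    + adj \<zeta> * (adj C\<^sub>1 * C\<^sub>1 - adj C\<^sub>2 * C\<^sub>2 + adj A\<^sub>0 * K * A\<^sub>0 - K) * \<zeta>"
    unfolding h\<^sub>1_def h\<^sub>2_def \<xi>_def by (simp add: hL hK algebra_simps)
  also have "\<dots> = 0" unfolding c12 c13 c22 c23 c33 by simp
  finally show ?thesis unfolding c11 by simp
qed

text \<open>With \<open>\<zeta> = z \<xi>\<close> the two equations say that \<open>G(z) h\<^sub>1 = K(z) h\<^sub>2\<close>, with state \<open>(1 - P Q) \<xi>\<close>.\<close>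

lemma graph:
  fixes u v \<zeta> :: fm
  defines "h\<^sub>1 \<equiv> \<Theta> * u + X\<^sub>0 * v + C\<^sub>1 * \<zeta>" and "h\<^sub>2 \<equiv> v + L * v + C\<^sub>2 * \<zeta>" and "\<xi> \<equiv> A\<^sub>0 * \<zeta> - \<eta> * u + B\<^sub>0 * v"
  shows "d\<^sub>1 * h\<^sub>1 - d\<^sub>2 * h\<^sub>2 = c * (\<zeta> - P * Q * \<zeta>)"
    "\<xi> - P * Q * \<xi> = a * (\<zeta> - P * Q * \<zeta>) - (b\<^sub>1 * h\<^sub>1 - b\<^sub>2 * h\<^sub>2)"
proof -
  have "d\<^sub>1 * h\<^sub>1 - d\<^sub>2 * h\<^sub>2 = (d\<^sub>1 * \<Theta>) * u + (d\<^sub>1 * X\<^sub>0 - d\<^sub>2 * L) * v - d\<^sub>2 * v + (d\<^sub>1 * C\<^sub>1 - d\<^sub>2 * C\<^sub>2) * \<zeta>"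
    unfolding h\<^sub>1_def h\<^sub>2_def by (simp add: algebra_simps)
  then show "d\<^sub>1 * h\<^sub>1 - d\<^sub>2 * h\<^sub>2 = c * (\<zeta> - P * Q * \<zeta>)"
    unfolding \<Theta> d_X d_C by (simp add: algebra_simps)
  have "b\<^sub>1 * h\<^sub>1 - b\<^sub>2 * h\<^sub>2 = (b\<^sub>1 * \<Theta>) * u + (b\<^sub>1 * X\<^sub>0 - b\<^sub>2 * L) * v - b\<^sub>2 * v + (b\<^sub>1 * C\<^sub>1 - b\<^sub>2 * C\<^sub>2) * \<zeta>"
    unfolding h\<^sub>1_def h\<^sub>2_def by (simp add: algebra_simps)
  then show "\<xi> - P * Q * \<xi> = a * (\<zeta> - P * Q * \<zeta>) - (b\<^sub>1 * h\<^sub>1 - b\<^sub>2 * h\<^sub>2)"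
    unfolding \<eta>[symmetric] b_X b_C \<xi>_def by (simp add: algebra_simps)
qed

end

section \<open>The stabilizing solution\<close>

text \<open>Instantiated twice: with P = P_1 - P_2 for the given data, and with q = 0 and P = P_1
  for G alone, where Q_0 plays the part of \<open>Q\<close>.\<close>

locale riccati =
  fixes m p q n :: nat and A B\<^sub>1 B\<^sub>2 C D\<^sub>1 D\<^sub>2 P Q R \<Gamma> \<Delta> C\<^sub>0 A\<^sub>0 C\<^sub>1 C\<^sub>2 :: "complex mat"
  assumes A: "A \<in> carrier_mat n n" and C: "C \<in> carrier_mat m n"
    and B\<^sub>1: "B\<^sub>1 \<in> carrier_mat n p" and B\<^sub>2: "B\<^sub>2 \<in> carrier_mat n q"
    and D\<^sub>1: "D\<^sub>1 \<in> carrier_mat m p" and D\<^sub>2: "D\<^sub>2 \<in> carrier_mat m q"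
    and A_stable: "stable_mat A" and CA_obs: "observable C A"
    and P: "P \<in> carrier_mat n n" and lyap: "P - A * P * A\<^sup>\<dagger> = B\<^sub>1 * B\<^sub>1\<^sup>\<dagger> - B\<^sub>2 * B\<^sub>2\<^sup>\<dagger>"
    and R: "R = D\<^sub>1 * D\<^sub>1\<^sup>\<dagger> - D\<^sub>2 * D\<^sub>2\<^sup>\<dagger> + C * P * C\<^sup>\<dagger>"
    and \<Gamma>: "\<Gamma> = B\<^sub>1 * D\<^sub>1\<^sup>\<dagger> - B\<^sub>2 * D\<^sub>2\<^sup>\<dagger> + A * P * C\<^sup>\<dagger>"
    and sol: "stabilizing_solution A C R \<Gamma> Q"
    and \<Delta>: "\<Delta> = R - \<Gamma>\<^sup>\<dagger> * Q * \<Gamma>"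
    and C\<^sub>0: "C\<^sub>0 = minv \<Delta> * (C - \<Gamma>\<^sup>\<dagger> * Q * A)"
    and A\<^sub>0: "A\<^sub>0 = A - \<Gamma> * minv \<Delta> * (C - \<Gamma>\<^sup>\<dagger> * Q * A)"
    and C\<^sub>1: "C\<^sub>1 = D\<^sub>1\<^sup>\<dagger> * C\<^sub>0 + B\<^sub>1\<^sup>\<dagger> * Q * A\<^sub>0"
    and C\<^sub>2: "C\<^sub>2 = D\<^sub>2\<^sup>\<dagger> * C\<^sub>0 + B\<^sub>2\<^sup>\<dagger> * Q * A\<^sub>0"
begin

lemma Q: "Q \<in> carrier_mat n n" using sol A unfolding stabilizing_solution_def by simp
lemma \<Gamma>c: "\<Gamma> \<in> carrier_mat n m" unfolding \<Gamma> using A B\<^sub>1 B\<^sub>2 C D\<^sub>1 D\<^sub>2 P by auto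
lemma Rc: "R \<in> carrier_mat m m" unfolding R using A B\<^sub>1 B\<^sub>2 C D\<^sub>1 D\<^sub>2 P by auto
lemma \<Delta>c: "\<Delta> \<in> carrier_mat m m" unfolding \<Delta> using \<Gamma>c Rc Q by auto

lemma \<Delta>sp: "strictly_positive_mat \<Delta>" using sol unfolding stabilizing_solution_def \<Delta> by simp

lemmas \<Delta>pd = strictly_positive_matD[OF \<Delta>c \<Delta>sp]
lemmas \<Delta>inj = positive_definite_matD(4)[OF \<Delta>c \<Delta>pd(2)]
lemmas \<Delta>i = minv_works(1)[OF \<Delta>c \<Delta>inj]
lemmas \<Delta>fm = minv_fm[OF \<Delta>c \<Delta>inj]

lemma C\<^sub>0c: "C\<^sub>0 \<in> carrier_mat m n" unfolding C\<^sub>0 using \<Delta>i C \<Gamma>c Q A by auto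
lemma A\<^sub>0c: "A\<^sub>0 \<in> carrier_mat n n" unfolding A\<^sub>0 using \<Delta>i C \<Gamma>c Q A by (auto intro!: minus_carrier_mat mult_carrier_mat)
lemma C\<^sub>1c: "C\<^sub>1 \<in> carrier_mat p n" unfolding C\<^sub>1 using A\<^sub>0c C\<^sub>0c B\<^sub>1 D\<^sub>1 Q by auto
lemma C\<^sub>2c: "C\<^sub>2 \<in> carrier_mat q n" unfolding C\<^sub>2 using A\<^sub>0c C\<^sub>0c B\<^sub>2 D\<^sub>2 Q by auto

lemmas carr = A C B\<^sub>1 B\<^sub>2 D\<^sub>1 D\<^sub>2 P Q \<Gamma>c Rc \<Delta>c \<Delta>i C\<^sub>0c A\<^sub>0c C\<^sub>1c C\<^sub>2c
lemmas dims [simp] = carr[THEN carrier_matD(1)] carr[THEN carrier_matD(2)]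

lemma A\<^sub>0_stable: "stable_mat A\<^sub>0" using sol unfolding stabilizing_solution_def A\<^sub>0 \<Delta> by simp

lemma f\<Delta>: "fm \<Delta> = fm R - adj (fm \<Gamma>) * fm Q * fm \<Gamma>"
  by (subst \<Delta>) simp

lemma fA\<^sub>0: "fm A\<^sub>0 = fm A - fm \<Gamma> * fm C\<^sub>0"
  by (subst A\<^sub>0, subst C\<^sub>0) (simp add: mult.assoc)

lemma fC\<^sub>0: "fm \<Delta> * fm C\<^sub>0 = fm C - adj (fm \<Gamma>) * fm Q * fm A"
proof -
  have "fm C\<^sub>0 = fm (minv \<Delta>) * fm (C - \<Gamma>\<^sup>\<dagger> * Q * A)" by (subst C\<^sub>0) simp
  then have "fm \<Delta> * fm C\<^sub>0 = (fm \<Delta> * fm (minv \<Delta>)) * fm (C - \<Gamma>\<^sup>\<dagger> * Q * A)"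
    by (simp only: mult.assoc)
  then show ?thesis by (simp add: \<Delta>fm(1) right_diff_distrib mult.assoc fm_one_left_assoc[of C m] flip: fm_adj)
qed

lemma hP: "P\<^sup>\<dagger> = P"
proof -
  have 0: "A\<^sup>\<dagger> \<in> carrier_mat n n" "stable_mat (A\<^sup>\<dagger>)" using A stable_adjoint[OF A A_stable] by auto
  have "fm P - fm A * fm P * adj (fm A) = fm B\<^sub>1 * adj (fm B\<^sub>1) - fm B\<^sub>2 * adj (fm B\<^sub>2)"
    using arg_cong[OF lyap, of fm] by simp
  then have e: "fm P = fm B\<^sub>1 * adj (fm B\<^sub>1) - fm B\<^sub>2 * adj (fm B\<^sub>2) + fm A * fm P * adj (fm A)"
    by (simp add: diff_eq_eq)
  have "adj (fm P) - fm P = fm A * (adj (fm P) - fm P) * adj (fm A)"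
    using arg_cong2[of _ _ _ _ minus, OF arg_cong[OF e, of adj] e] by (simp add: algebra_simps)
  moreover have "fm (P\<^sup>\<dagger> - P) = adj (fm P) - fm P"
    "fm ((A\<^sup>\<dagger>)\<^sup>\<dagger> * (P\<^sup>\<dagger> - P) * A\<^sup>\<dagger>) = fm A * (adj (fm P) - fm P) * adj (fm A)" by simp_all
  ultimately have "fm (P\<^sup>\<dagger> - P) = fm ((A\<^sup>\<dagger>)\<^sup>\<dagger> * (P\<^sup>\<dagger> - P) * A\<^sup>\<dagger>)" by argo
  then have "P\<^sup>\<dagger> - P = (A\<^sup>\<dagger>)\<^sup>\<dagger> * (P\<^sup>\<dagger> - P) * A\<^sup>\<dagger>"
    by (rule fm_cancel) simp_all
  from stein_unique[OF 0 minus_carrier_mat[OF P] this] have z: "P\<^sup>\<dagger> - P = 0\<^sub>m n n" .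
  have "fm (P\<^sup>\<dagger>) - fm P = fm (P\<^sup>\<dagger> - P)" by simp
  then have "fm (P\<^sup>\<dagger>) = fm P" unfolding z by simp
  then show ?thesis by (rule fm_cancel) simp_all
qed

text \<open>Strict positivity makes \<Delta> and its inverse Hermitian. The quadratic term of the
  Riccati equation is therefore Hermitian before anything is known about \<open>Q\<close>, and it
  drops out of the equation for the difference of \<open>Q\<close> and its adjoint, leaving a
  homogeneous Stein equation.\<close>

lemma hQ: "Q\<^sup>\<dagger> = Q"
proof -
  have hDi: "adj (fm (minv \<Delta>)) = fm (minv \<Delta>)"
    using arg_cong[OF positive_definite_minv(2)[OF \<Delta>c \<Delta>pd(2)], of fm] by simp
  have "Q = A\<^sup>\<dagger> * Q * A + (C - \<Gamma>\<^sup>\<dagger> * Q * A)\<^sup>\<dagger> * minv \<Delta> * (C - \<Gamma>\<^sup>\<dagger> * Q * A)"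
    using sol unfolding stabilizing_solution_def \<Delta> by simp
  then have e1: "fm Q = adj (fm A) * fm Q * fm A + adj (fm (C - \<Gamma>\<^sup>\<dagger> * Q * A)) * fm (minv \<Delta>) * fm (C - \<Gamma>\<^sup>\<dagger> * Q * A)"
    by (metis (no_types, lifting) \<open>Q = _\<close> fm_add fm_mult fm_adj dims mat_adjoint_dim index_mult_mat(2,3) index_minus_mat(2,3) index_add_mat(2,3))
  define E where "E = fm (C - \<Gamma>\<^sup>\<dagger> * Q * A)"
  have "fm Q - adj (fm Q) = (adj (fm A) * fm Q * fm A + adj E * fm (minv \<Delta>) * E) - adj (adj (fm A) * fm Q * fm A + adj E * fm (minv \<Delta>) * E)"
    by (rule arg_cong2[of _ _ _ _ minus, OF e1[folded E_def] arg_cong[OF e1[folded E_def], of adj]])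
  also have "\<dots> = adj (fm A) * (fm Q - adj (fm Q)) * fm A"
    by (simp add: hDi algebra_simps)
  finally have "fm Q - adj (fm Q) = adj (fm A) * (fm Q - adj (fm Q)) * fm A" .
  moreover have "fm (Q - Q\<^sup>\<dagger>) = fm Q - adj (fm Q)"
    "fm (A\<^sup>\<dagger> * (Q - Q\<^sup>\<dagger>) * A) = adj (fm A) * (fm Q - adj (fm Q)) * fm A" by simp_all
  ultimately have "fm (Q - Q\<^sup>\<dagger>) = fm (A\<^sup>\<dagger> * (Q - Q\<^sup>\<dagger>) * A)" by argo
  then have "Q - Q\<^sup>\<dagger> = A\<^sup>\<dagger> * (Q - Q\<^sup>\<dagger>) * A" by (rule fm_cancel) simp_all
  from stein_unique[OF A A_stable minus_carrier_mat[OF mat_adjoint_carrier[OF Q]] this] have z: "Q - Q\<^sup>\<dagger> = 0\<^sub>m n n" .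
  have "fm Q - fm (Q\<^sup>\<dagger>) = fm (Q - Q\<^sup>\<dagger>)" by simp
  then have "fm (Q\<^sup>\<dagger>) = fm Q" unfolding z by simp
  then show ?thesis by (rule fm_cancel) simp_all
qed

lemma fhQ: "adj (fm Q) = fm Q" and fhP: "adj (fm P) = fm P"
  using arg_cong[OF hQ, of fm] arg_cong[OF hP, of fm] by simp_all

text \<open>Splitting off the \<Gamma> part of the left outer factor in the quadratic term turns the
  right-hand A into \<open>A\<^sub>0\<close>. This mixed form is the Sylvester equation that
  \<open>coeff_adj_st\<close> needs.\<close>

lemma fric: "fm Q = adj (fm A) * fm Q * fm A\<^sub>0 + adj (fm C) * fm C\<^sub>0"
proof -
  define E where "E = C - \<Gamma>\<^sup>\<dagger> * Q * A"
  have Ed: "dim_row E = m" "dim_col E = n" unfolding E_def by simp_all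
  have fE: "fm E = fm C - adj (fm \<Gamma>) * fm Q * fm A" unfolding E_def by simp
  have "Q = A\<^sup>\<dagger> * Q * A + E\<^sup>\<dagger> * C\<^sub>0"
  proof -
    have "Q = A\<^sup>\<dagger> * Q * A + E\<^sup>\<dagger> * minv \<Delta> * E"
      using sol unfolding stabilizing_solution_def \<Delta> E_def by simp
    also have "E\<^sup>\<dagger> * minv \<Delta> * E = E\<^sup>\<dagger> * C\<^sub>0"
      unfolding C\<^sub>0 E_def[symmetric] by (rule fm_cancel) (simp_all add: Ed mult.assoc)
    finally show ?thesis .
  qed
  then have "fm Q = fm (A\<^sup>\<dagger> * Q * A + E\<^sup>\<dagger> * C\<^sub>0)" by simp
  also have "\<dots> = adj (fm A) * fm Q * fm A + adj (fm E) * fm C\<^sub>0" by (simp add: Ed)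
  finally show ?thesis unfolding fE fA\<^sub>0 by (simp add: fhQ algebra_simps)
qed

sublocale F: fm_riccati "fm A" "fm B\<^sub>1" "fm B\<^sub>2" "fm C" "fm D\<^sub>1" "fm D\<^sub>2" "fm P" "fm Q" "fm R" "fm \<Gamma>" "fm C\<^sub>0" "fm A\<^sub>0" "fm C\<^sub>1" "fm C\<^sub>2"
proof
  show "adj (fm P) = fm P" by (rule fhP)
  show "adj (fm Q) = fm Q" by (rule fhQ)
  show "fm P - fm A * fm P * adj (fm A) = fm B\<^sub>1 * adj (fm B\<^sub>1) - fm B\<^sub>2 * adj (fm B\<^sub>2)"
    using arg_cong[OF lyap, of fm] by simp
  show "fm R = fm D\<^sub>1 * adj (fm D\<^sub>1) - fm D\<^sub>2 * adj (fm D\<^sub>2) + fm C * fm P * adj (fm C)" by (subst R) simp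
  show "fm \<Gamma> = fm B\<^sub>1 * adj (fm D\<^sub>1) - fm B\<^sub>2 * adj (fm D\<^sub>2) + fm A * fm P * adj (fm C)" by (subst \<Gamma>) simp
  show "(fm R - adj (fm \<Gamma>) * fm Q * fm \<Gamma>) * fm C\<^sub>0 = fm C - adj (fm \<Gamma>) * fm Q * fm A"
    using fC\<^sub>0 unfolding f\<Delta> .
  show "fm A\<^sub>0 = fm A - fm \<Gamma> * fm C\<^sub>0" by (rule fA\<^sub>0)
  show "fm Q = adj (fm A) * fm Q * fm A\<^sub>0 + adj (fm C) * fm C\<^sub>0" by (rule fric)
  show "fm C\<^sub>1 = adj (fm D\<^sub>1) * fm C\<^sub>0 + adj (fm B\<^sub>1) * fm Q * fm A\<^sub>0" by (subst C\<^sub>1) simp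
  show "fm C\<^sub>2 = adj (fm D\<^sub>2) * fm C\<^sub>0 + adj (fm B\<^sub>2) * fm Q * fm A\<^sub>0" by (subst C\<^sub>2) simp
qed

lemma ric: "Q - A\<^sup>\<dagger> * Q * A\<^sub>0 = C\<^sup>\<dagger> * C\<^sub>0"
  by (rule fm_cancel) (use fric in \<open>simp_all add: algebra_simps\<close>)

lemma Q_step:
  assumes "x \<in> carrier_vec n" "v \<in> carrier_vec n"
  shows "cinner (Q *\<^sub>v x) v = cinner (Q *\<^sub>v (A\<^sub>0 *\<^sub>v x)) (A *\<^sub>v v) + cinner (C\<^sub>0 *\<^sub>v x) (C *\<^sub>v v)"
proof -
  have "cinner (Q *\<^sub>v x) v = ent (adj (fv v) * (adj (fm A) * fm Q * fm A\<^sub>0 + adj (fm C) * fm C\<^sub>0) * fv x) 0 0"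
    unfolding fric[symmetric] using assms by (simp add: cinner_fv mult.assoc)
  then show ?thesis using assms by (simp add: cinner_fv algebra_simps)
qed

text \<open>On such an orbit the mixed Riccati equation loses its \<open>C\<^sub>0\<close> term, so
  the form of Q at (x, v) equals its value at (A_0^k x, A^k v) for every k, and both arguments
  decay.\<close>

lemma Q_zero_of_C\<^sub>0_orbit:
  assumes x: "x \<in> carrier_vec n" and z: "\<And>k. C\<^sub>0 *\<^sub>v (A\<^sub>0 ^\<^sub>m k *\<^sub>v x) = 0\<^sub>v m"
  shows "Q *\<^sub>v x = 0\<^sub>v n"
proof -
  obtain c \<rho> where dA: "decay n A c \<rho>" using stable_decay[OF A A_stable] by blast
  obtain c' \<rho>' where dA0: "decay n A\<^sub>0 c' \<rho>'" using stable_decay[OF A\<^sub>0c A\<^sub>0_stable] by blast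
  have eq: "cinner (Q *\<^sub>v x) v = cinner (Q *\<^sub>v (A\<^sub>0 ^\<^sub>m k *\<^sub>v x)) (A ^\<^sub>m k *\<^sub>v v)" if v: "v \<in> carrier_vec n" for v k
  proof (induction k)
    case 0
    then show ?case using A A\<^sub>0c x v by simp
  next
    case (Suc k)
    have 1: "A\<^sub>0 ^\<^sub>m Suc k *\<^sub>v x = A\<^sub>0 *\<^sub>v (A\<^sub>0 ^\<^sub>m k *\<^sub>v x)" unfolding mat_pow_Suc2[OF A\<^sub>0c]
      by (rule assoc_mult_mat_vec[OF A\<^sub>0c pow_mat_carrier[OF A\<^sub>0c] x])
    have 2: "A ^\<^sub>m Suc k *\<^sub>v v = A *\<^sub>v (A ^\<^sub>m k *\<^sub>v v)" unfolding mat_pow_Suc2[OF A]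
      by (rule assoc_mult_mat_vec[OF A pow_mat_carrier[OF A] v])
    have "cinner (Q *\<^sub>v (A\<^sub>0 ^\<^sub>m k *\<^sub>v x)) (A ^\<^sub>m k *\<^sub>v v) = cinner (Q *\<^sub>v (A\<^sub>0 *\<^sub>v (A\<^sub>0 ^\<^sub>m k *\<^sub>v x))) (A *\<^sub>v (A ^\<^sub>m k *\<^sub>v v)) + cinner (0\<^sub>v m) (C *\<^sub>v (A ^\<^sub>m k *\<^sub>v v))"
      unfolding z[of k, symmetric]
      by (rule Q_step) (use mult_mat_vec_carrier'[OF pow_mat_carrier[OF A\<^sub>0c]] mult_mat_vec_carrier'[OF pow_mat_carrier[OF A]] in auto)
    also have "cinner (0\<^sub>v m) (C *\<^sub>v (A ^\<^sub>m k *\<^sub>v v)) = 0" by (simp add: cinner_fv)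
    finally show ?case unfolding 1 2 using Suc by simp
  qed
  have "cinner (Q *\<^sub>v x) (Q *\<^sub>v x) = 0"
  proof -
    have v: "Q *\<^sub>v x \<in> carrier_vec n" using Q by auto
    have "(\<lambda>k::nat. cinner (Q *\<^sub>v x) (Q *\<^sub>v x)) \<longlonglongrightarrow> 0"
      using cinner_pow_tendsto[OF dA dA0 Q x v] unfolding eq[OF v, symmetric] .
    then show ?thesis by (simp only: LIMSEQ_const_iff)
  qed
  then have "(cnorm (Q *\<^sub>v x))\<^sup>2 = 0" by (simp add: cnorm_sq)
  then show ?thesis using cnorm_eq_0_iff[of "Q *\<^sub>v x" n] Q by auto
qed

lemma Q_inj: "\<forall>x\<in>carrier_vec n. Q *\<^sub>v x = 0\<^sub>v n \<longrightarrow> x = 0\<^sub>v n"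
proof -
  text \<open>On the kernel of \<open>Q\<close> the Riccati equation forces \<open>C\<^sub>0 x = 0\<close>, so the kernel is invariant under
    \<open>A\<close>, on which it equals \<open>A\<^sub>0\<close>, and is contained in the kernel of \<open>C\<close>.\<close>
  have step: "Q *\<^sub>v (A *\<^sub>v x) = 0\<^sub>v n \<and> C *\<^sub>v x = 0\<^sub>v m" if x: "x \<in> carrier_vec n" and z: "Q *\<^sub>v x = 0\<^sub>v n" for x
  proof -
    obtain c \<rho> where dA: "decay n A c \<rho>" using stable_decay[OF A A_stable] by blast
    \<comment> \<open>The Riccati equation in its symmetric form, read as a balance along A with the
      nonnegative loss \<open>C\<^sub>0\<^sup>\<dagger> * \<Delta> * C\<^sub>0\<close>.\<close>
    have id: "Re (cinner (Q *\<^sub>v y) y) = Re (cinner (Q *\<^sub>v (A *\<^sub>v y)) (A *\<^sub>v y)) + Re (cinner (\<Delta> *\<^sub>v (C\<^sub>0 *\<^sub>v y)) (C\<^sub>0 *\<^sub>v y))"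
      if y: "y \<in> carrier_vec n" for y
    proof -
      have "adj (fm C) = adj (fm C\<^sub>0) * fm \<Delta> + adj (fm A) * fm Q * fm \<Gamma>"
        using arg_cong[OF fC\<^sub>0, of adj] arg_cong[OF \<Delta>pd(1), of fm] by (simp add: fhQ algebra_simps)
      then have "fm Q = adj (fm A) * fm Q * fm A + adj (fm C\<^sub>0) * fm \<Delta> * fm C\<^sub>0"
        using fric unfolding fA\<^sub>0 by (simp add: algebra_simps)
      then have "cinner (Q *\<^sub>v y) y = ent (adj (fv y) * (adj (fm A) * fm Q * fm A + adj (fm C\<^sub>0) * fm \<Delta> * fm C\<^sub>0) * fv y) 0 0"
        using y by (simp add: cinner_fv mult.assoc)
      then show ?thesis using y by (simp add: cinner_fv algebra_simps)
    qed
    have nn: "0 \<le> Re (cinner (\<Delta> *\<^sub>v (C\<^sub>0 *\<^sub>v y)) (C\<^sub>0 *\<^sub>v y))" for y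
      using positive_definite_matD(3)[OF \<Delta>c \<Delta>pd(2), of "C\<^sub>0 *\<^sub>v y"] C\<^sub>0c by auto
    \<comment> \<open>Q is positive semidefinite: its form does not increase along an orbit of A and
      tends to zero there.\<close>
    have Q0: "0 \<le> Re (cinner (Q *\<^sub>v y) y)" if y: "y \<in> carrier_vec n" for y
    proof -
      have le: "Re (cinner (Q *\<^sub>v (A ^\<^sub>m k *\<^sub>v y)) (A ^\<^sub>m k *\<^sub>v y)) \<le> Re (cinner (Q *\<^sub>v y) y)" for k
      proof (induction k)
        case 0
        then show ?case using A y by simp
      next
        case (Suc k)
        have 2: "A ^\<^sub>m Suc k *\<^sub>v y = A *\<^sub>v (A ^\<^sub>m k *\<^sub>v y)" unfolding mat_pow_Suc2[OF A]
          by (rule assoc_mult_mat_vec[OF A pow_mat_carrier[OF A] y])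
        show ?case unfolding 2 using Suc id[of "A ^\<^sub>m k *\<^sub>v y"] nn[of "A ^\<^sub>m k *\<^sub>v y"]
            mult_mat_vec_carrier'[OF pow_mat_carrier[OF A], of k y] by linarith
      qed
      have "(\<lambda>k. Re (cinner (Q *\<^sub>v (A ^\<^sub>m k *\<^sub>v y)) (A ^\<^sub>m k *\<^sub>v y))) \<longlonglongrightarrow> Re 0"
        by (intro tendsto_Re cinner_pow_tendsto[OF dA dA Q y y])
      from LIMSEQ_le_const2[OF this, of "Re (cinner (Q *\<^sub>v y) y)"] le show ?thesis by auto
    qed
    have "Re (cinner (Q *\<^sub>v x) x) = 0" unfolding z using x by (simp add: cinner_fv)
    then have "\<not> 0 < Re (cinner (\<Delta> *\<^sub>v (C\<^sub>0 *\<^sub>v x)) (C\<^sub>0 *\<^sub>v x))"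
      using id[OF x] Q0[of "A *\<^sub>v x"] A by auto
    then have c0: "C\<^sub>0 *\<^sub>v x = 0\<^sub>v m"
      using positive_definite_matD(2)[OF \<Delta>c \<Delta>pd(2), of "C\<^sub>0 *\<^sub>v x"] C\<^sub>0c by auto
    have fc0: "fm C\<^sub>0 * fv x = 0"
    proof -
      have "fv (C\<^sub>0 *\<^sub>v x) = 0" unfolding c0 by simp
      then show ?thesis using x by simp
    qed
    text \<open>The adjoint Riccati equation \<open>Q = A\<^sub>0\<^sup>* Q A + C\<^sub>0\<^sup>* C\<close> gives \<open>A\<^sub>0\<^sup>* (Q A x) = - C\<^sub>0\<^sup>* C x\<close>, while
      \<open>C x = \<Gamma>\<^sup>* Q A x\<close>.\<close>
    have cx: "fm C * fv x = adj (fm \<Gamma>) * fm Q * fm A * fv x"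
    proof -
      have "fm \<Delta> * fm C\<^sub>0 * fv x = 0" using fc0 by (simp add: mult.assoc)
      then show ?thesis unfolding fC\<^sub>0 by (simp add: algebra_simps)
    qed
    have "adj (fm A) * (fm Q * fm A * fv x) = 0"
    proof -
      have "fv (Q *\<^sub>v x) = 0" unfolding z by simp
      then have "fm Q * fv x = 0" using x by simp
      moreover have "fm Q * fv x = adj (fm A) * fm Q * fm A\<^sub>0 * fv x + adj (fm C) * (fm C\<^sub>0 * fv x)"
        by (subst fric) (simp add: algebra_simps)
      ultimately show ?thesis unfolding fc0 fA\<^sub>0 using fc0 by (simp add: algebra_simps)
    qed
    then have "Re (cinner (Q *\<^sub>v (A *\<^sub>v x)) (A *\<^sub>v x)) = 0" using x
      by (simp add: cinner_fv mult.assoc)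
    moreover have w: "A *\<^sub>v x \<in> carrier_vec n" using A by auto
    text \<open>A positive semidefinite form vanishing at a vector has it in its kernel.\<close>
    ultimately have "Q *\<^sub>v (A *\<^sub>v x) = 0\<^sub>v n"
    proof -
      define w where "w = A *\<^sub>v x"
      define v where "v = Q *\<^sub>v w"
      have w: "w \<in> carrier_vec n" "v \<in> carrier_vec n" unfolding w_def v_def using A Q by auto
      have q0: "Re (cinner (Q *\<^sub>v w) w) = 0" unfolding w_def by fact
      have "0 \<le> t\<^sup>2 * Re (cinner (Q *\<^sub>v v) v) - 2 * t * (cnorm v)\<^sup>2" for t :: real
      proof -
        define u where "u = w - complex_of_real t \<cdot>\<^sub>v v"
        have u: "u \<in> carrier_vec n" unfolding u_def using w by auto
        have "Re (cinner (Q *\<^sub>v u) u) = Re (cinner (Q *\<^sub>v w) w) - t * Re (cinner (Q *\<^sub>v v) w) - t * Re (cinner (Q *\<^sub>v w) v) + t * t * Re (cinner (Q *\<^sub>v v) v)"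
          unfolding u_def using w by (simp add: cinner_fv algebra_simps smul_diff)
        moreover have "cinner (Q *\<^sub>v w) v = cinner v v" unfolding v_def ..
        moreover have "cinner (Q *\<^sub>v v) w = cinner v v"
          using w cinner_mult_left[of v Q w] unfolding hQ v_def by simp
        ultimately show ?thesis using Q0[OF u] q0 by (simp add: cinner_self power2_eq_square)
      qed
      note par = this
      have "cnorm v = 0"
      proof (rule ccontr)
        assume "cnorm v \<noteq> 0"
        then have pv: "0 < (cnorm v)\<^sup>2" by simp
        have qv: "0 \<le> Re (cinner (Q *\<^sub>v v) v)" by (rule Q0[OF w(2)])
        \<comment> \<open>Small enough that the linear term of the parabola outweighs the quadratic
          one; the added 1 keeps the denominator positive.\<close>
        define t where "t = (cnorm v)\<^sup>2 / (Re (cinner (Q *\<^sub>v v) v) + 1)"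
        have t: "0 < t" unfolding t_def using pv qv by simp
        have "t * (Re (cinner (Q *\<^sub>v v) v) + 1) = (cnorm v)\<^sup>2" unfolding t_def using qv by simp
        then have "t * Re (cinner (Q *\<^sub>v v) v) < 2 * (cnorm v)\<^sup>2" using pv t unfolding distrib_left by linarith
        then have "t * (t * Re (cinner (Q *\<^sub>v v) v)) < t * (2 * (cnorm v)\<^sup>2)" using t by simp
        then show False using par[of t] by (simp add: power2_eq_square algebra_simps)
      qed
      then show ?thesis using cnorm_eq_0_iff[OF w(2)] unfolding v_def w_def by simp
    qed
    moreover have "C *\<^sub>v x = 0\<^sub>v m"
    proof (rule fv_cancel)
      have "fv (Q *\<^sub>v (A *\<^sub>v x)) = 0" using calculation by simp
      then have "fm Q * (fm A * fv x) = 0" using x by simp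
      then show "fv (C *\<^sub>v x) = fv (0\<^sub>v m)" using cx x by (simp add: mult.assoc)
    qed simp
    ultimately show ?thesis by simp
  qed
  show ?thesis
  proof (intro ballI impI)
    fix x assume x: "x \<in> carrier_vec n" "Q *\<^sub>v x = 0\<^sub>v n"
    have "Q *\<^sub>v (A ^\<^sub>m k *\<^sub>v x) = 0\<^sub>v n" for k
    proof (induction k)
      case 0
      then show ?case using A x by simp
    next
      case (Suc k)
      have 2: "A ^\<^sub>m Suc k *\<^sub>v x = A *\<^sub>v (A ^\<^sub>m k *\<^sub>v x)" unfolding mat_pow_Suc2[OF A]
        by (rule assoc_mult_mat_vec[OF A pow_mat_carrier[OF A] x(1)])
      show ?case unfolding 2 using step[OF _ Suc] mult_mat_vec_carrier'[OF pow_mat_carrier[OF A]] by blast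
    qed
    then have "C *\<^sub>v (A ^\<^sub>m k *\<^sub>v x) = 0\<^sub>v m" for k
      using step[of "A ^\<^sub>m k *\<^sub>v x"] mult_mat_vec_carrier'[OF pow_mat_carrier[OF A]] by blast
    then show "x = 0\<^sub>v n" using CA_obs x(1) unfolding observable_def by simp
  qed
qed

end

section \<open>Consequences of strict positivity\<close>

lemma mat_eq_vecI:
  fixes M N :: "complex mat"
  assumes "M \<in> carrier_mat k r" "N \<in> carrier_mat k r" "\<And>x. x \<in> carrier_vec r \<Longrightarrow> M *\<^sub>v x = N *\<^sub>v x"
  shows "M = N"
proof (rule eq_matI)
  fix i j assume ij: "i < dim_row N" "j < dim_col N"
  then have "(M *\<^sub>v unit_vec r j) $ i = (N *\<^sub>v unit_vec r j) $ i" using assms by simp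
  then show "M $$ (i, j) = N $$ (i, j)" using ij assms(1,2) by (simp add: scalar_prod_right_unit[of j r])
qed (use assms in auto)

text \<open>\<open>posE\<close> is strict positivity tested on
  \<open>st C\<^sub>0 A\<^sub>0 c x\<close>, with the norms of both adjoints already evaluated. It
  is the only form in which positivity is used from here on.\<close>

locale riccati_pos = riccati +
  fixes e :: real
  assumes e: "0 < e"
    and posE: "\<And>c x. c \<in> carrier_vec m \<Longrightarrow> x \<in> carrier_vec n \<Longrightarrow>
      e * ((cnorm c)\<^sup>2 + (\<Sum>i. (cnorm (C\<^sub>0 *\<^sub>v (A\<^sub>0 ^\<^sub>m i *\<^sub>v x)))\<^sup>2))
        + ((cnorm (D\<^sub>2\<^sup>\<dagger> *\<^sub>v c + B\<^sub>2\<^sup>\<dagger> *\<^sub>v (Q *\<^sub>v x)))\<^sup>2 + (\<Sum>i. (cnorm (C\<^sub>2 *\<^sub>v (A\<^sub>0 ^\<^sub>m i *\<^sub>v x)))\<^sup>2))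
      \<le> (cnorm (D\<^sub>1\<^sup>\<dagger> *\<^sub>v c + B\<^sub>1\<^sup>\<dagger> *\<^sub>v (Q *\<^sub>v x)))\<^sup>2 + (\<Sum>i. (cnorm (C\<^sub>1 *\<^sub>v (A\<^sub>0 ^\<^sub>m i *\<^sub>v x)))\<^sup>2)"
begin

text \<open>For the given data \<open>S\<close> is Q^{-1} + P_2 - P_1, \<open>Z\<close> its inverse
  and \<open>Om\<close> the matrix \<Omega>; for G alone \<open>S\<close> is Q_0^{-1} - P_1.
  \<open>T\<close> passes from the state of \<Upsilon> to the state of the realization of G and K.
  The storage form is K = Q T = Q S Q.\<close>

definition "K = Q - Q * P * Q"
definition "S = minv Q - P"
definition "Z = minv S"
definition "T = 1\<^sub>m n - P * Q"
definition "Om = P * Z * minv Q"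

lemmas Qi = minv_works(1)[OF Q Q_inj]
lemmas Qfm = minv_fm[OF Q Q_inj]
lemmas dimsQi [simp] = Qi[THEN carrier_matD(1)] Qi[THEN carrier_matD(2)]

lemma Kc: "K \<in> carrier_mat n n" unfolding K_def using P Q by (auto intro!: minus_carrier_mat mult_carrier_mat)
lemma Sc: "S \<in> carrier_mat n n" unfolding S_def using P by (rule minus_carrier_mat)
lemma Tc: "T \<in> carrier_mat n n" unfolding T_def using P Q by (auto intro!: minus_carrier_mat mult_carrier_mat)
lemmas dimsK [simp] = Kc[THEN carrier_matD(1)] Kc[THEN carrier_matD(2)] Sc[THEN carrier_matD(1)] Sc[THEN carrier_matD(2)]
  Tc[THEN carrier_matD(1)] Tc[THEN carrier_matD(2)]

lemma fK: "fm K = fm Q - fm Q * fm P * fm Q" unfolding K_def by simp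
lemma hK: "K\<^sup>\<dagger> = K" by (rule fm_cancel) (simp_all add: fK fhQ fhP mult.assoc)
lemma fS: "fm S = fm (minv Q) - fm P" unfolding S_def by simp
lemma fT: "fm T = fm (1\<^sub>m n) - fm P * fm Q" unfolding T_def by simp

lemma fT_apply: "x \<in> carrier_vec n \<Longrightarrow> fv (T *\<^sub>v x) = fv x - fm P * (fm Q * fv x)"
  by (simp add: fT left_diff_distrib mult.assoc)

lemma K_stein: "K - A\<^sub>0\<^sup>\<dagger> * K * A\<^sub>0 = C\<^sub>1\<^sup>\<dagger> * C\<^sub>1 - C\<^sub>2\<^sup>\<dagger> * C\<^sub>2"
  by (rule fm_cancel) (use F.stein in \<open>simp_all add: fK\<close>)

lemma pos_form:
  assumes c: "c \<in> carrier_vec m" and x: "x \<in> carrier_vec n"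
  shows "e * ((cnorm c)\<^sup>2 + (\<Sum>i. (cnorm (C\<^sub>0 *\<^sub>v (A\<^sub>0 ^\<^sub>m i *\<^sub>v x)))\<^sup>2)) + (cnorm (D\<^sub>2\<^sup>\<dagger> *\<^sub>v c + B\<^sub>2\<^sup>\<dagger> *\<^sub>v (Q *\<^sub>v x)))\<^sup>2
    \<le> (cnorm (D\<^sub>1\<^sup>\<dagger> *\<^sub>v c + B\<^sub>1\<^sup>\<dagger> *\<^sub>v (Q *\<^sub>v x)))\<^sup>2 + Re (cinner (K *\<^sub>v x) x)"
proof -
  obtain b \<rho> where "decay n A\<^sub>0 b \<rho>" using stable_decay[OF A\<^sub>0c A\<^sub>0_stable] by blast
  from stein_telescope[OF this C\<^sub>1c C\<^sub>2c Kc K_stein x] posE[OF c x] show ?thesis by linarith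
qed

text \<open>With c = C_0 x and A_0 x as state, the test sequence is the unshifted orbit C_0 A_0^k x,
  and the Stein equation turns \<open>pos_form\<close> into: the form of K at x is at least e times
  the energy of this orbit. If the form is not positive, the orbit vanishes; then Q x = 0 and x =
  0.\<close>

lemma K_pd: "positive_definite_mat K"
proof (rule positive_definite_matI[OF Kc hK], rule ccontr)
  fix x assume x: "x \<in> carrier_vec n" "x \<noteq> 0\<^sub>v n" and "\<not> 0 < Re (cinner (K *\<^sub>v x) x)"
  obtain b \<rho> where d: "decay n A\<^sub>0 b \<rho>" using stable_decay[OF A\<^sub>0c A\<^sub>0_stable] by blast
  have c0: "C\<^sub>0 *\<^sub>v x \<in> carrier_vec m" and a0: "A\<^sub>0 *\<^sub>v x \<in> carrier_vec n" using C\<^sub>0c A\<^sub>0c by auto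
  have 1: "D\<^sub>1\<^sup>\<dagger> *\<^sub>v (C\<^sub>0 *\<^sub>v x) + B\<^sub>1\<^sup>\<dagger> *\<^sub>v (Q *\<^sub>v (A\<^sub>0 *\<^sub>v x)) = C\<^sub>1 *\<^sub>v x"
    by (rule fv_cancel) (use x in \<open>simp_all add: F.C\<^sub>1 algebra_simps\<close>)
  have 2: "D\<^sub>2\<^sup>\<dagger> *\<^sub>v (C\<^sub>0 *\<^sub>v x) + B\<^sub>2\<^sup>\<dagger> *\<^sub>v (Q *\<^sub>v (A\<^sub>0 *\<^sub>v x)) = C\<^sub>2 *\<^sub>v x"
    by (rule fv_cancel) (use x in \<open>simp_all add: F.C\<^sub>2 algebra_simps\<close>)
  have "Re (cinner (K *\<^sub>v (A\<^sub>0 *\<^sub>v x)) (A\<^sub>0 *\<^sub>v x)) = Re (cinner (K *\<^sub>v x) x) - (cnorm (C\<^sub>1 *\<^sub>v x))\<^sup>2 + (cnorm (C\<^sub>2 *\<^sub>v x))\<^sup>2"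
  proof -
    have "Re (ent (adj (fv x) * ((fm K - adj (fm A\<^sub>0) * fm K * fm A\<^sub>0) - (adj (fm C\<^sub>1) * fm C\<^sub>1 - adj (fm C\<^sub>2) * fm C\<^sub>2)) * fv x) 0 0) = 0"
      unfolding fK F.stein by simp
    then show ?thesis unfolding cnorm_sq using x by (simp add: cinner_fv algebra_simps)
  qed
  moreover note pos_form[OF c0 a0, unfolded 1 2] \<open>\<not> 0 < Re (cinner (K *\<^sub>v x) x)\<close>
  ultimately have le: "e * ((cnorm (C\<^sub>0 *\<^sub>v x))\<^sup>2 + (\<Sum>i. (cnorm (C\<^sub>0 *\<^sub>v (A\<^sub>0 ^\<^sub>m i *\<^sub>v (A\<^sub>0 *\<^sub>v x))))\<^sup>2)) \<le> 0"
    by linarith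
  have sm: "summable (\<lambda>i. (cnorm (C\<^sub>0 *\<^sub>v (A\<^sub>0 ^\<^sub>m i *\<^sub>v (A\<^sub>0 *\<^sub>v x))))\<^sup>2)"
    by (rule st_ell2(2)[OF d C\<^sub>0c zero_carrier_vec a0])
  have nn: "0 \<le> (\<Sum>i. (cnorm (C\<^sub>0 *\<^sub>v (A\<^sub>0 ^\<^sub>m i *\<^sub>v (A\<^sub>0 *\<^sub>v x))))\<^sup>2)" by (intro suminf_nonneg sm) auto
  have "(cnorm (C\<^sub>0 *\<^sub>v x))\<^sup>2 + (\<Sum>i. (cnorm (C\<^sub>0 *\<^sub>v (A\<^sub>0 ^\<^sub>m i *\<^sub>v (A\<^sub>0 *\<^sub>v x))))\<^sup>2) \<le> 0"
    using le e by (simp add: mult_le_0_iff)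
  then have z: "(cnorm (C\<^sub>0 *\<^sub>v x))\<^sup>2 = 0" "(\<Sum>i. (cnorm (C\<^sub>0 *\<^sub>v (A\<^sub>0 ^\<^sub>m i *\<^sub>v (A\<^sub>0 *\<^sub>v x))))\<^sup>2) = 0"
    using nn zero_le_power2[of "cnorm (C\<^sub>0 *\<^sub>v x)"] by linarith+
  have zz: "C\<^sub>0 *\<^sub>v (A\<^sub>0 ^\<^sub>m k *\<^sub>v x) = 0\<^sub>v m" for k
  proof (cases k)
    case 0
    then show ?thesis using z(1) cnorm_eq_0_iff[OF c0] x A\<^sub>0c by simp
  next
    case (Suc i)
    have 3: "A\<^sub>0 ^\<^sub>m Suc i *\<^sub>v x = A\<^sub>0 ^\<^sub>m i *\<^sub>v (A\<^sub>0 *\<^sub>v x)"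
      using assoc_mult_mat_vec[OF pow_mat_carrier[OF A\<^sub>0c] A\<^sub>0c x(1)] by simp
    have "(cnorm (C\<^sub>0 *\<^sub>v (A\<^sub>0 ^\<^sub>m i *\<^sub>v (A\<^sub>0 *\<^sub>v x))))\<^sup>2 = 0"
      using z(2) suminf_eq_zero_iff[OF sm] by simp
    then show ?thesis unfolding Suc 3 using cnorm_eq_0_iff[of "C\<^sub>0 *\<^sub>v (A\<^sub>0 ^\<^sub>m i *\<^sub>v (A\<^sub>0 *\<^sub>v x))" m] C\<^sub>0c by auto
  qed
  from Q_zero_of_C\<^sub>0_orbit[OF x(1) zz] Q_inj x show False by blast
qed

lemma T_inj: "\<forall>x\<in>carrier_vec n. T *\<^sub>v x = 0\<^sub>v n \<longrightarrow> x = 0\<^sub>v n"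
proof (intro ballI impI)
  fix x assume x: "x \<in> carrier_vec n" "T *\<^sub>v x = 0\<^sub>v n"
  have "fv (T *\<^sub>v x) = 0" unfolding x(2) by simp
  then have "fv x - fm P * (fm Q * fv x) = 0" unfolding fT_apply[OF x(1)] .
  then have "fm Q * (fv x - fm P * (fm Q * fv x)) = 0" by simp
  then have "K *\<^sub>v x = 0\<^sub>v n" by (intro fv_cancel) (use x(1) in \<open>simp_all add: fK algebra_simps\<close>)
  then show "x = 0\<^sub>v n" using positive_definite_matD(4)[OF Kc K_pd] x(1) by blast
qed

lemma hQi: "adj (fm (minv Q)) = fm (minv Q)"
proof -
  have "(minv Q)\<^sup>\<dagger> * Q = 1\<^sub>m n"
    by (rule fm_cancel) (use arg_cong[OF Qfm(1), of adj] in \<open>simp_all add: fhQ\<close>)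
  from minv_eqI[OF Q _ this] Qi have "(minv Q)\<^sup>\<dagger> = minv Q" by simp
  from arg_cong[OF this, of fm] show ?thesis by simp
qed

text \<open>S is the congruence of K by the Hermitian inverse of Q.\<close>

lemma S_pd: "positive_definite_mat S"
proof (rule positive_definite_matI[OF Sc])
  show "S\<^sup>\<dagger> = S" by (rule fm_cancel) (simp_all add: fS hQi fhP)
  fix y :: "complex vec" assume y: "y \<in> carrier_vec n" "y \<noteq> 0\<^sub>v n"
  define x where "x = minv Q *\<^sub>v y"
  have x: "x \<in> carrier_vec n" "Q *\<^sub>v x = y" unfolding x_def using Qi y minv_solve(1)[OF Q Q_inj y(1)] by auto
  then have "x \<noteq> 0\<^sub>v n" using y by auto
  have yx: "fv y = fm Q * fv x" using arg_cong[OF x(2), of fv] x(1) by simp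
  have "fm (minv Q) * fv y = fv x"
    unfolding yx mult.assoc[symmetric] Qfm(2) using x(1) by simp
  then have "cinner (S *\<^sub>v y) y = ent (adj (fm Q * fv x) * (fv x - fm P * (fm Q * fv x))) 0 0"
    using y(1) yx by (simp add: cinner_fv fS left_diff_distrib mult.assoc)
  also have "\<dots> = cinner (K *\<^sub>v x) x" using x(1) by (simp add: cinner_fv fK fhQ algebra_simps)
  finally show "0 < Re (cinner (S *\<^sub>v y) y)"
    using positive_definite_matD(2)[OF Kc K_pd x(1) \<open>x \<noteq> 0\<^sub>v n\<close>] by simp
qed

lemmas S_inj = positive_definite_matD(4)[OF Sc S_pd]

lemma Zc: "Z \<in> carrier_mat n n" unfolding Z_def by (rule minv_works(1)[OF Sc S_inj])
lemmas dimsZ [simp] = Zc[THEN carrier_matD(1)] Zc[THEN carrier_matD(2)]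
lemma Zfm: "fm S * fm Z = fm (1\<^sub>m n)" "fm Z * fm S = fm (1\<^sub>m n)"
  unfolding Z_def by (rule minv_fm[OF Sc S_inj])+
lemma Z_pd: "positive_definite_mat Z" unfolding Z_def by (rule positive_definite_minv(1)[OF Sc S_pd])
lemma fhZ: "adj (fm Z) = fm Z"
  using arg_cong[OF positive_definite_matD(1)[OF Zc Z_pd], of fm] by simp

lemma QPZ: "fm Q * fm P * fm Z = fm Z - fm Q" "fm Z * fm P * fm Q = fm Z - fm Q"
proof -
  have "fm Q * (fm S * fm Z) = fm Q" unfolding Zfm by simp
  then have "(fm Q * fm (minv Q)) * fm Z - fm Q * fm P * fm Z = fm Q"
    unfolding fS by (simp add: algebra_simps)
  then show 1: "fm Q * fm P * fm Z = fm Z - fm Q" unfolding Qfm by (simp add: algebra_simps)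
  show "fm Z * fm P * fm Q = fm Z - fm Q"
    using arg_cong[OF 1, of adj] by (simp add: fhZ fhP fhQ mult.assoc)
qed

lemma Omc: "Om \<in> carrier_mat n n" unfolding Om_def using P Zc Qi by auto
lemmas dimsOm [simp] = Omc[THEN carrier_matD(1)] Omc[THEN carrier_matD(2)]

text \<open>The factored definition hides that \<open>Om\<close> is Hermitian; this form exhibits
  it.\<close>

lemma fOm: "fm Om = fm P + fm P * fm Z * fm P"
proof -
  have "fm Z * fm (minv Q) - fm (1\<^sub>m n) = fm Z * fm P"
  proof -
    have "fm Z * (fm S + fm P) = fm (1\<^sub>m n) + fm Z * fm P" by (simp add: distrib_left Zfm)
    then show ?thesis unfolding fS by simp
  qed
  then have "fm Z * fm (minv Q) = fm (1\<^sub>m n) + fm Z * fm P" by (simp add: algebra_simps)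
  then show ?thesis unfolding Om_def by (simp add: mult.assoc distrib_left)
qed

lemma Om_eq: "fm Om - fm P * fm Q * fm Om = fm P" "adj (fm Om) = fm Om"
proof -
  have "fm P * fm Q * fm Om = fm P * fm Q * fm P + fm P * (fm Q * fm P * fm Z) * fm P"
    unfolding fOm by (simp add: algebra_simps)
  then show "fm Om - fm P * fm Q * fm Om = fm P" unfolding QPZ(1) fOm by (simp add: algebra_simps)
  show "adj (fm Om) = fm Om" unfolding fOm by (simp add: fhP fhZ mult.assoc)
qed

text \<open>Since (1 - P Q) Q^{-1} = S and Z inverts S, the vector Q^{-1} Z b solves (1 - P Q)
  \<eta> = b without inverting 1 - P Q.\<close>

lemma eta_eq:
  assumes "fm (1\<^sub>m n) * b = b"
  shows "fm (minv Q) * (fm Z * b) - fm P * fm Q * (fm (minv Q) * (fm Z * b)) = b"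
    "fm Q * (fm (minv Q) * (fm Z * b)) = fm Z * b"
proof -
  show 1: "fm Q * (fm (minv Q) * (fm Z * b)) = fm Z * b"
    by (simp only: mult.assoc[symmetric] Qfm) simp
  have "fm (minv Q) * (fm Z * b) - fm P * (fm Z * b) = (fm S * fm Z) * b"
    unfolding fS by (simp add: algebra_simps)
  then show "fm (minv Q) * (fm Z * b) - fm P * fm Q * (fm (minv Q) * (fm Z * b)) = b"
    unfolding Zfm assms by (simp add: mult.assoc 1)
qed

text \<open>The case x = 0 of \<open>pos_form\<close>: e |c|^2 is bounded by the squared norm of
  \<open>D\<^sub>1\<^sup>\<dagger> *\<^sub>v c\<close>. Hence \<open>D\<^sub>1\<close> has full row
  rank.\<close>

lemma D\<^sub>1_inj: "c \<in> carrier_vec m \<Longrightarrow> D\<^sub>1\<^sup>\<dagger> *\<^sub>v c = 0\<^sub>v p \<Longrightarrow> c = 0\<^sub>v m"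
proof -
  assume c: "c \<in> carrier_vec m" and z: "D\<^sub>1\<^sup>\<dagger> *\<^sub>v c = 0\<^sub>v p"
  have pw: "A\<^sub>0 ^\<^sub>m i *\<^sub>v 0\<^sub>v n = 0\<^sub>v n" for i
    using pow_mat_carrier[OF A\<^sub>0c, of i] by (simp del: pow_mat_dim)
  have "e * (cnorm c)\<^sup>2 + (cnorm (D\<^sub>2\<^sup>\<dagger> *\<^sub>v c + 0\<^sub>v q))\<^sup>2 \<le> 0"
    using pos_form[OF c, of "0\<^sub>v n"] z by (simp add: pw cinner_fv)
  then have "e * (cnorm c)\<^sup>2 \<le> 0" by (smt (verit) zero_le_power2)
  then have "(cnorm c)\<^sup>2 \<le> 0" using e by (simp add: mult_le_0_iff)
  then show ?thesis using cnorm_eq_0_iff[OF c] by simp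
qed

end

section \<open>The left minimal rank factor\<close>

text \<open>The difference of the two adjoint images is orthogonal to itself. Hence the value of the
  adjoint at a preimage does not depend on which preimage \<open>inv_into\<close> selects.\<close>

lemma coeff_adj_cong_preimage:
  assumes F: "coeff_decay k r F a \<rho>" and g: "g \<in> ell2 k" and h: "h \<in> ell2 k"
    and eq: "coeff_op k F (coeff_adj r F g) = coeff_op k F (coeff_adj r F h)"
  shows "coeff_adj r F g i = coeff_adj r F h i"
proof -
  note c = coeff_adj_ell2[OF F g] coeff_adj_ell2[OF F h]
  note gh = ell2_diff[OF g h] and cd = ell2_diff[OF c]
  have d: "coeff_adj r F (\<lambda>i. g i - h i) = (\<lambda>i. coeff_adj r F g i - coeff_adj r F h i)"
    by (intro ext coeff_adj_diff[OF F g h])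
  have "ell2_inner (coeff_adj r F g) (\<lambda>i. coeff_adj r F g i - coeff_adj r F h i)
    = ell2_inner (coeff_adj r F h) (\<lambda>i. coeff_adj r F g i - coeff_adj r F h i)"
    unfolding d[symmetric] coeff_op_adjoint(1)[OF F c(1) gh, symmetric] coeff_op_adjoint(1)[OF F c(2) gh, symmetric] eq ..
  then have "ell2_inner (\<lambda>i. coeff_adj r F g i - coeff_adj r F h i) (\<lambda>i. coeff_adj r F g i - coeff_adj r F h i) = 0"
    unfolding ell2_inner_diff(1)[OF c cd] by simp
  from ell2_eq_0[OF cd this, of i] have "coeff_adj r F g i - coeff_adj r F h i = 0\<^sub>v r" .
  then have "fv (coeff_adj r F g i) - fv (coeff_adj r F h i) = 0"
    by (metis fv_diff fv_zero ell2_dim c)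
  then show ?thesis by (intro fv_cancel) (simp_all add: ell2_dim[OF c(1)] ell2_dim[OF c(2)])
qed

context riccati_pos
begin

text \<open>The projection behind \<Theta>_0 requires splitting the embedded vector y into a part in
  the kernel of T_G and a part in the range of its adjoint. If x is the first entry of the kernel
  part, a test sequence with entry u and state Q^{-1} Z B_1 x reduces this to W x +
  \<open>D\<^sub>1\<^sup>\<dagger>\<close> u = y, D_1 x = 0. The second summand of \<open>W\<close>
  is the contribution of the tail.\<close>

definition "W = 1\<^sub>m p + B\<^sub>1\<^sup>\<dagger> * Z * B\<^sub>1"

lemma Wc: "W \<in> carrier_mat p p" unfolding W_def by (rule carrier_matI) simp_all
lemmas dimsW [simp] = Wc[THEN carrier_matD(1)] Wc[THEN carrier_matD(2)]

lemma fW: "fm W = fm (1\<^sub>m p) + adj (fm B\<^sub>1) * fm Z * fm B\<^sub>1" unfolding W_def by simp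

lemma W_pd: "positive_definite_mat W"
proof (rule positive_definite_matI[OF Wc])
  show "W\<^sup>\<dagger> = W" by (rule fm_cancel) (simp_all add: fW fhZ mult.assoc)
  fix x :: "complex vec" assume x: "x \<in> carrier_vec p" "x \<noteq> 0\<^sub>v p"
  have "cinner (W *\<^sub>v x) x = cinner x x + cinner (Z *\<^sub>v (B\<^sub>1 *\<^sub>v x)) (B\<^sub>1 *\<^sub>v x)"
    using x by (simp add: cinner_fv fW algebra_simps)
  moreover have "0 \<le> Re (cinner (Z *\<^sub>v (B\<^sub>1 *\<^sub>v x)) (B\<^sub>1 *\<^sub>v x))"
    using positive_definite_matD(3)[OF Zc Z_pd, of "B\<^sub>1 *\<^sub>v x"] B\<^sub>1 by auto
  moreover have "0 < (cnorm x)\<^sup>2" using cnorm_eq_0_iff[OF x(1)] x(2) by simp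
  moreover have "Re (cinner x x) = (cnorm x)\<^sup>2" by (simp only: cnorm_sq)
  ultimately show "0 < Re (cinner (W *\<^sub>v x) x)" by (simp add: add_pos_nonneg)
qed

lemmas W_inj = positive_definite_matD(4)[OF Wc W_pd]
lemmas Wi = minv_works(1)[OF Wc W_inj]
lemmas Wfm = minv_fm[OF Wc W_inj]
lemmas dimsWi [simp] = Wi[THEN carrier_matD(1)] Wi[THEN carrier_matD(2)]

text \<open>The Schur complement by which u is eliminated from that system.\<close>

definition "H = D\<^sub>1 * minv W * D\<^sub>1\<^sup>\<dagger>"

lemma Hc: "H \<in> carrier_mat m m" unfolding H_def by (rule carrier_matI) simp_all
lemmas dimsH [simp] = Hc[THEN carrier_matD(1)] Hc[THEN carrier_matD(2)]

lemma H_inj: "\<forall>x\<in>carrier_vec m. H *\<^sub>v x = 0\<^sub>v m \<longrightarrow> x = 0\<^sub>v m"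
proof (intro ballI impI, rule ccontr)
  fix x assume x: "x \<in> carrier_vec m" "H *\<^sub>v x = 0\<^sub>v m" "x \<noteq> 0\<^sub>v m"
  have y: "D\<^sub>1\<^sup>\<dagger> *\<^sub>v x \<in> carrier_vec p" using D\<^sub>1 by auto
  have "cinner (H *\<^sub>v x) x = cinner (minv W *\<^sub>v (D\<^sub>1\<^sup>\<dagger> *\<^sub>v x)) (D\<^sub>1\<^sup>\<dagger> *\<^sub>v x)"
    using x(1) by (simp add: cinner_fv H_def mult.assoc)
  moreover have "cinner (H *\<^sub>v x) x = 0" unfolding x(2) using x(1) by (simp add: cinner_fv)
  ultimately show False
    using positive_definite_matD(2)[OF Wi positive_definite_minv(1)[OF Wc W_pd] y] D\<^sub>1_inj[OF x(1)] x(3) by auto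
qed

lemmas Hi = minv_works(1)[OF Hc H_inj]
lemmas Hfm = minv_fm[OF Hc H_inj]
lemmas dimsHi [simp] = Hi[THEN carrier_matD(1)] Hi[THEN carrier_matD(2)]

text \<open>The solution map from y to x in the system W x +
  \<open>D\<^sub>1\<^sup>\<dagger>\<close> u = y, D_1 x = 0.\<close>

definition "Pr = minv W * (1\<^sub>m p - D\<^sub>1\<^sup>\<dagger> * minv H * D\<^sub>1 * minv W)"

lemma Prc: "Pr \<in> carrier_mat p p" unfolding Pr_def by (rule carrier_matI) simp_all
lemmas dimsPr [simp] = Prc[THEN carrier_matD(1)] Prc[THEN carrier_matD(2)]

lemma fPr: "fm Pr = fm (minv W) - fm (minv W) * adj (fm D\<^sub>1) * fm (minv H) * fm D\<^sub>1 * fm (minv W)"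
  unfolding Pr_def by (simp add: right_diff_distrib mult.assoc)

lemma DPr: "fm D\<^sub>1 * fm Pr = 0"
proof -
  have "fm D\<^sub>1 * fm Pr = fm D\<^sub>1 * fm (minv W) - (fm H * fm (minv H)) * (fm D\<^sub>1 * fm (minv W))"
    unfolding fPr H_def by (simp add: right_diff_distrib mult.assoc)
  then show ?thesis unfolding Hfm by simp
qed

lemma PrW: "fm Pr * fm W = fm (1\<^sub>m p) - fm (minv W) * adj (fm D\<^sub>1) * fm (minv H) * fm D\<^sub>1"
  unfolding fPr left_diff_distrib mult.assoc Wfm by simp

lemma WPr: "fm W * fm Pr = fm (1\<^sub>m p) - adj (fm D\<^sub>1) * (fm (minv H) * (fm D\<^sub>1 * fm (minv W)))"
proof -
  have 1: "fm W * fm Pr = (fm W * fm (minv W)) - (fm W * fm (minv W)) * adj (fm D\<^sub>1) * (fm (minv H) * (fm D\<^sub>1 * fm (minv W)))"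
    unfolding fPr by (simp only: right_diff_distrib mult.assoc)
  have 2: "fm (1\<^sub>m p) * adj (fm D\<^sub>1) = adj (fm D\<^sub>1)" using fm_one_left(1)[of "D\<^sub>1\<^sup>\<dagger>" p] by simp
  show ?thesis using 1 unfolding Wfm 2 .
qed

end

locale riccati_pos0 = riccati_pos +
  assumes B\<^sub>2_0: "B\<^sub>2 = 0\<^sub>m n q" and D\<^sub>2_0: "D\<^sub>2 = 0\<^sub>m m q"
begin

lemma d_C': "fm D\<^sub>1 * fm C\<^sub>1 = fm C - fm C * fm P * fm Q"
  and b_C': "fm B\<^sub>1 * fm C\<^sub>1 = (fm A - fm A * fm P * fm Q) - (fm A\<^sub>0 - fm P * fm Q * fm A\<^sub>0)"
  using F.d_C F.b_C by (simp_all add: B\<^sub>2_0 D\<^sub>2_0)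

text \<open>Coefficient k + 1 of T_G on a sequence with tail C_1 A_0^j x. By \<open>b_C'\<close> the
  matrix B_1 C_1 is A T - T A_0, so the convolution telescopes, and \<open>d_C'\<close> absorbs the
  direct term. The summand with u is the contribution of the first entry.\<close>

lemma output_sum:
  assumes x: "x \<in> carrier_vec n" and l: "l < m" and u: "u \<in> carrier_vec p"
  shows "(D\<^sub>1 *\<^sub>v (C\<^sub>1 *\<^sub>v (A\<^sub>0 ^\<^sub>m k *\<^sub>v x)) + C *\<^sub>v (A ^\<^sub>m k *\<^sub>v (B\<^sub>1 *\<^sub>v u))) $ l
      + (\<Sum>j<k. (C * A ^\<^sub>m (k - Suc j) * B\<^sub>1 *\<^sub>v (C\<^sub>1 *\<^sub>v (A\<^sub>0 ^\<^sub>m j *\<^sub>v x))) $ l)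
    = (C *\<^sub>v (A ^\<^sub>m k *\<^sub>v (T *\<^sub>v x)) + C *\<^sub>v (A ^\<^sub>m k *\<^sub>v (B\<^sub>1 *\<^sub>v u))) $ l"
proof -
  have pA: "dim_row (A ^\<^sub>m i) = n" "dim_col (A ^\<^sub>m i) = n" "dim_row (A\<^sub>0 ^\<^sub>m i) = n" "dim_col (A\<^sub>0 ^\<^sub>m i) = n" for i
    using pow_mat_carrier[OF A, of i] pow_mat_carrier[OF A\<^sub>0c, of i] by auto
  define \<phi> where "\<phi> j = (C *\<^sub>v (A ^\<^sub>m (k - j) *\<^sub>v (T *\<^sub>v (A\<^sub>0 ^\<^sub>m j *\<^sub>v x)))) $ l" for j
  have t: "(C * A ^\<^sub>m (k - Suc j) * B\<^sub>1 *\<^sub>v (C\<^sub>1 *\<^sub>v (A\<^sub>0 ^\<^sub>m j *\<^sub>v x))) $ l = \<phi> j - \<phi> (Suc j)" if j: "j < k" for j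
  proof -
    define i where "i = k - Suc j"
    have kj: "k - j = Suc i" unfolding i_def using j by simp
    define w where "w = A\<^sub>0 ^\<^sub>m j *\<^sub>v x"
    have w: "w \<in> carrier_vec n" unfolding w_def using pow_mat_carrier[OF A\<^sub>0c, of j] by auto
    have w1: "A\<^sub>0 ^\<^sub>m Suc j *\<^sub>v x = A\<^sub>0 *\<^sub>v w" unfolding w_def mat_pow_Suc2[OF A\<^sub>0c]
      by (rule assoc_mult_mat_vec[OF A\<^sub>0c pow_mat_carrier[OF A\<^sub>0c] x])
    have "C * A ^\<^sub>m i * B\<^sub>1 *\<^sub>v (C\<^sub>1 *\<^sub>v w) = C *\<^sub>v (A ^\<^sub>m Suc i *\<^sub>v (T *\<^sub>v w)) - C *\<^sub>v (A ^\<^sub>m i *\<^sub>v (T *\<^sub>v (A\<^sub>0 *\<^sub>v w)))"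
    proof (rule fv_cancel)
      have "fm C * fm (A ^\<^sub>m i) * (fm B\<^sub>1 * fm C\<^sub>1) * fv w
        = fm C * (fm (A ^\<^sub>m i) * fm A * (fv w - fm P * (fm Q * fv w))) - fm C * (fm (A ^\<^sub>m i) * (fm A\<^sub>0 * fv w - fm P * (fm Q * (fm A\<^sub>0 * fv w))))"
        unfolding b_C' by (simp add: algebra_simps)
      then show "fv (C * A ^\<^sub>m i * B\<^sub>1 *\<^sub>v (C\<^sub>1 *\<^sub>v w)) = fv (C *\<^sub>v (A ^\<^sub>m Suc i *\<^sub>v (T *\<^sub>v w)) - C *\<^sub>v (A ^\<^sub>m i *\<^sub>v (T *\<^sub>v (A\<^sub>0 *\<^sub>v w))))"
        using w by (simp add: pA fT left_diff_distrib mult.assoc)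
    qed (simp add: pA)
    then show ?thesis unfolding \<phi>_def kj w1 w_def[symmetric] i_def[symmetric] using l
      by (simp add: pA del: index_mult_mat_vec)
  qed
  have "(\<Sum>j<k. (C * A ^\<^sub>m (k - Suc j) * B\<^sub>1 *\<^sub>v (C\<^sub>1 *\<^sub>v (A\<^sub>0 ^\<^sub>m j *\<^sub>v x))) $ l) = (\<Sum>j<k. \<phi> j - \<phi> (Suc j))"
    by (intro sum.cong refl t) simp
  also have "\<dots> = \<phi> 0 - \<phi> k" by (rule sum_lessThan_telescope')
  finally have 1: "(\<Sum>j<k. (C * A ^\<^sub>m (k - Suc j) * B\<^sub>1 *\<^sub>v (C\<^sub>1 *\<^sub>v (A\<^sub>0 ^\<^sub>m j *\<^sub>v x))) $ l) = \<phi> 0 - \<phi> k" .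
  have 2: "D\<^sub>1 *\<^sub>v (C\<^sub>1 *\<^sub>v (A\<^sub>0 ^\<^sub>m k *\<^sub>v x)) = C *\<^sub>v (A ^\<^sub>m (k - k) *\<^sub>v (T *\<^sub>v (A\<^sub>0 ^\<^sub>m k *\<^sub>v x)))"
  proof (rule fv_cancel)
    have "fm D\<^sub>1 * fm C\<^sub>1 * (fm (A\<^sub>0 ^\<^sub>m k) * fv x) = fm C * (fm (A\<^sub>0 ^\<^sub>m k) * fv x - fm P * (fm Q * (fm (A\<^sub>0 ^\<^sub>m k) * fv x)))"
      unfolding d_C' by (simp add: algebra_simps)
    moreover have "fm (1\<^sub>m n) * (fv y - fm P * X) = fv y - fm P * X" if "dim_vec y = n" for y X
      using that by (simp add: right_diff_distrib flip: mult.assoc)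
    from this[of "A\<^sub>0 ^\<^sub>m k *\<^sub>v x"] have "fm (1\<^sub>m n) * (fm (A\<^sub>0 ^\<^sub>m k) * fv x - fm P * X) = fm (A\<^sub>0 ^\<^sub>m k) * fv x - fm P * X" for X
      using x by (simp add: pA)
    ultimately show "fv (D\<^sub>1 *\<^sub>v (C\<^sub>1 *\<^sub>v (A\<^sub>0 ^\<^sub>m k *\<^sub>v x))) = fv (C *\<^sub>v (A ^\<^sub>m (k - k) *\<^sub>v (T *\<^sub>v (A\<^sub>0 ^\<^sub>m k *\<^sub>v x))))"
      using x by (simp add: pA fT left_diff_distrib mult.assoc)
  qed (simp add: pA)
  have "A\<^sub>0 ^\<^sub>m 0 *\<^sub>v x = x" using x by simp
  then show ?thesis unfolding 1 unfolding 2 \<phi>_def using l by (simp add: pA del: index_mult_mat_vec pow_mat.simps)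
qed

text \<open>An explicit g with the same image under T_G and its adjoint as the definition asks for
  identifies \<open>\<Theta> * \<Theta>\<^sup>\<dagger>\<close> with \<open>Pr\<close>. The
  conclusions follow from the algebra of \<open>Pr\<close> and injectivity of \<Theta>; apart from
  its size they are all that is used of \<Theta>_0 later.\<close>

lemma left_minimal_rank_factor_props:
  assumes lm: "left_minimal_rank_factor m p G \<Theta>"
    and G: "\<And>\<nu>. taylor_coeff m p G \<nu> = ss_coeff A B\<^sub>1 C D\<^sub>1 \<nu>"
  shows "D\<^sub>1 * \<Theta> = 0\<^sub>m m (p - m)" "\<Theta>\<^sup>\<dagger> * W * \<Theta> = 1\<^sub>m (p - m)"
    "\<And>x. x \<in> carrier_vec p \<Longrightarrow> D\<^sub>1 *\<^sub>v x = 0\<^sub>v m \<Longrightarrow> \<Theta> *\<^sub>v (\<Theta>\<^sup>\<dagger> *\<^sub>v (W *\<^sub>v x)) = x"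
proof -
  let ?F = "ss_coeff A B\<^sub>1 C D\<^sub>1"
  have Gc: "taylor_coeff m p G = ?F" using G by (intro ext)
  obtain c \<rho> where dA: "decay n A c \<rho>" using stable_decay[OF A A_stable] by blast
  obtain c' \<rho>' where dA0: "decay n A\<^sub>0 c' \<rho>'" using stable_decay[OF A\<^sub>0c A\<^sub>0_stable] by blast
  obtain a where F: "coeff_decay m p ?F a \<rho>" using ss_coeff_decay[OF dA C B\<^sub>1 D\<^sub>1] by blast
  note F' = F[folded Gc]
  have Thc: "\<Theta> \<in> carrier_mat p (p - m)" and inj: "inj_on (\<lambda>x. \<Theta> *\<^sub>v x) (carrier_vec (p - m))"
    using lm unfolding left_minimal_rank_factor_def by auto
  note [simp] = Thc[THEN carrier_matD(1)] Thc[THEN carrier_matD(2)]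
  let ?Op = "embed_adj p \<circ> toeplitz_adj m p G \<circ> inv_into (ell2 m) (toeplitz_op m p G \<circ> toeplitz_adj m p G) \<circ> toeplitz_op m p G \<circ> embed p"
  have key: "?Op y = y - Pr *\<^sub>v y" if y: "y \<in> carrier_vec p" for y
  proof -
    \<comment> \<open>These solve the system above: D_1 x = 0, T \<eta> = B_1 x, and the first entry
      of the adjoint image of the test sequence (u, \<eta>) is y - x.\<close>
    define u where "u = minv H *\<^sub>v (D\<^sub>1 *\<^sub>v (minv W *\<^sub>v y))"
    define x where "x = Pr *\<^sub>v y"
    define \<eta> where "\<eta> = minv Q *\<^sub>v (Z *\<^sub>v (B\<^sub>1 *\<^sub>v x))"
    have u: "u \<in> carrier_vec m" and x: "x \<in> carrier_vec p" and \<eta>: "\<eta> \<in> carrier_vec n"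
      unfolding u_def x_def \<eta>_def using Hi Prc Qi by auto
    have Dx: "D\<^sub>1 *\<^sub>v x = 0\<^sub>v m" unfolding x_def
      by (rule fv_cancel) (use y in \<open>simp_all add: DPr flip: mult.assoc\<close>)
    have b: "fm (1\<^sub>m n) * (fm B\<^sub>1 * fv x) = fm B\<^sub>1 * fv x" by (rule fm_one_left_assoc) simp
    have f\<eta>: "fv \<eta> = fm (minv Q) * (fm Z * (fm B\<^sub>1 * fv x))" unfolding \<eta>_def using x by simp
    have T\<eta>: "T *\<^sub>v \<eta> = B\<^sub>1 *\<^sub>v x"
    proof (rule fv_cancel)
      show "fv (T *\<^sub>v \<eta>) = fv (B\<^sub>1 *\<^sub>v x)" unfolding fT_apply[OF \<eta>] f\<eta>
        using eta_eq(1)[OF b] x by (simp add: mult.assoc)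
    qed simp
    have Wx: "fm W * fv x = fv y - adj (fm D\<^sub>1) * fv u"
    proof -
      have "fm W * fv x = (fm W * fm Pr) * fv y" unfolding x_def using y by (simp add: mult.assoc)
      then show ?thesis unfolding WPr u_def using y by (simp add: left_diff_distrib mult.assoc)
    qed
    have out: "D\<^sub>1\<^sup>\<dagger> *\<^sub>v u + B\<^sub>1\<^sup>\<dagger> *\<^sub>v (Q *\<^sub>v \<eta>) = y - x"
    proof (rule fv_cancel)
      have "fv x + adj (fm B\<^sub>1) * (fm Z * (fm B\<^sub>1 * fv x)) = fv y - adj (fm D\<^sub>1) * fv u"
        using Wx x unfolding fW by (simp add: distrib_right mult.assoc)
      then have "adj (fm D\<^sub>1) * fv u + adj (fm B\<^sub>1) * (fm Z * (fm B\<^sub>1 * fv x)) = fv y - fv x"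
        by (simp add: algebra_simps)
      then show "fv (D\<^sub>1\<^sup>\<dagger> *\<^sub>v u + B\<^sub>1\<^sup>\<dagger> *\<^sub>v (Q *\<^sub>v \<eta>)) = fv (y - x)"
        using u x y \<eta> f\<eta> eta_eq(2)[OF b] by simp
    qed (use x y in simp)
    define g where "g = st C\<^sub>0 A\<^sub>0 u \<eta>"
    have g: "g \<in> ell2 m" unfolding g_def by (rule st_ell2(1)[OF dA0 C\<^sub>0c u \<eta>])
    have adjg: "coeff_adj p ?F g = st C\<^sub>1 A\<^sub>0 (y - x) \<eta>"
      unfolding g_def out[symmetric] coeff_adj_st[OF dA C B\<^sub>1 D\<^sub>1 dA0 C\<^sub>0c Q ric u \<eta>]
      by (subst C\<^sub>1) simp
    have Tg: "coeff_op m ?F (st C\<^sub>1 A\<^sub>0 (y - x) \<eta>) = coeff_op m ?F (embed p y)"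
    proof
      fix i
      show "coeff_op m ?F (st C\<^sub>1 A\<^sub>0 (y - x) \<eta>) i = coeff_op m ?F (embed p y) i"
      proof (rule eq_vecI)
        fix l assume "l < dim_vec (coeff_op m ?F (embed p y) i)"
        then have l: "l < m" by (simp add: coeff_op_def)
        show "coeff_op m ?F (st C\<^sub>1 A\<^sub>0 (y - x) \<eta>) i $ l = coeff_op m ?F (embed p y) i $ l"
        proof (cases i)
          case 0
          have "D\<^sub>1 *\<^sub>v (y - x) = D\<^sub>1 *\<^sub>v y - D\<^sub>1 *\<^sub>v x" by (rule fv_cancel) (use x y in \<open>simp_all add: right_diff_distrib\<close>)
          then have "(D\<^sub>1 *\<^sub>v (y - x)) $ l = (D\<^sub>1 *\<^sub>v y) $ l"
            unfolding Dx using l by (simp del: index_mult_mat_vec)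
          then show ?thesis using 0 l by (simp add: coeff_op_def embed_def del: index_mult_mat_vec)
        next
          case (Suc k)
          have pA: "dim_row (A ^\<^sub>m i) = n" "dim_col (A ^\<^sub>m i) = n" for i
            using pow_mat_carrier[OF A, of i] by auto
          have sp: "(\<Sum>j\<le>Suc k. f j) = f 0 + (\<Sum>j<k. f (Suc j)) + f (Suc k)" for f :: "nat \<Rightarrow> complex"
          proof -
            have "(\<Sum>j\<le>Suc k. f j) = (\<Sum>j<Suc k. f j) + f (Suc k)" by (simp add: lessThan_Suc_atMost)
            then show ?thesis by (simp only: sum.lessThan_Suc_shift)
          qed
          have as: "C * A ^\<^sub>m k * B\<^sub>1 *\<^sub>v w = C *\<^sub>v (A ^\<^sub>m k *\<^sub>v (B\<^sub>1 *\<^sub>v w))" if "w \<in> carrier_vec p" for w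
            by (rule fv_cancel) (use that in \<open>simp_all add: pA mult.assoc\<close>)
          have ydec: "C *\<^sub>v (A ^\<^sub>m k *\<^sub>v (B\<^sub>1 *\<^sub>v y)) = C *\<^sub>v (A ^\<^sub>m k *\<^sub>v (B\<^sub>1 *\<^sub>v x)) + C *\<^sub>v (A ^\<^sub>m k *\<^sub>v (B\<^sub>1 *\<^sub>v (y - x)))"
            by (rule fv_cancel) (use x y in \<open>simp_all add: pA algebra_simps\<close>)
          have yx: "y - x \<in> carrier_vec p" using x y by simp
          have lhs: "coeff_op m ?F (st C\<^sub>1 A\<^sub>0 (y - x) \<eta>) i $ l =
             (C *\<^sub>v (A ^\<^sub>m k *\<^sub>v (B\<^sub>1 *\<^sub>v (y - x)))) $ l
             + (\<Sum>j<k. (C * A ^\<^sub>m (k - Suc j) * B\<^sub>1 *\<^sub>v (C\<^sub>1 *\<^sub>v (A\<^sub>0 ^\<^sub>m j *\<^sub>v \<eta>))) $ l)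
             + (D\<^sub>1 *\<^sub>v (C\<^sub>1 *\<^sub>v (A\<^sub>0 ^\<^sub>m k *\<^sub>v \<eta>))) $ l"
          proof -
            have "(\<Sum>j<k. (?F (Suc k - Suc j) *\<^sub>v st C\<^sub>1 A\<^sub>0 (y - x) \<eta> (Suc j)) $ l)
              = (\<Sum>j<k. (C * A ^\<^sub>m (k - Suc j) * B\<^sub>1 *\<^sub>v (C\<^sub>1 *\<^sub>v (A\<^sub>0 ^\<^sub>m j *\<^sub>v \<eta>))) $ l)"
            proof (rule sum.cong[OF refl])
              fix j assume "j \<in> {..<k}"
              then have "Suc k - Suc j = Suc (k - Suc j)" by auto
              then show "(?F (Suc k - Suc j) *\<^sub>v st C\<^sub>1 A\<^sub>0 (y - x) \<eta> (Suc j)) $ l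
                = (C * A ^\<^sub>m (k - Suc j) * B\<^sub>1 *\<^sub>v (C\<^sub>1 *\<^sub>v (A\<^sub>0 ^\<^sub>m j *\<^sub>v \<eta>))) $ l"
                by (simp only: nat.case st_simps)
            qed
            then show ?thesis unfolding Suc coeff_op_def using l
              by (simp add: sp as[OF yx] del: index_mult_mat_vec sum.atMost_Suc diff_Suc_Suc)
          qed
          have rhs: "coeff_op m ?F (embed p y) i $ l = (C *\<^sub>v (A ^\<^sub>m k *\<^sub>v (B\<^sub>1 *\<^sub>v y))) $ l"
          proof -
            have z: "(?F \<nu> *\<^sub>v 0\<^sub>v p) $ l = 0" for \<nu>
              using l by (cases \<nu>) (simp_all add: pA del: index_mult_mat_vec)
            show ?thesis unfolding Suc coeff_op_def using l
              by (simp add: sp as[OF y] embed_def z del: index_mult_mat_vec sum.atMost_Suc)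
          qed
          show ?thesis unfolding lhs rhs ydec using output_sum[OF \<eta> l yx, of k] l unfolding T\<eta>
            by (simp add: pA add.commute del: index_mult_mat_vec)
        qed
      qed (simp add: coeff_op_def)
    qed
    let ?TT = "toeplitz_op m p G \<circ> toeplitz_adj m p G"
    have TT: "?TT h = coeff_op m ?F (coeff_adj p ?F h)" if "h \<in> ell2 m" for h
      by (simp add: toeplitz_op_coeff toeplitz_adj_coeff[OF F' that] Gc)
    \<comment> \<open>h is the preimage selected by the definition, g the explicit one; the adjoint
      maps both to the same sequence.\<close>
    define h where "h = inv_into (ell2 m) ?TT (toeplitz_op m p G (embed p y))"
    have "?TT g = coeff_op m ?F (coeff_adj p ?F g)" by (rule TT[OF g])
    also have "\<dots> = toeplitz_op m p G (embed p y)" unfolding adjg Tg toeplitz_op_coeff Gc ..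
    finally have TTg: "toeplitz_op m p G (embed p y) = ?TT g" by (rule sym)
    then have im: "toeplitz_op m p G (embed p y) \<in> ?TT ` ell2 m" using g by blast
    have h: "h \<in> ell2 m" unfolding h_def by (rule inv_into_into[OF im])
    have "?TT h = toeplitz_op m p G (embed p y)" unfolding h_def by (rule f_inv_into_f[OF im])
    also note TTg
    finally have eq: "coeff_op m ?F (coeff_adj p ?F h) = coeff_op m ?F (coeff_adj p ?F g)"
      unfolding TT[OF h] TT[OF g] .
    have "?Op y = embed_adj p (toeplitz_adj m p G h)" by (simp add: h_def)
    also have "\<dots> = coeff_adj p ?F h 0"
      unfolding toeplitz_adj_coeff[OF F' h] Gc by (rule embed_adj_eq[OF coeff_adj_ell2[OF F h]])
    also have "\<dots> = coeff_adj p ?F g 0" by (rule coeff_adj_cong_preimage[OF F h g eq])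
    also have "\<dots> = y - x" unfolding adjg by simp
    finally show ?thesis unfolding x_def .
  qed
  have \<Theta>\<Theta>: "\<Theta> * \<Theta>\<^sup>\<dagger> = Pr"
  proof (rule eq_matI)
    fix i j assume "i < dim_row Pr" "j < dim_col Pr"
    then have ij: "i < p" "j < p" by simp_all
    have "\<Theta> * \<Theta>\<^sup>\<dagger> = 1\<^sub>m p - matrix_of_op p ?Op" using lm unfolding left_minimal_rank_factor_def by simp
    then have "(\<Theta> * \<Theta>\<^sup>\<dagger>) $$ (i, j) = (1\<^sub>m p) $$ (i, j) - (unit_vec p j - Pr *\<^sub>v unit_vec p j) $ i"
      using ij key[of "unit_vec p j"] by (simp add: matrix_of_op_def del: o_apply)
    also have "\<dots> = Pr $$ (i, j)" using ij by (simp add: scalar_prod_right_unit[of j p])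
    finally show "(\<Theta> * \<Theta>\<^sup>\<dagger>) $$ (i, j) = Pr $$ (i, j)" .
  qed simp_all
  have f\<Theta>: "fm \<Theta> * adj (fm \<Theta>) = fm Pr" using arg_cong[OF \<Theta>\<Theta>, of fm] by simp
  show D\<Theta>: "D\<^sub>1 * \<Theta> = 0\<^sub>m m (p - m)"
  proof -
    \<comment> \<open>The squared norm of this matrix at y is the form of
      \<open>D\<^sub>1 * Pr * D\<^sub>1\<^sup>\<dagger>\<close>, which vanishes.\<close>
    have "\<Theta>\<^sup>\<dagger> * D\<^sub>1\<^sup>\<dagger> = 0\<^sub>m (p - m) m"
    proof (rule mat_eq_vecI[of _ "p - m" m])
      fix y :: "complex vec" assume y: "y \<in> carrier_vec m"
      let ?w = "\<Theta>\<^sup>\<dagger> * D\<^sub>1\<^sup>\<dagger> *\<^sub>v y"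
      have "cinner ?w ?w = ent (adj (fv y) * (fm D\<^sub>1 * (fm \<Theta> * adj (fm \<Theta>))) * (adj (fm D\<^sub>1) * fv y)) 0 0"
        using y by (simp add: cinner_fv mult.assoc)
      then have "(cnorm ?w)\<^sup>2 = 0" unfolding f\<Theta> DPr by (simp add: cnorm_sq)
      moreover have "?w \<in> carrier_vec (p - m)" by (auto intro!: carrier_vecI)
      ultimately have "?w = 0\<^sub>v (p - m)" using cnorm_eq_0_iff by auto
      then show "?w = 0\<^sub>m (p - m) m *\<^sub>v y" using y by (auto intro!: fv_cancel)
    qed (auto intro!: carrier_matI)
    from arg_cong[OF this, of fm] have "adj (fm \<Theta>) * adj (fm D\<^sub>1) = 0" by simp
    from arg_cong[OF this, of adj] show ?thesis by (intro fm_cancel) simp_all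
  qed
  show 3: "\<Theta> *\<^sub>v (\<Theta>\<^sup>\<dagger> *\<^sub>v (W *\<^sub>v x)) = x" if x: "x \<in> carrier_vec p" and z: "D\<^sub>1 *\<^sub>v x = 0\<^sub>v m" for x
  proof (rule fv_cancel)
    have "fv (D\<^sub>1 *\<^sub>v x) = 0" unfolding z by simp
    then have "fm D\<^sub>1 * fv x = 0" using x by simp
    moreover have "fm \<Theta> * adj (fm \<Theta>) * fm W * fv x = fv x - fm (minv W) * adj (fm D\<^sub>1) * fm (minv H) * (fm D\<^sub>1 * fv x)"
      unfolding f\<Theta> PrW left_diff_distrib using x by (simp add: mult.assoc)
    ultimately show "fv (\<Theta> *\<^sub>v (\<Theta>\<^sup>\<dagger> *\<^sub>v (W *\<^sub>v x))) = fv x" using x by (simp add: mult.assoc)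
  qed (use x in simp)
  show "\<Theta>\<^sup>\<dagger> * W * \<Theta> = 1\<^sub>m (p - m)"
  proof (rule mat_eq_vecI[of _ "p - m" "p - m"])
    fix a :: "complex vec" assume a: "a \<in> carrier_vec (p - m)"
    have ta: "\<Theta> *\<^sub>v a \<in> carrier_vec p" using Thc by auto
    have "fm D\<^sub>1 * fm \<Theta> = 0" using arg_cong[OF D\<Theta>, of fm] by simp
    then have "fm D\<^sub>1 * (fm \<Theta> * fv a) = 0" by (simp flip: mult.assoc)
    then have "D\<^sub>1 *\<^sub>v (\<Theta> *\<^sub>v a) = 0\<^sub>v m"
      by (intro fv_cancel) (use a in simp_all)
    from 3[OF ta this] have "\<Theta> *\<^sub>v (\<Theta>\<^sup>\<dagger> * W * \<Theta> *\<^sub>v a) = \<Theta> *\<^sub>v a"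
    proof -
      have "\<Theta>\<^sup>\<dagger> * W * \<Theta> *\<^sub>v a = \<Theta>\<^sup>\<dagger> *\<^sub>v (W *\<^sub>v (\<Theta> *\<^sub>v a))"
        by (rule fv_cancel) (use a in \<open>simp_all add: mult.assoc\<close>)
      with 3[OF ta \<open>D\<^sub>1 *\<^sub>v (\<Theta> *\<^sub>v a) = 0\<^sub>v m\<close>] show ?thesis by simp
    qed
    moreover have "\<Theta>\<^sup>\<dagger> * W * \<Theta> *\<^sub>v a \<in> carrier_vec (p - m)" by (rule carrier_vecI) simp
    ultimately have "\<Theta>\<^sup>\<dagger> * W * \<Theta> *\<^sub>v a = a" using inj_onD[OF inj] a by blast
    then show "\<Theta>\<^sup>\<dagger> * W * \<Theta> *\<^sub>v a = 1\<^sub>m (p - m) *\<^sub>v a" using a by simp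
  qed (auto intro!: carrier_matI)
qed

end

section \<open>Matrix Schur functions\<close>

definition mholo :: "complex set \<Rightarrow> nat \<Rightarrow> nat \<Rightarrow> (complex \<Rightarrow> complex mat) \<Rightarrow> bool" where
  "mholo S k r F \<longleftrightarrow> (\<forall>z\<in>S. F z \<in> carrier_mat k r) \<and> (\<forall>i<k. \<forall>j<r. (\<lambda>z. F z $$ (i, j)) holomorphic_on S)"

lemma mholoD: "mholo S k r F \<Longrightarrow> z \<in> S \<Longrightarrow> F z \<in> carrier_mat k r"
  "mholo S k r F \<Longrightarrow> i < k \<Longrightarrow> j < r \<Longrightarrow> (\<lambda>z. F z $$ (i, j)) holomorphic_on S"
  unfolding mholo_def by auto

lemma mholoI:
  assumes "\<And>z. z \<in> S \<Longrightarrow> F z \<in> carrier_mat k r"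
    and "\<And>i j. i < k \<Longrightarrow> j < r \<Longrightarrow> f i j holomorphic_on S"
    and "\<And>i j z. i < k \<Longrightarrow> j < r \<Longrightarrow> z \<in> S \<Longrightarrow> F z $$ (i, j) = f i j z"
  shows "mholo S k r F"
  unfolding mholo_def
proof (intro conjI ballI allI impI)
  fix i j assume ij: "i < k" "j < r"
  show "(\<lambda>z. F z $$ (i, j)) holomorphic_on S"
    using assms(2)[OF ij] by (rule holomorphic_transform) (simp add: assms(3)[OF ij])
qed (rule assms(1))

lemma mholo_subset: "mholo S k r F \<Longrightarrow> S' \<subseteq> S \<Longrightarrow> mholo S' k r F"
  unfolding mholo_def by (meson holomorphic_on_subset subsetD)

lemma mholo_cong: "mholo S k r F \<Longrightarrow> (\<And>z. z \<in> S \<Longrightarrow> F z = F' z) \<Longrightarrow> mholo S k r F'"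
  by (rule mholoI[where f = "\<lambda>i j z. F z $$ (i, j)"]) (auto simp: mholo_def)

lemma mholo_const: "M \<in> carrier_mat k r \<Longrightarrow> mholo S k r (\<lambda>_. M)"
  unfolding mholo_def by auto

lemma mholo_add:
  assumes "mholo S k r F" "mholo S k r H"
  shows "mholo S k r (\<lambda>z. F z + H z)"
proof (rule mholoI[where f = "\<lambda>i j z. F z $$ (i, j) + H z $$ (i, j)"])
  show "F z + H z \<in> carrier_mat k r" if "z \<in> S" for z
    using mholoD(1)[OF assms(2) that] by (rule add_carrier_mat)
  show "(\<lambda>z. F z $$ (i, j) + H z $$ (i, j)) holomorphic_on S" if "i < k" "j < r" for i j
    using mholoD(2)[OF assms(1) that] mholoD(2)[OF assms(2) that] by (rule holomorphic_on_add)
  show "(F z + H z) $$ (i, j) = F z $$ (i, j) + H z $$ (i, j)" if "i < k" "j < r" "z \<in> S" for i j z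
    using mholoD(1)[OF assms(2) that(3)] that by simp
qed

lemma mholo_diff:
  assumes "mholo S k r F" "mholo S k r H"
  shows "mholo S k r (\<lambda>z. F z - H z)"
proof (rule mholoI[where f = "\<lambda>i j z. F z $$ (i, j) - H z $$ (i, j)"])
  show "F z - H z \<in> carrier_mat k r" if "z \<in> S" for z
    using mholoD(1)[OF assms(2) that] by (rule minus_carrier_mat)
  show "(\<lambda>z. F z $$ (i, j) - H z $$ (i, j)) holomorphic_on S" if "i < k" "j < r" for i j
    using mholoD(2)[OF assms(1) that] mholoD(2)[OF assms(2) that] by (rule holomorphic_on_diff)
  show "(F z - H z) $$ (i, j) = F z $$ (i, j) - H z $$ (i, j)" if "i < k" "j < r" "z \<in> S" for i j z
    using mholoD(1)[OF assms(2) that(3)] that by simp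
qed

lemma mholo_smult:
  assumes "f holomorphic_on S" "mholo S k r F"
  shows "mholo S k r (\<lambda>z. f z \<cdot>\<^sub>m F z)"
proof (rule mholoI[where f = "\<lambda>i j z. f z * F z $$ (i, j)"])
  show "f z \<cdot>\<^sub>m F z \<in> carrier_mat k r" if "z \<in> S" for z
    using mholoD(1)[OF assms(2) that] by simp
  show "(\<lambda>z. f z * F z $$ (i, j)) holomorphic_on S" if "i < k" "j < r" for i j
    using assms(1) mholoD(2)[OF assms(2) that] by (rule holomorphic_on_mult)
  show "(f z \<cdot>\<^sub>m F z) $$ (i, j) = f z * F z $$ (i, j)" if "i < k" "j < r" "z \<in> S" for i j z
    using mholoD(1)[OF assms(2) that(3)] that by simp
qed

lemma mholo_uminus: "mholo S k r F \<Longrightarrow> mholo S k r (\<lambda>z. - F z)"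
  by (rule mholoI[where f = "\<lambda>i j z. - F z $$ (i, j)"])
     (auto intro!: holomorphic_on_minus simp: mholo_def uminus_carrier_iff_mat)

lemma mholo_mult:
  assumes "mholo S k s F" "mholo S s r H"
  shows "mholo S k r (\<lambda>z. F z * H z)"
proof (rule mholoI[where f = "\<lambda>i j z. \<Sum>l<s. F z $$ (i, l) * H z $$ (l, j)"])
  show "F z * H z \<in> carrier_mat k r" if "z \<in> S" for z
    using mholoD(1)[OF assms(1) that] mholoD(1)[OF assms(2) that] by (rule mult_carrier_mat)
  show "(\<lambda>z. \<Sum>l<s. F z $$ (i, l) * H z $$ (l, j)) holomorphic_on S" if "i < k" "j < r" for i j
    using that mholoD(2)[OF assms(1)] mholoD(2)[OF assms(2)]
    by (intro holomorphic_on_sum holomorphic_on_mult) auto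
  show "(F z * H z) $$ (i, j) = (\<Sum>l<s. F z $$ (i, l) * H z $$ (l, j))" if "i < k" "j < r" "z \<in> S" for i j z
    using mholoD(1)[OF assms(1) that(3)] mholoD(1)[OF assms(2) that(3)] that
    by (simp add: scalar_prod_def lessThan_atLeast0)
qed

section \<open>Holomorphic inverses and the maximum principle for matrix functions\<close>

lemma det_holomorphic:
  assumes F: "mholo S n n F"
  shows "(\<lambda>z. det (F z)) holomorphic_on S"
proof -
  have "(\<lambda>z. \<Sum>p\<in>{p. p permutes {0..<n}}. signof p * (\<Prod>i = 0..<n. F z $$ (i, p i))) holomorphic_on S"
  proof (intro holomorphic_on_sum holomorphic_on_mult holomorphic_on_const holomorphic_on_prod mholoD(2)[OF F])
    fix p i assume "p \<in> {p. p permutes {0..<n}}" "i \<in> {0..<n}"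
    then show "p i < n" using permutes_in_image[of p "{0..<n}" i] by auto
  qed auto
  then show ?thesis
    by (rule holomorphic_transform) (use det_def'[OF mholoD(1)[OF F]] in simp)
qed

lemma minv_adj_mat:
  assumes M: "M \<in> carrier_mat n n" and d: "det M \<noteq> 0"
  shows "minv M = (1 / det M) \<cdot>\<^sub>m adj_mat M"
proof (rule minv_eqI[OF M])
  note a = adj_mat[OF M]
  show "(1 / det M) \<cdot>\<^sub>m adj_mat M \<in> carrier_mat n n" using a(1) by simp
  have "(1 / det M) \<cdot>\<^sub>m adj_mat M * M = (1 / det M) \<cdot>\<^sub>m (adj_mat M * M)"
    using a(1) M by (intro mult_smult_assoc_mat)
  also have "\<dots> = 1\<^sub>m n" unfolding a(3) using d by (intro eq_matI) auto
  finally show "(1 / det M) \<cdot>\<^sub>m adj_mat M * M = 1\<^sub>m n" .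
qed

text \<open>By Cramer's rule the entries of the inverse are quotients of determinants.\<close>

lemma mholo_minv:
  assumes F: "mholo S n n F" and d: "\<And>z. z \<in> S \<Longrightarrow> det (F z) \<noteq> 0"
  shows "mholo S n n (\<lambda>z. minv (F z))"
proof (rule mholoI[where f = "\<lambda>i j z. 1 / det (F z) * ((-1) ^ (j + i) * det (mat_delete (F z) j i))"])
  show "minv (F z) \<in> carrier_mat n n" if z: "z \<in> S" for z
    using adj_mat(1)[OF mholoD(1)[OF F z]] unfolding minv_adj_mat[OF mholoD(1)[OF F z] d[OF z]] by simp
  show "minv (F z) $$ (i, j) = 1 / det (F z) * ((-1) ^ (j + i) * det (mat_delete (F z) j i))"
    if "i < n" "j < n" "z \<in> S" for i j z
    using that mholoD(1)[OF F that(3)] unfolding minv_adj_mat[OF mholoD(1)[OF F that(3)] d[OF that(3)]]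
    by (simp add: adj_mat_def cofactor_def)
  fix i j assume ij: "i < n" "j < n"
  have "mholo S (n - 1) (n - 1) (\<lambda>z. mat_delete (F z) j i)"
  proof (rule mholoI[where f = "\<lambda>a b z. F z $$ (if a < j then a else Suc a, if b < i then b else Suc b)"])
    show "mat_delete (F z) j i \<in> carrier_mat (n - 1) (n - 1)" if "z \<in> S" for z
      using mholoD(1)[OF F that] by (rule mat_delete_carrier)
    show "(\<lambda>z. F z $$ (if a < j then a else Suc a, if b < i then b else Suc b)) holomorphic_on S" if "a < n - 1" "b < n - 1" for a b
      using that ij by (intro mholoD(2)[OF F]) auto
    show "mat_delete (F z) j i $$ (a, b) = F z $$ (if a < j then a else Suc a, if b < i then b else Suc b)"
      if "a < n - 1" "b < n - 1" "z \<in> S" for a b z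
      using that mholoD(1)[OF F that(3)] by (simp add: mat_delete_def)
  qed
  from det_holomorphic[OF this] det_holomorphic[OF F] d
  show "(\<lambda>z. 1 / det (F z) * ((-1) ^ (j + i) * det (mat_delete (F z) j i))) holomorphic_on S"
    by (intro holomorphic_intros) auto
qed

lemma det_inj: "M \<in> carrier_mat n n \<Longrightarrow> det M \<noteq> 0 \<longleftrightarrow> (\<forall>x\<in>carrier_vec n. M *\<^sub>v x = 0\<^sub>v n \<longrightarrow> x = 0\<^sub>v n)" for M :: "complex mat"
  using det_0_iff_vec_prod_zero_field[of M n] by blast

lemma det_of_lower_bound:
  fixes M :: "complex mat"
  assumes M: "M \<in> carrier_mat n n" and c: "0 < c" and b: "\<And>x. x \<in> carrier_vec n \<Longrightarrow> c * cnorm x \<le> cnorm (M *\<^sub>v x)"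
  shows "det M \<noteq> 0"
proof (subst det_inj[OF M], intro ballI impI)
  fix x assume x: "x \<in> carrier_vec n" "M *\<^sub>v x = 0\<^sub>v n"
  have "c * cnorm x \<le> 0" using b[OF x(1)] unfolding x(2) by simp
  then have "cnorm x \<le> 0" using c by (simp add: mult_le_0_iff)
  then show "x = 0\<^sub>v n" using cnorm_eq_0_iff[OF x(1)] cnorm_ge0[of x] by linarith
qed

text \<open>The scalar maximum principle is applied to the pairing of F(w) x with the fixed vector y
  = F(z) x. At w = z it equals |y|^2, and one factor |y| cancels.\<close>

lemma mat_maximum_modulus:
  assumes F: "mholo S k r F" and S: "cball 0 s \<subseteq> S" and s: "0 < s"
    and b: "\<And>z x. cmod z = s \<Longrightarrow> x \<in> carrier_vec r \<Longrightarrow> cnorm (F z *\<^sub>v x) \<le> c * cnorm x"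
    and z: "cmod z \<le> s" and x: "x \<in> carrier_vec r"
  shows "cnorm (F z *\<^sub>v x) \<le> c * cnorm x"
proof -
  have zS: "w \<in> S" if "cmod w \<le> s" for w using S that by auto
  define y where "y = F z *\<^sub>v x"
  have y: "y \<in> carrier_vec k" unfolding y_def using mholoD(1)[OF F zS[OF z]] by auto
  have hol: "(\<lambda>w. \<Sum>i<k. (\<Sum>j<r. F w $$ (i, j) * x $ j) * cnj (y $ i)) holomorphic_on S"
    using mholoD(2)[OF F] by (intro holomorphic_on_sum holomorphic_on_mult holomorphic_on_const) auto
  have ip: "cinner (F w *\<^sub>v x) y = (\<Sum>i<k. (\<Sum>j<r. F w $$ (i, j) * x $ j) * cnj (y $ i))" if "cmod w \<le> s" for w
  proof -
    have Fw: "F w \<in> carrier_mat k r" by (rule mholoD(1)[OF F zS[OF that]])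
    then have "(F w *\<^sub>v x) $ i = (\<Sum>j<r. F w $$ (i, j) * x $ j)" if "i < k" for i
      using that x mult_mat_vec_index_sum[of i "F w" x] by simp
    then show ?thesis using y by (simp add: cinner_sum)
  qed
  have "cmod (cinner (F z *\<^sub>v x) y) \<le> c * cnorm x * cnorm y"
    unfolding ip[OF z]
  proof (rule maximum_modulus_frontier[where S = "cball 0 s" and \<xi> = z
      and f = "\<lambda>w. \<Sum>i<k. (\<Sum>j<r. F w $$ (i, j) * x $ j) * cnj (y $ i)"])
    show "(\<lambda>w. \<Sum>i<k. (\<Sum>j<r. F w $$ (i, j) * x $ j) * cnj (y $ i)) holomorphic_on interior (cball 0 s)"
      by (rule holomorphic_on_subset[OF hol order_trans[OF interior_subset S]])
    show "continuous_on (closure (cball 0 s)) (\<lambda>w. \<Sum>i<k. (\<Sum>j<r. F w $$ (i, j) * x $ j) * cnj (y $ i))"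
      using holomorphic_on_imp_continuous_on[OF holomorphic_on_subset[OF hol S]] by simp
    show "bounded (cball (0::complex) s)" by simp
    show "z \<in> cball 0 s" using z by simp
    fix w :: complex assume "w \<in> frontier (cball 0 s)"
    then have w: "cmod w = s" using s by (simp add: frontier_cball sphere_def)
    have "cmod (cinner (F w *\<^sub>v x) y) \<le> cnorm (F w *\<^sub>v x) * cnorm y"
      using mholoD(1)[OF F zS, of w] w y by (intro cauchy_schwarz) auto
    also have "\<dots> \<le> c * cnorm x * cnorm y" using b[OF w x] by (intro mult_right_mono) auto
    finally show "cmod (\<Sum>i<k. (\<Sum>j<r. F w $$ (i, j) * x $ j) * cnj (y $ i)) \<le> c * cnorm x * cnorm y"
      using ip[of w] w by simp
  qed
  then have le: "(cnorm y)\<^sup>2 \<le> c * cnorm x * cnorm y" unfolding y_def[symmetric] cinner_self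
    by (simp add: norm_power)
  have "0 \<le> c * cnorm x"
    using b[of "complex_of_real s" x] s x by (simp add: order_trans[OF cnorm_ge0])
  then show ?thesis unfolding y_def[symmetric]
    using le mult_right_le_imp_le[of "cnorm y" "cnorm y" "c * cnorm x"] cnorm_ge0[of y]
    by (cases "cnorm y = 0") (auto simp: power2_eq_square)
qed

text \<open>Contractivity is stated on vectors and values off the disc are free, unlike in
  \<open>Hinf\<close>; restriction to the disc leads from one to the other.\<close>

definition schur :: "nat \<Rightarrow> nat \<Rightarrow> (complex \<Rightarrow> complex mat) \<Rightarrow> bool" where
  "schur k r F \<longleftrightarrow> mholo \<D> k r F \<and> (\<forall>z\<in>\<D>. \<forall>x\<in>carrier_vec r. cnorm (F z *\<^sub>v x) \<le> cnorm x)"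

lemma opnorm_le_1_iff:
  assumes M: "M \<in> carrier_mat k r"
  shows "opnorm M \<le> 1 \<longleftrightarrow> (\<forall>x\<in>carrier_vec r. cnorm (M *\<^sub>v x) \<le> cnorm x)"
proof -
  obtain b where b: "0 \<le> b" "\<And>x. x \<in> carrier_vec r \<Longrightarrow> cnorm (M *\<^sub>v x) \<le> b * cnorm x"
    using mat_bounded[OF M] by metis
  let ?X = "{x \<in> carrier_vec (dim_col M). cnorm x \<le> 1}"
  have "cnorm (M *\<^sub>v x) \<le> b" if "x \<in> ?X" for x
  proof -
    have "cnorm (M *\<^sub>v x) \<le> b * cnorm x" using b(2) that M by auto
    also have "\<dots> \<le> b * 1" using that b(1) by (intro mult_left_mono) auto
    finally show ?thesis by simp
  qed
  then have bdd: "bdd_above ((\<lambda>x. cnorm (M *\<^sub>v x)) ` ?X)" by (auto intro!: bdd_aboveI)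
  have ne: "0\<^sub>v (dim_col M) \<in> ?X" by simp
  show ?thesis
  proof
    assume o: "opnorm M \<le> 1"
    show "\<forall>x\<in>carrier_vec r. cnorm (M *\<^sub>v x) \<le> cnorm x"
    proof
      fix x :: "complex vec" assume x: "x \<in> carrier_vec r"
      show "cnorm (M *\<^sub>v x) \<le> cnorm x"
      proof (cases "cnorm x = 0")
        case True
        then have "x = 0\<^sub>v r" using cnorm_eq_0_iff[OF x] by simp
        then show ?thesis using M by simp
      next
        case False
        then have px: "0 < cnorm x" using cnorm_ge0[of x] by linarith
        define y where "y = complex_of_real (1 / cnorm x) \<cdot>\<^sub>v x"
        have y: "y \<in> ?X" unfolding y_def using x M px by (auto simp: norm_divide)
        have "cnorm (M *\<^sub>v y) \<le> 1" using cSUP_upper[OF y bdd] o unfolding opnorm_def by simp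
        moreover have "M *\<^sub>v y = complex_of_real (1 / cnorm x) \<cdot>\<^sub>v (M *\<^sub>v x)"
          unfolding y_def by (rule fv_cancel) (use M x in simp_all)
        ultimately show ?thesis using px by (simp add: norm_divide field_simps)
      qed
    qed
  next
    assume a: "\<forall>x\<in>carrier_vec r. cnorm (M *\<^sub>v x) \<le> cnorm x"
    show "opnorm M \<le> 1" unfolding opnorm_def
    proof (rule cSUP_least)
      show "?X \<noteq> {}" using ne by blast
      fix x assume "x \<in> ?X"
      then show "cnorm (M *\<^sub>v x) \<le> 1" using a M by (auto intro: order_trans)
    qed
  qed
qed

lemma Hinf_schur:
  assumes "F \<in> Hinf k r" "hinf_norm F \<le> 1"
  shows "schur k r F"
proof -
  have c: "F z \<in> carrier_mat k r" if "z \<in> \<D>" for z using assms(1) that unfolding Hinf_def by auto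
  have h: "mholo \<D> k r F" using assms(1) c unfolding Hinf_def mholo_def by auto
  have "opnorm (F z) \<le> 1" if "z \<in> \<D>" for z
  proof -
    have "opnorm (F z) \<le> hinf_norm F" unfolding hinf_norm_def
      using assms(1) that unfolding Hinf_def by (intro cSUP_upper) auto
    then show ?thesis using assms(2) by simp
  qed
  with h c show ?thesis unfolding schur_def using opnorm_le_1_iff by blast
qed

lemma schur_Hinf:
  assumes F: "schur k r F" and e: "F \<in> extensional \<D>"
  shows "F \<in> Hinf k r" "hinf_norm F \<le> 1"
proof -
  have h: "mholo \<D> k r F" using F unfolding schur_def by simp
  have o: "opnorm (F z) \<le> 1" if "z \<in> \<D>" for z
    using F mholoD(1)[OF h that] that opnorm_le_1_iff unfolding schur_def by blast
  then have "bdd_above ((\<lambda>z. opnorm (F z)) ` \<D>)" by (auto intro!: bdd_aboveI)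
  then show "F \<in> Hinf k r" using h e unfolding Hinf_def mholo_def by (auto simp: PiE_def)
  show "hinf_norm F \<le> 1" unfolding hinf_norm_def by (rule cSUP_least) (use o in auto)
qed

section \<open>Linear fractional transformations with bounded coefficients\<close>

lemma smul_zero_left [simp]: "smul 0 a = 0"
  by (rule fm_eqI) simp

text \<open>What remains of the state space model once the state is eliminated: the energy
  inequality, its reverse with a defect of order 1 - |z|^2, and bounds uniform in z.
  \<open>low\<close> expresses that u can be recovered from the two outputs.\<close>

locale lft =
  fixes p q r :: nat and U\<^sub>1\<^sub>1 U\<^sub>1\<^sub>2 U\<^sub>2\<^sub>1 U\<^sub>2\<^sub>2 :: "complex \<Rightarrow> complex mat" and \<kappa> \<beta> \<gamma> :: real
  assumes h11: "mholo \<D> p r U\<^sub>1\<^sub>1" and h12: "mholo \<D> p q U\<^sub>1\<^sub>2"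
    and h21: "mholo \<D> q r U\<^sub>2\<^sub>1" and h22: "mholo \<D> q q U\<^sub>2\<^sub>2"
    and contr: "\<And>z u v. z \<in> \<D> \<Longrightarrow> u \<in> carrier_vec r \<Longrightarrow> v \<in> carrier_vec q \<Longrightarrow>
      (cnorm (U\<^sub>1\<^sub>1 z *\<^sub>v u + U\<^sub>1\<^sub>2 z *\<^sub>v v))\<^sup>2 - (cnorm (U\<^sub>2\<^sub>1 z *\<^sub>v u + U\<^sub>2\<^sub>2 z *\<^sub>v v))\<^sup>2 \<le> (cnorm u)\<^sup>2 - (cnorm v)\<^sup>2"
    and expan: "\<And>z u v. z \<in> \<D> \<Longrightarrow> u \<in> carrier_vec r \<Longrightarrow> v \<in> carrier_vec q \<Longrightarrow>
      (cnorm u)\<^sup>2 - (cnorm v)\<^sup>2 \<le> (cnorm (U\<^sub>1\<^sub>1 z *\<^sub>v u + U\<^sub>1\<^sub>2 z *\<^sub>v v))\<^sup>2 - (cnorm (U\<^sub>2\<^sub>1 z *\<^sub>v u + U\<^sub>2\<^sub>2 z *\<^sub>v v))\<^sup>2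
        + (1 - (cmod z)\<^sup>2) * (\<gamma> * ((cnorm (U\<^sub>1\<^sub>1 z *\<^sub>v u + U\<^sub>1\<^sub>2 z *\<^sub>v v))\<^sup>2 + (cnorm (U\<^sub>2\<^sub>1 z *\<^sub>v u + U\<^sub>2\<^sub>2 z *\<^sub>v v))\<^sup>2))"
    and low: "\<And>z u v. z \<in> \<D> \<Longrightarrow> u \<in> carrier_vec r \<Longrightarrow> v \<in> carrier_vec q \<Longrightarrow>
      (cnorm u)\<^sup>2 \<le> \<kappa>\<^sup>2 * ((cnorm (U\<^sub>1\<^sub>1 z *\<^sub>v u + U\<^sub>1\<^sub>2 z *\<^sub>v v))\<^sup>2 + (cnorm (U\<^sub>2\<^sub>1 z *\<^sub>v u + U\<^sub>2\<^sub>2 z *\<^sub>v v))\<^sup>2)"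
    and b21: "\<And>z u. z \<in> \<D> \<Longrightarrow> u \<in> carrier_vec r \<Longrightarrow> cnorm (U\<^sub>2\<^sub>1 z *\<^sub>v u) \<le> \<beta> * cnorm u"
    and b22: "\<And>z v. z \<in> \<D> \<Longrightarrow> v \<in> carrier_vec q \<Longrightarrow> cnorm (U\<^sub>2\<^sub>2 z *\<^sub>v v) \<le> \<beta> * cnorm v"
    and \<kappa>: "1 \<le> \<kappa>" and \<beta>: "1 \<le> \<beta>" and \<gamma>: "0 \<le> \<gamma>"
begin

definition "\<rho> = sqrt (1 - 1 / \<kappa>\<^sup>2)"

lemma \<rho>: "0 \<le> \<rho>" "\<rho> < 1" and \<rho>_sq: "\<rho>\<^sup>2 = 1 - 1 / \<kappa>\<^sup>2"
proof -
  have 1: "1 \<le> \<kappa>\<^sup>2" using \<kappa> by (simp add: one_le_power)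
  then have 2: "0 < \<kappa>\<^sup>2" by linarith
  have "1 / \<kappa>\<^sup>2 \<le> 1" "0 < 1 / \<kappa>\<^sup>2" using 1 2 by (simp_all only: divide_le_eq_1_pos zero_less_divide_1_iff)
  then have 3: "0 \<le> 1 - 1 / \<kappa>\<^sup>2" "1 - 1 / \<kappa>\<^sup>2 < 1" by linarith+
  then show "0 \<le> \<rho>" "\<rho> < 1" unfolding \<rho>_def by (simp_all only: real_sqrt_ge_zero real_sqrt_lt_1_iff)
  show "\<rho>\<^sup>2 = 1 - 1 / \<kappa>\<^sup>2" unfolding \<rho>_def by (rule real_sqrt_pow2[OF 3(1)])
qed

lemmas c11 = mholoD(1)[OF h11] and c12 = mholoD(1)[OF h12] and c21 = mholoD(1)[OF h21] and c22 = mholoD(1)[OF h22]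

text \<open>If the second output is zero, \<open>low\<close> bounds |u| by \<kappa> times the first
  output, and \<open>contr\<close> bounds the square of that output by |u|^2 - |v|^2; eliminating it
  gives \<rho>. Since v is then - U_22^{-1} U_21 u, the norm of U_22^{-1} U_21 is at most \<rho> < 1
  throughout the disc.\<close>

lemma kernel_bound:
  assumes z: "z \<in> \<D>" and u: "u \<in> carrier_vec r" and v: "v \<in> carrier_vec q"
    and k: "U\<^sub>2\<^sub>1 z *\<^sub>v u + U\<^sub>2\<^sub>2 z *\<^sub>v v = 0\<^sub>v q"
  shows "cnorm v \<le> \<rho> * cnorm u"
proof -
  let ?h = "(cnorm (U\<^sub>1\<^sub>1 z *\<^sub>v u + U\<^sub>1\<^sub>2 z *\<^sub>v v))\<^sup>2"
  have k2: "0 < \<kappa>\<^sup>2" using \<kappa> by simp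
  have "(cnorm u)\<^sup>2 \<le> \<kappa>\<^sup>2 * ?h" using low[OF z u v] unfolding k by simp
  then have "(cnorm u)\<^sup>2 / \<kappa>\<^sup>2 \<le> ?h" using k2 by (simp add: divide_le_eq mult.commute)
  moreover have "?h \<le> (cnorm u)\<^sup>2 - (cnorm v)\<^sup>2" using contr[OF z u v] unfolding k by simp
  ultimately have "(cnorm v)\<^sup>2 \<le> (1 - 1 / \<kappa>\<^sup>2) * (cnorm u)\<^sup>2" by (simp add: algebra_simps)
  also note \<rho>_sq[symmetric]
  finally have "(cnorm v)\<^sup>2 \<le> (\<rho> * cnorm u)\<^sup>2" by (simp add: power_mult_distrib)
  then show ?thesis by (rule power2_le_imp_le) (use \<rho>(1) in simp)
qed

text \<open>A vector x killed by the denominator satisfies |x| \<le> \<rho> |Y x| \<le> \<rho>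
  |x|.\<close>

lemma denominator:
  assumes Y: "schur r q Y" and z: "z \<in> \<D>"
  shows "U\<^sub>2\<^sub>2 z + U\<^sub>2\<^sub>1 z * Y z \<in> carrier_mat q q" "det (U\<^sub>2\<^sub>2 z + U\<^sub>2\<^sub>1 z * Y z) \<noteq> 0"
    "\<And>x. x \<in> carrier_vec q \<Longrightarrow> (U\<^sub>2\<^sub>2 z + U\<^sub>2\<^sub>1 z * Y z) *\<^sub>v x = U\<^sub>2\<^sub>1 z *\<^sub>v (Y z *\<^sub>v x) + U\<^sub>2\<^sub>2 z *\<^sub>v x"
    "\<And>x. x \<in> carrier_vec q \<Longrightarrow> (U\<^sub>1\<^sub>2 z + U\<^sub>1\<^sub>1 z * Y z) *\<^sub>v x = U\<^sub>1\<^sub>1 z *\<^sub>v (Y z *\<^sub>v x) + U\<^sub>1\<^sub>2 z *\<^sub>v x"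
proof -
  have Yc: "Y z \<in> carrier_mat r q" using Y z unfolding schur_def by (auto dest: mholoD)
  show 1: "U\<^sub>2\<^sub>2 z + U\<^sub>2\<^sub>1 z * Y z \<in> carrier_mat q q"
    by (rule add_carrier_mat[OF mult_carrier_mat[OF c21[OF z] Yc]])
  show 2: "(U\<^sub>2\<^sub>2 z + U\<^sub>2\<^sub>1 z * Y z) *\<^sub>v x = U\<^sub>2\<^sub>1 z *\<^sub>v (Y z *\<^sub>v x) + U\<^sub>2\<^sub>2 z *\<^sub>v x" if "x \<in> carrier_vec q" for x
    by (rule fv_cancel) (use c22[OF z] c21[OF z] Yc that in \<open>simp_all add: algebra_simps\<close>)
  show "(U\<^sub>1\<^sub>2 z + U\<^sub>1\<^sub>1 z * Y z) *\<^sub>v x = U\<^sub>1\<^sub>1 z *\<^sub>v (Y z *\<^sub>v x) + U\<^sub>1\<^sub>2 z *\<^sub>v x" if "x \<in> carrier_vec q" for x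
    by (rule fv_cancel) (use c12[OF z] c11[OF z] Yc that in \<open>simp_all add: algebra_simps\<close>)
  show "det (U\<^sub>2\<^sub>2 z + U\<^sub>2\<^sub>1 z * Y z) \<noteq> 0"
  proof (subst det_inj[OF 1], intro ballI impI)
    fix x assume x: "x \<in> carrier_vec q" "(U\<^sub>2\<^sub>2 z + U\<^sub>2\<^sub>1 z * Y z) *\<^sub>v x = 0\<^sub>v q"
    have yx: "Y z *\<^sub>v x \<in> carrier_vec r" using Yc by auto
    have "cnorm x \<le> \<rho> * cnorm (Y z *\<^sub>v x)"
      by (rule kernel_bound[OF z yx x(1)]) (use 2[OF x(1)] x(2) in simp)
    also have "\<dots> \<le> \<rho> * cnorm x" using Y z x(1) \<rho>(1) unfolding schur_def by (intro mult_left_mono) auto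
    finally have "(1 - \<rho>) * cnorm x \<le> 0" by (simp add: algebra_simps)
    then have "cnorm x \<le> 0" using \<rho>(2) by (simp add: mult_le_0_iff)
    then show "x = 0\<^sub>v q" using cnorm_eq_0_iff[OF x(1)] cnorm_ge0[of x] by linarith
  qed
qed

lemma lft_schur:
  assumes Y: "schur r q Y"
  shows "schur p q (\<lambda>z. (U\<^sub>1\<^sub>2 z + U\<^sub>1\<^sub>1 z * Y z) * minv (U\<^sub>2\<^sub>2 z + U\<^sub>2\<^sub>1 z * Y z))"
proof -
  have hY: "mholo \<D> r q Y" using Y unfolding schur_def by simp
  have m: "mholo \<D> q q (\<lambda>z. minv (U\<^sub>2\<^sub>2 z + U\<^sub>2\<^sub>1 z * Y z))"
    by (intro mholo_minv mholo_add mholo_mult[OF h21 hY] h22 denominator(2)[OF Y])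
  have n: "mholo \<D> p q (\<lambda>z. U\<^sub>1\<^sub>2 z + U\<^sub>1\<^sub>1 z * Y z)"
    by (intro mholo_add mholo_mult[OF h11 hY] h12)
  have "cnorm ((U\<^sub>1\<^sub>2 z + U\<^sub>1\<^sub>1 z * Y z) * minv (U\<^sub>2\<^sub>2 z + U\<^sub>2\<^sub>1 z * Y z) *\<^sub>v y) \<le> cnorm y"
    if z: "z \<in> \<D>" and y: "y \<in> carrier_vec q" for z y
  proof -
    let ?N = "U\<^sub>2\<^sub>2 z + U\<^sub>2\<^sub>1 z * Y z"
    note d = denominator[OF Y z]
    have inj: "\<forall>x\<in>carrier_vec q. ?N *\<^sub>v x = 0\<^sub>v q \<longrightarrow> x = 0\<^sub>v q" using det_inj[OF d(1)] d(2) by blast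
    define x where "x = minv ?N *\<^sub>v y"
    have x: "x \<in> carrier_vec q" unfolding x_def using mholoD(1)[OF m z] by auto
    have yx: "Y z *\<^sub>v x \<in> carrier_vec r" using mholoD(1)[OF hY z] by auto
    have Nx: "U\<^sub>2\<^sub>1 z *\<^sub>v (Y z *\<^sub>v x) + U\<^sub>2\<^sub>2 z *\<^sub>v x = y"
      using minv_solve(1)[OF d(1) inj y] d(3)[OF x] unfolding x_def by simp
    have eq: "(U\<^sub>1\<^sub>2 z + U\<^sub>1\<^sub>1 z * Y z) * minv ?N *\<^sub>v y = U\<^sub>1\<^sub>1 z *\<^sub>v (Y z *\<^sub>v x) + U\<^sub>1\<^sub>2 z *\<^sub>v x"
      using assoc_mult_mat_vec[OF mholoD(1)[OF n z] mholoD(1)[OF m z] y] d(4)[OF x] unfolding x_def by simp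
    have "(cnorm (U\<^sub>1\<^sub>1 z *\<^sub>v (Y z *\<^sub>v x) + U\<^sub>1\<^sub>2 z *\<^sub>v x))\<^sup>2 - (cnorm y)\<^sup>2 \<le> (cnorm (Y z *\<^sub>v x))\<^sup>2 - (cnorm x)\<^sup>2"
      using contr[OF z yx x] unfolding Nx .
    moreover have "(cnorm (Y z *\<^sub>v x))\<^sup>2 \<le> (cnorm x)\<^sup>2"
      using Y z x unfolding schur_def by (intro power_mono) auto
    ultimately have "(cnorm ((U\<^sub>1\<^sub>2 z + U\<^sub>1\<^sub>1 z * Y z) * minv ?N *\<^sub>v y))\<^sup>2 \<le> (cnorm y)\<^sup>2" unfolding eq by linarith
    then show ?thesis by (rule power2_le_imp_le) simp
  qed
  then show ?thesis unfolding schur_def using mholo_mult[OF n m] by blast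
qed

text \<open>On the circle \<open>cmod z = s\<close> with \<open>s\<close> close to \<open>1\<close> the matrices \<open>1 - t U\<^sub>2\<^sub>1 U\<close> are bounded below uniformly
  in \<open>0 \<le> t \<le> 1\<close>; by the maximum principle, applied to their inverses, the bound propagates into the disc
  when \<open>t\<close> moves from \<open>0\<close> to \<open>1\<close> in small steps. At \<open>t = 1\<close> the matrix is \<open>U\<^sub>2\<^sub>2 V\<close>.\<close>

lemma lft_onto:
  assumes X: "schur p q X" and hU: "mholo \<D> r q U" and hV: "mholo \<D> q q V"
    and XU: "\<And>z. z \<in> \<D> \<Longrightarrow> U\<^sub>1\<^sub>1 z * U z + U\<^sub>1\<^sub>2 z * V z = X z"
    and IU: "\<And>z. z \<in> \<D> \<Longrightarrow> U\<^sub>2\<^sub>1 z * U z + U\<^sub>2\<^sub>2 z * V z = 1\<^sub>m q"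
  shows "\<exists>Y. schur r q Y \<and> (\<forall>z\<in>\<D>. (U\<^sub>1\<^sub>2 z + U\<^sub>1\<^sub>1 z * Y z) * minv (U\<^sub>2\<^sub>2 z + U\<^sub>2\<^sub>1 z * Y z) = X z)"
proof -
  note cU = mholoD(1)[OF hU] and cV = mholoD(1)[OF hV]
  have Ux: "U z *\<^sub>v x \<in> carrier_vec r" and Vx: "V z *\<^sub>v x \<in> carrier_vec q" if "z \<in> \<D>" for z x
    using cU[OF that] cV[OF that] by auto
  have hX: "U\<^sub>1\<^sub>1 z *\<^sub>v (U z *\<^sub>v x) + U\<^sub>1\<^sub>2 z *\<^sub>v (V z *\<^sub>v x) = X z *\<^sub>v x" if z: "z \<in> \<D>" and x: "x \<in> carrier_vec q" for z x
    unfolding XU[OF z, symmetric] by (rule fv_cancel) (use c11[OF z] c12[OF z] cU[OF z] cV[OF z] x in \<open>simp_all add: algebra_simps\<close>)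
  have hI: "U\<^sub>2\<^sub>1 z *\<^sub>v (U z *\<^sub>v x) + U\<^sub>2\<^sub>2 z *\<^sub>v (V z *\<^sub>v x) = x" if z: "z \<in> \<D>" and x: "x \<in> carrier_vec q" for z x
  proof -
    have "U\<^sub>2\<^sub>1 z *\<^sub>v (U z *\<^sub>v x) + U\<^sub>2\<^sub>2 z *\<^sub>v (V z *\<^sub>v x) = 1\<^sub>m q *\<^sub>v x"
      unfolding IU[OF z, symmetric] by (rule fv_cancel) (use c21[OF z] c22[OF z] cU[OF z] cV[OF z] x in \<open>simp_all add: algebra_simps\<close>)
    then show ?thesis using x by simp
  qed
  have Xx: "(cnorm (X z *\<^sub>v x))\<^sup>2 \<le> (cnorm x)\<^sup>2" if "z \<in> \<D>" "x \<in> carrier_vec q" for z x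
    using X that unfolding schur_def by (intro power_mono) auto
  have Ub: "cnorm (U z *\<^sub>v x) \<le> 2 * \<kappa> * cnorm x" if z: "z \<in> \<D>" and x: "x \<in> carrier_vec q" for z x
  proof (rule power2_le_imp_le)
    have "(cnorm (U z *\<^sub>v x))\<^sup>2 \<le> \<kappa>\<^sup>2 * ((cnorm (X z *\<^sub>v x))\<^sup>2 + (cnorm x)\<^sup>2)"
      using low[OF z Ux[OF z] Vx[OF z], of x x] unfolding hX[OF z x] hI[OF z x] .
    also have "\<dots> \<le> \<kappa>\<^sup>2 * (4 * (cnorm x)\<^sup>2)" using Xx[OF z x] zero_le_power2[of "cnorm x"]
      by (intro mult_left_mono zero_le_power2) linarith
    finally show "(cnorm (U z *\<^sub>v x))\<^sup>2 \<le> (2 * \<kappa> * cnorm x)\<^sup>2" by (simp add: power_mult_distrib)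
  qed (use \<kappa> in simp)
  \<comment> \<open>The defect of the reverse energy inequality on the circle of radius s, for
    outputs X x and x with |X x| \<le> |x|; hence the factor 2.\<close>
  define \<delta> where "\<delta> s = 2 * (1 - s\<^sup>2) * \<gamma>" for s :: real
  have \<delta>0: "0 \<le> \<delta> s" if "0 \<le> s" "s < 1" for s
    unfolding \<delta>_def using that \<gamma> by (simp add: power_le_one)
  have UV: "(cnorm (U z *\<^sub>v x))\<^sup>2 \<le> (cnorm (V z *\<^sub>v x))\<^sup>2 + \<delta> (cmod z) * (cnorm x)\<^sup>2"
    if z: "z \<in> \<D>" and x: "x \<in> carrier_vec q" for z x
  proof -
    have "(cnorm (U z *\<^sub>v x))\<^sup>2 - (cnorm (V z *\<^sub>v x))\<^sup>2 \<le> (cnorm (X z *\<^sub>v x))\<^sup>2 - (cnorm x)\<^sup>2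
      + (1 - (cmod z)\<^sup>2) * (\<gamma> * ((cnorm (X z *\<^sub>v x))\<^sup>2 + (cnorm x)\<^sup>2))"
      using expan[OF z Ux[OF z] Vx[OF z], of x x] unfolding hX[OF z x] hI[OF z x] .
    also have "\<dots> \<le> 0 + (1 - (cmod z)\<^sup>2) * (\<gamma> * (2 * (cnorm x)\<^sup>2))"
    proof (intro add_mono mult_left_mono)
      show "0 \<le> 1 - (cmod z)\<^sup>2" using z by (simp add: power_le_one)
    qed (use Xx[OF z x] \<gamma> in linarith)+
    finally show ?thesis unfolding \<delta>_def by (simp add: algebra_simps)
  qed
  \<comment> \<open>The constant at which the estimate on circles arrives: |x| / 2 \<le> (1 +
    \<beta> / (1 - \<rho>)) |W x|.\<close>
  define c where "c = 1 / (2 * (1 + \<beta> / (1 - \<rho>)))"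
  have bp: "0 \<le> \<beta> / (1 - \<rho>)" using \<beta> \<rho> by simp
  have "0 < 1 / (2 * (1 + w)) \<and> 1 / (2 * (1 + w)) \<le> 1 / 2" if "0 \<le> w" for w :: real
    using that by (simp add: field_simps)
  from this[OF bp] have c: "0 < c" "c \<le> 1 / 2" unfolding c_def by auto
  define W where "W t z = 1\<^sub>m q - complex_of_real t \<cdot>\<^sub>m (U\<^sub>2\<^sub>1 z * U z)" for t z
  have hW: "mholo \<D> q q (W t)" for t
    unfolding W_def by (intro mholo_diff mholo_const mholo_smult mholo_mult[OF h21 hU]) auto
  note cW = mholoD(1)[OF hW]
  have Wx: "W t z *\<^sub>v x = x - complex_of_real t \<cdot>\<^sub>v (U\<^sub>2\<^sub>1 z *\<^sub>v (U z *\<^sub>v x))" if z: "z \<in> \<D>" and x: "x \<in> carrier_vec q" for t z x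
    unfolding W_def by (rule fv_cancel) (use c21[OF z] cU[OF z] x in \<open>simp_all add: left_diff_distrib mult.assoc\<close>)
  \<comment> \<open>Put y = W x and v = U_22^{-1} y. Then (1 - t) U x and V x - v form a pair with
    second output zero, so |V x| \<le> |y| + \<rho> |U x|. The energy inequality bounds |U x| by |V
    x| plus a small multiple of |x|, and \<rho> < 1 lets |U x| be absorbed. Finally |x| \<le> |y| +
    \<beta> |U x|; the smallness assumption is made so that the error costs at most |x| / 2.\<close>
  have lower: "c * cnorm x \<le> cnorm (W t z *\<^sub>v x)"
    if z: "z \<in> \<D>" and x: "x \<in> carrier_vec q" and t: "0 \<le> t" "t \<le> 1"
      and small: "sqrt (\<delta> (cmod z)) \<le> (1 - \<rho>) / (2 * \<beta>)" for z x t
  proof -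
    define y where "y = W t z *\<^sub>v x"
    have y: "y \<in> carrier_vec q" unfolding y_def using cW[OF z] by auto
    have inj22: "cnorm v \<le> cnorm (U\<^sub>2\<^sub>2 z *\<^sub>v v)" if v: "v \<in> carrier_vec q" for v
    proof -
      have e: "U\<^sub>2\<^sub>1 z *\<^sub>v 0\<^sub>v r + U\<^sub>2\<^sub>2 z *\<^sub>v v = U\<^sub>2\<^sub>2 z *\<^sub>v v"
        by (rule fv_cancel) (use c21[OF z] c22[OF z] v in simp_all)
      have "(cnorm v)\<^sup>2 \<le> (cnorm (U\<^sub>2\<^sub>2 z *\<^sub>v v))\<^sup>2"
        using contr[OF z zero_carrier_vec v] zero_le_power2[of "cnorm (U\<^sub>1\<^sub>1 z *\<^sub>v 0\<^sub>v r + U\<^sub>1\<^sub>2 z *\<^sub>v v)"]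
        unfolding e cnorm_zero zero_power2 by linarith
      then show ?thesis by (rule power2_le_imp_le) simp
    qed
    have "det (U\<^sub>2\<^sub>2 z) \<noteq> 0" by (rule det_of_lower_bound[OF c22[OF z], of 1]) (use inj22 in auto)
    then have i22: "\<forall>x\<in>carrier_vec q. U\<^sub>2\<^sub>2 z *\<^sub>v x = 0\<^sub>v q \<longrightarrow> x = 0\<^sub>v q" using det_inj[OF c22[OF z]] by blast
    define v where "v = minv (U\<^sub>2\<^sub>2 z) *\<^sub>v y"
    have v: "v \<in> carrier_vec q" "U\<^sub>2\<^sub>2 z *\<^sub>v v = y"
      unfolding v_def using minv_works(1)[OF c22[OF z] i22] minv_solve(1)[OF c22[OF z] i22 y] by auto
    define a where "a = cnorm (U z *\<^sub>v x)"
    have vy: "cnorm v \<le> cnorm y" using inj22[OF v(1)] v(2) by simp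
    have "cnorm (V z *\<^sub>v x - v) \<le> \<rho> * cnorm (complex_of_real (1 - t) \<cdot>\<^sub>v (U z *\<^sub>v x))"
    proof (rule kernel_bound[OF z])
      have "fv (U\<^sub>2\<^sub>2 z *\<^sub>v v) = fv x - smul (complex_of_real t) (fm (U\<^sub>2\<^sub>1 z) * (fm (U z) * fv x))"
        unfolding v(2) y_def Wx[OF z x] using c21[OF z] cU[OF z] x by simp
      then have e1: "fm (U\<^sub>2\<^sub>2 z) * fv v = fv x - smul (complex_of_real t) (fm (U\<^sub>2\<^sub>1 z) * (fm (U z) * fv x))"
        using c22[OF z] v(1) by simp
      have "fv (U\<^sub>2\<^sub>1 z *\<^sub>v (U z *\<^sub>v x) + U\<^sub>2\<^sub>2 z *\<^sub>v (V z *\<^sub>v x)) = fv x" unfolding hI[OF z x] ..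
      then have e2: "fm (U\<^sub>2\<^sub>2 z) * (fm (V z) * fv x) = fv x - fm (U\<^sub>2\<^sub>1 z) * (fm (U z) * fv x)"
        using c21[OF z] c22[OF z] cU[OF z] cV[OF z] x by (simp add: algebra_simps)
      have sm: "smul (1 - complex_of_real t) w = w - smul (complex_of_real t) w" for w
        by (rule fm_eqI) (simp add: algebra_simps)
      show "U\<^sub>2\<^sub>1 z *\<^sub>v (complex_of_real (1 - t) \<cdot>\<^sub>v (U z *\<^sub>v x)) + U\<^sub>2\<^sub>2 z *\<^sub>v (V z *\<^sub>v x - v) = 0\<^sub>v q"
        by (rule fv_cancel) (use c21[OF z] c22[OF z] cU[OF z] cV[OF z] x v(1) in \<open>simp_all add: right_diff_distrib e1 e2 sm\<close>)
    qed (use Ux[OF z] Vx[OF z] v(1) in auto)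
    also have "\<dots> \<le> \<rho> * a"
    proof (rule mult_left_mono[OF _ \<rho>(1)])
      have "cmod (complex_of_real (1 - t)) \<le> 1" unfolding norm_of_real using t by simp
      then show "cnorm (complex_of_real (1 - t) \<cdot>\<^sub>v (U z *\<^sub>v x)) \<le> a"
        unfolding a_def cnorm_smult by (intro mult_left_le_one_le) auto
    qed
    finally have d: "cnorm (V z *\<^sub>v x - v) \<le> \<rho> * a" .
    have e: "v + (V z *\<^sub>v x - v) = V z *\<^sub>v x" by (rule fv_cancel) (use cV[OF z] v(1) x in simp_all)
    have "cnorm (v + (V z *\<^sub>v x - v)) \<le> cnorm v + cnorm (V z *\<^sub>v x - v)"
      by (rule cnorm_triangle) simp
    then have "cnorm (V z *\<^sub>v x) \<le> cnorm v + cnorm (V z *\<^sub>v x - v)" unfolding e .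
    then have Vy: "cnorm (V z *\<^sub>v x) \<le> cnorm y + \<rho> * a" using d vy by linarith
    have z1: "0 \<le> cmod z" "cmod z < 1" using z by auto
    have "a \<le> sqrt ((cnorm y + \<rho> * a)\<^sup>2 + (sqrt (\<delta> (cmod z)) * cnorm x)\<^sup>2)"
    proof (rule real_le_rsqrt)
      have "a\<^sup>2 \<le> (cnorm (V z *\<^sub>v x))\<^sup>2 + \<delta> (cmod z) * (cnorm x)\<^sup>2" unfolding a_def by (rule UV[OF z x])
      also have "\<dots> \<le> (cnorm y + \<rho> * a)\<^sup>2 + (sqrt (\<delta> (cmod z)) * cnorm x)\<^sup>2"
        using Vy \<delta>0[OF z1] by (intro add_mono power_mono) (auto simp: power_mult_distrib)
      finally show "a\<^sup>2 \<le> (cnorm y + \<rho> * a)\<^sup>2 + (sqrt (\<delta> (cmod z)) * cnorm x)\<^sup>2" .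
    qed
    also have "\<dots> \<le> (cnorm y + \<rho> * a) + sqrt (\<delta> (cmod z)) * cnorm x"
      using \<rho>(1) \<delta>0[OF z1] by (intro sqrt_sum_squares_le_sum) (auto simp: a_def intro!: add_nonneg_nonneg mult_nonneg_nonneg)
    finally have 1: "(1 - \<rho>) * a \<le> cnorm y + sqrt (\<delta> (cmod z)) * cnorm x" by (simp add: algebra_simps)
    have "sqrt (\<delta> (cmod z)) * cnorm x \<le> (1 - \<rho>) / (2 * \<beta>) * cnorm x" using small by (intro mult_right_mono) auto
    with 1 have "(1 - \<rho>) * a \<le> cnorm y + (1 - \<rho>) / (2 * \<beta>) * cnorm x" by linarith
    then have "\<beta> / (1 - \<rho>) * ((1 - \<rho>) * a) \<le> \<beta> / (1 - \<rho>) * (cnorm y + (1 - \<rho>) / (2 * \<beta>) * cnorm x)"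
      using bp by (intro mult_left_mono)
    then have 2: "\<beta> * a \<le> \<beta> / (1 - \<rho>) * cnorm y + cnorm x / 2"
    proof -
      have r: "1 - \<rho> \<noteq> 0" "\<beta> \<noteq> 0" using \<rho>(2) \<beta> by auto
      have "\<beta> / (1 - \<rho>) * ((1 - \<rho>) * a) = \<beta> * a" "\<beta> / (1 - \<rho>) * ((1 - \<rho>) / (2 * \<beta>) * cnorm x) = cnorm x / 2"
        using r by (simp_all add: divide_simps)
      with \<open>\<beta> / (1 - \<rho>) * ((1 - \<rho>) * a) \<le> _\<close> show ?thesis unfolding distrib_left by linarith
    qed
    have e: "y + complex_of_real t \<cdot>\<^sub>v (U\<^sub>2\<^sub>1 z *\<^sub>v (U z *\<^sub>v x)) = x"
      unfolding y_def Wx[OF z x] by (rule fv_cancel) (use c21[OF z] x in simp_all)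
    have "cnorm (y + complex_of_real t \<cdot>\<^sub>v (U\<^sub>2\<^sub>1 z *\<^sub>v (U z *\<^sub>v x))) \<le> cnorm y + cnorm (complex_of_real t \<cdot>\<^sub>v (U\<^sub>2\<^sub>1 z *\<^sub>v (U z *\<^sub>v x)))"
      by (rule cnorm_triangle) (use c21[OF z] y in simp)
    then have "cnorm x \<le> cnorm y + t * cnorm (U\<^sub>2\<^sub>1 z *\<^sub>v (U z *\<^sub>v x))"
      unfolding e using t by simp
    also have "\<dots> \<le> cnorm y + 1 * (\<beta> * a)"
      unfolding a_def using t b21[OF z Ux[OF z]] by (intro add_left_mono mult_mono) auto
    finally have "cnorm x / 2 \<le> (1 + \<beta> / (1 - \<rho>)) * cnorm y" using 2 unfolding distrib_right by linarith
    then have "cnorm x \<le> 2 * ((1 + \<beta> / (1 - \<rho>)) * cnorm y)" by linarith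
    then have "cnorm x \<le> (2 * (1 + \<beta> / (1 - \<rho>))) * cnorm y" by (simp only: mult.assoc)
    moreover have "1 / w * X \<le> Y" if "0 < w" "X \<le> w * Y" for w X Y :: real
      using that by (simp add: divide_le_eq mult.commute)
    moreover have "0 < 2 * (1 + \<beta> / (1 - \<rho>))"
      using bp by (intro mult_pos_pos add_pos_nonneg) simp_all
    ultimately show ?thesis unfolding y_def[symmetric] c_def by blast
  qed
  \<comment> \<open>A step of length 1 / N in t moves W by at most 2 \<kappa> \<beta> / N in norm,
    which is kept below c. N does not depend on the radius s.\<close>
  obtain N\<^sub>0 :: nat where N\<^sub>0: "2 * \<kappa> * \<beta> / c < real N\<^sub>0" using reals_Archimedean2 by blast
  obtain N :: nat where N: "0 < N" "2 * \<kappa> * \<beta> / c < real N"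
    using that[of "Suc N\<^sub>0"] N\<^sub>0 by simp
  \<comment> \<open>Each step loses part of the constant c inside the disc but keeps W invertible;
    the maximum principle for the inverse then restores the full c from the circle. Thus the
    constant does not deteriorate over the N steps.\<close>
  have propagate: "\<forall>z (x::complex vec). cmod z \<le> s \<longrightarrow> x \<in> carrier_vec q \<longrightarrow> c * cnorm x \<le> cnorm (W (real k / real N) z *\<^sub>v x)"
    if s: "0 < s" "s < 1" and small: "sqrt (\<delta> s) \<le> (1 - \<rho>) / (2 * \<beta>)" and k: "k \<le> N" for s k
    using k
  proof (induction k)
    case 0
    show ?case
    proof (intro allI impI)
      fix z :: complex and x :: "complex vec" assume z: "cmod z \<le> s" and x: "x \<in> carrier_vec q"
      then have zD: "z \<in> \<D>" using s by simp
      have "W (real 0 / real N) z *\<^sub>v x = x"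
        unfolding Wx[OF zD x] by (rule fv_cancel) (use x c21[OF zD] in simp_all)
      moreover have "c * cnorm x \<le> 1 * cnorm x" using c by (intro mult_right_mono) auto
      ultimately show "c * cnorm x \<le> cnorm (W (real 0 / real N) z *\<^sub>v x)" by simp
    qed
  next
    case (Suc k)
    let ?t' = "real k / real N" and ?t = "real (Suc k) / real N"
    define c' where "c' = c - 2 * \<kappa> * \<beta> / real N"
    have c': "0 < c'" unfolding c'_def using N c by (simp add: field_simps)
    have weak: "c' * cnorm x \<le> cnorm (W ?t z *\<^sub>v x)" if z: "cmod z \<le> s" and x: "x \<in> carrier_vec q" for z x
    proof -
      have zD: "z \<in> \<D>" using z s by simp
      have "W ?t' z *\<^sub>v x = W ?t z *\<^sub>v x + complex_of_real (1 / real N) \<cdot>\<^sub>v (U\<^sub>2\<^sub>1 z *\<^sub>v (U z *\<^sub>v x))"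
      proof -
        have "?t' = ?t - 1 / real N" by (simp add: add_divide_distrib)
        then have "smul (complex_of_real ?t') w = smul (complex_of_real ?t) w - smul (complex_of_real (1 / real N)) w" for w
          by (intro fm_eqI) (simp only: ent_smul ent_minus of_real_diff left_diff_distrib)
        then show ?thesis unfolding Wx[OF zD x]
          by (intro fv_cancel) (use x c21[OF zD] in \<open>simp_all del: of_real_divide of_nat_Suc of_real_of_nat_eq\<close>)
      qed
      then have "cnorm (W ?t' z *\<^sub>v x) \<le> cnorm (W ?t z *\<^sub>v x) + 1 / real N * cnorm (U\<^sub>2\<^sub>1 z *\<^sub>v (U z *\<^sub>v x))"
        using cnorm_triangle[of "W ?t z *\<^sub>v x" "complex_of_real (1 / real N) \<cdot>\<^sub>v (U\<^sub>2\<^sub>1 z *\<^sub>v (U z *\<^sub>v x))"] c21[OF zD] cW[OF zD, of ?t]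
        by (simp add: norm_divide)
      also have "\<dots> \<le> cnorm (W ?t z *\<^sub>v x) + 1 / real N * (\<beta> * (2 * \<kappa> * cnorm x))"
        using Ub[OF zD x] \<beta> by (intro add_left_mono mult_left_mono order_trans[OF b21[OF zD Ux[OF zD]]]) auto
      finally have "cnorm (W ?t' z *\<^sub>v x) \<le> cnorm (W ?t z *\<^sub>v x) + 2 * \<kappa> * \<beta> / real N * cnorm x" by (simp add: mult_ac)
      moreover have "c * cnorm x \<le> cnorm (W ?t' z *\<^sub>v x)" using Suc z x by simp
      ultimately show ?thesis unfolding c'_def left_diff_distrib by linarith
    qed
    define S where "S = {z \<in> \<D>. det (W ?t z) \<noteq> 0}"
    have Ssub: "S \<subseteq> \<D>" unfolding S_def by auto
    have hm: "mholo S q q (\<lambda>z. minv (W ?t z))"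
      by (rule mholo_minv[OF mholo_subset[OF hW Ssub]]) (simp add: S_def)
    have wS: "z \<in> S" if "cmod z \<le> s" for z
    proof -
      have zD: "z \<in> \<D>" using that s by simp
      have "det (W ?t z) \<noteq> 0" by (rule det_of_lower_bound[OF cW[OF zD] c']) (rule weak[OF that])
      then show ?thesis unfolding S_def using zD by simp
    qed
    show ?case
    proof (intro allI impI)
      fix z :: complex and x :: "complex vec" assume z: "cmod z \<le> s" and x: "x \<in> carrier_vec q"
      have inv: "W ?t w *\<^sub>v (minv (W ?t w) *\<^sub>v y) = y" "minv (W ?t w) *\<^sub>v (W ?t w *\<^sub>v y) = y"
        if w: "cmod w \<le> s" and y: "y \<in> carrier_vec q" for w y
      proof -
        have wD: "w \<in> \<D>" using w s by simp
        have "\<forall>x\<in>carrier_vec q. W ?t w *\<^sub>v x = 0\<^sub>v q \<longrightarrow> x = 0\<^sub>v q"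
          using det_inj[OF cW[OF wD]] wS[OF w] unfolding S_def by blast
        from minv_solve[OF cW[OF wD] this y]
        show "W ?t w *\<^sub>v (minv (W ?t w) *\<^sub>v y) = y" "minv (W ?t w) *\<^sub>v (W ?t w *\<^sub>v y) = y" .
      qed
      have "cnorm (minv (W ?t z) *\<^sub>v (W ?t z *\<^sub>v x)) \<le> (1 / c) * cnorm (W ?t z *\<^sub>v x)"
      proof (rule mat_maximum_modulus[OF hm _ s(1) _ z])
        show "cball 0 s \<subseteq> S" using wS by auto
        fix w :: complex and y :: "complex vec" assume w: "cmod w = s" and y: "y \<in> carrier_vec q"
        have wD: "w \<in> \<D>" using w s by simp
        have my: "minv (W ?t w) *\<^sub>v y \<in> carrier_vec q" using mholoD(1)[OF hm wS] w by auto
        have "c * cnorm (minv (W ?t w) *\<^sub>v y) \<le> cnorm (W ?t w *\<^sub>v (minv (W ?t w) *\<^sub>v y))"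
          by (rule lower[OF wD my]) (use small w Suc.prems N in \<open>auto simp: divide_le_eq simp del: of_nat_Suc\<close>)
        also have "\<dots> = cnorm y" using inv(1)[OF _ y] w by simp
        finally show "cnorm (minv (W ?t w) *\<^sub>v y) \<le> (1 / c) * cnorm y" using c by (simp add: field_simps)
      next
        show "W ?t z *\<^sub>v x \<in> carrier_vec q" using cW[of z ?t] z s by auto
      qed
      then show "c * cnorm x \<le> cnorm (W ?t z *\<^sub>v x)" unfolding inv(2)[OF z x] using c by (simp add: field_simps)
    qed
  qed
  \<comment> \<open>At t = 1 the bound is for U_22 V, and U_22 is at most \<beta>.\<close>
  have lowV: "c / \<beta> * cnorm x \<le> cnorm (V z *\<^sub>v x)"
    if s: "0 < s" "s < 1" and small: "sqrt (\<delta> s) \<le> (1 - \<rho>) / (2 * \<beta>)" and z: "cmod z \<le> s" and x: "x \<in> carrier_vec q" for s z x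
  proof -
    have zD: "z \<in> \<D>" using z s by simp
    have e: "W (real N / real N) z *\<^sub>v x = U\<^sub>2\<^sub>2 z *\<^sub>v (V z *\<^sub>v x)"
    proof (rule fv_cancel)
      have "fv (U\<^sub>2\<^sub>1 z *\<^sub>v (U z *\<^sub>v x) + U\<^sub>2\<^sub>2 z *\<^sub>v (V z *\<^sub>v x)) = fv x" unfolding hI[OF zD x] ..
      then have "fv x - fv (U\<^sub>2\<^sub>1 z *\<^sub>v (U z *\<^sub>v x)) = fv (U\<^sub>2\<^sub>2 z *\<^sub>v (V z *\<^sub>v x))"
        using c21[OF zD] c22[OF zD] by (simp add: algebra_simps del: fv_mult)
      then show "fv (W (real N / real N) z *\<^sub>v x) = fv (U\<^sub>2\<^sub>2 z *\<^sub>v (V z *\<^sub>v x))"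
        unfolding Wx[OF zD x] using N(1) c21[OF zD] x by (simp del: fv_mult)
    qed (simp only: dim_mult_mat_vec carrier_matD(1)[OF cW[OF zD]] carrier_matD(1)[OF c22[OF zD]])
    have "c * cnorm x \<le> cnorm (W (real N / real N) z *\<^sub>v x)" using propagate[OF s small order_refl] z x by blast
    then have "c * cnorm x \<le> \<beta> * cnorm (V z *\<^sub>v x)" unfolding e using b22[OF zD Vx[OF zD], of x] by linarith
    then show ?thesis using \<beta> by (simp add: divide_le_eq mult.commute)
  qed
  have \<delta>lim: "(\<delta> \<longlongrightarrow> 0) (at_left 1)"
  proof -
    have "(\<delta> \<longlongrightarrow> 2 * (1 - 1\<^sup>2) * \<gamma>) (at_left 1)" unfolding \<delta>_def by (intro tendsto_intros)
    then show ?thesis by simp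
  qed
  have small_ev: "\<forall>\<^sub>F s in at_left 1. sqrt (\<delta> s) \<le> (1 - \<rho>) / (2 * \<beta>)"
  proof -
    have "((\<lambda>s. sqrt (\<delta> s)) \<longlongrightarrow> sqrt 0) (at_left 1)" by (intro tendsto_intros \<delta>lim)
    moreover have "sqrt 0 < (1 - \<rho>) / (2 * \<beta>)" using \<rho>(2) \<beta> by simp
    ultimately have "\<forall>\<^sub>F s in at_left 1. sqrt (\<delta> s) < (1 - \<rho>) / (2 * \<beta>)" by (rule order_tendstoD)
    then show ?thesis by (rule eventually_mono) simp
  qed
  have good_ev: "\<forall>\<^sub>F s in at_left 1. 0 < s \<and> s < 1 \<and> cmod z < s \<and> sqrt (\<delta> s) \<le> (1 - \<rho>) / (2 * \<beta>)" if z: "z \<in> \<D>" for z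
  proof -
    have m: "max 0 (cmod z) < 1" using z by simp
    have "\<forall>\<^sub>F s in at_left 1. s \<in> {max 0 (cmod z)<..<1}" by (rule eventually_at_left_real[OF m])
    with small_ev show ?thesis
    proof eventually_elim
      case (elim s)
      then show ?case using order_le_less_trans[OF norm_ge_zero[of z], of s] by auto
    qed
  qed
  have detV: "det (V z) \<noteq> 0" if z: "z \<in> \<D>" for z
  proof -
    obtain s where s: "0 < s" "s < 1" "cmod z < s" "sqrt (\<delta> s) \<le> (1 - \<rho>) / (2 * \<beta>)"
      using eventually_happens'[OF _ good_ev[OF z]] by auto
    show ?thesis
      by (rule det_of_lower_bound[OF cV[OF z], of "c / \<beta>"]) (use c \<beta> lowV[OF s(1,2,4)] s(3) in auto)
  qed
  define Y where "Y z = U z * minv (V z)" for z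
  have hm: "mholo \<D> q q (\<lambda>z. minv (V z))" by (rule mholo_minv[OF hV detV])
  have hY: "mholo \<D> r q Y" unfolding Y_def by (rule mholo_mult[OF hU hm])
  have injV: "\<forall>x\<in>carrier_vec q. V z *\<^sub>v x = 0\<^sub>v q \<longrightarrow> x = 0\<^sub>v q" if z: "z \<in> \<D>" for z
    using det_inj[OF cV[OF z]] detV[OF z] by blast
  \<comment> \<open>The square of the bound for the inverse of V.\<close>
  define E where "E = (\<beta> / c)\<^sup>2"
  have Ybound: "cnorm (Y z *\<^sub>v y) \<le> sqrt (1 + \<delta> s * E) * cnorm y"
    if s: "0 < s" "s < 1" and small: "sqrt (\<delta> s) \<le> (1 - \<rho>) / (2 * \<beta>)" and z: "cmod z \<le> s" and y: "y \<in> carrier_vec q" for s z y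
  proof (rule mat_maximum_modulus[OF hY _ s(1) _ z y])
    show "cball 0 s \<subseteq> \<D>" using s by auto
    fix w :: complex and y :: "complex vec" assume w: "cmod w = s" and y: "y \<in> carrier_vec q"
    have wD: "w \<in> \<D>" using w s by simp
    define x where "x = minv (V w) *\<^sub>v y"
    have x: "x \<in> carrier_vec q" unfolding x_def using mholoD(1)[OF hm wD] by auto
    have Vxy: "V w *\<^sub>v x = y" unfolding x_def by (rule minv_solve(1)[OF cV[OF wD] injV[OF wD] y])
    have Yy: "Y w *\<^sub>v y = U w *\<^sub>v x" unfolding Y_def x_def
      by (rule assoc_mult_mat_vec[OF cU[OF wD] mholoD(1)[OF hm wD] y])
    have "cnorm x \<le> \<beta> / c * cnorm y"
      using lowV[OF s small, of w x] w x c \<beta> unfolding Vxy by (simp add: field_simps)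
    then have "(cnorm x)\<^sup>2 \<le> (\<beta> / c * cnorm y)\<^sup>2" by (rule power_mono) simp
    then have "(cnorm x)\<^sup>2 \<le> E * (cnorm y)\<^sup>2" unfolding E_def power_mult_distrib .
    then have "\<delta> s * (cnorm x)\<^sup>2 \<le> \<delta> s * (E * (cnorm y)\<^sup>2)" using \<delta>0 s by (intro mult_left_mono) auto
    then have "(cnorm (U w *\<^sub>v x))\<^sup>2 \<le> (cnorm y)\<^sup>2 + \<delta> s * (E * (cnorm y)\<^sup>2)"
      using UV[OF wD x] unfolding Vxy w by linarith
    also have "\<dots> = (1 + \<delta> s * E) * (cnorm y)\<^sup>2" by (simp add: algebra_simps)
    also have "\<dots> = (sqrt (1 + \<delta> s * E) * cnorm y)\<^sup>2"
    proof -
      have "0 \<le> 1 + \<delta> s * E"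
        unfolding E_def using \<delta>0[of s] s by (intro add_nonneg_nonneg mult_nonneg_nonneg) auto
      then show ?thesis by (simp add: power_mult_distrib)
    qed
    finally show "cnorm (Y w *\<^sub>v y) \<le> sqrt (1 + \<delta> s * E) * cnorm y"
      unfolding Yy by (rule power2_le_imp_le) (use \<delta>0[of s] s in \<open>auto simp: E_def\<close>)
  qed
  have "cnorm (Y z *\<^sub>v y) \<le> cnorm y" if z: "z \<in> \<D>" and y: "y \<in> carrier_vec q" for z y
  proof -
    \<comment> \<open>For fixed z the bound from the circle of radius s holds for all s close to 1;
      as s tends to 1 the defect disappears.\<close>
    have "((\<lambda>s. sqrt (1 + \<delta> s * E) * cnorm y) \<longlongrightarrow> sqrt (1 + 0 * E) * cnorm y) (at_left 1)"
      by (intro tendsto_intros \<delta>lim)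
    moreover have "\<forall>\<^sub>F s in at_left 1. cnorm (Y z *\<^sub>v y) \<le> sqrt (1 + \<delta> s * E) * cnorm y"
      using good_ev[OF z]
    proof eventually_elim
      case (elim s)
      then show ?case by (intro Ybound y) auto
    qed
    ultimately have "cnorm (Y z *\<^sub>v y) \<le> sqrt (1 + 0 * E) * cnorm y"
      by (rule tendsto_lowerbound) simp
    then show ?thesis by simp
  qed
  then have Ys: "schur r q Y" unfolding schur_def using hY by blast
  have "(U\<^sub>1\<^sub>2 z + U\<^sub>1\<^sub>1 z * Y z) * minv (U\<^sub>2\<^sub>2 z + U\<^sub>2\<^sub>1 z * Y z) = X z" if z: "z \<in> \<D>" for z
  proof -
    note cm = mholoD(1)[OF hm z] and cY = mholoD(1)[OF hY z] and cx = c11[OF z] c12[OF z] c21[OF z] c22[OF z] cU[OF z] cV[OF z]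
    have YV: "fm (Y z) * fm (V z) = fm (U z)"
      unfolding Y_def using cU[OF z] cm cV[OF z] minv_fm(2)[OF cV[OF z] injV[OF z]] by (simp add: mult.assoc)
    have 1: "(U\<^sub>2\<^sub>2 z + U\<^sub>2\<^sub>1 z * Y z) * V z = 1\<^sub>m q"
      unfolding IU[OF z, symmetric] by (rule fm_cancel) (use cx cY YV in \<open>simp_all add: algebra_simps\<close>)
    have 2: "(U\<^sub>1\<^sub>2 z + U\<^sub>1\<^sub>1 z * Y z) * V z = X z"
      unfolding XU[OF z, symmetric] by (rule fm_cancel) (use cx cY YV in \<open>simp_all add: algebra_simps\<close>)
    have "V z * (U\<^sub>2\<^sub>2 z + U\<^sub>2\<^sub>1 z * Y z) = 1\<^sub>m q"
      by (rule mat_mult_left_right_inverse[OF denominator(1)[OF Ys z] cV[OF z] 1])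
    from minv_eqI[OF denominator(1)[OF Ys z] cV[OF z] this] 2 show ?thesis by simp
  qed
  with Ys show ?thesis by blast
qed

end

section \<open>The coefficients of the parametrization\<close>

text \<open>\<open>W\<^sub>0\<close> is the weight \<open>W\<close> of the problem for G alone.
  \<open>\<Delta>\<^sub>1\<close> stands here in the form that the energy balance produces; it
  agrees with the original one because the identity of order p - m is
  \<open>\<Theta>\<^sup>\<dagger> * W\<^sub>0 * \<Theta>\<close>.\<close>

locale leech = riccati_pos +
  fixes \<Theta> W\<^sub>0 B\<^sub>0 \<Delta>\<^sub>0 \<Delta>\<^sub>1 :: "complex mat"
  assumes \<Theta>c: "\<Theta> \<in> carrier_mat p (p - m)" and D\<Theta>: "D\<^sub>1 * \<Theta> = 0\<^sub>m m (p - m)"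
    and W\<^sub>0c: "W\<^sub>0 \<in> carrier_mat p p" and W\<Theta>: "\<Theta>\<^sup>\<dagger> * W\<^sub>0 * \<Theta> = 1\<^sub>m (p - m)"
    and \<Theta>proj: "\<And>x. x \<in> carrier_vec p \<Longrightarrow> D\<^sub>1 *\<^sub>v x = 0\<^sub>v m \<Longrightarrow> \<Theta> *\<^sub>v (\<Theta>\<^sup>\<dagger> *\<^sub>v (W\<^sub>0 *\<^sub>v x)) = x"
    and B\<^sub>0: "B\<^sub>0 = B\<^sub>2 - \<Gamma> * minv \<Delta> * (D\<^sub>2 - \<Gamma>\<^sup>\<dagger> * Q * B\<^sub>2) + A\<^sub>0 * Om * C\<^sub>2\<^sup>\<dagger>"
    and \<Delta>\<^sub>0: "\<Delta>\<^sub>0 = pos_sqrt_mat (1\<^sub>m q + C\<^sub>2 * Om * C\<^sub>2\<^sup>\<dagger>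
      + (D\<^sub>2 - \<Gamma>\<^sup>\<dagger> * Q * B\<^sub>2)\<^sup>\<dagger> * minv \<Delta> * (D\<^sub>2 - \<Gamma>\<^sup>\<dagger> * Q * B\<^sub>2) + B\<^sub>2\<^sup>\<dagger> * Q * B\<^sub>2)"
    and \<Delta>\<^sub>1: "\<Delta>\<^sub>1 = pos_sqrt_mat (\<Theta>\<^sup>\<dagger> * \<Theta> + \<Theta>\<^sup>\<dagger> * B\<^sub>1\<^sup>\<dagger> * Z * B\<^sub>1 * \<Theta>)"
begin

text \<open>\<open>X\<^sub>0\<close> is \<Upsilon>_12 at 0 times \<Delta>_0, \<open>\<eta>\<close>
  is, up to sign, the input matrix for u before normalization, and \<open>N\<^sub>0\<close>,
  \<open>N\<^sub>1\<close> are the matrices under the square roots \<Delta>_0 and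
  \<Delta>_1.\<close>

definition "E = D\<^sub>2 - \<Gamma>\<^sup>\<dagger> * Q * B\<^sub>2"
definition "M = minv \<Delta> * E"
definition "X\<^sub>0 = D\<^sub>1\<^sup>\<dagger> * minv \<Delta> * E + D\<^sub>1\<^sup>\<dagger> * C\<^sub>0 * Om * C\<^sub>2\<^sup>\<dagger> + B\<^sub>1\<^sup>\<dagger> * Q * B\<^sub>0"
definition "L = C\<^sub>2 * Om * C\<^sub>2\<^sup>\<dagger> + E\<^sup>\<dagger> * minv \<Delta> * E + B\<^sub>2\<^sup>\<dagger> * Q * B\<^sub>2"
definition "\<eta> = minv Q * (Z * (B\<^sub>1 * \<Theta>))"
definition "N\<^sub>0 = 1\<^sub>m q + L"
definition "N\<^sub>1 = \<Theta>\<^sup>\<dagger> * \<Theta> + \<Theta>\<^sup>\<dagger> * B\<^sub>1\<^sup>\<dagger> * Z * B\<^sub>1 * \<Theta>"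

lemmas dims\<Theta> [simp] = \<Theta>c[THEN carrier_matD(1)] \<Theta>c[THEN carrier_matD(2)] W\<^sub>0c[THEN carrier_matD(1)] W\<^sub>0c[THEN carrier_matD(2)]

lemma dimsE [simp]: "dim_row E = m" "dim_col E = q" "dim_row M = m" "dim_col M = q" "dim_row B\<^sub>0 = n" "dim_col B\<^sub>0 = q"
  "dim_row X\<^sub>0 = p" "dim_col X\<^sub>0 = q" "dim_row L = q" "dim_col L = q" "dim_row \<eta> = n" "dim_col \<eta> = p - m"
  "dim_row N\<^sub>0 = q" "dim_col N\<^sub>0 = q" "dim_row N\<^sub>1 = p - m" "dim_col N\<^sub>1 = p - m"
proof -
  show 1: "dim_row E = m" "dim_col E = q" unfolding E_def by simp_all
  show "dim_row M = m" "dim_col M = q" unfolding M_def using 1 by simp_all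
  show 2: "dim_row B\<^sub>0 = n" "dim_col B\<^sub>0 = q" by (subst B\<^sub>0, simp)+
  show "dim_row X\<^sub>0 = p" "dim_col X\<^sub>0 = q" unfolding X\<^sub>0_def using 1 2 by simp_all
  show 3: "dim_row L = q" "dim_col L = q" unfolding L_def using 1 by simp_all
  show "dim_row \<eta> = n" "dim_col \<eta> = p - m" unfolding \<eta>_def by simp_all
  show "dim_row N\<^sub>0 = q" "dim_col N\<^sub>0 = q" unfolding N\<^sub>0_def using 3 by simp_all
  show "dim_row N\<^sub>1 = p - m" "dim_col N\<^sub>1 = p - m" unfolding N\<^sub>1_def by simp_all
qed

lemma carrE: "B\<^sub>0 \<in> carrier_mat n q" "X\<^sub>0 \<in> carrier_mat p q" "L \<in> carrier_mat q q" "\<eta> \<in> carrier_mat n (p - m)"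
  "N\<^sub>0 \<in> carrier_mat q q" "N\<^sub>1 \<in> carrier_mat (p - m) (p - m)" "M \<in> carrier_mat m q"
  by (rule carrier_matI, simp, simp)+

sublocale FL: fm_leech "fm A" "fm B\<^sub>1" "fm B\<^sub>2" "fm C" "fm D\<^sub>1" "fm D\<^sub>2" "fm P" "fm Q" "fm R" "fm \<Gamma>" "fm C\<^sub>0" "fm A\<^sub>0" "fm C\<^sub>1" "fm C\<^sub>2"
  "fm Om" "fm M" "fm B\<^sub>0" "fm X\<^sub>0" "fm L" "fm \<Theta>" "fm \<eta>" "fm Z"
proof
  have fE: "fm E = fm D\<^sub>2 - adj (fm \<Gamma>) * fm Q * fm B\<^sub>2" unfolding E_def by simp
  have fM: "fm M = fm (minv \<Delta>) * fm E" unfolding M_def by simp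
  show "fm Om - fm P * fm Q * fm Om = fm P" "adj (fm Om) = fm Om" by (rule Om_eq)+
  have "fm \<Delta> * fm M = fm E" unfolding fM mult.assoc[symmetric] \<Delta>fm(1) by simp
  then show "(fm R - adj (fm \<Gamma>) * fm Q * fm \<Gamma>) * fm M = fm D\<^sub>2 - adj (fm \<Gamma>) * fm Q * fm B\<^sub>2"
    unfolding f\<Delta> fE .
  show "fm B\<^sub>0 = fm B\<^sub>2 - fm \<Gamma> * fm M + fm A\<^sub>0 * fm Om * adj (fm C\<^sub>2)"
    by (subst B\<^sub>0) (simp add: fM mult.assoc flip: E_def)
  show "fm X\<^sub>0 = adj (fm D\<^sub>1) * fm M + adj (fm D\<^sub>1) * fm C\<^sub>0 * fm Om * adj (fm C\<^sub>2) + adj (fm B\<^sub>1) * fm Q * fm B\<^sub>0"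
    unfolding X\<^sub>0_def by (simp add: fM mult.assoc)
  show "fm L = fm C\<^sub>2 * fm Om * adj (fm C\<^sub>2) + adj (fm D\<^sub>2 - adj (fm \<Gamma>) * fm Q * fm B\<^sub>2) * fm M + adj (fm B\<^sub>2) * fm Q * fm B\<^sub>2"
    unfolding L_def fE[symmetric] by (simp add: fM mult.assoc)
  show "fm D\<^sub>1 * fm \<Theta> = 0" using arg_cong[OF D\<Theta>, of fm] by simp
  have f\<eta>: "fm \<eta> = fm (minv Q) * (fm Z * (fm B\<^sub>1 * fm \<Theta>))" unfolding \<eta>_def by simp
  have b: "fm (1\<^sub>m n) * (fm B\<^sub>1 * fm \<Theta>) = fm B\<^sub>1 * fm \<Theta>" by (rule fm_one_left_assoc) simp
  show "fm \<eta> - fm P * fm Q * fm \<eta> = fm B\<^sub>1 * fm \<Theta>" unfolding f\<eta> by (rule eta_eq(1)[OF b])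
  show "adj (fm Z) = fm Z" by (rule fhZ)
  show "fm Q * fm \<eta> = fm Z * fm B\<^sub>1 * fm \<Theta>" unfolding f\<eta> eta_eq(2)[OF b] by (simp add: mult.assoc)
qed

text \<open>The test sequence with c = N v and state B_0 v has first adjoint entries X_0 v and L v.
  By \<open>X_X\<close> the estimate \<open>pos_form\<close> then says that L is positive
  semidefinite, so \<open>N\<^sub>0\<close> is at least the identity.\<close>

lemma N\<^sub>0_pd: "positive_definite_mat N\<^sub>0"
proof (rule positive_definite_matI[OF carrE(5)])
  show "N\<^sub>0\<^sup>\<dagger> = N\<^sub>0" by (rule fm_cancel) (simp_all add: N\<^sub>0_def FL.hL)
  fix v :: "complex vec" assume v: "v \<in> carrier_vec q" "v \<noteq> 0\<^sub>v q"
  define c where "c = M *\<^sub>v v + C\<^sub>0 *\<^sub>v (Om *\<^sub>v (C\<^sub>2\<^sup>\<dagger> *\<^sub>v v))"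
  define x where "x = B\<^sub>0 *\<^sub>v v"
  have c: "c \<in> carrier_vec m" and x: "x \<in> carrier_vec n"
    unfolding c_def x_def by (rule carrier_vecI, simp)+
  have fc: "fv c = FL.N * fv v" unfolding c_def FL.N_def using v by (simp add: algebra_simps)
  have 1: "D\<^sub>1\<^sup>\<dagger> *\<^sub>v c + B\<^sub>1\<^sup>\<dagger> *\<^sub>v (Q *\<^sub>v x) = X\<^sub>0 *\<^sub>v v"
    by (rule fv_cancel) (use v c x in \<open>simp_all add: fc FL.X\<^sub>0' distrib_right mult.assoc\<close>, simp add: x_def)
  have 2: "D\<^sub>2\<^sup>\<dagger> *\<^sub>v c + B\<^sub>2\<^sup>\<dagger> *\<^sub>v (Q *\<^sub>v x) = L *\<^sub>v v"
    by (rule fv_cancel) (use v c x in \<open>simp_all add: fc FL.L' distrib_right mult.assoc\<close>, simp add: x_def)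
  obtain b \<rho> where d: "decay n A\<^sub>0 b \<rho>" using stable_decay[OF A\<^sub>0c A\<^sub>0_stable] by blast
  have "0 \<le> (\<Sum>i. (cnorm (C\<^sub>0 *\<^sub>v (A\<^sub>0 ^\<^sub>m i *\<^sub>v x)))\<^sup>2)"
    by (intro suminf_nonneg st_ell2(2)[OF d C\<^sub>0c zero_carrier_vec x]) auto
  then have "0 \<le> e * ((cnorm c)\<^sup>2 + (\<Sum>i. (cnorm (C\<^sub>0 *\<^sub>v (A\<^sub>0 ^\<^sub>m i *\<^sub>v x)))\<^sup>2))" using e by simp
  with pos_form[OF c x] have p: "0 \<le> (cnorm (X\<^sub>0 *\<^sub>v v))\<^sup>2 - (cnorm (L *\<^sub>v v))\<^sup>2 + Re (cinner (K *\<^sub>v x) x)"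
    unfolding 1 2 by linarith
  have "Re (ent (adj (fv v) * (adj (fm X\<^sub>0) * fm X\<^sub>0 - fm L * fm L) * fv v) 0 0)
    = Re (ent (adj (fv v) * (fm L - adj (fm B\<^sub>0) * (fm Q - fm Q * fm P * fm Q) * fm B\<^sub>0) * fv v) 0 0)"
    unfolding FL.X_X ..
  then have "(cnorm (X\<^sub>0 *\<^sub>v v))\<^sup>2 - (cnorm (L *\<^sub>v v))\<^sup>2 + Re (cinner (K *\<^sub>v x) x) = Re (cinner (L *\<^sub>v v) v)"
    unfolding cnorm_sq x_def using v by (simp add: cinner_fv fK FL.hL algebra_simps)
  moreover have "Re (cinner (N\<^sub>0 *\<^sub>v v) v) = (cnorm v)\<^sup>2 + Re (cinner (L *\<^sub>v v) v)"
    unfolding cnorm_sq N\<^sub>0_def using v by (simp add: cinner_fv algebra_simps)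
  moreover have "0 < (cnorm v)\<^sup>2" using cnorm_eq_0_iff[OF v(1)] v(2) by simp
  ultimately show "0 < Re (cinner (N\<^sub>0 *\<^sub>v v) v)" using p by linarith
qed

lemma W\<Theta>_apply: "a \<in> carrier_vec (p - m) \<Longrightarrow> \<Theta>\<^sup>\<dagger> *\<^sub>v (W\<^sub>0 *\<^sub>v (\<Theta> *\<^sub>v a)) = a"
proof (rule fv_cancel)
  assume a: "a \<in> carrier_vec (p - m)"
  have "adj (fm \<Theta>) * fm W\<^sub>0 * fm \<Theta> = fm (1\<^sub>m (p - m))" using arg_cong[OF W\<Theta>, of fm] by simp
  then have "adj (fm \<Theta>) * fm W\<^sub>0 * fm \<Theta> * fv a = fv a" using a by simp
  then show "fv (\<Theta>\<^sup>\<dagger> *\<^sub>v (W\<^sub>0 *\<^sub>v (\<Theta> *\<^sub>v a))) = fv a" using a by (simp add: mult.assoc)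
qed simp

text \<open>Both summands are nonnegative, and the first is definite because
  \<open>\<Theta>\<^sup>\<dagger> * W\<^sub>0\<close> is a left inverse of \<Theta>.\<close>

lemma N\<^sub>1_pd: "positive_definite_mat N\<^sub>1"
proof (rule positive_definite_matI[OF carrE(6)])
  show "N\<^sub>1\<^sup>\<dagger> = N\<^sub>1" by (rule fm_cancel) (simp_all add: N\<^sub>1_def fhZ mult.assoc)
  fix a :: "complex vec" assume a: "a \<in> carrier_vec (p - m)" "a \<noteq> 0\<^sub>v (p - m)"
  have ta: "\<Theta> *\<^sub>v a \<in> carrier_vec p" "B\<^sub>1 *\<^sub>v (\<Theta> *\<^sub>v a) \<in> carrier_vec n" by (rule carrier_vecI, simp)+
  have "Re (cinner (N\<^sub>1 *\<^sub>v a) a) = (cnorm (\<Theta> *\<^sub>v a))\<^sup>2 + Re (cinner (Z *\<^sub>v (B\<^sub>1 *\<^sub>v (\<Theta> *\<^sub>v a))) (B\<^sub>1 *\<^sub>v (\<Theta> *\<^sub>v a)))"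
    unfolding cnorm_sq N\<^sub>1_def using a by (simp add: cinner_fv algebra_simps)
  moreover have "0 \<le> Re (cinner (Z *\<^sub>v (B\<^sub>1 *\<^sub>v (\<Theta> *\<^sub>v a))) (B\<^sub>1 *\<^sub>v (\<Theta> *\<^sub>v a)))"
    by (rule positive_definite_matD(3)[OF Zc Z_pd ta(2)])
  moreover have "\<Theta> *\<^sub>v a \<noteq> 0\<^sub>v p"
  proof
    assume "\<Theta> *\<^sub>v a = 0\<^sub>v p"
    with W\<Theta>_apply[OF a(1)] have "a = 0\<^sub>v (p - m)" by simp
    with a(2) show False by simp
  qed
  then have "0 < (cnorm (\<Theta> *\<^sub>v a))\<^sup>2" using cnorm_eq_0_iff[OF ta(1)] by simp
  ultimately show "0 < Re (cinner (N\<^sub>1 *\<^sub>v a) a)" by linarith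
qed

lemma \<Delta>\<^sub>0_sqrt: "\<Delta>\<^sub>0 = pos_sqrt_mat N\<^sub>0"
proof -
  have "1\<^sub>m q + C\<^sub>2 * Om * C\<^sub>2\<^sup>\<dagger> + E\<^sup>\<dagger> * minv \<Delta> * E + B\<^sub>2\<^sup>\<dagger> * Q * B\<^sub>2 = N\<^sub>0"
    unfolding N\<^sub>0_def L_def by (rule fm_cancel) (simp_all add: add.assoc)
  then show ?thesis unfolding \<Delta>\<^sub>0 E_def by simp
qed

lemmas \<Delta>\<^sub>0_props = pos_sqrt_mat[OF carrE(5) N\<^sub>0_pd, folded \<Delta>\<^sub>0_sqrt]
lemmas \<Delta>\<^sub>1_props = pos_sqrt_mat[OF carrE(6) N\<^sub>1_pd, folded \<Delta>\<^sub>1[folded N\<^sub>1_def]]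
lemmas \<Delta>\<^sub>0_inj = positive_definite_matD(4)[OF \<Delta>\<^sub>0_props(1,2)]
lemmas \<Delta>\<^sub>1_inj = positive_definite_matD(4)[OF \<Delta>\<^sub>1_props(1,2)]
lemmas \<Delta>\<^sub>0i = minv_works(1)[OF \<Delta>\<^sub>0_props(1) \<Delta>\<^sub>0_inj]
lemmas \<Delta>\<^sub>1i = minv_works(1)[OF \<Delta>\<^sub>1_props(1) \<Delta>\<^sub>1_inj]
lemmas dims\<Delta> [simp] = \<Delta>\<^sub>0_props(1)[THEN carrier_matD(1)] \<Delta>\<^sub>0_props(1)[THEN carrier_matD(2)]
  \<Delta>\<^sub>1_props(1)[THEN carrier_matD(1)] \<Delta>\<^sub>1_props(1)[THEN carrier_matD(2)]
  \<Delta>\<^sub>0i[THEN carrier_matD(1)] \<Delta>\<^sub>0i[THEN carrier_matD(2)] \<Delta>\<^sub>1i[THEN carrier_matD(1)] \<Delta>\<^sub>1i[THEN carrier_matD(2)]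
lemmas \<Delta>\<^sub>0fm = minv_fm[OF \<Delta>\<^sub>0_props(1) \<Delta>\<^sub>0_inj]
lemmas \<Delta>\<^sub>1fm = minv_fm[OF \<Delta>\<^sub>1_props(1) \<Delta>\<^sub>1_inj]

lemma f\<Delta>\<^sub>0: "fm \<Delta>\<^sub>0 * fm \<Delta>\<^sub>0 = fm (1\<^sub>m q) + fm L" "adj (fm \<Delta>\<^sub>0) = fm \<Delta>\<^sub>0"
  using arg_cong[OF \<Delta>\<^sub>0_props(3), of fm] arg_cong[OF positive_definite_matD(1)[OF \<Delta>\<^sub>0_props(1,2)], of fm]
  by (simp_all add: N\<^sub>0_def)

lemma f\<Delta>\<^sub>1: "fm \<Delta>\<^sub>1 * fm \<Delta>\<^sub>1 = adj (fm \<Theta>) * fm \<Theta> + adj (fm \<Theta>) * adj (fm B\<^sub>1) * fm Z * fm B\<^sub>1 * fm \<Theta>" "adj (fm \<Delta>\<^sub>1) = fm \<Delta>\<^sub>1"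
  using arg_cong[OF \<Delta>\<^sub>1_props(3), of fm] arg_cong[OF positive_definite_matD(1)[OF \<Delta>\<^sub>1_props(1,2)], of fm]
  by (simp_all add: N\<^sub>1_def)

definition "U\<^sub>1\<^sub>1 z = \<Theta> * minv \<Delta>\<^sub>1 - z \<cdot>\<^sub>m (C\<^sub>1 * minv (1\<^sub>m n - z \<cdot>\<^sub>m A\<^sub>0) * minv Q * Z * B\<^sub>1 * \<Theta> * minv \<Delta>\<^sub>1)"
definition "U\<^sub>2\<^sub>1 z = - (z \<cdot>\<^sub>m (C\<^sub>2 * minv (1\<^sub>m n - z \<cdot>\<^sub>m A\<^sub>0) * minv Q * Z * B\<^sub>1 * \<Theta> * minv \<Delta>\<^sub>1))"
definition "U\<^sub>1\<^sub>2 z = X\<^sub>0 * minv \<Delta>\<^sub>0 + z \<cdot>\<^sub>m (C\<^sub>1 * minv (1\<^sub>m n - z \<cdot>\<^sub>m A\<^sub>0) * B\<^sub>0 * minv \<Delta>\<^sub>0)"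
definition "U\<^sub>2\<^sub>2 z = \<Delta>\<^sub>0 + z \<cdot>\<^sub>m (C\<^sub>2 * minv (1\<^sub>m n - z \<cdot>\<^sub>m A\<^sub>0) * B\<^sub>0 * minv \<Delta>\<^sub>0)"

lemma resolvent:
  assumes X: "X \<in> carrier_mat n n" "stable_mat X" and z: "z \<in> \<D>"
  shows "\<forall>x\<in>carrier_vec n. (1\<^sub>m n - z \<cdot>\<^sub>m X) *\<^sub>v x = 0\<^sub>v n \<longrightarrow> x = 0\<^sub>v n"
    "minv (1\<^sub>m n - z \<cdot>\<^sub>m X) \<in> carrier_mat n n"
proof -
  obtain c \<rho> where d: "decay n X c \<rho>" using stable_decay[OF X] by blast
  show 1: "\<forall>x\<in>carrier_vec n. (1\<^sub>m n - z \<cdot>\<^sub>m X) *\<^sub>v x = 0\<^sub>v n \<longrightarrow> x = 0\<^sub>v n"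
    by (rule resolvent_inj[OF d]) (use z in simp)
  show "minv (1\<^sub>m n - z \<cdot>\<^sub>m X) \<in> carrier_mat n n" by (rule minv_works(1)[OF resolvent_carrier[OF X(1)] 1])
qed

lemma mholo_resolvent:
  assumes X: "X \<in> carrier_mat n n" "stable_mat X"
  shows "mholo \<D> n n (\<lambda>z. minv (1\<^sub>m n - z \<cdot>\<^sub>m X))"
proof (rule mholo_minv)
  show "mholo \<D> n n (\<lambda>z. 1\<^sub>m n - z \<cdot>\<^sub>m X)"
    using X by (intro mholo_diff mholo_const mholo_smult holomorphic_on_ident) auto
  show "det (1\<^sub>m n - z \<cdot>\<^sub>m X) \<noteq> 0" if "z \<in> \<D>" for z
    using det_inj[OF resolvent_carrier[OF X(1)]] resolvent(1)[OF X that] by blast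
qed

lemma resolvent_solve:
  assumes X: "X \<in> carrier_mat n n" "stable_mat X" and z: "z \<in> \<D>" and y: "y \<in> carrier_vec n"
  shows "fm (minv (1\<^sub>m n - z \<cdot>\<^sub>m X)) * (fv y - smul z (fm X * fv y)) = fv y"
    "fm (minv (1\<^sub>m n - z \<cdot>\<^sub>m X)) * fv y - smul z (fm X * (fm (minv (1\<^sub>m n - z \<cdot>\<^sub>m X)) * fv y)) = fv y"
proof -
  have Xd: "dim_row X = n" "dim_col X = n" using X by auto
  note m = resolvent_carrier[OF X(1)] and r = resolvent[OF X z]
  have rd: "dim_row (minv (1\<^sub>m n - z \<cdot>\<^sub>m X)) = n" "dim_col (minv (1\<^sub>m n - z \<cdot>\<^sub>m X)) = n" using r(2) by auto
  have "fv (minv (1\<^sub>m n - z \<cdot>\<^sub>m X) *\<^sub>v ((1\<^sub>m n - z \<cdot>\<^sub>m X) *\<^sub>v y)) = fv y"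
    unfolding minv_solve(2)[OF m r(1) y] ..
  then show "fm (minv (1\<^sub>m n - z \<cdot>\<^sub>m X)) * (fv y - smul z (fm X * fv y)) = fv y"
    using y by (simp add: Xd rd left_diff_distrib)
  have "fv ((1\<^sub>m n - z \<cdot>\<^sub>m X) *\<^sub>v (minv (1\<^sub>m n - z \<cdot>\<^sub>m X) *\<^sub>v y)) = fv y"
    unfolding minv_solve(1)[OF m r(1) y] ..
  then show "fm (minv (1\<^sub>m n - z \<cdot>\<^sub>m X)) * fv y - smul z (fm X * (fm (minv (1\<^sub>m n - z \<cdot>\<^sub>m X)) * fv y)) = fv y"
    using y rd by (simp add: Xd left_diff_distrib)
qed

text \<open>The square roots only rescale the inputs, by u = \<Delta>_1 u' and v = \<Delta>_0 v'.
  The state equation is a hypothesis and \<xi> is not constructed, because the converse direction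
  obtains \<xi> from the outputs instead of the inputs.\<close>

lemma U_eval:
  assumes z: "z \<in> \<D>" and u': "u' \<in> carrier_vec (p - m)" and v': "v' \<in> carrier_vec q" and \<xi>: "\<xi> \<in> carrier_vec n"
    and u: "u = \<Delta>\<^sub>1 *\<^sub>v u'" and v: "v = \<Delta>\<^sub>0 *\<^sub>v v'"
    and eq: "fv \<xi> = fm A\<^sub>0 * smul z (fv \<xi>) - fm \<eta> * fv u' + fm B\<^sub>0 * fv v'"
  shows "fv (U\<^sub>1\<^sub>1 z *\<^sub>v u + U\<^sub>1\<^sub>2 z *\<^sub>v v) = fm \<Theta> * fv u' + fm X\<^sub>0 * fv v' + fm C\<^sub>1 * smul z (fv \<xi>)"
    "fv (U\<^sub>2\<^sub>1 z *\<^sub>v u + U\<^sub>2\<^sub>2 z *\<^sub>v v) = fv v' + fm L * fv v' + fm C\<^sub>2 * smul z (fv \<xi>)"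
proof -
  let ?R = "minv (1\<^sub>m n - z \<cdot>\<^sub>m A\<^sub>0)"
  have rd [simp]: "dim_row ?R = n" "dim_col ?R = n" using resolvent(2)[OF A\<^sub>0c A\<^sub>0_stable z] by auto
  have ud [simp]: "dim_vec u = p - m" "dim_vec v = q" unfolding u v by simp_all
  have iu: "fm (minv \<Delta>\<^sub>1) * fv u = fv u'"
    unfolding u using u' \<Delta>\<^sub>1fm(2) by (simp flip: mult.assoc)
  have iv: "fm (minv \<Delta>\<^sub>0) * fv v = fv v'"
    unfolding v using v' \<Delta>\<^sub>0fm(2) by (simp flip: mult.assoc)
  have dv: "fm \<Delta>\<^sub>0 * fv v = fv v' + fm L * fv v'"
  proof -
    have "fm \<Delta>\<^sub>0 * fv v = (fm \<Delta>\<^sub>0 * fm \<Delta>\<^sub>0) * fv v'" unfolding v using v' by (simp add: mult.assoc)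
    then show ?thesis unfolding f\<Delta>\<^sub>0 using v' by (simp add: distrib_right)
  qed
  have "fv \<xi> - smul z (fm A\<^sub>0 * fv \<xi>) = fm B\<^sub>0 * fv v' - fm \<eta> * fv u'"
    using eq by (simp add: algebra_simps)
  then have R: "fm ?R * (fm B\<^sub>0 * fv v') - fm ?R * (fm \<eta> * fv u') = fv \<xi>"
    using resolvent_solve(1)[OF A\<^sub>0c A\<^sub>0_stable z \<xi>] by (simp add: right_diff_distrib)
  have f\<eta>: "fm \<eta> * fv u' = fm (minv Q) * (fm Z * (fm B\<^sub>1 * (fm \<Theta> * fv u')))"
    unfolding \<eta>_def by (simp add: mult.assoc)
  have CR: "fm Y * smul z (fv \<xi>) = smul z (fm Y * (fm ?R * (fm B\<^sub>0 * fv v'))) - smul z (fm Y * (fm ?R * (fm (minv Q) * (fm Z * (fm B\<^sub>1 * (fm \<Theta> * fv u'))))))" for Y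
    unfolding R[symmetric] f\<eta> by (simp add: right_diff_distrib smul_diff)
  show "fv (U\<^sub>1\<^sub>1 z *\<^sub>v u + U\<^sub>1\<^sub>2 z *\<^sub>v v) = fm \<Theta> * fv u' + fm X\<^sub>0 * fv v' + fm C\<^sub>1 * smul z (fv \<xi>)"
    unfolding CR U\<^sub>1\<^sub>1_def U\<^sub>1\<^sub>2_def using u' v' by (simp add: mult.assoc distrib_right left_diff_distrib iu iv)
  show "fv (U\<^sub>2\<^sub>1 z *\<^sub>v u + U\<^sub>2\<^sub>2 z *\<^sub>v v) = fv v' + fm L * fv v' + fm C\<^sub>2 * smul z (fv \<xi>)"
    unfolding CR U\<^sub>2\<^sub>1_def U\<^sub>2\<^sub>2_def using u' v' by (simp add: mult.assoc distrib_right left_diff_distrib iu iv dv)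
qed

lemma U_state:
  assumes z: "z \<in> \<D>" and u: "u \<in> carrier_vec (p - m)" and v: "v \<in> carrier_vec q"
  obtains u' v' \<xi> where "u' \<in> carrier_vec (p - m)" "v' \<in> carrier_vec q" "\<xi> \<in> carrier_vec n"
    "u = \<Delta>\<^sub>1 *\<^sub>v u'" "v = \<Delta>\<^sub>0 *\<^sub>v v'" "fv \<xi> = fm A\<^sub>0 * smul z (fv \<xi>) - fm \<eta> * fv u' + fm B\<^sub>0 * fv v'"
    "fv (U\<^sub>1\<^sub>1 z *\<^sub>v u + U\<^sub>1\<^sub>2 z *\<^sub>v v) = fm \<Theta> * fv u' + fm X\<^sub>0 * fv v' + fm C\<^sub>1 * smul z (fv \<xi>)"
    "fv (U\<^sub>2\<^sub>1 z *\<^sub>v u + U\<^sub>2\<^sub>2 z *\<^sub>v v) = fv v' + fm L * fv v' + fm C\<^sub>2 * smul z (fv \<xi>)"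
proof -
  let ?R = "minv (1\<^sub>m n - z \<cdot>\<^sub>m A\<^sub>0)"
  have rd [simp]: "dim_row ?R = n" "dim_col ?R = n" using resolvent(2)[OF A\<^sub>0c A\<^sub>0_stable z] by auto
  define u' where "u' = minv \<Delta>\<^sub>1 *\<^sub>v u"
  define v' where "v' = minv \<Delta>\<^sub>0 *\<^sub>v v"
  define w where "w = B\<^sub>0 *\<^sub>v v' - \<eta> *\<^sub>v u'"
  define \<xi> where "\<xi> = ?R *\<^sub>v w"
  have c: "u' \<in> carrier_vec (p - m)" "v' \<in> carrier_vec q" "w \<in> carrier_vec n" "\<xi> \<in> carrier_vec n"
    unfolding u'_def v'_def w_def \<xi>_def by (rule carrier_vecI, simp)+
  have uu: "u = \<Delta>\<^sub>1 *\<^sub>v u'" unfolding u'_def by (rule minv_solve(1)[OF \<Delta>\<^sub>1_props(1) \<Delta>\<^sub>1_inj u, symmetric])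
  have vv: "v = \<Delta>\<^sub>0 *\<^sub>v v'" unfolding v'_def by (rule minv_solve(1)[OF \<Delta>\<^sub>0_props(1) \<Delta>\<^sub>0_inj v, symmetric])
  have f\<xi>: "fv \<xi> = fm ?R * fv w" unfolding \<xi>_def using c(3) by simp
  have fw: "fv w = fm B\<^sub>0 * fv v' - fm \<eta> * fv u'" unfolding w_def using c by simp
  have "fv \<xi> - smul z (fm A\<^sub>0 * fv \<xi>) = fv w"
    unfolding f\<xi> by (rule resolvent_solve(2)[OF A\<^sub>0c A\<^sub>0_stable z c(3)])
  then have eq: "fv \<xi> = fm A\<^sub>0 * smul z (fv \<xi>) - fm \<eta> * fv u' + fm B\<^sub>0 * fv v'"
    unfolding fw by (simp add: algebra_simps)
  show ?thesis by (rule that[OF c(1,2,4) uu vv eq U_eval[OF z c(1,2,4) uu vv eq]])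
qed

end

section \<open>Energy balance and uniform bounds for the coefficients\<close>

lemma two_squares: "(a + b)\<^sup>2 \<le> 2 * (a\<^sup>2 + b\<^sup>2)" for a b :: real
  using zero_le_power2[of "a - b"] by (simp add: power2_eq_square algebra_simps)

context leech begin

text \<open>The isometry and graph identities at \<zeta> = z \<xi>, in the language of vectors. The
  last two equations are the realization of G h_1 - K h_2 = 0 with state T \<xi>, governed by A and
  no longer by \<open>A\<^sub>0\<close>.\<close>

lemma U_graph:
  assumes z: "z \<in> \<D>" and u: "u \<in> carrier_vec (p - m)" and v: "v \<in> carrier_vec q"
    and h1: "h\<^sub>1 = U\<^sub>1\<^sub>1 z *\<^sub>v u + U\<^sub>1\<^sub>2 z *\<^sub>v v" and h2: "h\<^sub>2 = U\<^sub>2\<^sub>1 z *\<^sub>v u + U\<^sub>2\<^sub>2 z *\<^sub>v v"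
  obtains u' v' \<xi> where "u' \<in> carrier_vec (p - m)" "v' \<in> carrier_vec q" "\<xi> \<in> carrier_vec n"
    "h\<^sub>1 \<in> carrier_vec p" "h\<^sub>2 \<in> carrier_vec q"
    "u = \<Delta>\<^sub>1 *\<^sub>v u'" "v = \<Delta>\<^sub>0 *\<^sub>v v'" "fv \<xi> = fm A\<^sub>0 * smul z (fv \<xi>) - fm \<eta> * fv u' + fm B\<^sub>0 * fv v'"
    "fv h\<^sub>1 = fm \<Theta> * fv u' + fm X\<^sub>0 * fv v' + fm C\<^sub>1 * smul z (fv \<xi>)"
    "fv h\<^sub>2 = fv v' + fm L * fv v' + fm C\<^sub>2 * smul z (fv \<xi>)"
    "(cnorm h\<^sub>1)\<^sup>2 - (cnorm h\<^sub>2)\<^sup>2 + Re (cinner (K *\<^sub>v \<xi>) \<xi>)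
      = (cnorm u)\<^sup>2 - (cnorm v)\<^sup>2 + (cmod z)\<^sup>2 * Re (cinner (K *\<^sub>v \<xi>) \<xi>)"
    "D\<^sub>1 *\<^sub>v h\<^sub>1 - D\<^sub>2 *\<^sub>v h\<^sub>2 = z \<cdot>\<^sub>v (C *\<^sub>v (T *\<^sub>v \<xi>))"
    "(1\<^sub>m n - z \<cdot>\<^sub>m A) *\<^sub>v (T *\<^sub>v \<xi>) = B\<^sub>2 *\<^sub>v h\<^sub>2 - B\<^sub>1 *\<^sub>v h\<^sub>1"
proof -
  obtain u' v' \<xi> where c: "u' \<in> carrier_vec (p - m)" "v' \<in> carrier_vec q" "\<xi> \<in> carrier_vec n"
    and uu: "u = \<Delta>\<^sub>1 *\<^sub>v u'" and vv: "v = \<Delta>\<^sub>0 *\<^sub>v v'"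
    and eq: "fv \<xi> = fm A\<^sub>0 * smul z (fv \<xi>) - fm \<eta> * fv u' + fm B\<^sub>0 * fv v'"
    and e1: "fv h\<^sub>1 = fm \<Theta> * fv u' + fm X\<^sub>0 * fv v' + fm C\<^sub>1 * smul z (fv \<xi>)"
    and e2: "fv h\<^sub>2 = fv v' + fm L * fv v' + fm C\<^sub>2 * smul z (fv \<xi>)"
    using U_state[OF z u v] unfolding h1 h2 by metis
  have d: "dim_vec h\<^sub>1 = p" "dim_vec h\<^sub>2 = q" unfolding h1 h2 U\<^sub>1\<^sub>2_def U\<^sub>2\<^sub>2_def by simp_all
  have dx: "dim_vec u' = p - m" "dim_vec v' = q" "dim_vec \<xi> = n" using c by simp_all
  let ?\<zeta> = "smul z (fv \<xi>)"
  let ?K = "fm Q - fm Q * fm P * fm Q"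
  have zz: "adj ?\<zeta> * X * ?\<zeta> = smul (complex_of_real ((cmod z)\<^sup>2)) (adj (fv \<xi>) * X * fv \<xi>)" for X
    by (simp only: complex_norm_square adj_smul smul_mult_left smul_mult_right smul_smul mult.commute[of "cnj z" z])
  have nu: "adj (fv u) * fv u = adj (fv u') * (adj (fm \<Theta>) * fm \<Theta> + adj (fm \<Theta>) * adj (fm B\<^sub>1) * fm Z * fm B\<^sub>1 * fm \<Theta>) * fv u'"
    unfolding f\<Delta>\<^sub>1(1)[symmetric] uu using dx by (simp add: f\<Delta>\<^sub>1(2) mult.assoc)
  have nv: "adj (fv v) * fv v = adj (fv v') * (fv v' + fm L * fv v')"
  proof -
    have "adj (fv v) * fv v = adj (fv v') * ((fm \<Delta>\<^sub>0 * fm \<Delta>\<^sub>0) * fv v')"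
      unfolding vv using dx by (simp add: f\<Delta>\<^sub>0(2) mult.assoc)
    then show ?thesis unfolding f\<Delta>\<^sub>0(1) using dx by (simp add: distrib_right)
  qed
  have iso: "adj (fv h\<^sub>1) * fv h\<^sub>1 - adj (fv h\<^sub>2) * fv h\<^sub>2 + adj (fv \<xi>) * ?K * fv \<xi>
    = adj (fv u) * fv u - adj (fv v) * fv v + smul (complex_of_real ((cmod z)\<^sup>2)) (adj (fv \<xi>) * ?K * fv \<xi>)"
    using FL.isometry[where u = "fv u'" and v = "fv v'" and \<zeta> = ?\<zeta>] unfolding e1[symmetric] e2[symmetric] eq[symmetric] zz nu nv .
  have "Re (ent (adj (fv h\<^sub>1) * fv h\<^sub>1) 0 0) - Re (ent (adj (fv h\<^sub>2) * fv h\<^sub>2) 0 0) + Re (ent (adj (fv \<xi>) * ?K * fv \<xi>) 0 0)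
    = Re (ent (adj (fv u) * fv u) 0 0) - Re (ent (adj (fv v) * fv v) 0 0) + (cmod z)\<^sup>2 * Re (ent (adj (fv \<xi>) * ?K * fv \<xi>) 0 0)"
    using arg_cong[OF iso, of "\<lambda>X. Re (ent X 0 0)"]
    by (simp only: ent_plus ent_minus ent_smul plus_complex.sel minus_complex.sel Re_complex_of_real Im_complex_of_real times_complex.sel mult_zero_left diff_zero)
  moreover have "Re (ent (adj (fv \<xi>) * ?K * fv \<xi>) 0 0) = Re (cinner (K *\<^sub>v \<xi>) \<xi>)"
    using dx by (simp add: cinner_fv fK mult.assoc)
  ultimately have J: "(cnorm h\<^sub>1)\<^sup>2 - (cnorm h\<^sub>2)\<^sup>2 + Re (cinner (K *\<^sub>v \<xi>) \<xi>)
      = (cnorm u)\<^sup>2 - (cnorm v)\<^sup>2 + (cmod z)\<^sup>2 * Re (cinner (K *\<^sub>v \<xi>) \<xi>)"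
    by (simp only: cnorm_sq cinner_fv[OF refl])
  have tx: "fm T * fv \<xi> = fv \<xi> - fm P * (fm Q * fv \<xi>)" using fT_apply[OF c(3)] dx by simp
  note g = FL.graph[where u = "fv u'" and v = "fv v'" and \<zeta> = ?\<zeta>, unfolded e1[symmetric] e2[symmetric] eq[symmetric]]
  have g1: "D\<^sub>1 *\<^sub>v h\<^sub>1 - D\<^sub>2 *\<^sub>v h\<^sub>2 = z \<cdot>\<^sub>v (C *\<^sub>v (T *\<^sub>v \<xi>))"
    by (rule fv_cancel) (use g(1) d dx in \<open>simp_all add: tx smul_diff algebra_simps\<close>)
  have "fm T * fv \<xi> - smul z (fm A * (fm T * fv \<xi>)) = fm B\<^sub>2 * fv h\<^sub>2 - fm B\<^sub>1 * fv h\<^sub>1"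
    unfolding tx using g(2) by (simp add: smul_diff algebra_simps)
  then have g2: "(1\<^sub>m n - z \<cdot>\<^sub>m A) *\<^sub>v (T *\<^sub>v \<xi>) = B\<^sub>2 *\<^sub>v h\<^sub>2 - B\<^sub>1 *\<^sub>v h\<^sub>1"
    by (intro fv_cancel) (use d dx in \<open>simp_all add: left_diff_distrib\<close>)
  have ch: "h\<^sub>1 \<in> carrier_vec p" "h\<^sub>2 \<in> carrier_vec q" using d by (auto intro: carrier_vecI)
  show ?thesis by (rule that[OF c ch uu vv eq e1 e2 J g1 g2])
qed

lemma K_nonneg: "\<xi> \<in> carrier_vec n \<Longrightarrow> 0 \<le> Re (cinner (K *\<^sub>v \<xi>) \<xi>)"
  by (rule positive_definite_matD(3)[OF Kc K_pd])

lemma U_contractive: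
  assumes z: "z \<in> \<D>" and u: "u \<in> carrier_vec (p - m)" and v: "v \<in> carrier_vec q"
  shows "(cnorm (U\<^sub>1\<^sub>1 z *\<^sub>v u + U\<^sub>1\<^sub>2 z *\<^sub>v v))\<^sup>2 - (cnorm (U\<^sub>2\<^sub>1 z *\<^sub>v u + U\<^sub>2\<^sub>2 z *\<^sub>v v))\<^sup>2 \<le> (cnorm u)\<^sup>2 - (cnorm v)\<^sup>2"
proof -
  obtain \<xi> where \<xi>: "\<xi> \<in> carrier_vec n" and J: "(cnorm (U\<^sub>1\<^sub>1 z *\<^sub>v u + U\<^sub>1\<^sub>2 z *\<^sub>v v))\<^sup>2 - (cnorm (U\<^sub>2\<^sub>1 z *\<^sub>v u + U\<^sub>2\<^sub>2 z *\<^sub>v v))\<^sup>2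
      + Re (cinner (K *\<^sub>v \<xi>) \<xi>) = (cnorm u)\<^sup>2 - (cnorm v)\<^sup>2 + (cmod z)\<^sup>2 * Re (cinner (K *\<^sub>v \<xi>) \<xi>)"
    by (rule U_graph[OF z u v refl refl])
  have "(cmod z)\<^sup>2 \<le> 1" using z by (simp add: power_le_one)
  then have "(cmod z)\<^sup>2 * Re (cinner (K *\<^sub>v \<xi>) \<xi>) \<le> 1 * Re (cinner (K *\<^sub>v \<xi>) \<xi>)"
    by (rule mult_right_mono[OF _ K_nonneg[OF \<xi>]])
  then show ?thesis using J by linarith
qed

text \<open>Inputs and state are recovered from the outputs: \<xi> from the equation with A through
  the resolvent of A and the inverse of T, then v' by inverting \<open>N\<^sub>0\<close>, then u' by
  the left inverse of \<Theta>. Every step is bounded uniformly in z because A is stable.\<close>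

lemma U_state_bound:
  obtains k l where "0 \<le> k" "0 \<le> l" "\<And>z u v. z \<in> \<D> \<Longrightarrow> u \<in> carrier_vec (p - m) \<Longrightarrow> v \<in> carrier_vec q \<Longrightarrow>
    cnorm u \<le> k * (cnorm (U\<^sub>1\<^sub>1 z *\<^sub>v u + U\<^sub>1\<^sub>2 z *\<^sub>v v) + cnorm (U\<^sub>2\<^sub>1 z *\<^sub>v u + U\<^sub>2\<^sub>2 z *\<^sub>v v)) \<and>
    (\<exists>\<xi>. \<xi> \<in> carrier_vec n \<and> cnorm \<xi> \<le> l * (cnorm (U\<^sub>1\<^sub>1 z *\<^sub>v u + U\<^sub>1\<^sub>2 z *\<^sub>v v) + cnorm (U\<^sub>2\<^sub>1 z *\<^sub>v u + U\<^sub>2\<^sub>2 z *\<^sub>v v)) \<and>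
      (cnorm (U\<^sub>1\<^sub>1 z *\<^sub>v u + U\<^sub>1\<^sub>2 z *\<^sub>v v))\<^sup>2 - (cnorm (U\<^sub>2\<^sub>1 z *\<^sub>v u + U\<^sub>2\<^sub>2 z *\<^sub>v v))\<^sup>2 + Re (cinner (K *\<^sub>v \<xi>) \<xi>)
      = (cnorm u)\<^sup>2 - (cnorm v)\<^sup>2 + (cmod z)\<^sup>2 * Re (cinner (K *\<^sub>v \<xi>) \<xi>))"
proof -
  obtain c \<rho> where dA: "decay n A c \<rho>" using stable_decay[OF A A_stable] by blast
  define a where "a = real n * real n * c / (1 - \<rho>)"
  have a: "0 \<le> a" unfolding a_def using dA by (simp add: decay_def)
  have N0i: "minv N\<^sub>0 \<in> carrier_mat q q" by (rule minv_works(1)[OF carrE(5) positive_definite_matD(4)[OF carrE(5) N\<^sub>0_pd]])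
  have Ti: "minv T \<in> carrier_mat n n" by (rule minv_works(1)[OF Tc T_inj])
  have TW: "\<Theta>\<^sup>\<dagger> * W\<^sub>0 \<in> carrier_mat (p - m) p" by (rule mult_carrier_mat[OF mat_adjoint_carrier[OF \<Theta>c] W\<^sub>0c])
  obtain b\<^sub>1 where b1: "0 \<le> b\<^sub>1" "\<And>x. x \<in> carrier_vec p \<Longrightarrow> cnorm (B\<^sub>1 *\<^sub>v x) \<le> b\<^sub>1 * cnorm x" using mat_bounded[OF B\<^sub>1] by metis
  obtain b\<^sub>2 where b2: "0 \<le> b\<^sub>2" "\<And>x. x \<in> carrier_vec q \<Longrightarrow> cnorm (B\<^sub>2 *\<^sub>v x) \<le> b\<^sub>2 * cnorm x" using mat_bounded[OF B\<^sub>2] by metis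
  obtain t where t: "0 \<le> t" "\<And>x. x \<in> carrier_vec n \<Longrightarrow> cnorm (minv T *\<^sub>v x) \<le> t * cnorm x" using mat_bounded[OF Ti] by metis
  obtain w where w: "0 \<le> w" "\<And>x. x \<in> carrier_vec q \<Longrightarrow> cnorm (minv N\<^sub>0 *\<^sub>v x) \<le> w * cnorm x" using mat_bounded[OF N0i] by metis
  obtain c\<^sub>1 where c1: "0 \<le> c\<^sub>1" "\<And>x. x \<in> carrier_vec n \<Longrightarrow> cnorm (C\<^sub>1 *\<^sub>v x) \<le> c\<^sub>1 * cnorm x" using mat_bounded[OF C\<^sub>1c] by metis
  obtain c\<^sub>2 where c2: "0 \<le> c\<^sub>2" "\<And>x. x \<in> carrier_vec n \<Longrightarrow> cnorm (C\<^sub>2 *\<^sub>v x) \<le> c\<^sub>2 * cnorm x" using mat_bounded[OF C\<^sub>2c] by metis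
  obtain x\<^sub>0 where x0: "0 \<le> x\<^sub>0" "\<And>x. x \<in> carrier_vec q \<Longrightarrow> cnorm (X\<^sub>0 *\<^sub>v x) \<le> x\<^sub>0 * cnorm x" using mat_bounded[OF carrE(2)] by metis
  obtain d where d: "0 \<le> d" "\<And>x. x \<in> carrier_vec (p - m) \<Longrightarrow> cnorm (\<Delta>\<^sub>1 *\<^sub>v x) \<le> d * cnorm x" using mat_bounded[OF \<Delta>\<^sub>1_props(1)] by metis
  obtain f where f: "0 \<le> f" "\<And>x. x \<in> carrier_vec p \<Longrightarrow> cnorm (\<Theta>\<^sup>\<dagger> * W\<^sub>0 *\<^sub>v x) \<le> f * cnorm x" using mat_bounded[OF TW] by metis
  define l where "l = t * (a * (b\<^sub>2 + b\<^sub>1))"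
  define l\<^sub>1 where "l\<^sub>1 = w * (1 + c\<^sub>2 * l)"
  define l\<^sub>2 where "l\<^sub>2 = 1 + c\<^sub>1 * l + x\<^sub>0 * l\<^sub>1"
  define k where "k = d * (f * l\<^sub>2)"
  have nn: "0 \<le> l" "0 \<le> l\<^sub>1" "0 \<le> l\<^sub>2" "0 \<le> k" unfolding k_def l\<^sub>2_def l\<^sub>1_def l_def
    using a b1(1) b2(1) t(1) w(1) c1(1) c2(1) x0(1) d(1) f(1) by simp_all
  show ?thesis
  proof (rule that[OF nn(4,1)], goal_cases)
    case (1 z u v)
    define h\<^sub>1 where "h\<^sub>1 = U\<^sub>1\<^sub>1 z *\<^sub>v u + U\<^sub>1\<^sub>2 z *\<^sub>v v"
    define h\<^sub>2 where "h\<^sub>2 = U\<^sub>2\<^sub>1 z *\<^sub>v u + U\<^sub>2\<^sub>2 z *\<^sub>v v"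
    obtain u' v' \<xi> where cc: "u' \<in> carrier_vec (p - m)" "v' \<in> carrier_vec q" "\<xi> \<in> carrier_vec n"
      "h\<^sub>1 \<in> carrier_vec p" "h\<^sub>2 \<in> carrier_vec q"
      and uu: "u = \<Delta>\<^sub>1 *\<^sub>v u'"
      and e1: "fv h\<^sub>1 = fm \<Theta> * fv u' + fm X\<^sub>0 * fv v' + fm C\<^sub>1 * smul z (fv \<xi>)"
      and e2: "fv h\<^sub>2 = fv v' + fm L * fv v' + fm C\<^sub>2 * smul z (fv \<xi>)"
      and J: "(cnorm h\<^sub>1)\<^sup>2 - (cnorm h\<^sub>2)\<^sup>2 + Re (cinner (K *\<^sub>v \<xi>) \<xi>) = (cnorm u)\<^sup>2 - (cnorm v)\<^sup>2 + (cmod z)\<^sup>2 * Re (cinner (K *\<^sub>v \<xi>) \<xi>)"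
      and g: "(1\<^sub>m n - z \<cdot>\<^sub>m A) *\<^sub>v (T *\<^sub>v \<xi>) = B\<^sub>2 *\<^sub>v h\<^sub>2 - B\<^sub>1 *\<^sub>v h\<^sub>1"
      by (rule U_graph[OF 1 h\<^sub>1_def h\<^sub>2_def])
    note dd = carrier_vecD[OF cc(1)] carrier_vecD[OF cc(2)] carrier_vecD[OF cc(3)] carrier_vecD[OF cc(4)] carrier_vecD[OF cc(5)]
    define s where "s = cnorm h\<^sub>1 + cnorm h\<^sub>2"
    have s: "cnorm h\<^sub>1 \<le> s" "cnorm h\<^sub>2 \<le> s" "0 \<le> s" unfolding s_def by simp_all
    have z1: "cmod z \<le> 1" using 1 by simp
    have zle: "cmod z * X \<le> X" if "0 \<le> X" for X using mult_right_mono[OF z1 that] by simp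
    have Tx: "T *\<^sub>v \<xi> \<in> carrier_vec n" using Tc by auto
    have "cnorm (B\<^sub>2 *\<^sub>v h\<^sub>2 - B\<^sub>1 *\<^sub>v h\<^sub>1) \<le> cnorm (B\<^sub>2 *\<^sub>v h\<^sub>2) + cnorm (B\<^sub>1 *\<^sub>v h\<^sub>1)" by (rule cnorm_triangle_diff) simp
    also have "\<dots> \<le> b\<^sub>2 * s + b\<^sub>1 * s"
      using b1(2)[OF cc(4)] b2(2)[OF cc(5)] mult_left_mono[OF s(1) b1(1)] mult_left_mono[OF s(2) b2(1)] by linarith
    finally have 2: "cnorm (B\<^sub>2 *\<^sub>v h\<^sub>2 - B\<^sub>1 *\<^sub>v h\<^sub>1) \<le> (b\<^sub>2 + b\<^sub>1) * s" by (simp only: distrib_right)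
    have "cnorm \<xi> \<le> t * cnorm (T *\<^sub>v \<xi>)"
      using t(2)[OF Tx] unfolding minv_solve(2)[OF Tc T_inj cc(3)] .
    also have "\<dots> \<le> t * (a * cnorm (B\<^sub>2 *\<^sub>v h\<^sub>2 - B\<^sub>1 *\<^sub>v h\<^sub>1))"
      using resolvent_bound[OF dA z1 Tx, folded a_def] unfolding g by (rule mult_left_mono) (rule t)
    also have "\<dots> \<le> t * (a * ((b\<^sub>2 + b\<^sub>1) * s))" using 2 a t(1) by (intro mult_left_mono)
    finally have x: "cnorm \<xi> \<le> l * s" unfolding l_def by (simp only: mult.assoc)
    have lx: "0 \<le> l * s" using nn s by simp
    have cz: "cnorm (z \<cdot>\<^sub>v (Y *\<^sub>v \<xi>)) \<le> y * (l * s)" if "cnorm (Y *\<^sub>v \<xi>) \<le> y * cnorm \<xi>" "0 \<le> y" for y Y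
      using zle[OF cnorm_ge0[of "Y *\<^sub>v \<xi>"]] that(1) mult_left_mono[OF x that(2)] by simp
    have v': "v' = minv N\<^sub>0 *\<^sub>v (h\<^sub>2 - z \<cdot>\<^sub>v (C\<^sub>2 *\<^sub>v \<xi>))"
    proof -
      have "N\<^sub>0 *\<^sub>v v' = h\<^sub>2 - z \<cdot>\<^sub>v (C\<^sub>2 *\<^sub>v \<xi>)"
        by (rule fv_cancel) (use e2 dd in \<open>simp_all add: N\<^sub>0_def distrib_right\<close>)
      then show ?thesis using minv_solve(2)[OF carrE(5) positive_definite_matD(4)[OF carrE(5) N\<^sub>0_pd] cc(2)] by simp
    qed
    have "cnorm (h\<^sub>2 - z \<cdot>\<^sub>v (C\<^sub>2 *\<^sub>v \<xi>)) \<le> cnorm h\<^sub>2 + cnorm (z \<cdot>\<^sub>v (C\<^sub>2 *\<^sub>v \<xi>))" by (rule cnorm_triangle_diff) (simp add: dd)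
    then have "cnorm (h\<^sub>2 - z \<cdot>\<^sub>v (C\<^sub>2 *\<^sub>v \<xi>)) \<le> (1 + c\<^sub>2 * l) * s"
      using cz[OF c2(2)[OF cc(3)] c2(1)] s(2) unfolding distrib_right mult.assoc by linarith
    then have "w * cnorm (h\<^sub>2 - z \<cdot>\<^sub>v (C\<^sub>2 *\<^sub>v \<xi>)) \<le> w * ((1 + c\<^sub>2 * l) * s)" by (rule mult_left_mono[OF _ w(1)])
    moreover have "h\<^sub>2 - z \<cdot>\<^sub>v (C\<^sub>2 *\<^sub>v \<xi>) \<in> carrier_vec q" by (rule carrier_vecI) simp
    note w(2)[OF this, folded v']
    ultimately have vb: "cnorm v' \<le> l\<^sub>1 * s" unfolding l\<^sub>1_def mult.assoc by linarith
    define y where "y = (h\<^sub>1 - z \<cdot>\<^sub>v (C\<^sub>1 *\<^sub>v \<xi>)) - X\<^sub>0 *\<^sub>v v'"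
    have yc: "y \<in> carrier_vec p" unfolding y_def by (rule carrier_vecI) simp
    have "\<Theta> *\<^sub>v u' = y" by (rule fv_cancel) (use e1 dd in \<open>simp_all add: y_def\<close>)
    then have u': "u' = \<Theta>\<^sup>\<dagger> * W\<^sub>0 *\<^sub>v y"
      using W\<Theta>_apply[OF cc(1)] assoc_mult_mat_vec[OF mat_adjoint_carrier[OF \<Theta>c] W\<^sub>0c yc] by simp
    have "cnorm y \<le> cnorm (h\<^sub>1 - z \<cdot>\<^sub>v (C\<^sub>1 *\<^sub>v \<xi>)) + cnorm (X\<^sub>0 *\<^sub>v v')" unfolding y_def by (rule cnorm_triangle_diff) (simp add: dd)
    moreover have "cnorm (h\<^sub>1 - z \<cdot>\<^sub>v (C\<^sub>1 *\<^sub>v \<xi>)) \<le> cnorm h\<^sub>1 + cnorm (z \<cdot>\<^sub>v (C\<^sub>1 *\<^sub>v \<xi>))" by (rule cnorm_triangle_diff) (simp add: dd)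
    moreover have "cnorm (X\<^sub>0 *\<^sub>v v') \<le> x\<^sub>0 * (l\<^sub>1 * s)" using x0(2)[OF cc(2)] mult_left_mono[OF vb x0(1)] by linarith
    ultimately have "cnorm y \<le> s + c\<^sub>1 * (l * s) + x\<^sub>0 * (l\<^sub>1 * s)"
      using cz[OF c1(2)[OF cc(3)] c1(1)] s(1) by linarith
    then have "cnorm y \<le> l\<^sub>2 * s" unfolding l\<^sub>2_def by (simp add: algebra_simps)
    then have "f * cnorm y \<le> f * (l\<^sub>2 * s)" by (rule mult_left_mono[OF _ f(1)])
    then have "cnorm u' \<le> f * (l\<^sub>2 * s)" using f(2)[OF yc, folded u'] by linarith
    then have "d * cnorm u' \<le> d * (f * (l\<^sub>2 * s))" by (rule mult_left_mono[OF _ d(1)])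
    then have "cnorm u \<le> k * s" using d(2)[OF cc(1), folded uu] unfolding k_def mult.assoc by linarith
    then show ?case using x J cc(3) unfolding s_def h\<^sub>1_def[symmetric] h\<^sub>2_def[symmetric] by blast
  qed
qed

text \<open>The forward direction, from inputs to the second output; here uniformity in z comes from
  stability of \<open>A\<^sub>0\<close>.\<close>

lemma U_upper_bound:
  obtains \<beta> where "1 \<le> \<beta>" "\<And>z u v. z \<in> \<D> \<Longrightarrow> u \<in> carrier_vec (p - m) \<Longrightarrow> v \<in> carrier_vec q \<Longrightarrow>
    cnorm (U\<^sub>2\<^sub>1 z *\<^sub>v u + U\<^sub>2\<^sub>2 z *\<^sub>v v) \<le> \<beta> * (cnorm u + cnorm v)"
proof -
  obtain c \<rho> where dA: "decay n A\<^sub>0 c \<rho>" using stable_decay[OF A\<^sub>0c A\<^sub>0_stable] by blast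
  define a where "a = real n * real n * c / (1 - \<rho>)"
  have a: "0 \<le> a" unfolding a_def using dA by (simp add: decay_def)
  obtain b where b: "0 \<le> b" "\<And>x. x \<in> carrier_vec q \<Longrightarrow> cnorm (B\<^sub>0 *\<^sub>v x) \<le> b * cnorm x" using mat_bounded[OF carrE(1)] by metis
  obtain h where h: "0 \<le> h" "\<And>x. x \<in> carrier_vec (p - m) \<Longrightarrow> cnorm (\<eta> *\<^sub>v x) \<le> h * cnorm x" using mat_bounded[OF carrE(4)] by metis
  obtain c\<^sub>2 where c2: "0 \<le> c\<^sub>2" "\<And>x. x \<in> carrier_vec n \<Longrightarrow> cnorm (C\<^sub>2 *\<^sub>v x) \<le> c\<^sub>2 * cnorm x" using mat_bounded[OF C\<^sub>2c] by metis
  obtain w where w: "0 \<le> w" "\<And>x. x \<in> carrier_vec q \<Longrightarrow> cnorm (N\<^sub>0 *\<^sub>v x) \<le> w * cnorm x" using mat_bounded[OF carrE(5)] by metis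
  obtain d where d: "0 \<le> d" "\<And>x. x \<in> carrier_vec q \<Longrightarrow> cnorm (minv \<Delta>\<^sub>0 *\<^sub>v x) \<le> d * cnorm x" using mat_bounded[OF \<Delta>\<^sub>0i] by metis
  obtain f where f: "0 \<le> f" "\<And>x. x \<in> carrier_vec (p - m) \<Longrightarrow> cnorm (minv \<Delta>\<^sub>1 *\<^sub>v x) \<le> f * cnorm x" using mat_bounded[OF \<Delta>\<^sub>1i] by metis
  define \<beta> where "\<beta> = 1 + w * d + c\<^sub>2 * (a * (b * d + h * f))"
  have "1 \<le> \<beta>" unfolding \<beta>_def using a b h c2 w d f by simp
  then show ?thesis
  proof (rule that, goal_cases)
    case (1 z u v)
    define h\<^sub>2 where "h\<^sub>2 = U\<^sub>2\<^sub>1 z *\<^sub>v u + U\<^sub>2\<^sub>2 z *\<^sub>v v"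
    obtain u' v' \<xi> where cc: "u' \<in> carrier_vec (p - m)" "v' \<in> carrier_vec q" "\<xi> \<in> carrier_vec n" "h\<^sub>2 \<in> carrier_vec q"
      and uu: "u = \<Delta>\<^sub>1 *\<^sub>v u'" and vv: "v = \<Delta>\<^sub>0 *\<^sub>v v'"
      and eq: "fv \<xi> = fm A\<^sub>0 * smul z (fv \<xi>) - fm \<eta> * fv u' + fm B\<^sub>0 * fv v'"
      and e2: "fv h\<^sub>2 = fv v' + fm L * fv v' + fm C\<^sub>2 * smul z (fv \<xi>)"
      by (rule U_graph[OF 1 refl h\<^sub>2_def])
    note dd = carrier_vecD[OF cc(1)] carrier_vecD[OF cc(2)] carrier_vecD[OF cc(3)] carrier_vecD[OF cc(4)]
    define s where "s = cnorm u + cnorm v"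
    have s: "cnorm u \<le> s" "cnorm v \<le> s" "0 \<le> s" unfolding s_def by simp_all
    have z1: "cmod z \<le> 1" using 1 by simp
    have ub: "cnorm u' \<le> f * s"
      using f(2)[OF 1(2)] mult_left_mono[OF s(1) f(1)] unfolding uu minv_solve(2)[OF \<Delta>\<^sub>1_props(1) \<Delta>\<^sub>1_inj cc(1)] by linarith
    have vb: "cnorm v' \<le> d * s"
      using d(2)[OF 1(3)] mult_left_mono[OF s(2) d(1)] unfolding vv minv_solve(2)[OF \<Delta>\<^sub>0_props(1) \<Delta>\<^sub>0_inj cc(2)] by linarith
    have "fv \<xi> - smul z (fm A\<^sub>0 * fv \<xi>) = fm B\<^sub>0 * fv v' - fm \<eta> * fv u'" using eq by (simp add: algebra_simps)
    then have "(1\<^sub>m n - z \<cdot>\<^sub>m A\<^sub>0) *\<^sub>v \<xi> = B\<^sub>0 *\<^sub>v v' - \<eta> *\<^sub>v u'"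
      by (intro fv_cancel) (use dd in \<open>simp_all add: left_diff_distrib\<close>)
    with resolvent_bound[OF dA z1 cc(3), folded a_def] have xb: "cnorm \<xi> \<le> a * cnorm (B\<^sub>0 *\<^sub>v v' - \<eta> *\<^sub>v u')" by simp
    have "cnorm (B\<^sub>0 *\<^sub>v v' - \<eta> *\<^sub>v u') \<le> cnorm (B\<^sub>0 *\<^sub>v v') + cnorm (\<eta> *\<^sub>v u')" by (rule cnorm_triangle_diff) simp
    also have "\<dots> \<le> b * (d * s) + h * (f * s)"
      using b(2)[OF cc(2)] h(2)[OF cc(1)] mult_left_mono[OF vb b(1)] mult_left_mono[OF ub h(1)] by linarith
    finally have "cnorm \<xi> \<le> a * (b * (d * s) + h * (f * s))" using mult_left_mono[OF _ a] xb by force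
    then have "c\<^sub>2 * cnorm \<xi> \<le> c\<^sub>2 * (a * (b * (d * s) + h * (f * s)))" by (rule mult_left_mono[OF _ c2(1)])
    moreover have "cmod z * cnorm (C\<^sub>2 *\<^sub>v \<xi>) \<le> cnorm (C\<^sub>2 *\<^sub>v \<xi>)" using mult_right_mono[OF z1 cnorm_ge0[of "C\<^sub>2 *\<^sub>v \<xi>"]] by simp
    ultimately have cb: "cnorm (z \<cdot>\<^sub>v (C\<^sub>2 *\<^sub>v \<xi>)) \<le> c\<^sub>2 * (a * (b * (d * s) + h * (f * s)))" using c2(2)[OF cc(3)] by simp
    have "h\<^sub>2 = N\<^sub>0 *\<^sub>v v' + z \<cdot>\<^sub>v (C\<^sub>2 *\<^sub>v \<xi>)"
      by (rule fv_cancel) (use e2 dd in \<open>simp_all add: N\<^sub>0_def distrib_right\<close>)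
    then have "cnorm h\<^sub>2 \<le> cnorm (N\<^sub>0 *\<^sub>v v') + cnorm (z \<cdot>\<^sub>v (C\<^sub>2 *\<^sub>v \<xi>))" using cnorm_triangle[of "N\<^sub>0 *\<^sub>v v'" "z \<cdot>\<^sub>v (C\<^sub>2 *\<^sub>v \<xi>)"] by simp
    also have "\<dots> \<le> w * (d * s) + c\<^sub>2 * (a * (b * (d * s) + h * (f * s)))"
      using w(2)[OF cc(2)] mult_left_mono[OF vb w(1)] cb by linarith
    also have "\<dots> \<le> s + \<dots>" using s(3) by simp
    also have "\<dots> = \<beta> * s" unfolding \<beta>_def by (simp add: algebra_simps)
    finally show ?case unfolding h\<^sub>2_def s_def .
  qed
qed

lemma mholo_transfer:
  assumes "X \<in> carrier_mat k n" "Y \<in> carrier_mat n r" "F \<in> carrier_mat k r"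
  shows "mholo \<D> k r (\<lambda>z. F + z \<cdot>\<^sub>m (X * minv (1\<^sub>m n - z \<cdot>\<^sub>m A\<^sub>0) * Y))"
  by (intro mholo_add mholo_const mholo_smult holomorphic_on_ident
      mholo_mult[OF mholo_mult[OF mholo_const mholo_resolvent[OF A\<^sub>0c A\<^sub>0_stable]] mholo_const] assms)

lemma mholo_U: "mholo \<D> p (p - m) U\<^sub>1\<^sub>1" "mholo \<D> p q U\<^sub>1\<^sub>2" "mholo \<D> q (p - m) U\<^sub>2\<^sub>1" "mholo \<D> q q U\<^sub>2\<^sub>2"
proof -
  let ?Y = "minv Q * Z * B\<^sub>1 * \<Theta> * minv \<Delta>\<^sub>1"
  have Y: "?Y \<in> carrier_mat n (p - m)" "B\<^sub>0 * minv \<Delta>\<^sub>0 \<in> carrier_mat n q" "\<Theta> * minv \<Delta>\<^sub>1 \<in> carrier_mat p (p - m)" "X\<^sub>0 * minv \<Delta>\<^sub>0 \<in> carrier_mat p q"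
    "- C\<^sub>1 \<in> carrier_mat p n" "- C\<^sub>2 \<in> carrier_mat q n"
    by (rule carrier_matI, simp, simp)+
  have rd: "dim_row (minv (1\<^sub>m n - z \<cdot>\<^sub>m A\<^sub>0)) = n" "dim_col (minv (1\<^sub>m n - z \<cdot>\<^sub>m A\<^sub>0)) = n" if "z \<in> \<D>" for z
    using resolvent(2)[OF A\<^sub>0c A\<^sub>0_stable that] by auto
  show "mholo \<D> p (p - m) U\<^sub>1\<^sub>1"
    by (rule mholo_cong[OF mholo_transfer[OF Y(5,1,3)]], rule fm_cancel) (simp_all add: U\<^sub>1\<^sub>1_def rd mult.assoc)
  show "mholo \<D> p q U\<^sub>1\<^sub>2"
    by (rule mholo_cong[OF mholo_transfer[OF C\<^sub>1c Y(2,4)]], rule fm_cancel) (simp_all add: U\<^sub>1\<^sub>2_def rd mult.assoc)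
  show "mholo \<D> q (p - m) U\<^sub>2\<^sub>1"
    by (rule mholo_cong[OF mholo_transfer[OF Y(6,1) zero_carrier_mat]], rule fm_cancel) (simp_all add: U\<^sub>2\<^sub>1_def rd mult.assoc)
  show "mholo \<D> q q U\<^sub>2\<^sub>2"
    by (rule mholo_cong[OF mholo_transfer[OF C\<^sub>2c Y(2) \<Delta>\<^sub>0_props(1)]], rule fm_cancel) (simp_all add: U\<^sub>2\<^sub>2_def rd mult.assoc)
qed

text \<open>The reverse energy inequality is the balance of \<open>U_graph\<close>: its defect is 1
  - |z|^2 times the storage form at \<xi>, and \<open>U_state_bound\<close> controls \<xi> by the
  outputs.\<close>

lemma U_lft:
  obtains \<kappa> \<beta> \<gamma> where "lft p q (p - m) U\<^sub>1\<^sub>1 U\<^sub>1\<^sub>2 U\<^sub>2\<^sub>1 U\<^sub>2\<^sub>2 \<kappa> \<beta> \<gamma>"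
proof -
  obtain k l where kl: "0 \<le> k" "0 \<le> l" and b: "\<And>z u v. z \<in> \<D> \<Longrightarrow> u \<in> carrier_vec (p - m) \<Longrightarrow> v \<in> carrier_vec q \<Longrightarrow>
    cnorm u \<le> k * (cnorm (U\<^sub>1\<^sub>1 z *\<^sub>v u + U\<^sub>1\<^sub>2 z *\<^sub>v v) + cnorm (U\<^sub>2\<^sub>1 z *\<^sub>v u + U\<^sub>2\<^sub>2 z *\<^sub>v v)) \<and>
    (\<exists>\<xi>. \<xi> \<in> carrier_vec n \<and> cnorm \<xi> \<le> l * (cnorm (U\<^sub>1\<^sub>1 z *\<^sub>v u + U\<^sub>1\<^sub>2 z *\<^sub>v v) + cnorm (U\<^sub>2\<^sub>1 z *\<^sub>v u + U\<^sub>2\<^sub>2 z *\<^sub>v v)) \<and>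
      (cnorm (U\<^sub>1\<^sub>1 z *\<^sub>v u + U\<^sub>1\<^sub>2 z *\<^sub>v v))\<^sup>2 - (cnorm (U\<^sub>2\<^sub>1 z *\<^sub>v u + U\<^sub>2\<^sub>2 z *\<^sub>v v))\<^sup>2 + Re (cinner (K *\<^sub>v \<xi>) \<xi>)
      = (cnorm u)\<^sup>2 - (cnorm v)\<^sup>2 + (cmod z)\<^sup>2 * Re (cinner (K *\<^sub>v \<xi>) \<xi>))"
    using U_state_bound by blast
  obtain \<beta> where \<beta>: "1 \<le> \<beta>" "\<And>z u v. z \<in> \<D> \<Longrightarrow> u \<in> carrier_vec (p - m) \<Longrightarrow> v \<in> carrier_vec q \<Longrightarrow>
    cnorm (U\<^sub>2\<^sub>1 z *\<^sub>v u + U\<^sub>2\<^sub>2 z *\<^sub>v v) \<le> \<beta> * (cnorm u + cnorm v)"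
    using U_upper_bound by blast
  obtain b\<^sub>K where bK: "0 \<le> b\<^sub>K" "\<And>x. x \<in> carrier_vec n \<Longrightarrow> cnorm (K *\<^sub>v x) \<le> b\<^sub>K * cnorm x" using mat_bounded[OF Kc] by metis
  \<comment> \<open>The square of 2 k + 1 dominates 2 k^2, the 2 being due to (a + b)^2 \<le> 2 (a^2
    + b^2), and the added 1 ensures \<kappa> \<ge> 1. The same 2 enters \<gamma>.\<close>
  have "lft p q (p - m) U\<^sub>1\<^sub>1 U\<^sub>1\<^sub>2 U\<^sub>2\<^sub>1 U\<^sub>2\<^sub>2 (2 * k + 1) \<beta> (2 * (b\<^sub>K * l\<^sup>2))"
  proof
    fix z :: complex and u v :: "complex vec" assume z: "z \<in> \<D>" and u: "u \<in> carrier_vec (p - m)" and v: "v \<in> carrier_vec q"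
    define h\<^sub>1 where "h\<^sub>1 = U\<^sub>1\<^sub>1 z *\<^sub>v u + U\<^sub>1\<^sub>2 z *\<^sub>v v"
    define h\<^sub>2 where "h\<^sub>2 = U\<^sub>2\<^sub>1 z *\<^sub>v u + U\<^sub>2\<^sub>2 z *\<^sub>v v"
    obtain \<xi> where \<xi>: "\<xi> \<in> carrier_vec n" "cnorm \<xi> \<le> l * (cnorm h\<^sub>1 + cnorm h\<^sub>2)"
      and J: "(cnorm h\<^sub>1)\<^sup>2 - (cnorm h\<^sub>2)\<^sup>2 + Re (cinner (K *\<^sub>v \<xi>) \<xi>) = (cnorm u)\<^sup>2 - (cnorm v)\<^sup>2 + (cmod z)\<^sup>2 * Re (cinner (K *\<^sub>v \<xi>) \<xi>)"
      and ub: "cnorm u \<le> k * (cnorm h\<^sub>1 + cnorm h\<^sub>2)"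
      using b[OF z u v] unfolding h\<^sub>1_def h\<^sub>2_def by blast
    note sq = two_squares[of "cnorm h\<^sub>1" "cnorm h\<^sub>2"]
    have z1: "0 \<le> 1 - (cmod z)\<^sup>2" using z by (simp add: power_le_one)
    have "Re (cinner (K *\<^sub>v \<xi>) \<xi>) \<le> cnorm (K *\<^sub>v \<xi>) * cnorm \<xi>"
      by (rule order_trans[OF complex_Re_le_cmod cauchy_schwarz]) (use \<xi> in simp)
    also have "\<dots> \<le> (b\<^sub>K * cnorm \<xi>) * cnorm \<xi>" by (rule mult_right_mono[OF bK(2)[OF \<xi>(1)] cnorm_ge0])
    also have "\<dots> = b\<^sub>K * (cnorm \<xi>)\<^sup>2" by (simp add: power2_eq_square)
    also have "\<dots> \<le> b\<^sub>K * (l * (cnorm h\<^sub>1 + cnorm h\<^sub>2))\<^sup>2" by (intro mult_left_mono power_mono \<xi>(2) bK(1) cnorm_ge0)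
    also have "\<dots> = (b\<^sub>K * l\<^sup>2) * (cnorm h\<^sub>1 + cnorm h\<^sub>2)\<^sup>2" by (simp add: power_mult_distrib)
    also have "\<dots> \<le> (b\<^sub>K * l\<^sup>2) * (2 * ((cnorm h\<^sub>1)\<^sup>2 + (cnorm h\<^sub>2)\<^sup>2))" using bK(1) by (intro mult_left_mono sq) simp
    finally have "Re (cinner (K *\<^sub>v \<xi>) \<xi>) \<le> 2 * (b\<^sub>K * l\<^sup>2) * ((cnorm h\<^sub>1)\<^sup>2 + (cnorm h\<^sub>2)\<^sup>2)" by (simp add: algebra_simps)
    from mult_left_mono[OF this z1]
    have g: "Re (cinner (K *\<^sub>v \<xi>) \<xi>) - (cmod z)\<^sup>2 * Re (cinner (K *\<^sub>v \<xi>) \<xi>)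
        \<le> (1 - (cmod z)\<^sup>2) * (2 * (b\<^sub>K * l\<^sup>2) * ((cnorm h\<^sub>1)\<^sup>2 + (cnorm h\<^sub>2)\<^sup>2))"
      by (simp only: left_diff_distrib[of 1 "(cmod z)\<^sup>2" "Re (cinner (K *\<^sub>v \<xi>) \<xi>)"] mult_1_left)
    have "a - b \<le> c - d + t" if "r - s \<le> t" "c - d + r = a - b + s" for a b c d r s t :: real
      using that by linarith
    from this[OF g J]
    have "(cnorm u)\<^sup>2 - (cnorm v)\<^sup>2 \<le> (cnorm h\<^sub>1)\<^sup>2 - (cnorm h\<^sub>2)\<^sup>2
        + (1 - (cmod z)\<^sup>2) * (2 * (b\<^sub>K * l\<^sup>2) * ((cnorm h\<^sub>1)\<^sup>2 + (cnorm h\<^sub>2)\<^sup>2))" .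
    then show "(cnorm u)\<^sup>2 - (cnorm v)\<^sup>2 \<le> (cnorm (U\<^sub>1\<^sub>1 z *\<^sub>v u + U\<^sub>1\<^sub>2 z *\<^sub>v v))\<^sup>2 - (cnorm (U\<^sub>2\<^sub>1 z *\<^sub>v u + U\<^sub>2\<^sub>2 z *\<^sub>v v))\<^sup>2
        + (1 - (cmod z)\<^sup>2) * (2 * (b\<^sub>K * l\<^sup>2) * ((cnorm (U\<^sub>1\<^sub>1 z *\<^sub>v u + U\<^sub>1\<^sub>2 z *\<^sub>v v))\<^sup>2 + (cnorm (U\<^sub>2\<^sub>1 z *\<^sub>v u + U\<^sub>2\<^sub>2 z *\<^sub>v v))\<^sup>2))"
      unfolding h\<^sub>1_def h\<^sub>2_def .
    have "(cnorm u)\<^sup>2 \<le> (k * (cnorm h\<^sub>1 + cnorm h\<^sub>2))\<^sup>2" by (rule power_mono[OF ub]) simp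
    also have "\<dots> = k\<^sup>2 * (cnorm h\<^sub>1 + cnorm h\<^sub>2)\<^sup>2" by (simp add: power_mult_distrib)
    also have "\<dots> \<le> k\<^sup>2 * (2 * ((cnorm h\<^sub>1)\<^sup>2 + (cnorm h\<^sub>2)\<^sup>2))" by (intro mult_left_mono sq) simp
    also have "\<dots> = (2 * k\<^sup>2) * ((cnorm h\<^sub>1)\<^sup>2 + (cnorm h\<^sub>2)\<^sup>2)" by simp
    also have "\<dots> \<le> (2 * k + 1)\<^sup>2 * ((cnorm h\<^sub>1)\<^sup>2 + (cnorm h\<^sub>2)\<^sup>2)"
    proof (rule mult_right_mono)
      have "(2 * k + 1)\<^sup>2 = 2 * k\<^sup>2 + 2 * k\<^sup>2 + 4 * k + 1" by (simp add: power2_eq_square algebra_simps)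
      then show "2 * k\<^sup>2 \<le> (2 * k + 1)\<^sup>2" using kl(1) zero_le_power2[of k] by linarith
    qed simp
    finally show "(cnorm u)\<^sup>2 \<le> (2 * k + 1)\<^sup>2 * ((cnorm (U\<^sub>1\<^sub>1 z *\<^sub>v u + U\<^sub>1\<^sub>2 z *\<^sub>v v))\<^sup>2 + (cnorm (U\<^sub>2\<^sub>1 z *\<^sub>v u + U\<^sub>2\<^sub>2 z *\<^sub>v v))\<^sup>2)"
      unfolding h\<^sub>1_def h\<^sub>2_def .
  next
    fix z :: complex and u :: "complex vec" assume z: "z \<in> \<D>" and u: "u \<in> carrier_vec (p - m)"
    have "U\<^sub>2\<^sub>1 z *\<^sub>v u + U\<^sub>2\<^sub>2 z *\<^sub>v 0\<^sub>v q = U\<^sub>2\<^sub>1 z *\<^sub>v u"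
      by (rule fv_cancel) (use mholoD(1)[OF mholo_U(3) z] mholoD(1)[OF mholo_U(4) z] u in simp_all)
    then show "cnorm (U\<^sub>2\<^sub>1 z *\<^sub>v u) \<le> \<beta> * cnorm u" using \<beta>(2)[OF z u zero_carrier_vec] by simp
  next
    fix z :: complex and v :: "complex vec" assume z: "z \<in> \<D>" and v: "v \<in> carrier_vec q"
    have "U\<^sub>2\<^sub>1 z *\<^sub>v 0\<^sub>v (p - m) + U\<^sub>2\<^sub>2 z *\<^sub>v v = U\<^sub>2\<^sub>2 z *\<^sub>v v"
      by (rule fv_cancel) (use mholoD(1)[OF mholo_U(3) z] mholoD(1)[OF mholo_U(4) z] v in simp_all)
    then show "cnorm (U\<^sub>2\<^sub>2 z *\<^sub>v v) \<le> \<beta> * cnorm v" using \<beta>(2)[OF z zero_carrier_vec v] by simp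
  next
    show "1 \<le> 2 * k + 1" "0 \<le> 2 * (b\<^sub>K * l\<^sup>2)" using kl(1) bK(1) by simp_all
  qed (fact mholo_U U_contractive \<beta>(1))+
  then show ?thesis by (rule that)
qed

end

section \<open>Solutions of the equation G X = K\<close>

context leech begin

abbreviation "transfer B D z \<equiv> D + z \<cdot>\<^sub>m (C * minv (1\<^sub>m n - z \<cdot>\<^sub>m A) * B)"

text \<open>Eliminating T \<xi> from the two realization equations of \<open>U_graph\<close> leaves
  G h_1 = K h_2.\<close>

lemma transfer_eq:
  assumes z: "z \<in> \<D>" and u: "u \<in> carrier_vec (p - m)" and v: "v \<in> carrier_vec q"
  shows "transfer B\<^sub>1 D\<^sub>1 z *\<^sub>v (U\<^sub>1\<^sub>1 z *\<^sub>v u + U\<^sub>1\<^sub>2 z *\<^sub>v v) = transfer B\<^sub>2 D\<^sub>2 z *\<^sub>v (U\<^sub>2\<^sub>1 z *\<^sub>v u + U\<^sub>2\<^sub>2 z *\<^sub>v v)"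
proof -
  define h\<^sub>1 where "h\<^sub>1 = U\<^sub>1\<^sub>1 z *\<^sub>v u + U\<^sub>1\<^sub>2 z *\<^sub>v v"
  define h\<^sub>2 where "h\<^sub>2 = U\<^sub>2\<^sub>1 z *\<^sub>v u + U\<^sub>2\<^sub>2 z *\<^sub>v v"
  obtain \<xi> where c: "\<xi> \<in> carrier_vec n" "h\<^sub>1 \<in> carrier_vec p" "h\<^sub>2 \<in> carrier_vec q"
    and g1: "D\<^sub>1 *\<^sub>v h\<^sub>1 - D\<^sub>2 *\<^sub>v h\<^sub>2 = z \<cdot>\<^sub>v (C *\<^sub>v (T *\<^sub>v \<xi>))"
    and g2: "(1\<^sub>m n - z \<cdot>\<^sub>m A) *\<^sub>v (T *\<^sub>v \<xi>) = B\<^sub>2 *\<^sub>v h\<^sub>2 - B\<^sub>1 *\<^sub>v h\<^sub>1"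
    by (rule U_graph[OF z u v h\<^sub>1_def h\<^sub>2_def])
  let ?R = "minv (1\<^sub>m n - z \<cdot>\<^sub>m A)"
  note d = carrier_vecD[OF c(1)] carrier_vecD[OF c(2)] carrier_vecD[OF c(3)]
    carrier_matD(1)[OF resolvent(2)[OF A A_stable z]] carrier_matD(2)[OF resolvent(2)[OF A A_stable z]]
  have Tx: "T *\<^sub>v \<xi> \<in> carrier_vec n" by (rule carrier_vecI) simp
  have "?R *\<^sub>v (B\<^sub>2 *\<^sub>v h\<^sub>2 - B\<^sub>1 *\<^sub>v h\<^sub>1) = T *\<^sub>v \<xi>"
    unfolding g2[symmetric] by (rule minv_solve(2)[OF resolvent_carrier[OF A] resolvent(1)[OF A A_stable z] Tx])
  from arg_cong[OF this, of fv] have 1: "fm T * fv \<xi> = fm ?R * (fm B\<^sub>2 * fv h\<^sub>2) - fm ?R * (fm B\<^sub>1 * fv h\<^sub>1)"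
    by (simp add: d right_diff_distrib)
  from arg_cong[OF g1, of fv] have 2: "fm D\<^sub>1 * fv h\<^sub>1 - fm D\<^sub>2 * fv h\<^sub>2 = smul z (fm C * (fm T * fv \<xi>))"
    by (simp add: d)
  have "transfer B\<^sub>1 D\<^sub>1 z *\<^sub>v h\<^sub>1 = transfer B\<^sub>2 D\<^sub>2 z *\<^sub>v h\<^sub>2"
    by (rule fv_cancel) (use 2 d in \<open>simp_all add: 1 smul_diff algebra_simps\<close>)
  then show ?thesis unfolding h\<^sub>1_def h\<^sub>2_def .
qed

lemma leech_of_schur:
  assumes Y: "schur (p - m) q Y"
  defines "X \<equiv> \<lambda>z. (U\<^sub>1\<^sub>2 z + U\<^sub>1\<^sub>1 z * Y z) * minv (U\<^sub>2\<^sub>2 z + U\<^sub>2\<^sub>1 z * Y z)"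
  shows "schur p q X" and "\<And>z. z \<in> \<D> \<Longrightarrow> invertible_mat (U\<^sub>2\<^sub>2 z + U\<^sub>2\<^sub>1 z * Y z)"
    and "\<And>z. z \<in> \<D> \<Longrightarrow> transfer B\<^sub>1 D\<^sub>1 z * X z = transfer B\<^sub>2 D\<^sub>2 z"
proof -
  obtain \<kappa> \<beta> \<gamma> where "lft p q (p - m) U\<^sub>1\<^sub>1 U\<^sub>1\<^sub>2 U\<^sub>2\<^sub>1 U\<^sub>2\<^sub>2 \<kappa> \<beta> \<gamma>" by (rule U_lft)
  then interpret l: lft p q "p - m" U\<^sub>1\<^sub>1 U\<^sub>1\<^sub>2 U\<^sub>2\<^sub>1 U\<^sub>2\<^sub>2 \<kappa> \<beta> \<gamma> .
  show 1: "schur p q X" unfolding X_def by (rule l.lft_schur[OF Y])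
  have hY: "mholo \<D> (p - m) q Y" using Y unfolding schur_def by simp
  fix z assume z: "z \<in> \<D>"
  let ?N = "U\<^sub>2\<^sub>2 z + U\<^sub>2\<^sub>1 z * Y z"
  note dn = l.denominator[OF Y z]
  have inj: "\<forall>x\<in>carrier_vec q. ?N *\<^sub>v x = 0\<^sub>v q \<longrightarrow> x = 0\<^sub>v q" using det_inj[OF dn(1)] dn(2) by blast
  show "invertible_mat ?N" by (rule minv_works(4)[OF dn(1) inj])
  have cX: "X z \<in> carrier_mat p q" using 1 z unfolding schur_def by (auto dest: mholoD)
  have tc: "transfer B D z \<in> carrier_mat m k" if "B \<in> carrier_mat n k" "D \<in> carrier_mat m k" for B D k
    by (intro add_carrier_mat smult_carrier_mat mult_carrier_mat[OF mult_carrier_mat[OF C resolvent(2)[OF A A_stable z]]] that)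
  show "transfer B\<^sub>1 D\<^sub>1 z * X z = transfer B\<^sub>2 D\<^sub>2 z"
  proof (rule mat_eq_vecI[OF mult_carrier_mat[OF tc[OF B\<^sub>1 D\<^sub>1] cX] tc[OF B\<^sub>2 D\<^sub>2]])
    fix y :: "complex vec" assume y: "y \<in> carrier_vec q"
    define x where "x = minv ?N *\<^sub>v y"
    have x: "x \<in> carrier_vec q" unfolding x_def using minv_works(1)[OF dn(1) inj] by simp
    have yx: "Y z *\<^sub>v x \<in> carrier_vec (p - m)" using mholoD(1)[OF hY z] by simp
    have Nx: "U\<^sub>2\<^sub>1 z *\<^sub>v (Y z *\<^sub>v x) + U\<^sub>2\<^sub>2 z *\<^sub>v x = y"
      using minv_solve(1)[OF dn(1) inj y] dn(3)[OF x] unfolding x_def by simp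
    have cn: "U\<^sub>1\<^sub>2 z + U\<^sub>1\<^sub>1 z * Y z \<in> carrier_mat p q"
      by (rule add_carrier_mat[OF mult_carrier_mat[OF l.c11[OF z] mholoD(1)[OF hY z]]])
    have "X z *\<^sub>v y = U\<^sub>1\<^sub>1 z *\<^sub>v (Y z *\<^sub>v x) + U\<^sub>1\<^sub>2 z *\<^sub>v x"
      using assoc_mult_mat_vec[OF cn minv_works(1)[OF dn(1) inj] y] dn(4)[OF x] unfolding x_def X_def by simp
    then show "transfer B\<^sub>1 D\<^sub>1 z * X z *\<^sub>v y = transfer B\<^sub>2 D\<^sub>2 z *\<^sub>v y"
      using assoc_mult_mat_vec[OF tc[OF B\<^sub>1 D\<^sub>1] cX y] transfer_eq[OF z yx x] unfolding Nx by simp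
  qed
qed

text \<open>The inputs that produce the outputs X and 1 are recovered as in
  \<open>U_state_bound\<close>, now as matrix functions. What has to be verified is that they are
  consistent with the state equation of \<open>U_eval\<close>.\<close>

lemma leech_onto:
  assumes X: "schur p q X" and GX: "\<And>z. z \<in> \<D> \<Longrightarrow> transfer B\<^sub>1 D\<^sub>1 z * X z = transfer B\<^sub>2 D\<^sub>2 z"
  shows "\<exists>Y. schur (p - m) q Y \<and> (\<forall>z\<in>\<D>. (U\<^sub>1\<^sub>2 z + U\<^sub>1\<^sub>1 z * Y z) * minv (U\<^sub>2\<^sub>2 z + U\<^sub>2\<^sub>1 z * Y z) = X z)"
proof -
  obtain \<kappa> \<beta> \<gamma> where "lft p q (p - m) U\<^sub>1\<^sub>1 U\<^sub>1\<^sub>2 U\<^sub>2\<^sub>1 U\<^sub>2\<^sub>2 \<kappa> \<beta> \<gamma>" by (rule U_lft)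
  then interpret l: lft p q "p - m" U\<^sub>1\<^sub>1 U\<^sub>1\<^sub>2 U\<^sub>2\<^sub>1 U\<^sub>2\<^sub>2 \<kappa> \<beta> \<gamma> .
  have hX: "mholo \<D> p q X" using X unfolding schur_def by simp
  have inj0: "\<forall>x\<in>carrier_vec q. N\<^sub>0 *\<^sub>v x = 0\<^sub>v q \<longrightarrow> x = 0\<^sub>v q" by (rule positive_definite_matD(4)[OF carrE(5) N\<^sub>0_pd])
  have N0i: "minv N\<^sub>0 \<in> carrier_mat q q" by (rule minv_works(1)[OF carrE(5) inj0])
  have Ti: "minv T \<in> carrier_mat n n" by (rule minv_works(1)[OF Tc T_inj])
  have TW: "\<Theta>\<^sup>\<dagger> * W\<^sub>0 \<in> carrier_mat (p - m) p" by (rule mult_carrier_mat[OF mat_adjoint_carrier[OF \<Theta>c] W\<^sub>0c])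
  \<comment> \<open>State and inputs before normalization. V inverts the formula for the second
    output, U applies the left inverse of \<Theta> to what remains of the first.\<close>
  define \<Xi> where "\<Xi> z = - (minv T * (minv (1\<^sub>m n - z \<cdot>\<^sub>m A) * (B\<^sub>1 * X z - B\<^sub>2)))" for z
  define V where "V z = minv N\<^sub>0 * (1\<^sub>m q - z \<cdot>\<^sub>m (C\<^sub>2 * \<Xi> z))" for z
  define U where "U z = \<Theta>\<^sup>\<dagger> * W\<^sub>0 * (X z - z \<cdot>\<^sub>m (C\<^sub>1 * \<Xi> z) - X\<^sub>0 * V z)" for z
  have h\<Xi>: "mholo \<D> n q \<Xi>" unfolding \<Xi>_def
    by (rule mholo_uminus[OF mholo_mult[OF mholo_const[OF Ti] mholo_mult[OF mholo_resolvent[OF A A_stable]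
        mholo_diff[OF mholo_mult[OF mholo_const[OF B\<^sub>1] hX] mholo_const[OF B\<^sub>2]]]]])
  have hV: "mholo \<D> q q V" unfolding V_def
    by (rule mholo_mult[OF mholo_const[OF N0i] mholo_diff[OF mholo_const[OF one_carrier_mat]
        mholo_smult[OF holomorphic_on_ident mholo_mult[OF mholo_const[OF C\<^sub>2c] h\<Xi>]]]])
  have hU: "mholo \<D> (p - m) q U" unfolding U_def
    by (rule mholo_mult[OF mholo_const[OF TW] mholo_diff[OF mholo_diff[OF hX
        mholo_smult[OF holomorphic_on_ident mholo_mult[OF mholo_const[OF C\<^sub>1c] h\<Xi>]]] mholo_mult[OF mholo_const[OF carrE(2)] hV]]])
  have main: "U\<^sub>1\<^sub>1 z *\<^sub>v (\<Delta>\<^sub>1 *\<^sub>v (U z *\<^sub>v x)) + U\<^sub>1\<^sub>2 z *\<^sub>v (\<Delta>\<^sub>0 *\<^sub>v (V z *\<^sub>v x)) = X z *\<^sub>v x"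
    "U\<^sub>2\<^sub>1 z *\<^sub>v (\<Delta>\<^sub>1 *\<^sub>v (U z *\<^sub>v x)) + U\<^sub>2\<^sub>2 z *\<^sub>v (\<Delta>\<^sub>0 *\<^sub>v (V z *\<^sub>v x)) = x"
    if z: "z \<in> \<D>" and x: "x \<in> carrier_vec q" for z x
  proof -
    let ?R = "minv (1\<^sub>m n - z \<cdot>\<^sub>m A)"
    note cm = mholoD(1)[OF hX z] mholoD(1)[OF h\<Xi> z] mholoD(1)[OF hV z] mholoD(1)[OF hU z] resolvent(2)[OF A A_stable z] N0i Ti
    note dm = cm[THEN carrier_matD(1)] cm[THEN carrier_matD(2)] carrier_vecD[OF x]
    define h where "h = X z *\<^sub>v x"
    define \<xi> where "\<xi> = \<Xi> z *\<^sub>v x"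
    define v where "v = V z *\<^sub>v x"
    define u where "u = U z *\<^sub>v x"
    have c: "h \<in> carrier_vec p" "\<xi> \<in> carrier_vec n" "v \<in> carrier_vec q" "u \<in> carrier_vec (p - m)"
      unfolding h_def \<xi>_def v_def u_def using cm by simp_all
    note d = c[THEN carrier_vecD] carrier_vecD[OF x]
    have fh: "fv h = fm (X z) * fv x" unfolding h_def by (simp add: dm)
    have f\<xi>: "fv \<xi> = - (fm (minv T) * (fm ?R * (fm B\<^sub>1 * fv h - fm B\<^sub>2 * fv x)))"
      unfolding \<xi>_def \<Xi>_def fh by (simp add: dm algebra_simps)
    have fv: "fv v = fm (minv N\<^sub>0) * (fv x - smul z (fm C\<^sub>2 * fv \<xi>))"
      unfolding v_def V_def \<xi>_def by (simp add: dm algebra_simps)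
    have fu: "fv u = adj (fm \<Theta>) * (fm W\<^sub>0 * (fv h - smul z (fm C\<^sub>1 * fv \<xi>) - fm X\<^sub>0 * fv v))"
      unfolding u_def U_def \<xi>_def v_def fh by (simp add: dm algebra_simps)
    have one: "fm (1\<^sub>m n) * (fm ?R * Y) = fm ?R * Y" for Y by (rule fm_one_left_assoc) (simp add: dm)
    have tx: "fm T * fv \<xi> = fv \<xi> - fm P * (fm Q * fv \<xi>)" using fT_apply[OF c(2)] d by simp
    have Tx: "fm T * fv \<xi> = - (fm ?R * (fm B\<^sub>1 * fv h - fm B\<^sub>2 * fv x))"
    proof -
      have "fm T * fv \<xi> = - ((fm T * fm (minv T)) * (fm ?R * (fm B\<^sub>1 * fv h - fm B\<^sub>2 * fv x)))"
        unfolding f\<xi> by (simp only: mult.assoc mult_minus_right)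
      then show ?thesis unfolding minv_fm(1)[OF Tc T_inj] one .
    qed
    define w where "w = B\<^sub>1 *\<^sub>v h - B\<^sub>2 *\<^sub>v x"
    have w: "w \<in> carrier_vec n" unfolding w_def by (rule carrier_vecI) simp
    have fw: "fm B\<^sub>1 * fv h - fm B\<^sub>2 * fv x = fv w" unfolding w_def using d by simp
    have RT: "fm T * fv \<xi> = smul z (fm A * (fm T * fv \<xi>)) - fv w"
      using resolvent_solve(2)[OF A A_stable z w] unfolding Tx fw by (simp add: algebra_simps)
    have a: "fv x = fv v + fm L * fv v + fm C\<^sub>2 * smul z (fv \<xi>)"
    proof -
      have "fm N\<^sub>0 * fv v = (fm N\<^sub>0 * fm (minv N\<^sub>0)) * (fv x - smul z (fm C\<^sub>2 * fv \<xi>))" unfolding fv by (simp only: mult.assoc)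
      then have "fm N\<^sub>0 * fv v = fv x - smul z (fm C\<^sub>2 * fv \<xi>)"
        unfolding minv_fm(1)[OF carrE(5) inj0] using d by (simp add: right_diff_distrib)
      then show ?thesis using d by (simp add: N\<^sub>0_def distrib_right eq_diff_eq)
    qed
    define y where "y = h - z \<cdot>\<^sub>v (C\<^sub>1 *\<^sub>v \<xi>) - X\<^sub>0 *\<^sub>v v"
    have y: "y \<in> carrier_vec p" unfolding y_def by (rule carrier_vecI) simp
    have fy: "fv y = fv h - smul z (fm C\<^sub>1 * fv \<xi>) - fm X\<^sub>0 * fv v" unfolding y_def using d by simp
    \<comment> \<open>\<open>d_C\<close> and \<open>d_X\<close> reduce D_1 y to (G X - K) x. On the
      kernel of D_1 the product of \<Theta> with its left inverse is the identity, so y is indeed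
      \<Theta> u.\<close>
    have "fm D\<^sub>1 * fv y = 0"
    proof -
      have dC: "fm D\<^sub>1 * (fm C\<^sub>1 * fv \<xi>) = fm D\<^sub>2 * (fm C\<^sub>2 * fv \<xi>) + fm C * (fm T * fv \<xi>)"
        using arg_cong[OF F.d_C, of "\<lambda>X. X * fv \<xi>"] unfolding tx by (simp add: algebra_simps)
      have dX: "fm D\<^sub>1 * (fm X\<^sub>0 * fv v) = fm D\<^sub>2 * (fv v + fm L * fv v)"
        using arg_cong[OF FL.d_X, of "\<lambda>X. X * fv v"] by (simp add: algebra_simps)
      have dv: "fv v + fm L * fv v = fv x - smul z (fm C\<^sub>2 * fv \<xi>)" using a by simp
      have "fm (transfer B\<^sub>1 D\<^sub>1 z * X z) * fv x = fm (transfer B\<^sub>2 D\<^sub>2 z) * fv x" unfolding GX[OF z] ..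
      then have G: "fm D\<^sub>1 * fv h + smul z (fm C * (fm ?R * (fm B\<^sub>1 * fv h))) = fm D\<^sub>2 * fv x + smul z (fm C * (fm ?R * (fm B\<^sub>2 * fv x)))"
        unfolding fh by (simp add: dm algebra_simps)
      have "fm D\<^sub>1 * fv y = fm D\<^sub>1 * fv h - smul z (fm D\<^sub>2 * (fm C\<^sub>2 * fv \<xi>) + fm C * (fm T * fv \<xi>)) - fm D\<^sub>2 * (fv x - smul z (fm C\<^sub>2 * fv \<xi>))"
        unfolding fy right_diff_distrib dX dv smul_mult_right dC by simp
      also have "\<dots> = fm D\<^sub>1 * fv h - fm D\<^sub>2 * fv x + smul z (fm C * (fm ?R * (fm B\<^sub>1 * fv h))) - smul z (fm C * (fm ?R * (fm B\<^sub>2 * fv x)))"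
        unfolding Tx by (simp add: smul_add smul_diff algebra_simps)
      also have "\<dots> = 0" using G by (simp add: algebra_simps)
      finally show ?thesis .
    qed
    then have "D\<^sub>1 *\<^sub>v y = 0\<^sub>v m" by (intro fv_cancel) (use y in simp_all)
    from arg_cong[OF \<Theta>proj[OF y this], of fv] have "fm \<Theta> * fv u = fv y"
      unfolding fu fy[symmetric] using y by simp
    then have b: "fv h = fm \<Theta> * fv u + fm X\<^sub>0 * fv v + fm C\<^sub>1 * smul z (fv \<xi>)"
      unfolding fy by (simp add: algebra_simps)
    have eq: "fv \<xi> = fm A\<^sub>0 * smul z (fv \<xi>) - fm \<eta> * fv u + fm B\<^sub>0 * fv v"
    proof -
      \<comment> \<open>\<xi> was defined through A. The right-hand side of the state equation with
        \<open>A\<^sub>0\<close> has the same image under T, by \<open>graph\<close>, and T is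
        injective.\<close>
      define \<xi>' where "\<xi>' = A\<^sub>0 *\<^sub>v (z \<cdot>\<^sub>v \<xi>) - \<eta> *\<^sub>v u + B\<^sub>0 *\<^sub>v v"
      have c': "\<xi>' \<in> carrier_vec n" unfolding \<xi>'_def by (rule carrier_vecI) simp
      have e: "fv \<xi>' = fm A\<^sub>0 * smul z (fv \<xi>) - fm \<eta> * fv u + fm B\<^sub>0 * fv v" unfolding \<xi>'_def using d by simp
      have tx': "fm T * fv \<xi>' = fv \<xi>' - fm P * (fm Q * fv \<xi>')" using fT_apply[OF c'] c' by simp
      note g = FL.graph(2)[where u = "fv u" and v = "fv v" and \<zeta> = "smul z (fv \<xi>)", unfolded a[symmetric] b[symmetric] e[symmetric]]
      have "fm T * fv \<xi>' = smul z (fm A * (fm T * fv \<xi>)) - fv w"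
        unfolding tx' tx fw[symmetric] using g by (simp add: smul_diff mult.assoc right_diff_distrib)
      then have "T *\<^sub>v \<xi>' = T *\<^sub>v \<xi>" unfolding RT[symmetric] by (intro fv_cancel) (use c' d in simp_all)
      from arg_cong[OF this, of "(*\<^sub>v) (minv T)"] have "\<xi>' = \<xi>"
        unfolding minv_solve(2)[OF Tc T_inj c'] minv_solve(2)[OF Tc T_inj c(2)] .
      with e show ?thesis by simp
    qed
    note ev = U_eval[OF z c(4,3,2) refl refl eq, folded a b]
    show "U\<^sub>1\<^sub>1 z *\<^sub>v (\<Delta>\<^sub>1 *\<^sub>v (U z *\<^sub>v x)) + U\<^sub>1\<^sub>2 z *\<^sub>v (\<Delta>\<^sub>0 *\<^sub>v (V z *\<^sub>v x)) = X z *\<^sub>v x"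
      unfolding h_def[symmetric] u_def[symmetric] v_def[symmetric]
      by (rule fv_cancel[OF ev(1)]) (simp add: d carrier_matD(1)[OF l.c12[OF z]])
    show "U\<^sub>2\<^sub>1 z *\<^sub>v (\<Delta>\<^sub>1 *\<^sub>v (U z *\<^sub>v x)) + U\<^sub>2\<^sub>2 z *\<^sub>v (\<Delta>\<^sub>0 *\<^sub>v (V z *\<^sub>v x)) = x"
      unfolding u_def[symmetric] v_def[symmetric]
      by (rule fv_cancel[OF ev(2)]) (simp add: d carrier_matD(1)[OF l.c22[OF z]])
  qed
  have hU': "mholo \<D> (p - m) q (\<lambda>z. \<Delta>\<^sub>1 * U z)" by (rule mholo_mult[OF mholo_const[OF \<Delta>\<^sub>1_props(1)] hU])
  have hV': "mholo \<D> q q (\<lambda>z. \<Delta>\<^sub>0 * V z)" by (rule mholo_mult[OF mholo_const[OF \<Delta>\<^sub>0_props(1)] hV])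
  show ?thesis
  proof (rule l.lft_onto[OF X hU' hV'])
    fix z assume z: "z \<in> \<D>"
    note cm = l.c11[OF z] l.c12[OF z] l.c21[OF z] l.c22[OF z] mholoD(1)[OF hU z] mholoD(1)[OF hV z] mholoD(1)[OF hX z]
      mholoD(1)[OF hU' z] mholoD(1)[OF hV' z]
    note dm = cm[THEN carrier_matD(1)] cm[THEN carrier_matD(2)]
    have ap: "(F * (\<Delta>\<^sub>1 * U z) + H * (\<Delta>\<^sub>0 * V z)) *\<^sub>v x = F *\<^sub>v (\<Delta>\<^sub>1 *\<^sub>v (U z *\<^sub>v x)) + H *\<^sub>v (\<Delta>\<^sub>0 *\<^sub>v (V z *\<^sub>v x))"
      if "x \<in> carrier_vec q" "F \<in> carrier_mat k (p - m)" "H \<in> carrier_mat k q" for x F H k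
      by (rule fv_cancel) (use that in \<open>simp_all add: dm distrib_right mult.assoc\<close>)
    show "U\<^sub>1\<^sub>1 z * (\<Delta>\<^sub>1 * U z) + U\<^sub>1\<^sub>2 z * (\<Delta>\<^sub>0 * V z) = X z"
      by (rule mat_eq_vecI[OF add_carrier_mat[OF mult_carrier_mat[OF cm(2,9)]] cm(7)]) (simp add: ap[OF _ cm(1,2)] main(1)[OF z])
    show "U\<^sub>2\<^sub>1 z * (\<Delta>\<^sub>1 * U z) + U\<^sub>2\<^sub>2 z * (\<Delta>\<^sub>0 * V z) = 1\<^sub>m q"
      by (rule mat_eq_vecI[OF add_carrier_mat[OF mult_carrier_mat[OF cm(4,9)]] one_carrier_mat]) (simp add: ap[OF _ cm(3,4)] main(2)[OF z])
  qed
qed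

end

text \<open>Positivity is evaluated on the test sequences, whose adjoint images are again of the
  form \<open>st\<close> with outputs \<open>C\<^sub>1\<close> and \<open>C\<^sub>2\<close>.\<close>

lemma (in riccati) riccati_posI:
  assumes e: "0 < e" and pos: "\<And>f. f \<in> ell2 m \<Longrightarrow>
    e * (\<Sum>i. (cnorm (f i))\<^sup>2) + (\<Sum>i. (cnorm (coeff_adj q (ss_coeff A B\<^sub>2 C D\<^sub>2) f i))\<^sup>2)
      \<le> (\<Sum>i. (cnorm (coeff_adj p (ss_coeff A B\<^sub>1 C D\<^sub>1) f i))\<^sup>2)"
  shows "riccati_pos m p q n A B\<^sub>1 B\<^sub>2 C D\<^sub>1 D\<^sub>2 P Q R \<Gamma> \<Delta> C\<^sub>0 A\<^sub>0 C\<^sub>1 C\<^sub>2 e"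
proof
  fix c x :: "complex vec" assume c: "c \<in> carrier_vec m" and x: "x \<in> carrier_vec n"
  obtain a \<rho> where dA: "decay n A a \<rho>" using stable_decay[OF A A_stable] by blast
  obtain b \<rho>' where d0: "decay n A\<^sub>0 b \<rho>'" using stable_decay[OF A\<^sub>0c A\<^sub>0_stable] by blast
  have c1: "D\<^sub>1\<^sup>\<dagger> *\<^sub>v c + B\<^sub>1\<^sup>\<dagger> *\<^sub>v (Q *\<^sub>v x) \<in> carrier_vec p" and c2: "D\<^sub>2\<^sup>\<dagger> *\<^sub>v c + B\<^sub>2\<^sup>\<dagger> *\<^sub>v (Q *\<^sub>v x) \<in> carrier_vec q"
    by (rule carrier_vecI, simp)+
  show "e * ((cnorm c)\<^sup>2 + (\<Sum>i. (cnorm (C\<^sub>0 *\<^sub>v (A\<^sub>0 ^\<^sub>m i *\<^sub>v x)))\<^sup>2))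
        + ((cnorm (D\<^sub>2\<^sup>\<dagger> *\<^sub>v c + B\<^sub>2\<^sup>\<dagger> *\<^sub>v (Q *\<^sub>v x)))\<^sup>2 + (\<Sum>i. (cnorm (C\<^sub>2 *\<^sub>v (A\<^sub>0 ^\<^sub>m i *\<^sub>v x)))\<^sup>2))
      \<le> (cnorm (D\<^sub>1\<^sup>\<dagger> *\<^sub>v c + B\<^sub>1\<^sup>\<dagger> *\<^sub>v (Q *\<^sub>v x)))\<^sup>2 + (\<Sum>i. (cnorm (C\<^sub>1 *\<^sub>v (A\<^sub>0 ^\<^sub>m i *\<^sub>v x)))\<^sup>2)"
    using pos[OF st_ell2(1)[OF d0 C\<^sub>0c c x]]
    unfolding coeff_adj_st[OF dA C B\<^sub>1 D\<^sub>1 d0 C\<^sub>0c Q ric c x, folded C\<^sub>1] coeff_adj_st[OF dA C B\<^sub>2 D\<^sub>2 d0 C\<^sub>0c Q ric c x, folded C\<^sub>2]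
      st_ell2(3)[OF d0 C\<^sub>0c c x] st_ell2(3)[OF d0 C\<^sub>1c c1 x] st_ell2(3)[OF d0 C\<^sub>2c c2 x] .
qed (rule e)

section \<open>The two Riccati equations combined into the parametrization\<close>

lemma schur_restrict: "schur k r F \<Longrightarrow> schur k r (restrict F \<D>)"
  unfolding schur_def by (auto intro: mholo_cong)

theorem theorem1p1:
  fixes m p q n :: nat
    and G K :: "complex \<Rightarrow> complex mat"
    and A B\<^sub>1 B\<^sub>2 C D\<^sub>1 D\<^sub>2 P\<^sub>1 P\<^sub>2 Q Q\<^sub>0 \<Theta>\<^sub>0 :: "complex mat"
    and R\<^sub>0 \<Gamma> R\<^sub>1\<^sub>0 \<Gamma>\<^sub>0 \<Delta> A\<^sub>0 C\<^sub>0 C\<^sub>1 C\<^sub>2 \<Omega> B\<^sub>0 \<Delta>\<^sub>0 \<Delta>\<^sub>1 :: "complex mat"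
    and \<Upsilon>\<^sub>1\<^sub>1 \<Upsilon>\<^sub>2\<^sub>1 \<Upsilon>\<^sub>1\<^sub>2 \<Upsilon>\<^sub>2\<^sub>2 :: "complex \<Rightarrow> complex mat"
  assumes G: "stable_rational m p G" and K: "stable_rational m q K"
    and pos: "strictly_positive (ell2 m) ell2_inner
      (\<lambda>f i. toeplitz_op m p G (toeplitz_adj m p G f) i - toeplitz_op m q K (toeplitz_adj m q K f) i)"
    and G_inj: "\<not> (\<exists>x\<in>carrier_vec p. x \<noteq> 0\<^sub>v p \<and> (\<forall>z\<in>\<D>. G z *\<^sub>v x = 0\<^sub>v m))"
    and A: "A \<in> carrier_mat n n" and C: "C \<in> carrier_mat m n"
    and B\<^sub>1: "B\<^sub>1 \<in> carrier_mat n p" and B\<^sub>2: "B\<^sub>2 \<in> carrier_mat n q"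
    and D\<^sub>1: "D\<^sub>1 \<in> carrier_mat m p" and D\<^sub>2: "D\<^sub>2 \<in> carrier_mat m q"
    and G_real: "\<forall>z\<in>\<D>. G z = D\<^sub>1 + z \<cdot>\<^sub>m (C * minv (1\<^sub>m n - z \<cdot>\<^sub>m A) * B\<^sub>1)"
    and K_real: "\<forall>z\<in>\<D>. K z = D\<^sub>2 + z \<cdot>\<^sub>m (C * minv (1\<^sub>m n - z \<cdot>\<^sub>m A) * B\<^sub>2)"
    and A_stable: "stable_mat A" and CA_obs: "observable C A"
    and P\<^sub>1: "P\<^sub>1 \<in> carrier_mat n n" "P\<^sub>1 - A * P\<^sub>1 * A\<^sup>\<dagger> = B\<^sub>1 * B\<^sub>1\<^sup>\<dagger>"
    and P\<^sub>2: "P\<^sub>2 \<in> carrier_mat n n" "P\<^sub>2 - A * P\<^sub>2 * A\<^sup>\<dagger> = B\<^sub>2 * B\<^sub>2\<^sup>\<dagger>"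
    and R\<^sub>0: "R\<^sub>0 = D\<^sub>1 * D\<^sub>1\<^sup>\<dagger> - D\<^sub>2 * D\<^sub>2\<^sup>\<dagger> + C * (P\<^sub>1 - P\<^sub>2) * C\<^sup>\<dagger>"
    and \<Gamma>: "\<Gamma> = B\<^sub>1 * D\<^sub>1\<^sup>\<dagger> - B\<^sub>2 * D\<^sub>2\<^sup>\<dagger> + A * (P\<^sub>1 - P\<^sub>2) * C\<^sup>\<dagger>"
    and R\<^sub>1\<^sub>0: "R\<^sub>1\<^sub>0 = D\<^sub>1 * D\<^sub>1\<^sup>\<dagger> + C * P\<^sub>1 * C\<^sup>\<dagger>"
    and \<Gamma>\<^sub>0: "\<Gamma>\<^sub>0 = B\<^sub>1 * D\<^sub>1\<^sup>\<dagger> + A * P\<^sub>1 * C\<^sup>\<dagger>"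
    and Q: "stabilizing_solution A C R\<^sub>0 \<Gamma> Q"
    and Q\<^sub>0: "stabilizing_solution A C R\<^sub>1\<^sub>0 \<Gamma>\<^sub>0 Q\<^sub>0"
    and \<Theta>\<^sub>0: "left_minimal_rank_factor m p G \<Theta>\<^sub>0"
    and \<Delta>: "\<Delta> = R\<^sub>0 - \<Gamma>\<^sup>\<dagger> * Q * \<Gamma>"
    and A\<^sub>0: "A\<^sub>0 = A - \<Gamma> * minv \<Delta> * (C - \<Gamma>\<^sup>\<dagger> * Q * A)"
    and C\<^sub>0: "C\<^sub>0 = minv \<Delta> * (C - \<Gamma>\<^sup>\<dagger> * Q * A)"
    and C\<^sub>1: "C\<^sub>1 = D\<^sub>1\<^sup>\<dagger> * C\<^sub>0 + B\<^sub>1\<^sup>\<dagger> * Q * A\<^sub>0"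
    and C\<^sub>2: "C\<^sub>2 = D\<^sub>2\<^sup>\<dagger> * C\<^sub>0 + B\<^sub>2\<^sup>\<dagger> * Q * A\<^sub>0"
    and \<Omega>: "\<Omega> = (P\<^sub>1 - P\<^sub>2) * minv (minv Q + P\<^sub>2 - P\<^sub>1) * minv Q"
    and B\<^sub>0: "B\<^sub>0 = B\<^sub>2 - \<Gamma> * minv \<Delta> * (D\<^sub>2 - \<Gamma>\<^sup>\<dagger> * Q * B\<^sub>2) + A\<^sub>0 * \<Omega> * C\<^sub>2\<^sup>\<dagger>"
    and \<Delta>\<^sub>0: "\<Delta>\<^sub>0 = pos_sqrt_mat (1\<^sub>m q + C\<^sub>2 * \<Omega> * C\<^sub>2\<^sup>\<dagger>
      + (D\<^sub>2 - \<Gamma>\<^sup>\<dagger> * Q * B\<^sub>2)\<^sup>\<dagger> * minv \<Delta> * (D\<^sub>2 - \<Gamma>\<^sup>\<dagger> * Q * B\<^sub>2) + B\<^sub>2\<^sup>\<dagger> * Q * B\<^sub>2)"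
    and \<Delta>\<^sub>1: "\<Delta>\<^sub>1 = pos_sqrt_mat (1\<^sub>m (p - m)
      + \<Theta>\<^sub>0\<^sup>\<dagger> * B\<^sub>1\<^sup>\<dagger> * (minv (minv Q + P\<^sub>2 - P\<^sub>1) - minv (minv Q\<^sub>0 - P\<^sub>1)) * B\<^sub>1 * \<Theta>\<^sub>0)"
    and \<Upsilon>\<^sub>1\<^sub>1: "\<Upsilon>\<^sub>1\<^sub>1 = (\<lambda>z. \<Theta>\<^sub>0 * minv \<Delta>\<^sub>1
      - z \<cdot>\<^sub>m (C\<^sub>1 * minv (1\<^sub>m n - z \<cdot>\<^sub>m A\<^sub>0) * minv Q * minv (minv Q + P\<^sub>2 - P\<^sub>1) * B\<^sub>1 * \<Theta>\<^sub>0 * minv \<Delta>\<^sub>1))"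
    and \<Upsilon>\<^sub>2\<^sub>1: "\<Upsilon>\<^sub>2\<^sub>1 = (\<lambda>z.
      - (z \<cdot>\<^sub>m (C\<^sub>2 * minv (1\<^sub>m n - z \<cdot>\<^sub>m A\<^sub>0) * minv Q * minv (minv Q + P\<^sub>2 - P\<^sub>1) * B\<^sub>1 * \<Theta>\<^sub>0 * minv \<Delta>\<^sub>1)))"
    and \<Upsilon>\<^sub>1\<^sub>2: "\<Upsilon>\<^sub>1\<^sub>2 = (\<lambda>z. (D\<^sub>1\<^sup>\<dagger> * minv \<Delta> * (D\<^sub>2 - \<Gamma>\<^sup>\<dagger> * Q * B\<^sub>2) + D\<^sub>1\<^sup>\<dagger> * C\<^sub>0 * \<Omega> * C\<^sub>2\<^sup>\<dagger>
        + B\<^sub>1\<^sup>\<dagger> * Q * B\<^sub>0) * minv \<Delta>\<^sub>0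
      + z \<cdot>\<^sub>m (C\<^sub>1 * minv (1\<^sub>m n - z \<cdot>\<^sub>m A\<^sub>0) * B\<^sub>0 * minv \<Delta>\<^sub>0))"
    and \<Upsilon>\<^sub>2\<^sub>2: "\<Upsilon>\<^sub>2\<^sub>2 = (\<lambda>z. \<Delta>\<^sub>0 + z \<cdot>\<^sub>m (C\<^sub>2 * minv (1\<^sub>m n - z \<cdot>\<^sub>m A\<^sub>0) * B\<^sub>0 * minv \<Delta>\<^sub>0))"
  shows "(\<forall>Y\<in>Hinf (p - m) q. hinf_norm Y \<le> 1 \<longrightarrow>
            (\<forall>z\<in>\<D>. invertible_mat (\<Upsilon>\<^sub>2\<^sub>2 z + \<Upsilon>\<^sub>2\<^sub>1 z * Y z))) \<and>
         leech_solutions p q G K =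
           (\<lambda>Y. \<lambda>z\<in>\<D>. (\<Upsilon>\<^sub>1\<^sub>2 z + \<Upsilon>\<^sub>1\<^sub>1 z * Y z) * minv (\<Upsilon>\<^sub>2\<^sub>2 z + \<Upsilon>\<^sub>2\<^sub>1 z * Y z))
             ` {Y \<in> Hinf (p - m) q. hinf_norm Y \<le> 1}"
proof -
  let ?P = "P\<^sub>1 - P\<^sub>2" and ?C\<^sub>0 = "minv (R\<^sub>1\<^sub>0 - \<Gamma>\<^sub>0\<^sup>\<dagger> * Q\<^sub>0 * \<Gamma>\<^sub>0) * (C - \<Gamma>\<^sub>0\<^sup>\<dagger> * Q\<^sub>0 * A)"
    and ?A\<^sub>0 = "A - \<Gamma>\<^sub>0 * minv (R\<^sub>1\<^sub>0 - \<Gamma>\<^sub>0\<^sup>\<dagger> * Q\<^sub>0 * \<Gamma>\<^sub>0) * (C - \<Gamma>\<^sub>0\<^sup>\<dagger> * Q\<^sub>0 * A)"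
  have d [simp]: "dim_row A = n" "dim_col A = n" "dim_row C = m" "dim_col C = n" "dim_row B\<^sub>1 = n" "dim_col B\<^sub>1 = p"
    "dim_row B\<^sub>2 = n" "dim_col B\<^sub>2 = q" "dim_row D\<^sub>1 = m" "dim_col D\<^sub>1 = p" "dim_row D\<^sub>2 = m" "dim_col D\<^sub>2 = q"
    "dim_row P\<^sub>1 = n" "dim_col P\<^sub>1 = n" "dim_row P\<^sub>2 = n" "dim_col P\<^sub>2 = n"
    using A C B\<^sub>1 B\<^sub>2 D\<^sub>1 D\<^sub>2 P\<^sub>1(1) P\<^sub>2(1) by auto
  obtain a \<rho> where dA: "decay n A a \<rho>" using stable_decay[OF A A_stable] by blast
  have tG: "taylor_coeff m p G = ss_coeff A B\<^sub>1 C D\<^sub>1" by (rule ext) (rule taylor_state_space[OF dA C B\<^sub>1 D\<^sub>1 G_real])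
  have tK: "taylor_coeff m q K = ss_coeff A B\<^sub>2 C D\<^sub>2" by (rule ext) (rule taylor_state_space[OF dA C B\<^sub>2 D\<^sub>2 K_real])
  obtain b where cG: "coeff_decay m p (ss_coeff A B\<^sub>1 C D\<^sub>1) b \<rho>" by (rule ss_coeff_decay[OF dA C B\<^sub>1 D\<^sub>1])
  obtain b' where cK: "coeff_decay m q (ss_coeff A B\<^sub>2 C D\<^sub>2) b' \<rho>" by (rule ss_coeff_decay[OF dA C B\<^sub>2 D\<^sub>2])
  obtain e where e: "e > 0" "\<And>f. f \<in> ell2 m \<Longrightarrow>
    e * (\<Sum>i. (cnorm (f i))\<^sup>2) + (\<Sum>i. (cnorm (coeff_adj q (ss_coeff A B\<^sub>2 C D\<^sub>2) f i))\<^sup>2)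
      \<le> (\<Sum>i. (cnorm (coeff_adj p (ss_coeff A B\<^sub>1 C D\<^sub>1) f i))\<^sup>2)"
    using pos_adjoints[OF pos, unfolded tG tK, OF cG cK] by blast
  have r: "riccati m p q n A B\<^sub>1 B\<^sub>2 C D\<^sub>1 D\<^sub>2 ?P Q R\<^sub>0 \<Gamma> \<Delta> C\<^sub>0 A\<^sub>0 C\<^sub>1 C\<^sub>2"
  proof
    show "?P - A * ?P * A\<^sup>\<dagger> = B\<^sub>1 * B\<^sub>1\<^sup>\<dagger> - B\<^sub>2 * B\<^sub>2\<^sup>\<dagger>"
      unfolding P\<^sub>1(2)[symmetric] P\<^sub>2(2)[symmetric] by (rule fm_cancel) (simp_all add: algebra_simps)
  qed (fact A C B\<^sub>1 B\<^sub>2 D\<^sub>1 D\<^sub>2 A_stable CA_obs R\<^sub>0 \<Gamma> Q \<Delta> C\<^sub>0 A\<^sub>0 C\<^sub>1 C\<^sub>2 minus_carrier_mat[OF P\<^sub>2(1)])+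
  interpret rp: riccati_pos m p q n A B\<^sub>1 B\<^sub>2 C D\<^sub>1 D\<^sub>2 ?P Q R\<^sub>0 \<Gamma> \<Delta> C\<^sub>0 A\<^sub>0 C\<^sub>1 C\<^sub>2 e
    by (rule riccati.riccati_posI[OF r e])
  have z0: "0\<^sub>m k 0 * 0\<^sub>m 0 l = 0\<^sub>m k l" for k l by (rule left_mult_zero_mat) simp
  have za: "(0\<^sub>m k 0)\<^sup>\<dagger> = (0\<^sub>m 0 k :: complex mat)" for k by (rule eq_matI) simp_all
  have mz: "M - 0\<^sub>m k l = M" if "dim_row M = k" "dim_col M = l" for M :: "complex mat" and k l
    by (rule eq_matI) (use that in simp_all)
  \<comment> \<open>G alone: K is replaced by a function without columns, so that Q_0 and P_1 take
    the places of Q and P_1 - P_2.\<close>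
  have s: "riccati m p 0 n A B\<^sub>1 (0\<^sub>m n 0) C D\<^sub>1 (0\<^sub>m m 0) P\<^sub>1 Q\<^sub>0 R\<^sub>1\<^sub>0 \<Gamma>\<^sub>0 (R\<^sub>1\<^sub>0 - \<Gamma>\<^sub>0\<^sup>\<dagger> * Q\<^sub>0 * \<Gamma>\<^sub>0) ?C\<^sub>0 ?A\<^sub>0
    (D\<^sub>1\<^sup>\<dagger> * ?C\<^sub>0 + B\<^sub>1\<^sup>\<dagger> * Q\<^sub>0 * ?A\<^sub>0) ((0\<^sub>m m 0)\<^sup>\<dagger> * ?C\<^sub>0 + (0\<^sub>m n 0)\<^sup>\<dagger> * Q\<^sub>0 * ?A\<^sub>0)"
  proof
    show "P\<^sub>1 - A * P\<^sub>1 * A\<^sup>\<dagger> = B\<^sub>1 * B\<^sub>1\<^sup>\<dagger> - 0\<^sub>m n 0 * (0\<^sub>m n 0)\<^sup>\<dagger>"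
      unfolding za z0 P\<^sub>1(2) by (rule mz[symmetric]) simp_all
    show "R\<^sub>1\<^sub>0 = D\<^sub>1 * D\<^sub>1\<^sup>\<dagger> - 0\<^sub>m m 0 * (0\<^sub>m m 0)\<^sup>\<dagger> + C * P\<^sub>1 * C\<^sup>\<dagger>" unfolding za z0 R\<^sub>1\<^sub>0 by (subst mz) simp_all
    show "\<Gamma>\<^sub>0 = B\<^sub>1 * D\<^sub>1\<^sup>\<dagger> - 0\<^sub>m n 0 * (0\<^sub>m m 0)\<^sup>\<dagger> + A * P\<^sub>1 * C\<^sup>\<dagger>" unfolding za z0 \<Gamma>\<^sub>0 by (subst mz) simp_all
  qed (fact A C B\<^sub>1 D\<^sub>1 A_stable CA_obs Q\<^sub>0 P\<^sub>1(1) zero_carrier_mat refl)+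
  \<comment> \<open>The term of K is nonnegative, so dropping it keeps the inequality with the same
    constant e.\<close>
  have se: "e * (\<Sum>i. (cnorm (f i))\<^sup>2) + (\<Sum>i. (cnorm (coeff_adj 0 (ss_coeff A (0\<^sub>m n 0) C (0\<^sub>m m 0)) f i))\<^sup>2)
      \<le> (\<Sum>i. (cnorm (coeff_adj p (ss_coeff A B\<^sub>1 C D\<^sub>1) f i))\<^sup>2)" if f: "f \<in> ell2 m" for f
  proof -
    have "0 \<le> (\<Sum>i. (cnorm (coeff_adj q (ss_coeff A B\<^sub>2 C D\<^sub>2) f i))\<^sup>2)"
      by (rule suminf_nonneg[OF ell2_summable[OF coeff_adj_ell2[OF cK f]]]) simp
    moreover have "cnorm (coeff_adj 0 F f i) = 0" for F i by (simp add: coeff_adj_def cnorm_L2)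
    ultimately show ?thesis using e(2)[OF f] by simp
  qed
  interpret s: riccati_pos0 m p 0 n A B\<^sub>1 "0\<^sub>m n 0" C D\<^sub>1 "0\<^sub>m m 0" P\<^sub>1 Q\<^sub>0 R\<^sub>1\<^sub>0 \<Gamma>\<^sub>0 "R\<^sub>1\<^sub>0 - \<Gamma>\<^sub>0\<^sup>\<dagger> * Q\<^sub>0 * \<Gamma>\<^sub>0" ?C\<^sub>0 ?A\<^sub>0
    "D\<^sub>1\<^sup>\<dagger> * ?C\<^sub>0 + B\<^sub>1\<^sup>\<dagger> * Q\<^sub>0 * ?A\<^sub>0" "(0\<^sub>m m 0)\<^sup>\<dagger> * ?C\<^sub>0 + (0\<^sub>m n 0)\<^sup>\<dagger> * Q\<^sub>0 * ?A\<^sub>0" e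
    by (rule riccati_pos0.intro[OF riccati.riccati_posI[OF s e(1) se]], assumption, unfold_locales, rule refl, rule refl)
  have "minv Q + P\<^sub>2 - P\<^sub>1 = rp.S" unfolding rp.S_def by (rule fm_cancel) simp_all
  then have Z: "minv (minv Q + P\<^sub>2 - P\<^sub>1) = rp.Z" unfolding rp.Z_def by simp
  have Z0: "minv (minv Q\<^sub>0 - P\<^sub>1) = s.Z" unfolding s.Z_def s.S_def ..
  have Om: "\<Omega> = rp.Om" unfolding \<Omega> Z rp.Om_def ..
  note th = s.left_minimal_rank_factor_props[OF \<Theta>\<^sub>0, unfolded tG, OF refl]
  have \<Theta>c: "\<Theta>\<^sub>0 \<in> carrier_mat p (p - m)" using \<Theta>\<^sub>0 unfolding left_minimal_rank_factor_def by blast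
  have \<Theta>d [simp]: "dim_row \<Theta>\<^sub>0 = p" "dim_col \<Theta>\<^sub>0 = p - m" using \<Theta>c by auto
  have \<Delta>1: "\<Delta>\<^sub>1 = pos_sqrt_mat (\<Theta>\<^sub>0\<^sup>\<dagger> * \<Theta>\<^sub>0 + \<Theta>\<^sub>0\<^sup>\<dagger> * B\<^sub>1\<^sup>\<dagger> * rp.Z * B\<^sub>1 * \<Theta>\<^sub>0)"
  proof -
    \<comment> \<open>The normalization of \<Theta>_0, written out: it replaces the identity in
      \<Delta>_1^2, after which the terms with Q_0 cancel.\<close>
    have "adj (fm \<Theta>\<^sub>0) * fm \<Theta>\<^sub>0 + adj (fm \<Theta>\<^sub>0) * (adj (fm B\<^sub>1) * (fm s.Z * (fm B\<^sub>1 * fm \<Theta>\<^sub>0))) = fm (1\<^sub>m (p - m))"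
      using arg_cong[OF th(2), of fm] by (simp add: s.fW algebra_simps)
    then have "1\<^sub>m (p - m) + \<Theta>\<^sub>0\<^sup>\<dagger> * B\<^sub>1\<^sup>\<dagger> * (rp.Z - s.Z) * B\<^sub>1 * \<Theta>\<^sub>0 = \<Theta>\<^sub>0\<^sup>\<dagger> * \<Theta>\<^sub>0 + \<Theta>\<^sub>0\<^sup>\<dagger> * B\<^sub>1\<^sup>\<dagger> * rp.Z * B\<^sub>1 * \<Theta>\<^sub>0"
      by (intro fm_cancel) (simp_all add: algebra_simps)
    then show ?thesis unfolding \<Delta>\<^sub>1 Z Z0 by simp
  qed
  interpret L: leech m p q n A B\<^sub>1 B\<^sub>2 C D\<^sub>1 D\<^sub>2 ?P Q R\<^sub>0 \<Gamma> \<Delta> C\<^sub>0 A\<^sub>0 C\<^sub>1 C\<^sub>2 e \<Theta>\<^sub>0 s.W B\<^sub>0 \<Delta>\<^sub>0 \<Delta>\<^sub>1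
    by unfold_locales (fact \<Theta>c th s.Wc B\<^sub>0[unfolded Om] \<Delta>\<^sub>0[unfolded Om] \<Delta>1)+
  have U: "\<Upsilon>\<^sub>1\<^sub>1 = L.U\<^sub>1\<^sub>1" "\<Upsilon>\<^sub>2\<^sub>1 = L.U\<^sub>2\<^sub>1" "\<Upsilon>\<^sub>1\<^sub>2 = L.U\<^sub>1\<^sub>2" "\<Upsilon>\<^sub>2\<^sub>2 = L.U\<^sub>2\<^sub>2"
    unfolding \<Upsilon>\<^sub>1\<^sub>1 \<Upsilon>\<^sub>2\<^sub>1 \<Upsilon>\<^sub>1\<^sub>2 \<Upsilon>\<^sub>2\<^sub>2 L.U\<^sub>1\<^sub>1_def L.U\<^sub>2\<^sub>1_def L.U\<^sub>1\<^sub>2_def L.U\<^sub>2\<^sub>2_def L.X\<^sub>0_def L.E_def Z Om by (rule refl)+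
  let ?X = "\<lambda>Y. \<lambda>z\<in>\<D>. (\<Upsilon>\<^sub>1\<^sub>2 z + \<Upsilon>\<^sub>1\<^sub>1 z * Y z) * minv (\<Upsilon>\<^sub>2\<^sub>2 z + \<Upsilon>\<^sub>2\<^sub>1 z * Y z)"
  have GK: "G z = D\<^sub>1 + z \<cdot>\<^sub>m (C * minv (1\<^sub>m n - z \<cdot>\<^sub>m A) * B\<^sub>1)" "K z = D\<^sub>2 + z \<cdot>\<^sub>m (C * minv (1\<^sub>m n - z \<cdot>\<^sub>m A) * B\<^sub>2)" if "z \<in> \<D>" for z
    using G_real K_real that by blast+
  show ?thesis
  proof (intro conjI ballI impI subset_antisym subsetI)
    fix Y z assume "Y \<in> Hinf (p - m) q" "hinf_norm Y \<le> 1" "z \<in> \<D>"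
    then show "invertible_mat (\<Upsilon>\<^sub>2\<^sub>2 z + \<Upsilon>\<^sub>2\<^sub>1 z * Y z)" unfolding U by (intro L.leech_of_schur(2) Hinf_schur)
  next
    fix X assume "X \<in> leech_solutions p q G K"
    then have X: "X \<in> Hinf p q" "hinf_norm X \<le> 1" and GX: "\<And>z. z \<in> \<D> \<Longrightarrow> G z * X z = K z"
      unfolding leech_solutions_def by auto
    obtain Y where Y: "schur (p - m) q Y"
      and YX: "\<And>z. z \<in> \<D> \<Longrightarrow> (\<Upsilon>\<^sub>1\<^sub>2 z + \<Upsilon>\<^sub>1\<^sub>1 z * Y z) * minv (\<Upsilon>\<^sub>2\<^sub>2 z + \<Upsilon>\<^sub>2\<^sub>1 z * Y z) = X z"
      using L.leech_onto[OF Hinf_schur[OF X]] GX GK unfolding U by auto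
    have "X \<in> extensional \<D>" using X(1) unfolding Hinf_def by (auto simp: PiE_def)
    \<comment> \<open>Restriction makes the parameter extensional without changing X, which depends
      on values in the disc only.\<close>
    then have "X = ?X (restrict Y \<D>)" by (intro extensionalityI[of _ \<D>]) (auto simp: YX)
    moreover have "restrict Y \<D> \<in> {Y \<in> Hinf (p - m) q. hinf_norm Y \<le> 1}"
      using schur_Hinf[OF schur_restrict[OF Y]] by simp
    ultimately show "X \<in> ?X ` {Y \<in> Hinf (p - m) q. hinf_norm Y \<le> 1}" by (rule image_eqI)
  next
    fix X assume "X \<in> ?X ` {Y \<in> Hinf (p - m) q. hinf_norm Y \<le> 1}"
    then obtain Y where Y: "Y \<in> Hinf (p - m) q" "hinf_norm Y \<le> 1" and X: "X = ?X Y" by blast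
    note l = L.leech_of_schur[OF Hinf_schur[OF Y], folded U]
    have "G z * X z = K z" if "z \<in> \<D>" for z using l(3)[OF that] that unfolding X GK[OF that] by simp
    with schur_Hinf[OF schur_restrict[OF l(1)]] show "X \<in> leech_solutions p q G K"
      unfolding leech_solutions_def X by simp
  qed
qed

end
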